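(* Consider a piecewise linear Hamiltonian system with three zones (the unperturbed system, $\epsilon=0$, described in the context) satisfying hypotheses (H1), (H2), (H3) stated in the context, and suppose that the center $(p_x,p_y)$ of its central subsystem has $p_x\neq 0$. (i) If the center of the central subsystem is real or boundary (i.e. $-1\le p_x\le 1$, $p_x\ne 0$), then at least six limit cycles can bifurcate from the periodic annulus of the unperturbed system under piecewise linear perturbations: there are real coefficients $r_{ij},u_{ij},p_{ij},s_{ij},v_{ij},q_{ij}$ of the perturbation $(f,g)$ such that, for all sufficiently small $\epsilon>0$, the perturbed system has at least six limit cycles bifurcating from the periodic annulus. (ii) If the center of the central subsystem is virtual (i.e. $p_x<-1$ or $p_x>1$), then at least four limit cycles can bifurcate from the periodic annulus in the same sense: there are real coefficients of $(f,g)$ such that, for all sufficiently small $\epsilon>0$, the perturbed system has at least four limit cycles bifurcating from the periodic annulus.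
   Context: **System.** For $0\le \epsilon\ll 1$ consider the discontinuous planar piecewise linear near-Hamiltonian system $$\dot x=H_y(x,y)+\epsilon f(x,y),\qquad \dot y=-H_x(x,y)+\epsilon g(x,y),$$ where $H=H^L$, $f=f_L$, $g=g_L$ for $x\le -1$ (left subsystem); $H=H^C$, $f=f_C$, $g=g_C$ for $-1\le x\le 1$ (central subsystem); $H=H^R$, $f=f_R$, $g=g_R$ for $x\ge 1$ (right subsystem), with, for $i\in\{L,C,R\}$, $$H^i(x,y)=\tfrac{b_i}{2}y^2-\tfrac{c_i}{2}x^2+a_ixy+\alpha_i y-\beta_i x ,$$ $$f_L=r_{10}x+r_{01}y+r_{00},\quad f_C=u_{10}x+u_{01}y+u_{00},\quad f_R=p_{10}x+p_{01}y+p_{00},$$ $$g_L=s_{10}x+s_{01}y+s_{00},\quad g_C=v_{10}x+v_{01}y+v_{00},\quad g_R=q_{10}x+q_{01}y+q_{00},$$ all coefficients being real. The unperturbed system is the one with $\epsilon=0$. The three zones are $\{x\le -1\}$, $\{-1\le x\le 1\}$, $\{x\ge 1\}$. **Position of singular points.** A singular point $(p_x,p_y)$ of the linear system defining the central subsystem is real if $-1<p_x<1$, boundary if $p_x=\pm1$, virtual if $p_x>1$ or $p_x<-1$. **Hypotheses on the unperturbed system.** (H1) The linear system defining the central subsystem has a center, and those defining the left and right subsystems have saddles. (H2) All points of the lines $x=\pm1$ are crossing points, except for some tangent points. That is, on each of these lines the product of the $x$-components of the two adjacent vector fields is positive, except at points where one of these vector fields is tangent to the line. (H3) The system has a periodic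 annulus consisting of crossing periodic orbits, traversed clockwise, each passing through three or two zones. This annulus contains both a one-parameter family (over an open interval) of crossing periodic orbits passing through all three zones and a one-parameter family (over an open interval) of crossing periodic orbits passing through exactly two zones. **Terminology.** A crossing periodic orbit is a periodic orbit that meets the lines $x=\pm 1$ only at crossing points, and meets at least one of them. A limit cycle is an isolated crossing periodic orbit. A limit cycle of the perturbed system bifurcates from the periodic annulus if it tends, as $\epsilon\to0^+$, to a periodic orbit of the annulus of the unperturbed system. *)

theory Defs
  imports "HOL-Complex_Analysis.Complex_Analysis"
begin

section \<open>Piecewise linear Hamiltonian systems with three zones\<close>

type_synonym plane = "real \<times> real"

datatype zone = LeftZone | CentralZone | RightZone

fun zone_set :: "zone \<Rightarrow> plane set" where
  "zone_set LeftZone = {p. fst p \<le> -1}"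
| "zone_set CentralZone = {p. -1 \<le> fst p \<and> fst p \<le> 1}"
| "zone_set RightZone = {p. 1 \<le> fst p}"

definition switching_lines :: "plane set" where
  "switching_lines = {p. fst p = -1 \<or> fst p = 1}"

definition quad_ham :: "real \<Rightarrow> real \<Rightarrow> real \<Rightarrow> real \<Rightarrow> real \<Rightarrow> real \<Rightarrow> real \<Rightarrow> real" where
  "quad_ham a b c \<alpha> \<beta> x y = b / 2 * y\<^sup>2 - c / 2 * x\<^sup>2 + a * x * y + \<alpha> * y - \<beta> * x"

text \<open>The Hamiltonian vector field \<open>(H\<^sub>y, - H\<^sub>x)\<close>.\<close>

definition ham_field :: "(real \<Rightarrow> real \<Rightarrow> real) \<Rightarrow> plane \<Rightarrow> plane" where
  "ham_field H p = (deriv (\<lambda>y. H (fst p) y) (snd p), - deriv (\<lambda>x. H x (snd p)) (fst p))"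

text \<open>A piecewise system assigns to every zone a vector field, which is defined on the whole plane
  but is used only on the (closed) zone.  The coefficients are indexed by the zone.\<close>

definition unperturbed ::
  "(zone \<Rightarrow> real) \<Rightarrow> (zone \<Rightarrow> real) \<Rightarrow> (zone \<Rightarrow> real) \<Rightarrow> (zone \<Rightarrow> real) \<Rightarrow> (zone \<Rightarrow> real) \<Rightarrow>
   zone \<Rightarrow> plane \<Rightarrow> plane" where
  "unperturbed a b c \<alpha> \<beta> i = ham_field (quad_ham (a i) (b i) (c i) (\<alpha> i) (\<beta> i))"

definition affine_field ::
  "(zone \<Rightarrow> real) \<Rightarrow> (zone \<Rightarrow> real) \<Rightarrow> (zone \<Rightarrow> real) \<Rightarrow>
   (zone \<Rightarrow> real) \<Rightarrow> (zone \<Rightarrow> real) \<Rightarrow> (zone \<Rightarrow> real) \<Rightarrow> zone \<Rightarrow> plane \<Rightarrow> plane" where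
  "affine_field f10 f01 f00 g10 g01 g00 i p =
     (f10 i * fst p + f01 i * snd p + f00 i, g10 i * fst p + g01 i * snd p + g00 i)"

definition perturbed ::
  "(zone \<Rightarrow> plane \<Rightarrow> plane) \<Rightarrow> (zone \<Rightarrow> plane \<Rightarrow> plane) \<Rightarrow> real \<Rightarrow> zone \<Rightarrow> plane \<Rightarrow> plane" where
  "perturbed X F \<epsilon> i p = X i p + \<epsilon> *\<^sub>R F i p"

lemma unperturbed_eq:
  "unperturbed a b c \<alpha> \<beta> i p =
     (b i * snd p + a i * fst p + \<alpha> i, c i * fst p - a i * snd p + \<beta> i)"
proof -
  have 1: "((\<lambda>y. quad_ham (a i) (b i) (c i) (\<alpha> i) (\<beta> i) (fst p) y) has_real_derivative
      b i * snd p + a i * fst p + \<alpha> i) (at (snd p))"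
    unfolding quad_ham_def by (auto intro!: derivative_eq_intros)
  have 2: "((\<lambda>x. quad_ham (a i) (b i) (c i) (\<alpha> i) (\<beta> i) x (snd p)) has_real_derivative
      - (c i * fst p - a i * snd p + \<beta> i)) (at (fst p))"
    unfolding quad_ham_def by (auto intro!: derivative_eq_intros)
  show ?thesis
    unfolding unperturbed_def ham_field_def DERIV_imp_deriv[OF 1] DERIV_imp_deriv[OF 2] by simp
qed


section \<open>Centers and saddles\<close>

definition closed_orbit :: "(plane \<Rightarrow> plane) \<Rightarrow> plane set \<Rightarrow> bool" where
  "closed_orbit V \<Gamma> \<longleftrightarrow>
     (\<exists>\<gamma> T. (\<forall>t. (\<gamma> has_vector_derivative V (\<gamma> t)) (at t)) \<and> T > 0 \<and> (\<forall>t. \<gamma> (t + T) = \<gamma> t) \<and>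
        inj_on \<gamma> {0..<T} \<and> \<Gamma> = range \<gamma>)"

definition is_center :: "(plane \<Rightarrow> plane) \<Rightarrow> plane \<Rightarrow> bool" where
  "is_center V p \<longleftrightarrow> V p = 0 \<and>
     (\<exists>U. open U \<and> p \<in> U \<and> (\<forall>q\<in>U - {p}. \<exists>\<Gamma>. closed_orbit V \<Gamma> \<and> q \<in> \<Gamma>))"

text \<open>A singular point whose linear part has real eigenvalues of opposite signs.\<close>

definition is_saddle :: "(plane \<Rightarrow> plane) \<Rightarrow> plane \<Rightarrow> bool" where
  "is_saddle V p \<longleftrightarrow> V p = 0 \<and> V differentiable (at p) \<and>
     (\<exists>l m v w. l < 0 \<and> 0 < m \<and> v \<noteq> 0 \<and> w \<noteq> 0 \<and>
        frechet_derivative V (at p) v = l *\<^sub>R v \<and> frechet_derivative V (at p) w = m *\<^sub>R w)"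


section \<open>Crossing periodic orbits\<close>

definition crossing_point :: "(zone \<Rightarrow> plane \<Rightarrow> plane) \<Rightarrow> plane \<Rightarrow> bool" where
  "crossing_point X p \<longleftrightarrow>
     (fst p = -1 \<and> 0 < fst (X LeftZone p) * fst (X CentralZone p)) \<or>
     (fst p = 1 \<and> 0 < fst (X CentralZone p) * fst (X RightZone p))"

definition tangent_point :: "(zone \<Rightarrow> plane \<Rightarrow> plane) \<Rightarrow> plane \<Rightarrow> bool" where
  "tangent_point X p \<longleftrightarrow>
     (fst p = -1 \<and> (fst (X LeftZone p) = 0 \<or> fst (X CentralZone p) = 0)) \<or>
     (fst p = 1 \<and> (fst (X CentralZone p) = 0 \<or> fst (X RightZone p) = 0))"

text \<open>Trajectories are concatenations of pieces of orbits of the three systems: right after and right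
  before every time, the curve stays in one of the closed zones and solves the system of that zone
  there.  At a crossing point the two zones are different.\<close>

definition trajectory :: "(zone \<Rightarrow> plane \<Rightarrow> plane) \<Rightarrow> (real \<Rightarrow> plane) \<Rightarrow> bool" where
  "trajectory X \<gamma> \<longleftrightarrow>
     (\<forall>t. (\<exists>i. \<exists>d>0. \<forall>s\<in>{t..t + d}. \<gamma> s \<in> zone_set i \<and>
             (\<gamma> has_vector_derivative X i (\<gamma> s)) (at s within {t..t + d})) \<and>
          (\<exists>i. \<exists>d>0. \<forall>s\<in>{t - d..t}. \<gamma> s \<in> zone_set i \<and>
             (\<gamma> has_vector_derivative X i (\<gamma> s)) (at s within {t - d..t})))"

definition periodic_solution :: "(zone \<Rightarrow> plane \<Rightarrow> plane) \<Rightarrow> (real \<Rightarrow> plane) \<Rightarrow> real \<Rightarrow> bool" where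
  "periodic_solution X \<gamma> T \<longleftrightarrow>
     trajectory X \<gamma> \<and> T > 0 \<and> (\<forall>t. \<gamma> (t + T) = \<gamma> t) \<and> inj_on \<gamma> {0..<T}"

definition periodic_orbit :: "(zone \<Rightarrow> plane \<Rightarrow> plane) \<Rightarrow> plane set \<Rightarrow> bool" where
  "periodic_orbit X \<Gamma> \<longleftrightarrow> (\<exists>\<gamma> T. periodic_solution X \<gamma> T \<and> \<Gamma> = range \<gamma>)"

definition plane_to_complex :: "plane \<Rightarrow> complex" where
  "plane_to_complex p = Complex (fst p) (snd p)"

definition clockwise_periodic_orbit :: "(zone \<Rightarrow> plane \<Rightarrow> plane) \<Rightarrow> plane set \<Rightarrow> bool" where
  "clockwise_periodic_orbit X \<Gamma> \<longleftrightarrow>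
     (\<exists>\<gamma> T. periodic_solution X \<gamma> T \<and> \<Gamma> = range \<gamma> \<and>
        (\<forall>z\<in>inside \<Gamma>.
           winding_number (\<lambda>s. plane_to_complex (\<gamma> (T * s))) (plane_to_complex z) = -1))"

definition crossing_periodic_orbit :: "(zone \<Rightarrow> plane \<Rightarrow> plane) \<Rightarrow> plane set \<Rightarrow> bool" where
  "crossing_periodic_orbit X \<Gamma> \<longleftrightarrow>
     periodic_orbit X \<Gamma> \<and> \<Gamma> \<inter> switching_lines \<noteq> {} \<and>
     (\<forall>p\<in>\<Gamma> \<inter> switching_lines. crossing_point X p)"

definition zones_visited :: "plane set \<Rightarrow> zone set" where
  "zones_visited \<Gamma> = {i. \<Gamma> \<inter> interior (zone_set i) \<noteq> {}}"


section \<open>The hypotheses on the unperturbed system\<close>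

definition open_interval :: "real set \<Rightarrow> bool" where
  "open_interval J \<longleftrightarrow> open J \<and> is_interval J \<and> J \<noteq> {}"

text \<open>A topological annulus foliated by periodic orbits \<open>\<Gamma> h\<close>, \<open>h \<in> J\<close>, all traversed clockwise.\<close>

definition periodic_annulus ::
  "(zone \<Rightarrow> plane \<Rightarrow> plane) \<Rightarrow> real set \<Rightarrow> (real \<Rightarrow> plane set) \<Rightarrow> bool" where
  "periodic_annulus X J \<Gamma> \<longleftrightarrow>
     open_interval J \<and> (\<forall>h\<in>J. clockwise_periodic_orbit X (\<Gamma> h)) \<and>
     (\<exists>\<Phi> \<Psi>. homeomorphism (J \<times> sphere (0::complex) 1) (\<Union>h\<in>J. \<Gamma> h) \<Phi> \<Psi> \<and>
        (\<forall>h\<in>J. \<Phi> ` ({h} \<times> sphere 0 1) = \<Gamma> h))"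

definition crossing_except_tangencies :: "(zone \<Rightarrow> plane \<Rightarrow> plane) \<Rightarrow> bool" where
  "crossing_except_tangencies X \<longleftrightarrow>
     (\<forall>p\<in>switching_lines. crossing_point X p \<or> tangent_point X p)"

text \<open>An orbit through two zones and one through three zones in the same annulus are always separated
  by an orbit touching a switching line at a tangent point, which is not a crossing periodic orbit.
  Such orbits therefore have to be admitted as exceptional leaves of the annulus; all other leaves
  are crossing periodic orbits.\<close>

definition crossing_annulus ::
  "(zone \<Rightarrow> plane \<Rightarrow> plane) \<Rightarrow> real set \<Rightarrow> (real \<Rightarrow> plane set) \<Rightarrow> bool" where
  "crossing_annulus X J \<Gamma> \<longleftrightarrow>
     periodic_annulus X J \<Gamma> \<and>
     (\<forall>h\<in>J. (crossing_periodic_orbit X (\<Gamma> h) \<and> card (zones_visited (\<Gamma> h)) \<in> {2, 3}) \<or>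
            (\<exists>p\<in>\<Gamma> h. tangent_point X p)) \<and>
     (\<exists>I\<subseteq>J. open_interval I \<and>
        (\<forall>h\<in>I. crossing_periodic_orbit X (\<Gamma> h) \<and> card (zones_visited (\<Gamma> h)) = 3)) \<and>
     (\<exists>I\<subseteq>J. open_interval I \<and>
        (\<forall>h\<in>I. crossing_periodic_orbit X (\<Gamma> h) \<and> card (zones_visited (\<Gamma> h)) = 2))"


section \<open>Limit cycles bifurcating from the annulus\<close>

definition limit_cycle :: "(zone \<Rightarrow> plane \<Rightarrow> plane) \<Rightarrow> plane set \<Rightarrow> bool" where
  "limit_cycle X \<Gamma> \<longleftrightarrow>
     crossing_periodic_orbit X \<Gamma> \<and>
     (\<exists>U. open U \<and> \<Gamma> \<subseteq> U \<and> (\<forall>\<Gamma>'. crossing_periodic_orbit X \<Gamma>' \<and> \<Gamma>' \<subseteq> U \<longrightarrow> \<Gamma>' = \<Gamma>))"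

text \<open>Convergence of sets in the Hausdorff distance.\<close>

definition hausdorff_tendsto :: "('a \<Rightarrow> plane set) \<Rightarrow> plane set \<Rightarrow> 'a filter \<Rightarrow> bool" where
  "hausdorff_tendsto G A F \<longleftrightarrow>
     (\<forall>e>0. eventually (\<lambda>x. (\<forall>p\<in>G x. \<exists>q\<in>A. dist p q < e) \<and> (\<forall>q\<in>A. \<exists>p\<in>G x. dist p q < e)) F)"

definition limit_cycles_bifurcate ::
  "(zone \<Rightarrow> plane \<Rightarrow> plane) \<Rightarrow> (zone \<Rightarrow> plane \<Rightarrow> plane) \<Rightarrow> plane set set \<Rightarrow> nat \<Rightarrow> bool" where
  "limit_cycles_bifurcate X F \<A> n \<longleftrightarrow>
     (\<exists>(G :: nat \<Rightarrow> real \<Rightarrow> plane set) (A :: nat \<Rightarrow> plane set).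
        (\<forall>k<n. A k \<in> \<A> \<and> hausdorff_tendsto (G k) (A k) (at_right 0)) \<and>
        (\<forall>\<^sub>F \<epsilon> in at_right 0.
           (\<forall>k<n. limit_cycle (perturbed X F \<epsilon>) (G k \<epsilon>)) \<and> inj_on (\<lambda>k. G k \<epsilon>) {..<n}))"

end

theory Submission imports Defs "HOL-Real_Asymp.Real_Asymp" begin


text \<open>A piecewise linear change of coordinates turns every zone into \<open>x' = \<rho> z\<close>, \<open>z' = \<mu> (x - s)\<close>, and the
  perturbation is chosen such that the perturbed flows remain explicit.  On the section \<open>x = 1\<close>, \<open>z > 0\<close>
  the first order change of \<open>z\<^sup>2 / 2\<close> along an orbit of height \<open>r\<close> is a combination of
  \<open>r\<close>, \<open>(w\<^sup>2 - r\<^sup>2) ln ((w + r) / (w - r))\<close> and \<open>(r\<^sup>2 + k\<^sup>2) (\<pi> + 2 arctan (k / r))\<close>, with similar terms in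
  \<open>v = sqrt (r\<^sup>2 - R\<^sup>2)\<close> when the orbit passes through three zones, where \<open>R\<close> is the height of the orbit
  touching \<open>x = -1\<close>.  Expanding at \<open>r = R\<close> in powers of \<open>v\<close> and of \<open>r - R\<close>, the coefficients can be chosen
  such that this Melnikov function has four sign changes for \<open>r > R\<close> and, if the center is not virtual,
  two more for \<open>r < R\<close>.  The return map is real analytic, so its fixed points are isolated, and every
  sign change yields a limit cycle.  By the first integral the leaves of the annulus sweep out a
  neighbourhood of \<open>r = R\<close>.\<close>


section \<open>Real analytic functions\<close>

definition real_analytic_at :: "(real \<Rightarrow> real) \<Rightarrow> real \<Rightarrow> bool" where
  "real_analytic_at f x \<longleftrightarrow>
     (\<exists>g e. e > 0 \<and> g holomorphic_on ball (complex_of_real x) e \<and>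
        (\<forall>y. \<bar>y - x\<bar> < e \<longrightarrow> g (of_real y) = of_real (f y)))"

lemma real_analytic_atI:
  assumes "open S" "of_real x \<in> S" "g holomorphic_on S"
    and "\<And>y. of_real y \<in> S \<Longrightarrow> g (of_real y) = of_real (f y)"
  shows "real_analytic_at f x"
proof -
  obtain e where e: "e > 0" "ball (of_real x) e \<subseteq> S"
    using assms(1,2) open_contains_ball by blast
  have "g (of_real y) = of_real (f y)" if "\<bar>y - x\<bar> < e" for y
  proof -
    have "complex_of_real y \<in> ball (of_real x) e"
      using that by (simp add: dist_real_def abs_minus_commute)
    then have "complex_of_real y \<in> S" using e by (rule_tac subsetD)
    then show ?thesis by (rule assms(4))
  qed
  moreover have "g holomorphic_on ball (of_real x) e"
    using assms(3) e(2) by (rule holomorphic_on_subset)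
  ultimately show ?thesis
    unfolding real_analytic_at_def using e(1) by (intro exI[of _ g] exI[of _ e]) simp
qed

lemma real_analytic_at_imp_isCont:
  assumes "real_analytic_at f x"
  shows "isCont f x"
proof -
  obtain g e where g: "e > 0" "g holomorphic_on ball (complex_of_real x) e"
      "\<And>y. \<bar>y - x\<bar> < e \<Longrightarrow> g (of_real y) = of_real (f y)"
    using assms unfolding real_analytic_at_def by blast
  have "continuous_on (ball (complex_of_real x) e) g"
    using g(2) by (rule holomorphic_on_imp_continuous_on)
  then have "isCont g (complex_of_real x)"
    using g(1) by (simp add: continuous_on_eq_continuous_at)
  then have "isCont (\<lambda>y. g (of_real y)) x"
    using isCont_o2[where f = complex_of_real and g = g and a = x] by simp
  then have "isCont (\<lambda>y. Re (g (of_real y))) x"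
    by (rule continuous_Re)
  moreover have "\<forall>\<^sub>F y in nhds x. Re (g (of_real y)) = f y"
    using g(1,3) by (auto simp: eventually_nhds_metric dist_real_def intro!: exI[of _ e])
  ultimately show ?thesis
    by (simp add: isCont_cong)
qed

lemma real_analytic_at_compose:
  assumes "real_analytic_at f x" "real_analytic_at h (f x)"
  shows "real_analytic_at (\<lambda>y. h (f y)) x"
proof -
  obtain g e where g: "e > 0" "g holomorphic_on ball (complex_of_real x) e"
      "\<And>y. \<bar>y - x\<bar> < e \<Longrightarrow> g (of_real y) = of_real (f y)"
    using assms unfolding real_analytic_at_def by blast
  obtain k d where k: "d > 0" "k holomorphic_on ball (complex_of_real (f x)) d"
      "\<And>y. \<bar>y - f x\<bar> < d \<Longrightarrow> k (of_real y) = of_real (h y)"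
    using assms unfolding real_analytic_at_def by blast
  let ?S = "ball (complex_of_real x) e \<inter> g -` ball (of_real (f x)) d"
  have "open ?S"
    by (rule continuous_open_preimage[OF holomorphic_on_imp_continuous_on[OF g(2)]]) auto
  moreover have "of_real x \<in> ?S" using g k by auto
  moreover have "(k \<circ> g) holomorphic_on ?S"
    by (rule holomorphic_on_compose_gen[OF holomorphic_on_subset[OF g(2)] k(2)]) auto
  moreover have "(k \<circ> g) (of_real y) = of_real (h (f y))" if "of_real y \<in> ?S" for y
  proof -
    have "\<bar>y - x\<bar> < e" using that by (simp add: dist_real_def abs_minus_commute)
    then have *: "g (of_real y) = of_real (f y)" using g by blast
    then have "\<bar>f y - f x\<bar> < d" using that by (auto simp: dist_real_def abs_minus_commute)
    then show ?thesis using * k by simp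
  qed
  ultimately show ?thesis by (rule real_analytic_atI)
qed

lemma real_analytic_at_holomorphic:
  assumes "g holomorphic_on UNIV" "\<And>y. g (of_real y) = of_real (f y)"
  shows "real_analytic_at f x"
  by (rule real_analytic_atI[of UNIV]) (use assms in auto)

named_theorems real_analytic_intros

lemma real_analytic_at_const [real_analytic_intros]: "real_analytic_at (\<lambda>_. c) x"
  by (rule real_analytic_at_holomorphic[of "\<lambda>_. of_real c"]) auto

lemma real_analytic_at_ident [real_analytic_intros]: "real_analytic_at (\<lambda>y. y) x"
  by (rule real_analytic_at_holomorphic[of "\<lambda>y. y"]) auto

lemma real_analytic_at_binop:
  assumes "real_analytic_at f x" "real_analytic_at h x"
    and hol: "\<And>S u v. u holomorphic_on S \<Longrightarrow> v holomorphic_on S \<Longrightarrow> (\<lambda>z. q (u z) (v z)) holomorphic_on S"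
    and real: "\<And>s t. q (complex_of_real s) (of_real t) = of_real (p s t)"
  shows "real_analytic_at (\<lambda>y. p (f y) (h y)) x"
proof -
  obtain g e where g: "e > 0" "g holomorphic_on ball (complex_of_real x) e"
      "\<And>y. \<bar>y - x\<bar> < e \<Longrightarrow> g (of_real y) = of_real (f y)"
    using assms unfolding real_analytic_at_def by blast
  obtain k d where k: "d > 0" "k holomorphic_on ball (complex_of_real x) d"
      "\<And>y. \<bar>y - x\<bar> < d \<Longrightarrow> k (of_real y) = of_real (h y)"
    using assms unfolding real_analytic_at_def by blast
  show ?thesis unfolding real_analytic_at_def
  proof (intro exI conjI)
    show "min d e > 0" using g k by auto
    show "(\<lambda>z. q (g z) (k z)) holomorphic_on ball (of_real x) (min d e)"
      by (rule hol; rule holomorphic_on_subset, rule g k, rule subset_ball) simp_all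
  qed (use g k real in auto)
qed

lemma real_analytic_at_add [real_analytic_intros]:
  "real_analytic_at f x \<Longrightarrow> real_analytic_at h x \<Longrightarrow> real_analytic_at (\<lambda>y. f y + h y) x"
  by (rule real_analytic_at_binop[where q = "(+)"]) (auto intro: holomorphic_intros)

lemma real_analytic_at_diff [real_analytic_intros]:
  "real_analytic_at f x \<Longrightarrow> real_analytic_at h x \<Longrightarrow> real_analytic_at (\<lambda>y. f y - h y) x"
  by (rule real_analytic_at_binop[where q = "(-)"]) (auto intro: holomorphic_intros)

lemma real_analytic_at_mult [real_analytic_intros]:
  "real_analytic_at f x \<Longrightarrow> real_analytic_at h x \<Longrightarrow> real_analytic_at (\<lambda>y. f y * h y) x"
  by (rule real_analytic_at_binop[where q = "(*)"]) (auto intro: holomorphic_intros)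

lemma real_analytic_at_power [real_analytic_intros]:
  "real_analytic_at f x \<Longrightarrow> real_analytic_at (\<lambda>y. f y ^ n) x"
  by (induction n) (auto intro: real_analytic_intros)

lemma real_analytic_at_inverse:
  assumes "x \<noteq> 0" shows "real_analytic_at inverse x"
  by (rule real_analytic_atI[of "- {0}" _ inverse])
    (use assms in \<open>auto intro!: holomorphic_intros\<close>)

lemma real_analytic_at_divide [real_analytic_intros]:
  "real_analytic_at f x \<Longrightarrow> real_analytic_at h x \<Longrightarrow> h x \<noteq> 0 \<Longrightarrow> real_analytic_at (\<lambda>y. f y / h y) x"
  unfolding divide_inverse
  by (intro real_analytic_intros real_analytic_at_compose[OF _ real_analytic_at_inverse])

lemma real_analytic_at_exp [real_analytic_intros]:
  "real_analytic_at f x \<Longrightarrow> real_analytic_at (\<lambda>y. exp (f y)) x"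
  by (rule real_analytic_at_compose, assumption, rule real_analytic_at_holomorphic[of exp])
    (auto simp: exp_of_real intro!: holomorphic_intros)

lemma real_analytic_at_ln [real_analytic_intros]:
  assumes "real_analytic_at f x" "f x > 0"
  shows "real_analytic_at (\<lambda>y. ln (f y)) x"
proof (rule real_analytic_at_compose[OF assms(1)])
  show "real_analytic_at ln (f x)"
    by (rule real_analytic_atI[of "{z. Re z > 0}" _ Ln])
      (use assms in \<open>auto simp: open_halfspace_Re_gt Ln_of_real complex_nonpos_Reals_iff
        intro!: holomorphic_on_Ln\<close>)
qed

lemma real_analytic_at_sqrt [real_analytic_intros]:
  assumes "real_analytic_at f x" "f x > 0"
  shows "real_analytic_at (\<lambda>y. sqrt (f y)) x"
proof (rule real_analytic_at_compose[OF assms(1)])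
  show "real_analytic_at sqrt (f x)"
    by (rule real_analytic_atI[of "{z. Re z > 0}" _ csqrt])
      (use assms in \<open>auto simp: open_halfspace_Re_gt complex_nonpos_Reals_iff
        intro!: holomorphic_on_subset[OF holomorphic_on_csqrt]\<close>)
qed

lemma real_analytic_at_arctan [real_analytic_intros]:
  assumes "real_analytic_at f x"
  shows "real_analytic_at (\<lambda>y. arctan (f y)) x"
proof (rule real_analytic_at_compose[OF assms(1)])
  show "real_analytic_at arctan (f x)"
    by (rule real_analytic_atI[of "{z. \<bar>Im z\<bar> < 1}" _ Arctan])
      (auto simp: Arctan_of_real intro!: holomorphic_on_Arctan open_Collect_less continuous_intros)
qed

lemma real_analytic_isolated_zeros:
  assumes an: "\<And>x. x \<in> {a<..<b} \<Longrightarrow> real_analytic_at f x"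
    and c: "c \<in> {a<..<b}" "f c \<noteq> 0" and x: "x \<in> {a<..<b}"
  shows "\<forall>\<^sub>F y in at x. f y \<noteq> 0"
proof -
  have dich: "(\<forall>\<^sub>F y in nhds x. f y = 0) \<or> (\<forall>\<^sub>F y in at x. f y \<noteq> 0)" if x: "x \<in> {a<..<b}" for x
  proof (cases "f x = 0")
    case False
    have "isCont f x" using an[OF x] by (rule real_analytic_at_imp_isCont)
    then have "(f \<longlongrightarrow> f x) (at x)" by (simp add: isCont_def)
    then show ?thesis using False tendsto_imp_eventually_ne by blast
  next
    case True
    obtain g e where g: "e > 0" "g holomorphic_on ball (complex_of_real x) e"
        "\<And>y. \<bar>y - x\<bar> < e \<Longrightarrow> g (of_real y) = of_real (f y)"
      using an[OF x] unfolding real_analytic_at_def by blast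
    show ?thesis
    proof (cases "\<exists>w\<in>ball (complex_of_real x) e. g w \<noteq> 0")
      case False
      have "f y = 0" if "\<bar>y - x\<bar> < e" for y
      proof -
        have "complex_of_real y \<in> ball (of_real x) e"
          using that by (simp add: dist_real_def abs_minus_commute)
        then show ?thesis using False g(3)[OF that] by auto
      qed
      then have "\<forall>\<^sub>F y in nhds x. f y = 0"
        using g(1) by (auto simp: eventually_nhds_metric dist_real_def intro!: exI[of _ e])
      then show ?thesis ..
    next
      case True2: True
      then obtain w where w: "w \<in> ball (complex_of_real x) e" "g w \<noteq> 0" by blast
      have gx: "g (of_real x) = 0" using g(1) g(3)[of x] True by simp
      obtain r where r: "r > 0" "ball (of_real x) r \<subseteq> ball (complex_of_real x) e"
          "\<And>z. z \<in> ball (of_real x) r - {of_real x} \<Longrightarrow> g z \<noteq> 0"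
        using isolated_zeros[OF g(2) _ _ _ gx w] g(1) by auto
      have "f y \<noteq> 0" if "y \<noteq> x" "\<bar>y - x\<bar> < min r e" for y
      proof -
        have "complex_of_real y \<in> ball (of_real x) r - {of_real x}"
          using that by (simp add: dist_real_def abs_minus_commute)
        then have "g (of_real y) \<noteq> 0" using r(3) by blast
        then show ?thesis using g(3)[of y] that by auto
      qed
      then have "\<forall>\<^sub>F y in at x. f y \<noteq> 0"
        using r(1) g(1) by (auto simp: eventually_at dist_real_def intro!: exI[of _ "min r e"])
      then show ?thesis ..
    qed
  qed
  define Z where "Z = (\<lambda>x. \<forall>\<^sub>F y in nhds x. f y = 0)"
  have loc: "\<forall>\<^sub>F w in at y within {a<..<b}. Z y = Z w" if y: "y \<in> {a<..<b}" for y
  proof -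
    have "\<forall>\<^sub>F w in at y. Z y = Z w"
    proof (cases "Z y")
      case True
      then have "\<forall>\<^sub>F w in nhds y. Z w" unfolding Z_def by (simp add: eventually_eventually)
      then show ?thesis using True by (simp add: eventually_nhds_conv_at)
    next
      case False
      then have "\<forall>\<^sub>F w in at y. f w \<noteq> 0" using dich[OF y] by (auto simp: Z_def)
      then show ?thesis
      proof eventually_elim
        case (elim w)
        then have "\<not> Z w" unfolding Z_def by (meson eventually_nhds_x_imp_x)
        then show ?case using False by simp
      qed
    qed
    then show ?thesis by (rule filter_leD[OF at_le, rotated]) auto
  qed
  have "Z x = Z c"
    by (rule connected_local_const[of "{a<..<b}"]) (use c x loc in auto)
  moreover have "\<not> Z c" unfolding Z_def using c(2) by (meson eventually_nhds_x_imp_x)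
  ultimately show ?thesis using dich[OF x] by (auto simp: Z_def)
qed

text \<open>The solution is the locally uniform limit of the simplified Newton iterates, which depend
  holomorphically on the parameter.\<close>

lemma real_analytic_implicit:
  fixes A B :: "complex \<Rightarrow> complex"
  assumes hol: "A holomorphic_on UNIV" "B holomorphic_on UNIV"
    and real: "\<And>t. A (of_real t) = of_real (a t)" "\<And>t. B (of_real t) = of_real (b t)"
    and root: "\<forall>\<^sub>F y in nhds y0. a (\<tau> y) + b (\<tau> y) * y = 0"
    and cont: "isCont \<tau> y0"
    and nd: "deriv A (of_real (\<tau> y0)) + deriv B (of_real (\<tau> y0)) * of_real y0 \<noteq> 0"
  shows "real_analytic_at \<tau> y0"
proof -
  define t0 where "t0 = complex_of_real (\<tau> y0)"
  define d where "d = deriv A t0 + deriv B t0 * of_real y0"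
  have d0: "d \<noteq> 0" using nd unfolding d_def t0_def .
  define \<phi> where "\<phi> = (\<lambda>y t. t - (A t + B t * y) / d)"
  define \<psi> where "\<psi> = (\<lambda>y t. 1 - (deriv A t + deriv B t * y) / d)"
  have der: "(\<phi> y has_field_derivative \<psi> y t) (at t)" for y t
  proof -
    have "(A has_field_derivative deriv A t) (at t)" "(B has_field_derivative deriv B t) (at t)"
      using hol by (auto intro!: holomorphic_derivI)
    then show ?thesis
      unfolding \<phi>_def \<psi>_def
      by (intro DERIV_diff DERIV_ident DERIV_cdivide DERIV_add DERIV_cmult_right)
  qed
  have cA: "continuous_on UNIV (deriv A)" "continuous_on UNIV (deriv B)"
    using hol by (auto intro!: holomorphic_on_imp_continuous_on holomorphic_deriv)
  have "continuous_on UNIV (\<lambda>p. norm (\<psi> (fst p) (snd p)))"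
    unfolding \<psi>_def using d0
    by (intro continuous_intros continuous_on_compose2[OF cA(1)] continuous_on_compose2[OF cA(2)]) auto
  then have "isCont (\<lambda>p. norm (\<psi> (fst p) (snd p))) (of_real y0, t0)"
    by (simp add: continuous_on_eq_continuous_at)
  moreover have "norm (\<psi> (of_real y0) t0) = 0"
    using d0 unfolding \<psi>_def d_def by simp
  ultimately have "((\<lambda>p. norm (\<psi> (fst p) (snd p))) \<longlongrightarrow> 0) (nhds (of_real y0, t0))"
    using tendsto_at_iff_tendsto_nhds[of "\<lambda>p. norm (\<psi> (fst p) (snd p))" "(of_real y0, t0)"]
    by (simp add: isCont_def)
  then have "\<forall>\<^sub>F p in nhds (of_real y0, t0). norm (\<psi> (fst p) (snd p)) < 1/2"
    by (rule order_tendstoD) simp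
  then have "\<exists>U. open U \<and> (of_real y0, t0) \<in> U \<and> (\<forall>p\<in>U. norm (\<psi> (fst p) (snd p)) < 1/2)"
    unfolding eventually_nhds by simp
  then obtain U where U: "open U" "(of_real y0, t0) \<in> U" and U3: "\<forall>p\<in>U. norm (\<psi> (fst p) (snd p)) < 1/2"
    by metis
  obtain X Y where "open X" "open Y" "(of_real y0, t0) \<in> X \<times> Y" "X \<times> Y \<subseteq> U"
    by (rule open_prod_elim[OF U(1,2)])
  then have XY: "open X" "open Y" "complex_of_real y0 \<in> X" "t0 \<in> Y" "X \<times> Y \<subseteq> U"
    by simp_all
  obtain r where r: "r > 0" "cball t0 r \<subseteq> Y" using XY open_contains_cball by blast
  have root0: "A t0 + B t0 * of_real y0 = 0"
  proof -
    have "a (\<tau> y0) + b (\<tau> y0) * y0 = 0" using root by (rule eventually_nhds_x_imp_x)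
    then have "complex_of_real (a (\<tau> y0) + b (\<tau> y0) * y0) = 0" by simp
    then show ?thesis unfolding t0_def real by simp
  qed
  have "((\<lambda>y. norm (\<phi> y t0 - t0)) \<longlongrightarrow> norm (\<phi> (of_real y0) t0 - t0)) (nhds (of_real y0))"
    unfolding \<phi>_def using d0 by (intro tendsto_intros) (auto simp: filterlim_ident)
  moreover have "norm (\<phi> (of_real y0) t0 - t0) = 0" using root0 by (simp add: \<phi>_def)
  ultimately have "\<forall>\<^sub>F y in nhds (of_real y0). norm (\<phi> y t0 - t0) < r / 2"
    using r(1) by (intro order_tendstoD(2)) auto
  then have "\<exists>X'. open X' \<and> of_real y0 \<in> X' \<and> (\<forall>y\<in>X'. norm (\<phi> y t0 - t0) < r / 2)"
    unfolding eventually_nhds by simp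
  then obtain X' where X': "open X'" "of_real y0 \<in> X'" "\<forall>y\<in>X'. norm (\<phi> y t0 - t0) < r / 2"
    by metis
  define S where "S = X \<inter> X'"
  have S: "open S" "of_real y0 \<in> S" using XY X' by (auto simp: S_def)
  have contr: "norm (\<phi> y s - \<phi> y t) \<le> 1/2 * norm (s - t)"
    if "y \<in> S" "s \<in> cball t0 r" "t \<in> cball t0 r" for y s t
  proof (rule field_differentiable_bound[OF convex_cball])
    show "(\<phi> y has_field_derivative \<psi> y z) (at z within cball t0 r)" for z
      using der has_field_derivative_at_within by blast
    show "norm (\<psi> y z) \<le> 1/2" if "z \<in> cball t0 r" for z
    proof -
      have "(y, z) \<in> U" using subsetD[OF XY(5), of "(y, z)"] subsetD[OF r(2) that] \<open>y \<in> S\<close> by (simp add: S_def)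
      then show ?thesis using U3 by fastforce
    qed
  qed (use that in auto)
  have self: "\<phi> y t \<in> cball t0 r" if "y \<in> S" "t \<in> cball t0 r" for y t
  proof -
    have "norm (\<phi> y t - t0) \<le> norm (\<phi> y t - \<phi> y t0) + norm (\<phi> y t0 - t0)"
      using norm_triangle_ineq[of "\<phi> y t - \<phi> y t0" "\<phi> y t0 - t0"] by simp
    also have "\<dots> \<le> 1/2 * norm (t - t0) + r/2"
    proof -
      have "norm (\<phi> y t0 - t0) < r / 2" using X'(3) that(1) by (simp add: S_def)
      moreover have "norm (\<phi> y t - \<phi> y t0) \<le> 1/2 * norm (t - t0)"
        using contr[OF that] r(1) by simp
      ultimately show ?thesis by linarith
    qed
    also have "\<dots> \<le> r" using that(2) by (simp add: dist_norm norm_minus_commute)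
    finally show ?thesis by (simp add: dist_norm norm_minus_commute)
  qed
  have "\<exists>!t. t \<in> cball t0 r \<and> \<phi> y t = t" if "y \<in> S" for y
  proof (rule Banach_fix[of "cball t0 r" "1/2"])
    show "\<phi> y ` cball t0 r \<subseteq> cball t0 r" using self[OF that] by blast
    show "dist (\<phi> y s) (\<phi> y t) \<le> 1/2 * dist s t" if "s \<in> cball t0 r" "t \<in> cball t0 r" for s t
      using contr[OF \<open>y \<in> S\<close> that] unfolding dist_norm .
  qed (use r in \<open>simp_all add: complete_eq_closed\<close>)
  then have "\<forall>y. \<exists>t. y \<in> S \<longrightarrow> t \<in> cball t0 r \<and> \<phi> y t = t" by blast
  then obtain g where "\<forall>y. y \<in> S \<longrightarrow> g y \<in> cball t0 r \<and> \<phi> y (g y) = g y"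
    unfolding choice_iff by (elim exE)
  then have g: "g y \<in> cball t0 r \<and> \<phi> y (g y) = g y" if "y \<in> S" for y
    using that by simp
  have guniq: "t = g y" if "y \<in> S" "t \<in> cball t0 r" "\<phi> y t = t" for y t
  proof -
    have "norm (t - g y) \<le> 1/2 * norm (t - g y)" using contr[OF that(1,2), of "g y"] that(3) g[OF that(1)] by simp
    then show ?thesis by simp
  qed
  define T where "T = (\<lambda>n y. (\<phi> y ^^ n) t0)"
  have T: "T n y \<in> cball t0 r" if "y \<in> S" for n y
  proof (induction n)
    case 0
    show ?case using r by (simp add: T_def)
  next
    case (Suc n)
    then show ?case using self[OF that Suc] by (simp add: T_def)
  qed
  have Thol: "T n holomorphic_on S" for n
  proof (induction n)
    case (Suc n)
    have "(A \<circ> T n) holomorphic_on S" "(B \<circ> T n) holomorphic_on S"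
      using Suc hol by (auto intro!: holomorphic_on_compose_gen[where t = UNIV])
    then have "(\<lambda>y. T n y - (A (T n y) + B (T n y) * y) / d) holomorphic_on S"
      using Suc d0 unfolding o_def by (intro holomorphic_intros)
    moreover have "T (Suc n) = (\<lambda>y. T n y - (A (T n y) + B (T n y) * y) / d)"
      by (simp add: T_def \<phi>_def fun_eq_iff)
    ultimately show ?case by simp
  qed (simp add: T_def)
  have Tlim: "norm (T n y - g y) \<le> (1/2) ^ n * r" if "y \<in> S" for n y
  proof (induction n)
    case 0
    then show ?case using g[OF that] by (simp add: T_def dist_norm)
  next
    case (Suc n)
    have "T (Suc n) y - g y = \<phi> y (T n y) - \<phi> y (g y)" using g[OF that] by (simp add: T_def)
    then show ?case using contr[OF that T[OF that, of n], of "g y"] g[OF that] Suc by simp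
  qed
  have "g holomorphic_on S"
  proof (rule holomorphic_uniform_sequence[OF S(1) Thol])
    fix y assume "y \<in> S"
    then obtain e where e: "e > 0" "cball y e \<subseteq> S" using S(1) open_contains_cball by blast
    have "(\<lambda>n. (1/2) ^ n * r) \<longlonglongrightarrow> 0 * r"
      by (intro tendsto_intros LIMSEQ_realpow_zero) auto
    then have lim: "(\<lambda>n. (1/2) ^ n * r) \<longlonglongrightarrow> 0" by simp
    have "uniform_limit (cball y e) T g sequentially"
    proof (rule uniform_limitI)
      fix \<epsilon> :: real assume "\<epsilon> > 0"
      with lim have "\<forall>\<^sub>F n in sequentially. (1/2) ^ n * r < \<epsilon>" by (rule order_tendstoD)
      then show "\<forall>\<^sub>F n in sequentially. \<forall>y\<in>cball y e. dist (T n y) (g y) < \<epsilon>"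
      proof eventually_elim
        case (elim n)
        show ?case
        proof
          fix y' assume "y' \<in> cball y e"
          then have "norm (T n y' - g y') \<le> (1/2) ^ n * r" using Tlim e(2) by blast
          then show "dist (T n y') (g y') < \<epsilon>" using elim by (simp add: dist_norm)
        qed
      qed
    qed
    then show "\<exists>d>0. cball y d \<subseteq> S \<and> uniform_limit (cball y d) T g sequentially"
      using e by blast
  qed
  moreover have "\<forall>\<^sub>F y in nhds y0. g (of_real y) = of_real (\<tau> y) \<and> of_real y \<in> S"
  proof -
    have "(\<tau> \<longlongrightarrow> \<tau> y0) (nhds y0)" using cont by (simp add: isCont_def tendsto_at_iff_tendsto_nhds)
    then have "\<forall>\<^sub>F y in nhds y0. dist (\<tau> y) (\<tau> y0) < r" using r(1) by (rule tendstoD)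
    moreover have "\<forall>\<^sub>F y in nhds y0. complex_of_real y \<in> S"
      using S by (intro topological_tendstoD[where l = "of_real y0"] tendsto_intros) (auto simp: filterlim_ident)
    ultimately show ?thesis using root
    proof eventually_elim
      case (elim y)
      have 1: "of_real (\<tau> y) \<in> cball t0 r"
        using elim(1) by (simp add: t0_def dist_real_def abs_minus_commute)
      have "complex_of_real (a (\<tau> y) + b (\<tau> y) * y) = 0" using elim(3) by simp
      then have "\<phi> (of_real y) (of_real (\<tau> y)) = of_real (\<tau> y)" by (simp add: \<phi>_def real)
      then show ?case using guniq[OF elim(2) 1] elim(2) by simp
    qed
  qed
  then obtain e where e: "e > 0" "\<forall>y. dist y y0 < e \<longrightarrow> g (of_real y) = of_real (\<tau> y)"
    by (auto simp: eventually_nhds_metric)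
  show ?thesis
  proof (rule real_analytic_atI[of "S \<inter> ball (of_real y0) e"])
    show "g (of_real y) = of_real (\<tau> y)" if "of_real y \<in> S \<inter> ball (complex_of_real y0) e" for y
    proof -
      have "dist y y0 < e" using that by (simp add: dist_commute)
      then show ?thesis using e(2) by simp
    qed
    show "g holomorphic_on S \<inter> ball (of_real y0) e"
      using \<open>g holomorphic_on S\<close> by (rule holomorphic_on_subset) simp
  qed (use S e in \<open>simp_all add: open_Int\<close>)
qed


section \<open>Concatenations of orbit pieces\<close>

definition piece :: "(zone \<Rightarrow> plane \<Rightarrow> plane) \<Rightarrow> zone \<Rightarrow> (real \<Rightarrow> plane) \<Rightarrow> real \<Rightarrow> real \<Rightarrow> bool" where
  "piece V i \<gamma> a b \<longleftrightarrow> (\<forall>s\<in>{a..b}. \<gamma> s \<in> zone_set i \<and>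
      (\<gamma> has_vector_derivative V i (\<gamma> s)) (at s within {a..b}))"

lemma trajectory_iff:
  "trajectory V \<gamma> \<longleftrightarrow> (\<forall>t. (\<exists>i d. d > 0 \<and> piece V i \<gamma> t (t + d)) \<and> (\<exists>i d. d > 0 \<and> piece V i \<gamma> (t - d) t))"
  unfolding trajectory_def piece_def by blast

lemma piece_subset:
  assumes "piece V i \<gamma> a b" "a \<le> a'" "b' \<le> b"
  shows "piece V i \<gamma> a' b'"
  unfolding piece_def
proof
  fix s assume "s \<in> {a'..b'}"
  then have "s \<in> {a..b}" using assms by auto
  then have *: "\<gamma> s \<in> zone_set i" "(\<gamma> has_vector_derivative V i (\<gamma> s)) (at s within {a..b})"
    using assms(1) by (auto simp: piece_def)
  have "(\<gamma> has_vector_derivative V i (\<gamma> s)) (at s within {a'..b'})"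
    by (rule has_vector_derivative_within_subset[OF *(2)]) (use assms in auto)
  with * show "\<gamma> s \<in> zone_set i \<and> (\<gamma> has_vector_derivative V i (\<gamma> s)) (at s within {a'..b'})"
    by simp
qed

lemma piece_cong:
  assumes "piece V i \<gamma> a b" "\<And>s. a \<le> s \<Longrightarrow> s \<le> b \<Longrightarrow> \<gamma>' s = \<gamma> s"
  shows "piece V i \<gamma>' a b"
  unfolding piece_def
proof
  fix s assume s: "s \<in> {a..b}"
  then have *: "\<gamma> s \<in> zone_set i" "(\<gamma> has_vector_derivative V i (\<gamma> s)) (at s within {a..b})"
    using assms(1) by (auto simp: piece_def)
  have "(\<gamma>' has_vector_derivative V i (\<gamma> s)) (at s within {a..b})"
    by (rule has_vector_derivative_transform[OF s _ *(2)]) (use assms(2) in auto)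
  with * show "\<gamma>' s \<in> zone_set i \<and> (\<gamma>' has_vector_derivative V i (\<gamma>' s)) (at s within {a..b})"
    using assms(2)[of s] s by simp
qed

lemma piece_shift:
  assumes "piece V i \<gamma> (a + c) (b + c)"
  shows "piece V i (\<lambda>s. \<gamma> (s + c)) a b"
  unfolding piece_def
proof
  fix s assume s: "s \<in> {a..b}"
  then have *: "\<gamma> (s + c) \<in> zone_set i"
    "(\<gamma> has_vector_derivative V i (\<gamma> (s + c))) (at (s + c) within {a + c..b + c})"
    using assms by (auto simp: piece_def)
  have "(\<gamma> \<circ> (\<lambda>s. s + c) has_vector_derivative 1 *\<^sub>R V i (\<gamma> (s + c))) (at s within {a..b})"
  proof (rule vector_diff_chain_within)
    show "((\<lambda>s. s + c) has_vector_derivative 1) (at s within {a..b})"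
      by (auto intro!: derivative_eq_intros simp flip: has_real_derivative_iff_has_vector_derivative)
    have "(\<lambda>s. s + c) ` {a..b} = {a + c..b + c}" by (rule image_add_atLeastAtMost')
    then show "(\<gamma> has_vector_derivative V i (\<gamma> (s + c))) (at (s + c) within (\<lambda>s. s + c) ` {a..b})"
      using *(2) by simp
  qed
  with * show "\<gamma> (s + c) \<in> zone_set i \<and>
      ((\<lambda>s. \<gamma> (s + c)) has_vector_derivative V i (\<gamma> (s + c))) (at s within {a..b})"
    by (simp add: o_def)
qed

lemma piece_continuous_on: "piece V i \<gamma> a b \<Longrightarrow> continuous_on {a..b} \<gamma>"
  unfolding piece_def continuous_on_eq_continuous_within
  using has_vector_derivative_continuous by blast

lemma piece_tendsto_left: "piece V i \<gamma> a b \<Longrightarrow> a < b \<Longrightarrow> (\<gamma> \<longlongrightarrow> \<gamma> b) (at_left b)"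
  using piece_continuous_on[of V i \<gamma> a b] at_within_Icc_at_left[of a b]
  unfolding continuous_on_def by (metis atLeastAtMost_iff less_imp_le order_refl)

lemma piece_tendsto_right: "piece V i \<gamma> a b \<Longrightarrow> a < b \<Longrightarrow> (\<gamma> \<longlongrightarrow> \<gamma> a) (at_right a)"
  using piece_continuous_on[of V i \<gamma> a b] at_within_Icc_at_right[of a b]
  unfolding continuous_on_def by (metis atLeastAtMost_iff less_imp_le order_refl)

lemma trajectory_isCont:
  assumes "trajectory V \<gamma>" shows "isCont \<gamma> t"
proof -
  obtain i d where "d > 0" "piece V i \<gamma> t (t + d)" using assms unfolding trajectory_iff by blast
  then have 1: "(\<gamma> \<longlongrightarrow> \<gamma> t) (at_right t)" by (intro piece_tendsto_right) auto
  obtain j e where "e > 0" "piece V j \<gamma> (t - e) t" using assms unfolding trajectory_iff by blast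
  then have 2: "(\<gamma> \<longlongrightarrow> \<gamma> t) (at_left t)" by (intro piece_tendsto_left) auto
  show ?thesis using filterlim_split_at[OF 2 1] by (simp add: isCont_def)
qed

definition unique_pieces :: "(zone \<Rightarrow> plane \<Rightarrow> plane) \<Rightarrow> bool" where
  "unique_pieces V \<longleftrightarrow> (\<forall>i \<gamma> \<gamma>' a b. a \<le> b \<longrightarrow> piece V i \<gamma> a b \<longrightarrow> piece V i \<gamma>' a b \<longrightarrow>
      \<gamma> a = \<gamma>' a \<longrightarrow> \<gamma> b = \<gamma>' b)"

definition enters :: "(zone \<Rightarrow> plane \<Rightarrow> plane) \<Rightarrow> zone \<Rightarrow> plane \<Rightarrow> bool" where
  "enters V i p \<longleftrightarrow> (\<forall>j \<gamma> a b. a < b \<longrightarrow> piece V j \<gamma> a b \<longrightarrow> \<gamma> a = p \<longrightarrow> j = i)"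

text \<open>A path along which the zone entered next is determined by the current point, so that every
  trajectory through its initial point has to follow it.\<close>

definition det_path :: "(zone \<Rightarrow> plane \<Rightarrow> plane) \<Rightarrow> (real \<Rightarrow> plane) \<Rightarrow> real \<Rightarrow> bool" where
  "det_path V c T \<longleftrightarrow> 0 < T \<and>
     (\<forall>u. 0 \<le> u \<longrightarrow> u < T \<longrightarrow>
        (\<exists>i d. enters V i (c u) \<and> 0 < d \<and> u + d \<le> T \<and> piece V i c u (u + d))) \<and>
     (\<forall>u. 0 < u \<longrightarrow> u \<le> T \<longrightarrow> (\<exists>i d. 0 < d \<and> d \<le> u \<and> piece V i c (u - d) u))"

lemma det_pathD_right:
  assumes "det_path V c T" "0 \<le> u" "u < T"
  obtains i d where "enters V i (c u)" "0 < d" "u + d \<le> T" "piece V i c u (u + d)"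
  using assms unfolding det_path_def by blast

lemma det_pathD_left:
  assumes "det_path V c T" "0 < u" "u \<le> T"
  obtains i d where "0 < d" "d \<le> u" "piece V i c (u - d) u"
  using assms unfolding det_path_def by blast

lemma real_interval_induction:
  fixes T :: real
  assumes left: "\<And>u. 0 \<le> u \<Longrightarrow> u \<le> T \<Longrightarrow> (\<And>u'. 0 \<le> u' \<Longrightarrow> u' < u \<Longrightarrow> P u') \<Longrightarrow> P u"
    and right: "\<And>u. 0 \<le> u \<Longrightarrow> u < T \<Longrightarrow> P u \<Longrightarrow> \<exists>d>0. \<forall>w. u \<le> w \<longrightarrow> w \<le> u + d \<longrightarrow> P w"
    and v: "0 \<le> v" "v \<le> T"
  shows "P v"
proof (rule ccontr)
  assume "\<not> P v"
  define B where "B = {u. 0 \<le> u \<and> u \<le> T \<and> \<not> P u}"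
  have vB: "v \<in> B" using v \<open>\<not> P v\<close> by (simp add: B_def)
  have bdd: "bdd_below B" by (rule bdd_belowI[of _ 0]) (simp add: B_def)
  define s where "s = Inf B"
  have s0: "0 \<le> s" unfolding s_def by (rule cInf_greatest) (use vB in \<open>auto simp: B_def\<close>)
  have sv: "s \<le> v" unfolding s_def using vB bdd by (rule cInf_lower)
  have below: "P u" if "0 \<le> u" "u < s" for u
  proof (rule ccontr)
    assume "\<not> P u"
    then have "u \<in> B" using that sv v by (simp add: B_def)
    then have "s \<le> u" unfolding s_def using bdd by (rule cInf_lower)
    then show False using that by simp
  qed
  have "s \<le> T" using sv v by simp
  then have Ps: "P s" by (rule left[OF s0]) (rule below)
  show False
  proof (cases "s < T")
    case True
    from right[OF s0 True Ps] obtain d where d: "d > 0" "\<forall>w. s \<le> w \<longrightarrow> w \<le> s + d \<longrightarrow> P w"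
      by (elim exE conjE)
    have "s + d \<le> Inf B"
    proof (rule cInf_greatest)
      show "B \<noteq> {}" using vB by blast
      fix u assume u: "u \<in> B"
      then have su: "s \<le> u" unfolding s_def using bdd by (rule cInf_lower)
      show "s + d \<le> u"
      proof (rule ccontr)
        assume "\<not> s + d \<le> u"
        then have "P u" using d(2) su by simp
        then show False using u by (simp add: B_def)
      qed
    qed
    then show False using d(1) by (simp add: s_def)
  next
    case False
    then have "s = v" using sv v by simp
    then show False using Ps \<open>\<not> P v\<close> by simp
  qed
qed

lemma det_path_follow:
  assumes uniq: "unique_pieces V" and c: "det_path V c T" and \<gamma>: "trajectory V \<gamma>"
    and start: "\<gamma> t0 = c 0" and v: "0 \<le> v" "v \<le> T"
  shows "\<gamma> (t0 + v) = c v"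
proof (rule real_interval_induction[where P = "\<lambda>v. \<gamma> (t0 + v) = c v", OF _ _ v])
  fix u assume u: "0 \<le> u" "u \<le> T" and IH: "\<And>u'. 0 \<le> u' \<Longrightarrow> u' < u \<Longrightarrow> \<gamma> (t0 + u') = c u'"
  show "\<gamma> (t0 + u) = c u"
  proof (cases "u = 0")
    case False
    then have u0: "0 < u" using u by simp
    obtain i d where "0 < d" "d \<le> u" "piece V i c (u - d) u" by (rule det_pathD_left[OF c u0 u(2)])
    then have 1: "(c \<longlongrightarrow> c u) (at_left u)" by (intro piece_tendsto_left) auto
    have "isCont (\<lambda>w. \<gamma> (t0 + w)) u"
      using isCont_o2[where f = "\<lambda>w. t0 + w" and g = \<gamma> and a = u] trajectory_isCont[OF \<gamma>] by simp
    then have 2: "((\<lambda>w. \<gamma> (t0 + w)) \<longlongrightarrow> \<gamma> (t0 + u)) (at_left u)"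
      unfolding isCont_def by (rule tendsto_mono[rotated]) (simp add: at_le)
    have "\<forall>\<^sub>F w in at_left u. \<gamma> (t0 + w) = c w"
      using eventually_at_left_real[OF u0] by eventually_elim (use IH in auto)
    with 2 have "(c \<longlongrightarrow> \<gamma> (t0 + u)) (at_left u)" by (rule Lim_transform_eventually)
    then show ?thesis using 1 tendsto_unique by (metis trivial_limit_at_left_real)
  qed (use start in simp)
next
  fix u assume u: "0 \<le> u" "u < T" and eq: "\<gamma> (t0 + u) = c u"
  obtain i d where d: "enters V i (c u)" "0 < d" "u + d \<le> T" "piece V i c u (u + d)"
    by (rule det_pathD_right[OF c u])
  obtain j e where e: "e > 0" "piece V j \<gamma> (t0 + u) (t0 + u + e)"
    using \<gamma> unfolding trajectory_iff by blast
  have "j = i"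
    using d(1) e eq unfolding enters_def by (meson less_add_same_cancel1)
  have "\<gamma> (t0 + w) = c w" if w: "u \<le> w" "w \<le> u + min d e" for w
  proof -
    have 1: "piece V i c u w" using piece_subset[OF d(4)] w by simp
    have "piece V i (\<lambda>s. \<gamma> (s + t0)) u w"
      by (rule piece_shift, rule piece_subset[of _ _ _ "t0 + u" "t0 + u + e"]) (use e w \<open>j = i\<close> in auto)
    then have "\<gamma> (w + t0) = c w"
      using uniq 1 w eq unfolding unique_pieces_def by (metis add.commute)
    then show ?thesis by (simp add: add.commute)
  qed
  then show "\<exists>d>0. \<forall>w. u \<le> w \<longrightarrow> w \<le> u + d \<longrightarrow> \<gamma> (t0 + w) = c w"
    using d e by (intro exI[of _ "min d e"]) auto
qed

definition cat :: "(real \<Rightarrow> plane) \<Rightarrow> real \<Rightarrow> (real \<Rightarrow> plane) \<Rightarrow> real \<Rightarrow> plane" where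
  "cat c1 T1 c2 = (\<lambda>t. if t \<le> T1 then c1 t else c2 (t - T1))"

lemma det_path_cat:
  assumes c1: "det_path V c1 T1" and c2: "det_path V c2 T2" and eq: "c1 T1 = c2 0"
  shows "det_path V (cat c1 T1 c2) (T1 + T2)"
proof -
  have cat2: "cat c1 T1 c2 s = c2 (s - T1)" if "T1 \<le> s" for s
    using that eq by (cases "s = T1") (auto simp: cat_def)
  have T: "0 < T1" "0 < T2" using c1 c2 by (auto simp: det_path_def)
  show ?thesis unfolding det_path_def
  proof (intro conjI allI impI)
    fix u assume u: "0 \<le> u" "u < T1 + T2"
    show "\<exists>i d. enters V i (cat c1 T1 c2 u) \<and> 0 < d \<and> u + d \<le> T1 + T2 \<and>
        piece V i (cat c1 T1 c2) u (u + d)"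
    proof (cases "u < T1")
      case True
      then obtain i d where d: "enters V i (c1 u)" "0 < d" "u + d \<le> T1" "piece V i c1 u (u + d)"
        using det_pathD_right[OF c1 u(1) True] by metis
      then have "piece V i (cat c1 T1 c2) u (u + d)"
        by (intro piece_cong[OF d(4)]) (auto simp: cat_def)
      with d T True show ?thesis by (intro exI[of _ i] exI[of _ d]) (auto simp: cat_def)
    next
      case False
      then have "0 \<le> u - T1" "u - T1 < T2" using u by auto
      then obtain i d where d: "enters V i (c2 (u - T1))" "0 < d" "u - T1 + d \<le> T2"
          "piece V i c2 (u - T1) (u - T1 + d)"
        by (rule det_pathD_right[OF c2])
      have "piece V i (\<lambda>s. c2 (s + (- T1))) u (u + d)"
        using d(4) by (intro piece_shift) (simp add: algebra_simps)
      then have "piece V i (cat c1 T1 c2) u (u + d)"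
        by (rule piece_cong) (use cat2 False in auto)
      with d False show ?thesis by (intro exI[of _ i] exI[of _ d]) (auto simp: cat2)
    qed
  next
    fix u assume u: "0 < u" "u \<le> T1 + T2"
    show "\<exists>i d. 0 < d \<and> d \<le> u \<and> piece V i (cat c1 T1 c2) (u - d) u"
    proof (cases "u \<le> T1")
      case True
      then obtain i d where d: "0 < d" "d \<le> u" "piece V i c1 (u - d) u"
        by (rule det_pathD_left[OF c1 u(1)])
      then have "piece V i (cat c1 T1 c2) (u - d) u"
        using True by (intro piece_cong[OF d(3)]) (auto simp: cat_def)
      with d show ?thesis by blast
    next
      case False
      then have "0 < u - T1" "u - T1 \<le> T2" using u by auto
      then obtain i d where d: "0 < d" "d \<le> u - T1" "piece V i c2 (u - T1 - d) (u - T1)"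
        by (rule det_pathD_left[OF c2])
      have "piece V i (\<lambda>s. c2 (s + (- T1))) (u - d) u"
        using d(3) by (intro piece_shift) (simp add: algebra_simps)
      then have "piece V i (cat c1 T1 c2) (u - d) u"
        by (rule piece_cong) (use cat2 d in auto)
      with d T show ?thesis by (intro exI[of _ i] exI[of _ d]) auto
    qed
  qed (use T in simp)
qed

lemma cat_image:
  assumes "0 \<le> T1" "0 \<le> T2" "c1 T1 = c2 0"
  shows "cat c1 T1 c2 ` {0..T1 + T2} = c1 ` {0..T1} \<union> c2 ` {0..T2}"
proof -
  have "{0..T1 + T2} = {0..T1} \<union> (\<lambda>s. s + T1) ` {0..T2}"
    using assms by (auto simp: image_add_atLeastAtMost')
  moreover have "cat c1 T1 c2 ` {0..T1} = c1 ` {0..T1}"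
    by (intro image_cong) (auto simp: cat_def)
  moreover have "cat c1 T1 c2 ` (\<lambda>s. s + T1) ` {0..T2} = c2 ` {0..T2}"
    unfolding image_image by (intro image_cong) (use assms in \<open>auto simp: cat_def\<close>)
  ultimately show ?thesis by (simp add: image_Un)
qed

lemma det_path_suffix:
  assumes c: "det_path V c T" and s: "0 \<le> s" "s < T"
  shows "det_path V (\<lambda>u. c (u + s)) (T - s)"
  unfolding det_path_def
proof (intro conjI allI impI)
  fix u assume u: "0 \<le> u" "u < T - s"
  have "0 \<le> u + s" "u + s < T" using u s by auto
  then obtain i d where d: "enters V i (c (u + s))" "0 < d" "u + s + d \<le> T" "piece V i c (u + s) (u + s + d)"
    by (rule det_pathD_right[OF c])
  have "piece V i (\<lambda>u. c (u + s)) u (u + d)"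
    using d(4) by (intro piece_shift) (simp add: algebra_simps)
  with d show "\<exists>i d. enters V i (c (u + s)) \<and> 0 < d \<and> u + d \<le> T - s \<and> piece V i (\<lambda>u. c (u + s)) u (u + d)"
    by (intro exI[of _ i] exI[of _ d]) auto
next
  fix u assume u: "0 < u" "u \<le> T - s"
  have "0 < u + s" "u + s \<le> T" using u s by auto
  then obtain i d where d: "0 < d" "d \<le> u + s" "piece V i c (u + s - d) (u + s)"
    by (rule det_pathD_left[OF c])
  have "piece V i (\<lambda>u. c (u + s)) (u - min d u) u"
    by (rule piece_shift, rule piece_subset[OF d(3)]) auto
  with d u show "\<exists>i d. 0 < d \<and> d \<le> u \<and> piece V i (\<lambda>u. c (u + s)) (u - d) u"
    by (intro exI[of _ i] exI[of _ "min d u"]) auto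
qed (use s in simp)

section \<open>Closed paths\<close>

definition periodic_ext :: "(real \<Rightarrow> plane) \<Rightarrow> real \<Rightarrow> real \<Rightarrow> plane" where
  "periodic_ext c T t = c (t - T * of_int \<lfloor>t / T\<rfloor>)"

lemma periodic_ext_eq:
  assumes "0 < T" "c T = c 0" "0 \<le> x" "x \<le> T"
  shows "periodic_ext c T (x + T * of_int n) = c x"
proof -
  have *: "(x + T * of_int n) / T = x / T + of_int n" using assms by (simp add: field_simps)
  show ?thesis
  proof (cases "x = T")
    case True
    then have "\<lfloor>x / T + of_int n\<rfloor> = n + 1" using assms by simp
    then show ?thesis unfolding periodic_ext_def * using True assms by (simp add: algebra_simps)
  next
    case False
    then have "\<lfloor>x / T\<rfloor> = 0" using assms by (simp add: floor_eq_iff)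
    then have "\<lfloor>x / T + of_int n\<rfloor> = n" by (simp only: floor_add_int[symmetric])
    then show ?thesis unfolding periodic_ext_def * by simp
  qed
qed

lemma real_decompose:
  fixes T :: real assumes "0 < T"
  obtains x n where "0 \<le> x" "x < T" "t = x + T * of_int n"
proof (rule that[of "t - T * of_int \<lfloor>t / T\<rfloor>" "\<lfloor>t / T\<rfloor>"])
  have 1: "of_int \<lfloor>t / T\<rfloor> \<le> t / T" and 2: "t / T < of_int \<lfloor>t / T\<rfloor> + 1" by linarith+
  show "0 \<le> t - T * of_int \<lfloor>t / T\<rfloor>"
    using mult_left_mono[OF 1, of T] assms by simp
  show "t - T * of_int \<lfloor>t / T\<rfloor> < T"
    using mult_strict_left_mono[OF 2 assms] assms by (simp add: algebra_simps)
qed simp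

lemma periodic_ext_periodic:
  assumes "0 < T" "c T = c 0"
  shows "periodic_ext c T (t + T) = periodic_ext c T t"
proof -
  obtain x n where x: "0 \<le> x" "x < T" "t = x + T * of_int n" by (rule real_decompose[OF assms(1)])
  have "t + T = x + T * of_int (n + 1)" using x by (simp add: algebra_simps)
  then show ?thesis using periodic_ext_eq[OF assms] x by (metis less_imp_le)
qed

lemma range_periodic_ext:
  assumes "0 < T" "c T = c 0"
  shows "range (periodic_ext c T) = c ` {0..T}"
proof
  show "range (periodic_ext c T) \<subseteq> c ` {0..T}"
  proof
    fix p assume "p \<in> range (periodic_ext c T)"
    then obtain t where t: "p = periodic_ext c T t" by blast
    obtain x n where x: "0 \<le> x" "x < T" "t = x + T * of_int n" by (rule real_decompose[OF assms(1)])
    then have "p = c x" using periodic_ext_eq[OF assms] t by simp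
    then show "p \<in> c ` {0..T}" using x by simp
  qed
  show "c ` {0..T} \<subseteq> range (periodic_ext c T)"
  proof
    fix p assume "p \<in> c ` {0..T}"
    then obtain x where "p = c x" "0 \<le> x" "x \<le> T" by auto
    then have "p = periodic_ext c T x" using periodic_ext_eq[OF assms, of x 0] by simp
    then show "p \<in> range (periodic_ext c T)" by blast
  qed
qed

lemma trajectory_periodic_ext:
  assumes c: "det_path V c T" and closed: "c T = c 0"
  shows "trajectory V (periodic_ext c T)"
  unfolding trajectory_iff
proof (intro allI conjI)
  fix t
  have T: "0 < T" using c by (simp add: det_path_def)
  obtain x n where x: "0 \<le> x" "x < T" "t = x + T * of_int n" by (rule real_decompose[OF T])
  have shift: "piece V i (periodic_ext c T) (a + T * of_int m) (b + T * of_int m)"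
    if "piece V i c a b" "0 \<le> a" "b \<le> T" for i a b m
  proof -
    have "piece V i (\<lambda>s. c (s + - (T * of_int m))) (a + T * of_int m) (b + T * of_int m)"
      using that(1) by (intro piece_shift) simp
    then show ?thesis
    proof (rule piece_cong)
      fix s assume "a + T * of_int m \<le> s" "s \<le> b + T * of_int m"
      then show "periodic_ext c T s = c (s + - (T * of_int m))"
        using periodic_ext_eq[OF T closed, of "s - T * of_int m" m] that by simp
    qed
  qed
  obtain i d where "0 < d" "x + d \<le> T" "piece V i c x (x + d)" by (rule det_pathD_right[OF c x(1,2)])
  then have "piece V i (periodic_ext c T) (x + T * of_int n) (x + d + T * of_int n)"
    using x by (intro shift) auto
  then show "\<exists>i d. 0 < d \<and> piece V i (periodic_ext c T) t (t + d)"
    using \<open>0 < d\<close> x(3) by (intro exI[of _ i] exI[of _ d]) (simp add: algebra_simps)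
  obtain y m where y: "0 < y" "y \<le> T" "t = y + T * of_int m"
  proof (cases "x = 0")
    case True
    have "t = T + T * of_int (n - 1)" using x True by (simp add: algebra_simps)
    then show thesis using T by (intro that[of T "n - 1"]) auto
  next
    case False
    then show thesis using x by (intro that[of x n]) auto
  qed
  obtain i d where "0 < d" "d \<le> y" "piece V i c (y - d) y" by (rule det_pathD_left[OF c y(1,2)])
  then have "piece V i (periodic_ext c T) (y - d + T * of_int m) (y + T * of_int m)"
    using y by (intro shift) auto
  then show "\<exists>i d. 0 < d \<and> piece V i (periodic_ext c T) (t - d) t"
    using \<open>0 < d\<close> y(3) by (intro exI[of _ i] exI[of _ d]) (simp add: algebra_simps)
qed

lemma periodic_solution_periodic_ext:
  assumes uniq: "unique_pieces V" and c: "det_path V c T" and closed: "c T = c 0"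
    and simple: "\<And>u. 0 < u \<Longrightarrow> u < T \<Longrightarrow> c u \<noteq> c 0"
  shows "periodic_solution V (periodic_ext c T) T"
proof -
  let ?p = "periodic_ext c T"
  have T: "0 < T" using c by (simp add: det_path_def)
  have p: "?p x = c x" if "0 \<le> x" "x \<le> T" for x
    using periodic_ext_eq[OF T closed that, of 0] by simp
  have less: "s = s'" if "s \<in> {0..<T}" "s' \<in> {0..<T}" "?p s = ?p s'" "s \<le> s'" for s s'
  proof (rule ccontr)
    assume "s \<noteq> s'"
    have "?p (s' + (T - s)) = c (T - s + s)"
      by (rule det_path_follow[OF uniq det_path_suffix[OF c, of s] trajectory_periodic_ext[OF c closed]])
        (use that p in auto)
    also have "s' + (T - s) = (s' - s) + T" by simp
    also have "?p \<dots> = ?p (s' - s)" by (rule periodic_ext_periodic[OF T closed])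
    also have "\<dots> = c (s' - s)" using that by (intro p) auto
    finally show False using simple[of "s' - s"] closed that \<open>s \<noteq> s'\<close> by auto
  qed
  have "inj_on ?p {0..<T}"
    by (rule inj_onI, metis less linear)
  then show ?thesis
    unfolding periodic_solution_def
    using trajectory_periodic_ext[OF c closed] T periodic_ext_periodic[OF T closed] by blast
qed

lemma trajectory_range_closed_path:
  assumes uniq: "unique_pieces V" and c: "det_path V c T" and closed: "c T = c 0"
    and \<gamma>: "trajectory V \<gamma>" and per: "0 < T'" "\<And>t. \<gamma> (t + T') = \<gamma> t" and start: "\<gamma> t0 = c 0"
  shows "range \<gamma> = c ` {0..T}"
proof -
  have T: "0 < T" using c by (simp add: det_path_def)
  have starts: "\<gamma> (t0 + T * of_nat n) = c 0" for n
  proof (induction n)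
    case (Suc n)
    have "\<gamma> (t0 + T * of_nat n + T) = c T"
      by (rule det_path_follow[OF uniq c \<gamma> Suc]) (use T in auto)
    then show ?case using closed by (simp add: algebra_simps)
  qed (use start in simp)
  have pern: "\<gamma> (t + T' * of_nat n) = \<gamma> t" for t n
  proof (induction n)
    case (Suc n)
    have "t + T' * of_nat (Suc n) = t + T' * of_nat n + T'" by (simp add: algebra_simps)
    then show ?case using per(2)[of "t + T' * of_nat n"] Suc by metis
  qed simp
  show ?thesis
  proof
    show "range \<gamma> \<subseteq> c ` {0..T}"
    proof
      fix p assume "p \<in> range \<gamma>"
      then obtain t where t: "p = \<gamma> t" by blast
      obtain k :: nat where "(t0 - t) / T' < k" using reals_Archimedean2 by blast
      then have k: "t0 \<le> t + T' * k" using per(1) by (simp add: field_simps)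
      obtain x n where x: "0 \<le> x" "x < T" "t + T' * k - t0 = x + T * of_int n"
        by (rule real_decompose[OF T])
      have "n \<ge> 0"
      proof (rule ccontr)
        assume "\<not> n \<ge> 0"
        then have "of_int n \<le> (-1::real)" by linarith
        then have "T * of_int n \<le> T * (-1)" using T by (intro mult_left_mono) auto
        then show False using x k by linarith
      qed
      then have "t + T' * k = t0 + T * of_nat (nat n) + x" using x by simp
      then have "\<gamma> (t + T' * k) = c x"
        using det_path_follow[OF uniq c \<gamma> starts, of x "nat n"] x by simp
      then show "p \<in> c ` {0..T}" using t pern x by simp
    qed
    show "c ` {0..T} \<subseteq> range \<gamma>"
    proof
      fix p assume "p \<in> c ` {0..T}"
      then obtain x where "p = c x" "0 \<le> x" "x \<le> T" by auto
      then have "p = \<gamma> (t0 + x)" using det_path_follow[OF uniq c \<gamma> start] by simp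
      then show "p \<in> range \<gamma>" by blast
    qed
  qed
qed

section \<open>Zones\<close>

lemma interior_zones [simp]:
  "interior {p :: plane. fst p \<le> -1} = {p. fst p < -1}"
  "interior {p :: plane. -1 \<le> fst p \<and> fst p \<le> 1} = {p. -1 < fst p \<and> fst p < 1}"
  "interior {p :: plane. 1 \<le> fst p} = {p. 1 < fst p}"
proof -
  have "{p :: plane. fst p \<le> -1} = {..-1} \<times> UNIV" "{p :: plane. -1 \<le> fst p \<and> fst p \<le> 1} = {-1..1} \<times> UNIV"
    "{p :: plane. 1 \<le> fst p} = {1..} \<times> UNIV" by auto
  then show "interior {p :: plane. fst p \<le> -1} = {p. fst p < -1}"
    "interior {p :: plane. -1 \<le> fst p \<and> fst p \<le> 1} = {p. -1 < fst p \<and> fst p < 1}"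
    "interior {p :: plane. 1 \<le> fst p} = {p. 1 < fst p}"
    by (auto simp: interior_Times)
qed

lemma not_switching_interior: "p \<in> interior (zone_set i) \<Longrightarrow> p \<notin> switching_lines"
  by (cases i) (auto simp: switching_lines_def)

lemma enters_interior: "p \<in> interior (zone_set i) \<Longrightarrow> enters V i p"
  unfolding enters_def
proof (intro allI impI)
  fix j \<gamma> a b assume p: "p \<in> interior (zone_set i)" and *: "a < (b::real)" "piece V j \<gamma> a b" "\<gamma> a = p"
  then have "p \<in> zone_set j" unfolding piece_def by (metis atLeastAtMost_iff less_imp_le order_refl)
  then show "j = i" using p by (cases i; cases j) auto
qed

lemma piece_fst_derivative:
  assumes "piece V i \<gamma> a b" "s \<in> {a..b}"
  shows "((\<lambda>s. fst (\<gamma> s)) has_real_derivative fst (V i (\<gamma> s))) (at s within {a..b})"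
proof -
  have "(\<gamma> has_vector_derivative V i (\<gamma> s)) (at s within {a..b})"
    using assms by (simp add: piece_def)
  then show ?thesis
    unfolding has_real_derivative_iff_has_vector_derivative
    by (rule bounded_linear.has_vector_derivative[OF bounded_linear_fst])
qed

lemma piece_fst_increases:
  assumes "piece V i \<gamma> a b" "a < b" "fst (V i (\<gamma> a)) > 0"
  shows "\<exists>s\<in>{a..b}. fst (\<gamma> s) > fst (\<gamma> a)"
proof -
  obtain d where d: "d > 0" "\<And>h. h > 0 \<Longrightarrow> a + h \<in> {a..b} \<Longrightarrow> h < d \<Longrightarrow> fst (\<gamma> a) < fst (\<gamma> (a + h))"
    using has_real_derivative_pos_inc_right[OF piece_fst_derivative[OF assms(1), of a]] assms by auto
  have "fst (\<gamma> a) < fst (\<gamma> (a + min (d/2) (b - a)))"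
    by (rule d(2)) (use d(1) assms(2) in auto)
  then show ?thesis using d(1) assms(2) by (intro bexI[of _ "a + min (d/2) (b - a)"]) auto
qed

lemma piece_fst_decreases:
  assumes "piece V i \<gamma> a b" "a < b" "fst (V i (\<gamma> a)) < 0"
  shows "\<exists>s\<in>{a..b}. fst (\<gamma> s) < fst (\<gamma> a)"
proof -
  obtain d where d: "d > 0" "\<And>h. h > 0 \<Longrightarrow> a + h \<in> {a..b} \<Longrightarrow> h < d \<Longrightarrow> fst (\<gamma> a) > fst (\<gamma> (a + h))"
    using has_real_derivative_neg_dec_right[OF piece_fst_derivative[OF assms(1), of a]] assms by auto
  have "fst (\<gamma> a) > fst (\<gamma> (a + min (d/2) (b - a)))"
    by (rule d(2)) (use d(1) assms(2) in auto)
  then show ?thesis using d(1) assms(2) by (intro bexI[of _ "a + min (d/2) (b - a)"]) auto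
qed

lemma piece_in_zone: "piece V i \<gamma> a b \<Longrightarrow> a \<le> s \<Longrightarrow> s \<le> b \<Longrightarrow> \<gamma> s \<in> zone_set i"
  by (simp add: piece_def)

lemma enters_right:
  assumes "fst p = 1" "fst (V CentralZone p) > 0" shows "enters V RightZone p"
  unfolding enters_def
proof (intro allI impI)
  fix j \<gamma> a b assume *: "a < (b::real)" "piece V j \<gamma> a b" "\<gamma> a = p"
  have "p \<in> zone_set j" using piece_in_zone[OF *(2), of a] * by simp
  moreover have "j \<noteq> CentralZone"
    using piece_fst_increases[OF *(2,1)] piece_in_zone[OF *(2)] assms * by fastforce
  ultimately show "j = RightZone" using assms(1) by (cases j) auto
qed

lemma enters_left:
  assumes "fst p = -1" "fst (V CentralZone p) < 0" shows "enters V LeftZone p"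
  unfolding enters_def
proof (intro allI impI)
  fix j \<gamma> a b assume *: "a < (b::real)" "piece V j \<gamma> a b" "\<gamma> a = p"
  have "p \<in> zone_set j" using piece_in_zone[OF *(2), of a] * by simp
  moreover have "j \<noteq> CentralZone"
    using piece_fst_decreases[OF *(2,1)] piece_in_zone[OF *(2)] assms * by fastforce
  ultimately show "j = LeftZone" using assms(1) by (cases j) auto
qed

lemma enters_central_from_right:
  assumes "fst p = 1" "fst (V RightZone p) < 0" shows "enters V CentralZone p"
  unfolding enters_def
proof (intro allI impI)
  fix j \<gamma> a b assume *: "a < (b::real)" "piece V j \<gamma> a b" "\<gamma> a = p"
  have "p \<in> zone_set j" using piece_in_zone[OF *(2), of a] * by simp
  moreover have "j \<noteq> RightZone"
    using piece_fst_decreases[OF *(2,1)] piece_in_zone[OF *(2)] assms * by fastforce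
  ultimately show "j = CentralZone" using assms(1) by (cases j) auto
qed

lemma enters_central_from_left:
  assumes "fst p = -1" "fst (V LeftZone p) > 0" shows "enters V CentralZone p"
  unfolding enters_def
proof (intro allI impI)
  fix j \<gamma> a b assume *: "a < (b::real)" "piece V j \<gamma> a b" "\<gamma> a = p"
  have "p \<in> zone_set j" using piece_in_zone[OF *(2), of a] * by simp
  moreover have "j \<noteq> LeftZone"
    using piece_fst_increases[OF *(2,1)] piece_in_zone[OF *(2)] assms * by fastforce
  ultimately show "j = CentralZone" using assms(1) by (cases j) auto
qed

lemma det_path_arc:
  assumes "0 < T" "piece V i c 0 T" "enters V i (c 0)"
    and "\<And>u. 0 < u \<Longrightarrow> u < T \<Longrightarrow> c u \<in> interior (zone_set i)"
  shows "det_path V c T"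
  unfolding det_path_def
proof (intro conjI allI impI)
  fix u assume u: "0 \<le> u" "u < T"
  have "enters V i (c u)" using assms u by (cases "u = 0") (auto intro: enters_interior)
  moreover have "piece V i c u (u + (T - u))" using piece_subset[OF assms(2)] u by simp
  ultimately show "\<exists>i d. enters V i (c u) \<and> 0 < d \<and> u + d \<le> T \<and> piece V i c u (u + d)"
    using u by (intro exI[of _ i] exI[of _ "T - u"]) auto
next
  fix u assume u: "0 < u" "u \<le> T"
  have "piece V i c (u - u) u" using piece_subset[OF assms(2)] u by simp
  then show "\<exists>i d. 0 < d \<and> d \<le> u \<and> piece V i c (u - d) u" using u by blast
qed (use assms in simp)


section \<open>Generalized trigonometric functions\<close>

text \<open>The solutions of \<open>f'' = K f\<close> with initial values \<open>(1, 0)\<close> and \<open>(0, 1)\<close>, for \<open>K \<noteq> 0\<close>.\<close>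

definition gcosh :: "real \<Rightarrow> real \<Rightarrow> real" where
  "gcosh K t = (if K < 0 then cos (sqrt (- K) * t) else cosh (sqrt K * t))"

definition gsinh :: "real \<Rightarrow> real \<Rightarrow> real" where
  "gsinh K t = (if K < 0 then sin (sqrt (- K) * t) / sqrt (- K) else sinh (sqrt K * t) / sqrt K)"

lemma gcosh_0 [simp]: "gcosh K 0 = 1" and gsinh_0 [simp]: "gsinh K 0 = 0"
  by (auto simp: gcosh_def gsinh_def)

lemma gcosh_has_derivative [derivative_intros]:
  assumes "K \<noteq> 0" "(f has_field_derivative f') (at t within S)"
  shows "((\<lambda>t. gcosh K (f t)) has_field_derivative K * gsinh K (f t) * f') (at t within S)"
proof -
  define w where "w = sqrt \<bar>K\<bar>"
  have w: "w > 0" "K = w\<^sup>2 \<or> K = - w\<^sup>2" using assms(1) by (auto simp: w_def)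
  then show ?thesis unfolding gcosh_def gsinh_def
    by (auto intro!: derivative_eq_intros assms simp: field_simps power2_eq_square)
qed

lemma gsinh_has_derivative [derivative_intros]:
  assumes "K \<noteq> 0" "(f has_field_derivative f') (at t within S)"
  shows "((\<lambda>t. gsinh K (f t)) has_field_derivative gcosh K (f t) * f') (at t within S)"
proof -
  define w where "w = sqrt \<bar>K\<bar>"
  have w: "w > 0" "K = w\<^sup>2 \<or> K = - w\<^sup>2" using assms(1) by (auto simp: w_def)
  then show ?thesis unfolding gcosh_def gsinh_def
    by (auto intro!: derivative_eq_intros assms simp: field_simps power2_eq_square)
qed

lemma gcosh_minus [simp]: "gcosh K (- t) = gcosh K t" and gsinh_minus [simp]: "gsinh K (- t) = - gsinh K t"
  by (auto simp: gcosh_def gsinh_def)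

lemma gcosh_add: "K \<noteq> 0 \<Longrightarrow> gcosh K (s + t) = gcosh K s * gcosh K t + K * gsinh K s * gsinh K t"
  by (auto simp: gcosh_def gsinh_def cos_add cosh_add distrib_left field_simps)

lemma gsinh_add: "K \<noteq> 0 \<Longrightarrow> gsinh K (s + t) = gsinh K s * gcosh K t + gcosh K s * gsinh K t"
  by (auto simp: gcosh_def gsinh_def sin_add sinh_add distrib_left field_simps)

lemma gcosh_gsinh: "K \<noteq> 0 \<Longrightarrow> (gcosh K t)\<^sup>2 - K * (gsinh K t)\<^sup>2 = 1"
  using gcosh_add[of K t "- t"] by (simp add: power2_eq_square)

lemma continuous_on_gcosh [continuous_intros]:
    "continuous_on S f \<Longrightarrow> continuous_on S (\<lambda>x. gcosh K (f x))"
  and continuous_on_gsinh [continuous_intros]: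
    "continuous_on S f \<Longrightarrow> continuous_on S (\<lambda>x. gsinh K (f x))"
proof -
  have 1: "continuous_on UNIV (gcosh K)"
    unfolding gcosh_def by (cases "K < 0") (auto intro!: continuous_intros)
  have 2: "continuous_on UNIV (gsinh K)"
    unfolding gsinh_def divide_inverse by (cases "K < 0") (auto intro!: continuous_intros)
  show "continuous_on S (\<lambda>x. gcosh K (f x))" if "continuous_on S f"
    using continuous_on_compose2[OF 1 that] by simp
  show "continuous_on S (\<lambda>x. gsinh K (f x))" if "continuous_on S f"
    using continuous_on_compose2[OF 2 that] by simp
qed

definition entire_ext :: "(real \<Rightarrow> real) \<Rightarrow> bool" where
  "entire_ext f \<longleftrightarrow> (\<exists>g. g holomorphic_on UNIV \<and> (\<forall>t. g (of_real t) = complex_of_real (f t)))"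

lemma entire_extI:
  "g holomorphic_on UNIV \<Longrightarrow> (\<And>t. g (of_real t) = complex_of_real (f t)) \<Longrightarrow> entire_ext f"
  unfolding entire_ext_def by (intro exI[of _ g]) simp

lemma entire_ext_real_analytic: "entire_ext f \<Longrightarrow> real_analytic_at f x"
  unfolding entire_ext_def by (elim exE conjE) (rule real_analytic_at_holomorphic, auto)

lemma entire_ext_const: "entire_ext (\<lambda>t. c)"
  by (rule entire_extI[of "\<lambda>t. of_real c"]) auto

lemma entire_ext_add: "entire_ext f \<Longrightarrow> entire_ext h \<Longrightarrow> entire_ext (\<lambda>t. f t + h t)"
  unfolding entire_ext_def
proof (elim exE conjE)
  fix u v assume "u holomorphic_on UNIV" "v holomorphic_on UNIV"
    "\<forall>t. u (of_real t) = complex_of_real (f t)" "\<forall>t. v (of_real t) = complex_of_real (h t)"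
  then show "\<exists>g. g holomorphic_on UNIV \<and> (\<forall>t. g (of_real t) = complex_of_real (f t + h t))"
    by (intro exI[of _ "\<lambda>z. u z + v z"] conjI holomorphic_intros) auto
qed

lemma entire_ext_mult: "entire_ext f \<Longrightarrow> entire_ext h \<Longrightarrow> entire_ext (\<lambda>t. f t * h t)"
  unfolding entire_ext_def
proof (elim exE conjE)
  fix u v assume "u holomorphic_on UNIV" "v holomorphic_on UNIV"
    "\<forall>t. u (of_real t) = complex_of_real (f t)" "\<forall>t. v (of_real t) = complex_of_real (h t)"
  then show "\<exists>g. g holomorphic_on UNIV \<and> (\<forall>t. g (of_real t) = complex_of_real (f t * h t))"
    by (intro exI[of _ "\<lambda>z. u z * v z"] conjI holomorphic_intros) auto
qed

lemma entire_ext_exp: "entire_ext (\<lambda>t. exp (a * t))"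
  by (rule entire_extI[of "\<lambda>z. exp (of_real a * z)"])
    (auto intro!: holomorphic_intros simp flip: exp_of_real)

lemma entire_ext_gcosh: "entire_ext (gcosh K)"
proof (cases "K < 0")
  case True
  then show ?thesis
    by (intro entire_extI[of "\<lambda>z. cos (of_real (sqrt (- K)) * z)"])
      (auto simp: gcosh_def intro!: holomorphic_intros simp flip: cos_of_real)
next
  case False
  then show ?thesis
    by (intro entire_extI[of "\<lambda>z. (exp (of_real (sqrt K) * z) + exp (- (of_real (sqrt K) * z))) / 2"])
      (auto simp: gcosh_def cosh_def intro!: holomorphic_intros simp flip: exp_of_real)
qed

lemma entire_ext_gsinh: "entire_ext (gsinh K)"
proof (cases "K < 0")
  case True
  then show ?thesis
    by (intro entire_extI[of "\<lambda>z. sin (of_real (sqrt (- K)) * z) / of_real (sqrt (- K))"])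
      (auto simp: gsinh_def intro!: holomorphic_intros simp flip: sin_of_real)
next
  case False
  show ?thesis
  proof (cases "K = 0")
    case True
    then show ?thesis by (intro entire_extI[of "\<lambda>z. 0"]) (auto simp: gsinh_def)
  next
    case K: False
    then show ?thesis using False
      by (intro entire_extI[of "\<lambda>z. (exp (of_real (sqrt K) * z) - exp (- (of_real (sqrt K) * z))) / 2 / of_real (sqrt K)"])
        (auto simp: gsinh_def sinh_def intro!: holomorphic_intros simp flip: exp_of_real)
  qed
qed

lemma entire_ext_implicit:
  assumes a: "entire_ext a" and b: "entire_ext b"
    and da: "\<And>t. (a has_real_derivative a' t) (at t)" and db: "\<And>t. (b has_real_derivative b' t) (at t)"
    and root: "\<forall>\<^sub>F y in nhds y0. a (\<tau> y) + b (\<tau> y) * y = 0"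
    and cont: "isCont \<tau> y0" and nd: "a' (\<tau> y0) + b' (\<tau> y0) * y0 \<noteq> 0"
  shows "real_analytic_at \<tau> y0"
proof -
  obtain A B where A: "A holomorphic_on UNIV" "\<And>t. A (of_real t) = complex_of_real (a t)"
    and B: "B holomorphic_on UNIV" "\<And>t. B (of_real t) = complex_of_real (b t)"
    using a b unfolding entire_ext_def by metis
  have der: "deriv F (of_real t) = of_real f'"
    if "F holomorphic_on UNIV" "\<And>t. F (of_real t) = complex_of_real (f t)" "(f has_real_derivative f') (at t)"
    for F f f' t
  proof (rule vector_derivative_unique_at)
    have "(F has_field_derivative deriv F (of_real t)) (at (of_real t))"
      using that(1) by (rule holomorphic_derivI) auto
    then show "((\<lambda>t. F (of_real t)) has_vector_derivative deriv F (of_real t)) (at t)"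
      by (rule has_vector_derivative_real_field)
    have "((\<lambda>t. complex_of_real (f t)) has_vector_derivative of_real f') (at t)"
      using that(3) by (intro has_vector_derivative_of_real) (simp add: has_real_derivative_iff_has_vector_derivative)
    then show "((\<lambda>t. F (of_real t)) has_vector_derivative of_real f') (at t)"
      using that(2) by simp
  qed
  show ?thesis
  proof (rule real_analytic_implicit[OF A(1) B(1) A(2) B(2) root cont])
    have "complex_of_real (a' (\<tau> y0) + b' (\<tau> y0) * y0) \<noteq> 0" using nd of_real_eq_0_iff by blast
    then show "deriv A (of_real (\<tau> y0)) + deriv B (of_real (\<tau> y0)) * of_real y0 \<noteq> 0"
      using der[OF A da] der[OF B db] by simp
  qed
qed

section \<open>Persistence of arcs\<close>

lemma eventually_nhds_Pair:
  "(\<forall>\<^sub>F z in nhds (a, b). Q z) \<longleftrightarrow>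
    (\<exists>P1 P2. eventually P1 (nhds a) \<and> eventually P2 (nhds b) \<and> (\<forall>x y. P1 x \<longrightarrow> P2 y \<longrightarrow> Q (x, y)))"
  by (simp add: nhds_prod eventually_prod_filter)

lemma eventually_nhds_real: "(\<forall>\<^sub>F t in nhds (x::real). P t) \<longleftrightarrow> (\<exists>d>0. \<forall>t. \<bar>t - x\<bar> < d \<longrightarrow> P t)"
  by (simp add: eventually_nhds_metric dist_real_def)

lemma eventually_tube:
  assumes cont: "continuous_on (U \<times> UNIV) f" and U: "open U" "x0 \<in> U" and C: "compact C" and W: "open W"
    and sub: "\<And>t. t \<in> C \<Longrightarrow> f (x0, t) \<in> W"
  shows "\<forall>\<^sub>F x in nhds x0. \<forall>t\<in>C. f (x, t) \<in> W"
proof -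
  have "open ((U \<times> UNIV) \<inter> f -` W)"
    using cont U W by (intro continuous_open_preimage) (auto simp: open_Times)
  moreover have "{x0} \<times> C \<subseteq> (U \<times> UNIV) \<inter> f -` W" using sub U by auto
  ultimately obtain X0 where "x0 \<in> X0" "open X0" "X0 \<times> C \<subseteq> (U \<times> UNIV) \<inter> f -` W"
    using Elementary_Topology.tube_lemma[OF C] by metis
  then show ?thesis unfolding eventually_nhds by (intro exI[of _ X0]) blast
qed

lemma arc_persists:
  fixes h h' :: "real \<Rightarrow> 'a::metric_space \<Rightarrow> real"
  assumes U: "open U" "\<theta>0 \<in> U"
    and der: "\<And>t \<theta>. \<theta> \<in> U \<Longrightarrow> ((\<lambda>t. h t \<theta>) has_real_derivative h' t \<theta>) (at t)"
    and cont: "continuous_on (U \<times> UNIV) (\<lambda>z. h (snd z) (fst z))"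
    and cont': "continuous_on (U \<times> UNIV) (\<lambda>z. h' (snd z) (fst z))"
    and start: "\<And>\<theta>. \<theta> \<in> U \<Longrightarrow> h 0 \<theta> = x0"
    and W: "open W" and r0: "r0 > 0"
    and in0: "\<And>r. 0 < r \<Longrightarrow> r < r0 \<Longrightarrow> x0 + d0 * r \<in> W" and in1: "\<And>r. 0 < r \<Longrightarrow> r < r0 \<Longrightarrow> x1 - d1 * r \<in> W"
    and d: "d0 = 1 \<or> d0 = -1" "d1 = 1 \<or> d1 = -1"
    and trans: "h' 0 \<theta>0 * d0 > 0" "h' \<tau>0 \<theta>0 * d1 > 0"
    and hit: "0 < \<tau>0" "h \<tau>0 \<theta>0 = x1" "\<And>t. 0 < t \<Longrightarrow> t < \<tau>0 \<Longrightarrow> h t \<theta>0 \<in> W"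
    and \<zeta>: "\<zeta> > 0"
  shows "\<forall>\<^sub>F \<theta> in nhds \<theta>0. \<exists>\<tau>. \<bar>\<tau> - \<tau>0\<bar> < \<zeta> \<and> 0 < \<tau> \<and> h \<tau> \<theta> = x1 \<and> (\<forall>t. 0 < t \<longrightarrow> t < \<tau> \<longrightarrow> h t \<theta> \<in> W)"
proof -
  have opn: "open (U \<times> (UNIV :: real set))" using U by (simp add: open_Times)
  have tend: "((\<lambda>z. f (snd z) (fst z)) \<longlongrightarrow> f t \<theta>0) (nhds (\<theta>0, t))"
    if "continuous_on (U \<times> UNIV) (\<lambda>z. f (snd z) (fst z))" for f :: "real \<Rightarrow> 'a \<Rightarrow> real" and t
  proof -
    have "isCont (\<lambda>z. f (snd z) (fst z)) (\<theta>0, t)"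
      using that opn U by (simp add: continuous_on_eq_continuous_at)
    then show ?thesis
      using tendsto_at_iff_tendsto_nhds[of "\<lambda>z. f (snd z) (fst z)" "(\<theta>0, t)"] by (simp add: isCont_def)
  qed
  have e0: "\<forall>\<^sub>F z in nhds (\<theta>0, 0). h' (snd z) (fst z) * d0 > 0 \<and> dist (h (snd z) (fst z)) x0 < r0"
  proof (intro eventually_conj)
    show "\<forall>\<^sub>F z in nhds (\<theta>0, 0). h' (snd z) (fst z) * d0 > 0"
      by (rule order_tendstoD(1)[OF tendsto_mult_right[OF tend[OF cont']]]) (use trans in simp)
    show "\<forall>\<^sub>F z in nhds (\<theta>0, 0). dist (h (snd z) (fst z)) x0 < r0"
      using tendstoD[OF tend[OF cont, of 0] r0] start[OF U(2)] by simp
  qed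
  have e1: "\<forall>\<^sub>F z in nhds (\<theta>0, \<tau>0). h' (snd z) (fst z) * d1 > 0 \<and> dist (h (snd z) (fst z)) x1 < r0"
  proof (intro eventually_conj)
    show "\<forall>\<^sub>F z in nhds (\<theta>0, \<tau>0). h' (snd z) (fst z) * d1 > 0"
      by (rule order_tendstoD(1)[OF tendsto_mult_right[OF tend[OF cont']]]) (use trans in simp)
    show "\<forall>\<^sub>F z in nhds (\<theta>0, \<tau>0). dist (h (snd z) (fst z)) x1 < r0"
      using tendstoD[OF tend[OF cont, of \<tau>0] r0] hit by simp
  qed
  obtain A0 a0 where A0: "eventually A0 (nhds \<theta>0)" "a0 > 0"
      "\<And>\<theta> t. A0 \<theta> \<Longrightarrow> \<bar>t\<bar> < a0 \<Longrightarrow> h' t \<theta> * d0 > 0 \<and> \<bar>h t \<theta> - x0\<bar> < r0"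
    using e0 unfolding eventually_nhds_Pair eventually_nhds_real dist_real_def by auto
  obtain A1 a1 where A1: "eventually A1 (nhds \<theta>0)" "a1 > 0"
      "\<And>\<theta> t. A1 \<theta> \<Longrightarrow> \<bar>t - \<tau>0\<bar> < a1 \<Longrightarrow> h' t \<theta> * d1 > 0 \<and> \<bar>h t \<theta> - x1\<bar> < r0"
    using e1 unfolding eventually_nhds_Pair eventually_nhds_real dist_real_def by auto
  define a where "a = Min {a0 / 2, a1 / 2, \<zeta> / 2, \<tau>0 / 2}"
  have a: "a > 0" "a < a0" "a < a1" "a < \<zeta>" "a < \<tau>0"
    using A0(2) A1(2) \<zeta> hit(1) unfolding a_def by auto
  have U': "\<forall>\<^sub>F \<theta> in nhds \<theta>0. \<theta> \<in> U" using U by (rule eventually_nhds_in_open)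
  have mid: "\<forall>\<^sub>F \<theta> in nhds \<theta>0. \<forall>t\<in>{a..\<tau>0 - a}. h t \<theta> \<in> W"
    using eventually_tube[OF cont U compact_Icc W, of a "\<tau>0 - a"] hit(3) a by simp
  have mono: "h s \<theta> * e < h t \<theta> * e"
    if "\<theta> \<in> U" "s < t" "\<And>u. s \<le> u \<Longrightarrow> u \<le> t \<Longrightarrow> h' u \<theta> * e > 0" for s t \<theta> e
  proof (rule DERIV_pos_imp_increasing[OF that(2)])
    fix u assume "s \<le> u" "u \<le> t"
    then show "\<exists>y. ((\<lambda>u. h u \<theta> * e) has_real_derivative y) (at u) \<and> y > 0"
      using that(3) DERIV_cmult_right[OF der[OF that(1)]] by blast
  qed
  have lo0: "h (\<tau>0 - a) \<theta>0 * d1 < x1 * d1"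
    using mono[OF U(2), of "\<tau>0 - a" \<tau>0 d1] A1(3)[OF eventually_nhds_x_imp_x[OF A1(1)]] a hit(2) by simp
  have hi0: "x1 * d1 < h (\<tau>0 + a) \<theta>0 * d1"
    using mono[OF U(2), of \<tau>0 "\<tau>0 + a" d1] A1(3)[OF eventually_nhds_x_imp_x[OF A1(1)]] a hit(2) by simp
  have tend1: "((\<lambda>\<theta>. h t \<theta>) \<longlongrightarrow> h t \<theta>0) (nhds \<theta>0)" for t
  proof -
    have "filterlim (\<lambda>\<theta>. (\<theta>, t)) (nhds (\<theta>0, t)) (nhds \<theta>0)"
      by (intro tendsto_Pair tendsto_const) (simp add: filterlim_ident)
    from filterlim_compose[OF tend[OF cont] this] show ?thesis by simp
  qed
  have lo: "\<forall>\<^sub>F \<theta> in nhds \<theta>0. h (\<tau>0 - a) \<theta> * d1 < x1 * d1"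
    by (rule order_tendstoD(2)[OF tendsto_mult_right[OF tend1] lo0])
  have hi: "\<forall>\<^sub>F \<theta> in nhds \<theta>0. x1 * d1 < h (\<tau>0 + a) \<theta> * d1"
    by (rule order_tendstoD(1)[OF tendsto_mult_right[OF tend1] hi0])
  show ?thesis using A0(1) A1(1) U' mid lo hi
  proof eventually_elim
    case (elim \<theta>)
    have "continuous_on {\<tau>0 - a..\<tau>0 + a} (\<lambda>t. h t \<theta> * d1)"
      by (intro continuous_on_mult_right DERIV_continuous_on[where D = "\<lambda>t. h' t \<theta>"])
        (rule has_field_derivative_at_within[OF der[OF elim(3)]])
    then have "\<exists>\<tau>\<ge>\<tau>0 - a. \<tau> \<le> \<tau>0 + a \<and> h \<tau> \<theta> * d1 = x1 * d1"
      using elim(5,6) a by (intro IVT') auto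
    then obtain \<tau> where \<tau>: "\<tau>0 - a \<le> \<tau>" "\<tau> \<le> \<tau>0 + a" "h \<tau> \<theta> * d1 = x1 * d1" by blast
    have hx: "h \<tau> \<theta> = x1" using \<tau>(3) d(2) by auto
    have "h t \<theta> \<in> W" if t: "0 < t" "t < \<tau>" for t
    proof -
      consider "t < a" | "a \<le> t" "t \<le> \<tau>0 - a" | "\<tau>0 - a < t" by linarith
      then show ?thesis
      proof cases
        case 1
        have "x0 * d0 < h t \<theta> * d0"
          using mono[OF elim(3), of 0 t d0] A0(3)[OF elim(1)] start[OF elim(3)] t 1 a by simp
        moreover have "\<bar>h t \<theta> - x0\<bar> < r0" using A0(3)[OF elim(1), of t] t 1 a by simp
        ultimately have "0 < (h t \<theta> - x0) * d0" "(h t \<theta> - x0) * d0 < r0" using d(1) by (auto simp: algebra_simps)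
        then have "x0 + d0 * ((h t \<theta> - x0) * d0) \<in> W" by (rule in0)
        then show ?thesis using d(1) by auto
      next
        case 2
        then show ?thesis using elim(4) by simp
      next
        case 3
        have "h t \<theta> * d1 < x1 * d1"
          using mono[OF elim(3), of t \<tau> d1] A1(3)[OF elim(2)] t 3 a \<tau> hx by simp
        moreover have "\<bar>h t \<theta> - x1\<bar> < r0" using A1(3)[OF elim(2), of t] t 3 a \<tau> by simp
        ultimately have "0 < (x1 - h t \<theta>) * d1" "(x1 - h t \<theta>) * d1 < r0" using d(2) by (auto simp: algebra_simps)
        then have "x1 - d1 * ((x1 - h t \<theta>) * d1) \<in> W" by (rule in1)
        then show ?thesis using d(2) by auto
      qed
    qed
    then show ?case using \<tau> hx a by (intro exI[of _ \<tau>]) auto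
  qed
qed


section \<open>The perturbed system in normal form\<close>

text \<open>In every zone the field is \<open>z \<mapsto> (M + \<epsilon> \<delta>) (z - \<sigma>)\<close> with a trace-free matrix \<open>M\<close> and a singular
  point \<open>\<sigma>\<close> depending on \<open>\<epsilon>\<close>.  As \<open>\<epsilon> \<delta>\<close> is a scalar matrix, it commutes with \<open>M\<close>, so that the
  flow is explicit and the quadratic first integral of \<open>M\<close> is multiplied by \<open>exp (2 \<epsilon> \<delta> t)\<close>.\<close>

lemma saddle_form_identity:
  fixes C S E u v r g :: real
  shows "(E * (C * v + S * (g * r) * u))\<^sup>2 / 2 - g / 2 * (E * (C * u + S * r * v))\<^sup>2
      = E * E * ((C * C - r * (g * r) * (S * S)) * (v\<^sup>2 / 2 - g / 2 * u\<^sup>2))"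
proof -
  have "(E * (C * v + S * (g * r) * u))\<^sup>2 - g * (E * (C * u + S * r * v))\<^sup>2
      = E * E * ((C * C - r * (g * r) * (S * S)) * (v\<^sup>2 - g * u\<^sup>2))"
    by (simp add: power2_eq_square algebra_simps)
  then show ?thesis by (simp add: diff_divide_distrib[symmetric])
qed

locale normal_form =
  fixes \<rho> \<mu> s \<delta> m :: "zone \<Rightarrow> real"
  assumes \<rho>_pos: "\<rho> i > 0" and \<mu>_nonzero: "\<mu> i \<noteq> 0"
begin

definition field :: "real \<Rightarrow> zone \<Rightarrow> plane \<Rightarrow> plane" where
  "field \<epsilon> i p = (\<rho> i * (snd p - \<epsilon> * m i) + \<epsilon> * \<delta> i * (fst p - s i),
                 \<mu> i * (fst p - s i) + \<epsilon> * \<delta> i * snd p)"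

definition K :: "zone \<Rightarrow> real" where "K i = \<rho> i * \<mu> i"

definition D :: "real \<Rightarrow> zone \<Rightarrow> real" where "D \<epsilon> i = K i - (\<epsilon> * \<delta> i)\<^sup>2"

definition sx :: "real \<Rightarrow> zone \<Rightarrow> real" where "sx \<epsilon> i = s i - \<epsilon>\<^sup>2 * \<delta> i * \<rho> i * m i / D \<epsilon> i"

definition sz :: "real \<Rightarrow> zone \<Rightarrow> real" where "sz \<epsilon> i = \<epsilon> * K i * m i / D \<epsilon> i"

definition small :: "real set" where "small = {\<epsilon>. \<forall>i. D \<epsilon> i \<noteq> 0}"

definition flow :: "real \<Rightarrow> zone \<Rightarrow> plane \<Rightarrow> real \<Rightarrow> plane" where
  "flow \<epsilon> i p t =
    (sx \<epsilon> i + exp (\<epsilon> * \<delta> i * t) * (gcosh (K i) t * (fst p - sx \<epsilon> i) + gsinh (K i) t * \<rho> i * (snd p - sz \<epsilon> i)),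
     sz \<epsilon> i + exp (\<epsilon> * \<delta> i * t) * (gcosh (K i) t * (snd p - sz \<epsilon> i) + gsinh (K i) t * \<mu> i * (fst p - sx \<epsilon> i)))"

lemma K_nonzero: "K i \<noteq> 0"
  using \<rho>_pos[of i] \<mu>_nonzero[of i] by (simp add: K_def)

lemma zero_small: "0 \<in> small"
  by (simp add: small_def D_def K_nonzero)

lemma small_eq: "small = {\<epsilon>. D \<epsilon> LeftZone \<noteq> 0 \<and> D \<epsilon> CentralZone \<noteq> 0 \<and> D \<epsilon> RightZone \<noteq> 0}"
  unfolding small_def by (metis zone.exhaust)

lemma open_small: "open small"
  unfolding small_eq D_def
  by (intro open_Collect_conj open_Collect_neq continuous_intros)

lemma field_shift:
  assumes "D \<epsilon> i \<noteq> 0"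
  shows "field \<epsilon> i p = (\<rho> i * (snd p - sz \<epsilon> i) + \<epsilon> * \<delta> i * (fst p - sx \<epsilon> i),
                        \<mu> i * (fst p - sx \<epsilon> i) + \<epsilon> * \<delta> i * (snd p - sz \<epsilon> i))"
proof -
  define d where "d = D \<epsilon> i"
  have d: "d \<noteq> 0" "K i = d + (\<epsilon> * \<delta> i)\<^sup>2" "\<mu> i = (d + (\<epsilon> * \<delta> i)\<^sup>2) / \<rho> i" "\<rho> i \<noteq> 0"
    using assms \<rho>_pos[of i] by (auto simp: d_def D_def K_def)
  show ?thesis unfolding field_def sx_def sz_def d_def[symmetric] d(2) d(3)
    using d(1,4) by (simp add: field_simps power2_eq_square)
qed

lemma flow_0 [simp]: "flow \<epsilon> i p 0 = p"
  by (simp add: flow_def prod_eq_iff)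

lemma flow_derivative:
  assumes "D \<epsilon> i \<noteq> 0"
  shows "(flow \<epsilon> i p has_vector_derivative field \<epsilon> i (flow \<epsilon> i p t)) (at t within S)"
proof -
  note K = K_nonzero[of i]
  have 1: "((\<lambda>t. fst (flow \<epsilon> i p t)) has_real_derivative fst (field \<epsilon> i (flow \<epsilon> i p t))) (at t within S)"
    unfolding field_shift[OF assms] flow_def fst_conv snd_conv
    by (rule derivative_eq_intros K refl | simp)+ (simp add: K_def algebra_simps)
  have 2: "((\<lambda>t. snd (flow \<epsilon> i p t)) has_real_derivative snd (field \<epsilon> i (flow \<epsilon> i p t))) (at t within S)"
    unfolding field_shift[OF assms] flow_def fst_conv snd_conv
    by (rule derivative_eq_intros K refl | simp)+ (simp add: K_def algebra_simps)
  have "((\<lambda>t. (fst (flow \<epsilon> i p t), snd (flow \<epsilon> i p t))) has_vector_derivative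
     (fst (field \<epsilon> i (flow \<epsilon> i p t)), snd (field \<epsilon> i (flow \<epsilon> i p t)))) (at t within S)"
    using 1 2 unfolding has_real_derivative_iff_has_vector_derivative by (rule has_vector_derivative_Pair)
  then show ?thesis by simp
qed

lemma flow_add: "flow \<epsilon> i (flow \<epsilon> i p t) u = flow \<epsilon> i p (t + u)"
proof -
  define C S E C' S' E' where "C = gcosh (K i) t" and "S = gsinh (K i) t" and "E = exp (\<epsilon> * \<delta> i * t)"
    and "C' = gcosh (K i) u" and "S' = gsinh (K i) u" and "E' = exp (\<epsilon> * \<delta> i * u)"
  note d = this
  have C: "gcosh (K i) (t + u) = C * C' + \<rho> i * \<mu> i * S * S'"
    unfolding gcosh_add[OF K_nonzero] d by (simp add: K_def)
  have S: "gsinh (K i) (t + u) = S * C' + C * S'"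
    unfolding gsinh_add[OF K_nonzero] d ..
  have E: "exp (\<epsilon> * \<delta> i * (t + u)) = E * E'"
    by (simp add: d distrib_left exp_add)
  show ?thesis
    unfolding flow_def C S E fst_conv snd_conv d[symmetric] by (simp add: algebra_simps)
qed

lemma flow_unique:
  assumes D: "D \<epsilon> i \<noteq> 0"
    and sol: "\<And>u. u \<in> {a..b} \<Longrightarrow> (\<gamma> has_vector_derivative field \<epsilon> i (\<gamma> u)) (at u within {a..b})"
    and t: "t \<in> {a..b}"
  shows "\<gamma> t = flow \<epsilon> i (\<gamma> a) (t - a)"
proof -
  note K = K_nonzero[of i]
  define X where "X = (\<lambda>u. fst (\<gamma> u) - sx \<epsilon> i)"
  define Z where "Z = (\<lambda>u. snd (\<gamma> u) - sz \<epsilon> i)"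
  have dX: "(X has_real_derivative \<rho> i * Z u + \<epsilon> * \<delta> i * X u) (at u within {a..b})" if "u \<in> {a..b}" for u
  proof -
    have "((\<lambda>u. fst (\<gamma> u)) has_real_derivative fst (field \<epsilon> i (\<gamma> u))) (at u within {a..b})"
      unfolding has_real_derivative_iff_has_vector_derivative
      by (rule bounded_linear.has_vector_derivative[OF bounded_linear_fst sol[OF that]])
    then show ?thesis unfolding X_def Z_def field_shift[OF D]
      by (auto intro!: derivative_eq_intros)
  qed
  have dZ: "(Z has_real_derivative \<mu> i * X u + \<epsilon> * \<delta> i * Z u) (at u within {a..b})" if "u \<in> {a..b}" for u
  proof -
    have "((\<lambda>u. snd (\<gamma> u)) has_real_derivative snd (field \<epsilon> i (\<gamma> u))) (at u within {a..b})"
      unfolding has_real_derivative_iff_has_vector_derivative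
      by (rule bounded_linear.has_vector_derivative[OF bounded_linear_snd sol[OF that]])
    then show ?thesis unfolding X_def Z_def field_shift[OF D]
      by (auto intro!: derivative_eq_intros)
  qed
  define e where "e = (\<lambda>u. exp (- (\<epsilon> * \<delta> i * (u - a))))"
  define C where "C = (\<lambda>u. gcosh (K i) (u - a))"
  define S where "S = (\<lambda>u. gsinh (K i) (u - a))"
  have de: "(e has_real_derivative - (\<epsilon> * \<delta> i) * e u) (at u within {a..b})"
    and dC: "(C has_real_derivative K i * S u) (at u within {a..b})"
    and dS: "(S has_real_derivative C u) (at u within {a..b})" for u
    unfolding e_def C_def S_def using K by (auto intro!: derivative_eq_intros)
  have "((\<lambda>u. e u * (C u * X u - S u * \<rho> i * Z u)) has_real_derivative 0) (at u within {a..b})"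
    if "u \<in> {a..b}" for u
    by (rule derivative_eq_intros de dC dS dX[OF that] dZ[OF that] refl)+ (simp add: K_def algebra_simps)
  then obtain c1 where c1: "\<And>u. u \<in> {a..b} \<Longrightarrow> e u * (C u * X u - S u * \<rho> i * Z u) = c1"
    using has_field_derivative_zero_constant[of "{a..b}" "\<lambda>u. e u * (C u * X u - S u * \<rho> i * Z u)"] by auto
  have "((\<lambda>u. e u * (C u * Z u - S u * \<mu> i * X u)) has_real_derivative 0) (at u within {a..b})"
    if "u \<in> {a..b}" for u
    by (rule derivative_eq_intros de dC dS dX[OF that] dZ[OF that] refl)+ (simp add: K_def algebra_simps)
  then obtain c2 where c2: "\<And>u. u \<in> {a..b} \<Longrightarrow> e u * (C u * Z u - S u * \<mu> i * X u) = c2"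
    using has_field_derivative_zero_constant[of "{a..b}" "\<lambda>u. e u * (C u * Z u - S u * \<mu> i * X u)"] by auto
  have "a \<in> {a..b}" using t by simp
  from c1[OF this] c2[OF this] have c: "c1 = X a" "c2 = Z a" by (auto simp: e_def C_def S_def)
  define E where "E = exp (\<epsilon> * \<delta> i * (t - a))"
  have E: "E * e t = 1" by (simp add: E_def e_def flip: exp_add)
  have Xa: "X a = e t * (C t * X t - S t * \<rho> i * Z t)" and Za: "Z a = e t * (C t * Z t - S t * \<mu> i * X t)"
    using c1[OF t] c2[OF t] c by simp_all
  have CS: "C t * C t - K i * (S t * S t) = 1"
    using gcosh_gsinh[OF K, of "t - a"] by (simp add: C_def S_def power2_eq_square)
  have "E * (C t * X a + S t * \<rho> i * Z a)
      = (E * e t) * (C t * (C t * X t - S t * \<rho> i * Z t) + S t * \<rho> i * (C t * Z t - S t * \<mu> i * X t))"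
    unfolding Xa Za by (simp add: algebra_simps)
  also have "\<dots> = (C t * C t - K i * (S t * S t)) * X t" unfolding E by (simp add: K_def algebra_simps)
  finally have 1: "X t = E * (C t * X a + S t * \<rho> i * Z a)" unfolding CS by simp
  have "E * (C t * Z a + S t * \<mu> i * X a)
      = (E * e t) * (C t * (C t * Z t - S t * \<mu> i * X t) + S t * \<mu> i * (C t * X t - S t * \<rho> i * Z t))"
    unfolding Xa Za by (simp add: algebra_simps)
  also have "\<dots> = (C t * C t - K i * (S t * S t)) * Z t" unfolding E by (simp add: K_def algebra_simps)
  finally have 2: "Z t = E * (C t * Z a + S t * \<mu> i * X a)" unfolding CS by simp
  show ?thesis
    using 1 2 unfolding flow_def X_def Z_def E_def C_def S_def by (simp add: prod_eq_iff)
qed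

lemma unique_pieces_field:
  assumes "\<epsilon> \<in> small" shows "unique_pieces (field \<epsilon>)"
  unfolding unique_pieces_def
proof (intro allI impI)
  fix i \<gamma> \<gamma>' and a b :: real
  assume *: "a \<le> b" "piece (field \<epsilon>) i \<gamma> a b" "piece (field \<epsilon>) i \<gamma>' a b" "\<gamma> a = \<gamma>' a"
  have D: "D \<epsilon> i \<noteq> 0" using assms by (simp add: small_def)
  have "\<gamma> b = flow \<epsilon> i (\<gamma> a) (b - a)"
    by (rule flow_unique[OF D]) (use * in \<open>auto simp: piece_def\<close>)
  moreover have "\<gamma>' b = flow \<epsilon> i (\<gamma>' a) (b - a)"
    by (rule flow_unique[OF D]) (use * in \<open>auto simp: piece_def\<close>)
  ultimately show "\<gamma> b = \<gamma>' b" using *(4) by simp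
qed

lemma flow_first_integral:
  "(snd (flow \<epsilon> i p t) - sz \<epsilon> i)\<^sup>2 / 2 - \<mu> i / (2 * \<rho> i) * (fst (flow \<epsilon> i p t) - sx \<epsilon> i)\<^sup>2 =
    exp (2 * (\<epsilon> * \<delta> i * t)) * ((snd p - sz \<epsilon> i)\<^sup>2 / 2 - \<mu> i / (2 * \<rho> i) * (fst p - sx \<epsilon> i)\<^sup>2)"
proof -
  define u where "u = fst p - sx \<epsilon> i"
  define v where "v = snd p - sz \<epsilon> i"
  define C where "C = gcosh (K i) t"
  define S where "S = gsinh (K i) t"
  define E where "E = exp (\<epsilon> * \<delta> i * t)"
  define g where "g = \<mu> i / \<rho> i"
  have g: "\<mu> i = g * \<rho> i" "g * \<rho> i / (2 * \<rho> i) = g / 2" using \<rho>_pos[of i] by (auto simp: g_def)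
  have CS: "C * C = 1 + \<rho> i * (g * \<rho> i) * (S * S)"
    using gcosh_gsinh[OF K_nonzero, of i t] by (simp add: C_def S_def K_def g(1) power2_eq_square)
  have E2: "exp (2 * (\<epsilon> * \<delta> i * t)) = E * E" by (simp add: E_def flip: exp_add)
  have "(E * (C * v + S * (g * \<rho> i) * u))\<^sup>2 / 2 - g / 2 * (E * (C * u + S * \<rho> i * v))\<^sup>2
      = E * E * ((C * C - \<rho> i * (g * \<rho> i) * (S * S)) * (v\<^sup>2 / 2 - g / 2 * u\<^sup>2))"
    by (rule saddle_form_identity)
  also have "\<dots> = E * E * (v\<^sup>2 / 2 - g / 2 * u\<^sup>2)" unfolding CS by simp
  finally show ?thesis unfolding E2
    by (simp add: flow_def u_def v_def C_def S_def E_def g)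
qed

lemma continuous_on_flow:
  "continuous_on ((small \<times> UNIV) \<times> UNIV) (\<lambda>z. flow (fst (fst z)) i (x0, snd (fst z)) (snd z))"
proof -
  have D: "D (fst (fst z)) i \<noteq> 0" if "z \<in> (small \<times> UNIV) \<times> UNIV" for z :: "(real \<times> real) \<times> real"
    using that by (auto simp: small_def)
  have cD: "continuous_on ((small \<times> UNIV) \<times> UNIV) (\<lambda>z :: (real \<times> real) \<times> real. D (fst (fst z)) i)"
    unfolding D_def by (intro continuous_intros)
  have csx: "continuous_on ((small \<times> UNIV) \<times> UNIV) (\<lambda>z :: (real \<times> real) \<times> real. sx (fst (fst z)) i)"
    unfolding sx_def by (intro continuous_intros cD) (use D in blast)
  have csz: "continuous_on ((small \<times> UNIV) \<times> UNIV) (\<lambda>z :: (real \<times> real) \<times> real. sz (fst (fst z)) i)"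
    unfolding sz_def by (intro continuous_intros cD) (use D in blast)
  show ?thesis
    unfolding flow_def fst_conv snd_conv by (intro continuous_intros csx csz)
qed

lemma continuous_on_field_flow:
  "continuous_on ((small \<times> UNIV) \<times> UNIV)
     (\<lambda>z. field (fst (fst z)) i (flow (fst (fst z)) i (x0, snd (fst z)) (snd z)))"
  unfolding field_def by (intro continuous_intros continuous_on_flow)

end


section \<open>Transition maps\<close>

definition hausclose :: "real \<Rightarrow> plane set \<Rightarrow> plane set \<Rightarrow> bool" where
  "hausclose e A B \<longleftrightarrow> (\<forall>p\<in>A. \<exists>q\<in>B. dist p q < e) \<and> (\<forall>q\<in>B. \<exists>p\<in>A. dist p q < e)"

lemma hausclose_Un: "hausclose e A B \<Longrightarrow> hausclose e A' B' \<Longrightarrow> hausclose e (A \<union> A') (B \<union> B')"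
  unfolding hausclose_def by blast

text \<open>\<open>P \<epsilon> y\<close> is the height at which the orbit of \<open>V \<epsilon>\<close> through \<open>(x0, y)\<close> arrives at the line \<open>x = x1\<close>
  after having passed close to the crossing points in \<open>B\<close>; the path followed is \<open>c \<epsilon> y\<close> on \<open>[0, T \<epsilon> y]\<close>.
  The number \<open>S\<close> is the first order change of half the squared height, that is, the contribution of the
  path to the Melnikov function.\<close>

definition transit ::
  "(real \<Rightarrow> zone \<Rightarrow> plane \<Rightarrow> plane) \<Rightarrow> real \<Rightarrow> real \<Rightarrow> real \<Rightarrow> real \<Rightarrow> plane set \<Rightarrow> real \<Rightarrow> real \<Rightarrow>
   (real \<Rightarrow> real \<Rightarrow> real) \<Rightarrow> (real \<Rightarrow> real \<Rightarrow> real \<Rightarrow> plane) \<Rightarrow> (real \<Rightarrow> real \<Rightarrow> real) \<Rightarrow> bool" where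
  "transit V x0 y0 x1 q0 B k S P c T \<longleftrightarrow>
    ((\<lambda>e. P (fst e) (snd e)) \<longlongrightarrow> q0) (nhds (0, y0)) \<and>
    (\<forall>\<^sub>F e in nhds (0, y0). real_analytic_at (P (fst e)) (snd e)) \<and>
    (\<forall>\<^sub>F e in nhds (0, y0). det_path (V (fst e)) (c (fst e) (snd e)) (T (fst e) (snd e)) \<and>
       c (fst e) (snd e) 0 = (x0, snd e) \<and> c (fst e) (snd e) (T (fst e) (snd e)) = (x1, P (fst e) (snd e))) \<and>
    (\<forall>\<zeta>>0. \<forall>\<^sub>F e in nhds (0, y0). \<forall>u. 0 < u \<longrightarrow> u < T (fst e) (snd e) \<longrightarrow>
       c (fst e) (snd e) u \<in> switching_lines \<longrightarrow>
       (\<exists>b\<in>B. fst (c (fst e) (snd e) u) = fst b \<and> \<bar>snd (c (fst e) (snd e) u) - snd b\<bar> < \<zeta>)) \<and>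
    (\<forall>\<zeta>>0. \<forall>\<^sub>F e in nhds (0, y0). hausclose \<zeta> (c (fst e) (snd e) ` {0..T (fst e) (snd e)}) (c 0 y0 ` {0..T 0 y0})) \<and>
    (\<forall>\<^sub>F e in nhds (0, (y0, y0)). P (fst e) (fst (snd e)) = P (fst e) (snd (snd e)) \<longrightarrow> fst (snd e) = snd (snd e)) \<and>
    ((\<lambda>e. ((P (fst e) (snd e))\<^sup>2 / 2 - (snd e)\<^sup>2 / 2 - k) / fst e) \<longlongrightarrow> S) (at_right 0 \<times>\<^sub>F nhds y0) \<and>
    (\<forall>b\<in>B. \<forall>\<zeta>>0. \<forall>\<^sub>F e in nhds (0, snd b). \<exists>c' T'. det_path (V (fst e)) c' T' \<and>
       c' 0 = (fst b, snd e) \<and> fst (c' T') = x1 \<and> \<bar>snd (c' T') - q0\<bar> < \<zeta>)"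

lemma transitD:
  assumes "transit V x0 y0 x1 q0 B k S P c T"
  shows "((\<lambda>e. P (fst e) (snd e)) \<longlongrightarrow> q0) (nhds (0, y0))"
    and "\<forall>\<^sub>F e in nhds (0, y0). real_analytic_at (P (fst e)) (snd e)"
    and "\<forall>\<^sub>F e in nhds (0, y0). det_path (V (fst e)) (c (fst e) (snd e)) (T (fst e) (snd e)) \<and>
       c (fst e) (snd e) 0 = (x0, snd e) \<and> c (fst e) (snd e) (T (fst e) (snd e)) = (x1, P (fst e) (snd e))"
    and "\<zeta> > 0 \<Longrightarrow> \<forall>\<^sub>F e in nhds (0, y0). \<forall>u. 0 < u \<longrightarrow> u < T (fst e) (snd e) \<longrightarrow>
       c (fst e) (snd e) u \<in> switching_lines \<longrightarrow>
       (\<exists>b\<in>B. fst (c (fst e) (snd e) u) = fst b \<and> \<bar>snd (c (fst e) (snd e) u) - snd b\<bar> < \<zeta>)"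
    and "\<zeta> > 0 \<Longrightarrow> \<forall>\<^sub>F e in nhds (0, y0). hausclose \<zeta> (c (fst e) (snd e) ` {0..T (fst e) (snd e)}) (c 0 y0 ` {0..T 0 y0})"
    and "\<forall>\<^sub>F e in nhds (0, (y0, y0)). P (fst e) (fst (snd e)) = P (fst e) (snd (snd e)) \<longrightarrow> fst (snd e) = snd (snd e)"
    and "((\<lambda>e. ((P (fst e) (snd e))\<^sup>2 / 2 - (snd e)\<^sup>2 / 2 - k) / fst e) \<longlongrightarrow> S) (at_right 0 \<times>\<^sub>F nhds y0)"
    and "b \<in> B \<Longrightarrow> \<zeta> > 0 \<Longrightarrow> \<forall>\<^sub>F e in nhds (0, snd b). \<exists>c' T'. det_path (V (fst e)) c' T' \<and>
       c' 0 = (fst b, snd e) \<and> fst (c' T') = x1 \<and> \<bar>snd (c' T') - q0\<bar> < \<zeta>"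
proof -
  note t = assms[unfolded transit_def]
  note t2 = t[THEN conjunct2]
  note t3 = t2[THEN conjunct2]
  note t4 = t3[THEN conjunct2]
  note t5 = t4[THEN conjunct2]
  note t6 = t5[THEN conjunct2]
  note t7 = t6[THEN conjunct2]
  note t8 = t7[THEN conjunct2]
  show "((\<lambda>e. P (fst e) (snd e)) \<longlongrightarrow> q0) (nhds (0, y0))" by (rule t[THEN conjunct1])
  show "\<forall>\<^sub>F e in nhds (0, y0). real_analytic_at (P (fst e)) (snd e)" by (rule t2[THEN conjunct1])
  show "\<forall>\<^sub>F e in nhds (0, y0). det_path (V (fst e)) (c (fst e) (snd e)) (T (fst e) (snd e)) \<and>
       c (fst e) (snd e) 0 = (x0, snd e) \<and> c (fst e) (snd e) (T (fst e) (snd e)) = (x1, P (fst e) (snd e))"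
    by (rule t3[THEN conjunct1])
  show "\<forall>\<^sub>F e in nhds (0, y0). \<forall>u. 0 < u \<longrightarrow> u < T (fst e) (snd e) \<longrightarrow>
       c (fst e) (snd e) u \<in> switching_lines \<longrightarrow>
       (\<exists>b\<in>B. fst (c (fst e) (snd e) u) = fst b \<and> \<bar>snd (c (fst e) (snd e) u) - snd b\<bar> < \<zeta>)" if "\<zeta> > 0"
    by (rule t4[THEN conjunct1, THEN spec, THEN mp, OF that])
  show "\<forall>\<^sub>F e in nhds (0, y0). hausclose \<zeta> (c (fst e) (snd e) ` {0..T (fst e) (snd e)}) (c 0 y0 ` {0..T 0 y0})"
    if "\<zeta> > 0" by (rule t5[THEN conjunct1, THEN spec, THEN mp, OF that])
  show "\<forall>\<^sub>F e in nhds (0, (y0, y0)). P (fst e) (fst (snd e)) = P (fst e) (snd (snd e)) \<longrightarrow> fst (snd e) = snd (snd e)"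
    by (rule t6[THEN conjunct1])
  show "((\<lambda>e. ((P (fst e) (snd e))\<^sup>2 / 2 - (snd e)\<^sup>2 / 2 - k) / fst e) \<longlongrightarrow> S) (at_right 0 \<times>\<^sub>F nhds y0)"
    by (rule t7[THEN conjunct1])
  show "\<forall>\<^sub>F e in nhds (0, snd b). \<exists>c' T'. det_path (V (fst e)) c' T' \<and>
       c' 0 = (fst b, snd e) \<and> fst (c' T') = x1 \<and> \<bar>snd (c' T') - q0\<bar> < \<zeta>" if "b \<in> B" "\<zeta> > 0"
    by (rule t8[THEN bspec, THEN spec, THEN mp, OF that])
qed

lemma transit_base:
  assumes "transit V x0 y0 x1 q0 B k S P c T"
  shows "det_path (V 0) (c 0 y0) (T 0 y0)" "c 0 y0 0 = (x0, y0)" "c 0 y0 (T 0 y0) = (x1, q0)"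
proof -
  note t = transitD[OF assms]
  from eventually_nhds_x_imp_x[OF t(3)]
  have d: "det_path (V 0) (c 0 y0) (T 0 y0)" "c 0 y0 0 = (x0, y0)" "c 0 y0 (T 0 y0) = (x1, P 0 y0)" by simp_all
  have "P 0 y0 = q0"
  proof (rule ccontr)
    assume "P 0 y0 \<noteq> q0"
    then have "\<forall>\<^sub>F e in nhds (0, y0). P (fst e) (snd e) \<noteq> P 0 y0"
      by (intro tendsto_imp_eventually_ne[OF t(1)]) simp
    then show False using eventually_nhds_x_imp_x by fastforce
  qed
  then show "det_path (V 0) (c 0 y0) (T 0 y0)" "c 0 y0 0 = (x0, y0)" "c 0 y0 (T 0 y0) = (x1, q0)" using d by simp_all
qed

lemma snd_tendsto_prod: "filterlim snd G (F \<times>\<^sub>F G)"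
  by (simp add: filterlim_snd)

lemma transit_compose:
  assumes t1: "transit V x0 y0 x1 q1 B1 k1 S1 P1 c1 T1" and t2: "transit V x1 q1 x2 q2 B2 k2 S2 P2 c2 T2"
  shows "transit V x0 y0 x2 q2 (B1 \<union> {(x1, q1)} \<union> B2) (k1 + k2) (S1 + S2)
    (\<lambda>\<epsilon> y. P2 \<epsilon> (P1 \<epsilon> y)) (\<lambda>\<epsilon> y. cat (c1 \<epsilon> y) (T1 \<epsilon> y) (c2 \<epsilon> (P1 \<epsilon> y)))
    (\<lambda>\<epsilon> y. T1 \<epsilon> y + T2 \<epsilon> (P1 \<epsilon> y))"
proof -
  note a = transitD[OF t1] and b = transitD[OF t2]
  have lim: "filterlim (\<lambda>e. (fst e, P1 (fst e) (snd e))) (nhds (0, q1)) (nhds (0, y0))"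
    by (intro tendsto_Pair a(1)) (simp add: nhds_prod filterlim_fst)
  have P10: "P1 0 y0 = q1"
  proof (rule ccontr)
    assume "P1 0 y0 \<noteq> q1"
    then have "\<forall>\<^sub>F e in nhds (0, y0). P1 (fst e) (snd e) \<noteq> P1 0 y0"
      by (intro tendsto_imp_eventually_ne[OF a(1)]) simp
    then show False using eventually_nhds_x_imp_x by fastforce
  qed
  have pull: "\<forall>\<^sub>F e in nhds (0, y0). Q (fst e) (P1 (fst e) (snd e))"
    if "\<forall>\<^sub>F e in nhds (0, q1). Q (fst e) (snd e)" for Q
    using eventually_compose_filterlim[OF that lim] by simp
  have paths: "\<forall>\<^sub>F e in nhds (0, y0).
      (det_path (V (fst e)) (c1 (fst e) (snd e)) (T1 (fst e) (snd e)) \<and>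
       c1 (fst e) (snd e) 0 = (x0, snd e) \<and> c1 (fst e) (snd e) (T1 (fst e) (snd e)) = (x1, P1 (fst e) (snd e))) \<and>
      (det_path (V (fst e)) (c2 (fst e) (P1 (fst e) (snd e))) (T2 (fst e) (P1 (fst e) (snd e))) \<and>
       c2 (fst e) (P1 (fst e) (snd e)) 0 = (x1, P1 (fst e) (snd e)) \<and>
       c2 (fst e) (P1 (fst e) (snd e)) (T2 (fst e) (P1 (fst e) (snd e))) = (x2, P2 (fst e) (P1 (fst e) (snd e))))"
    by (rule eventually_conj[OF a(3) pull[OF b(3)]])
  have near: "\<forall>\<^sub>F e in nhds (0, y0). \<bar>P1 (fst e) (snd e) - q1\<bar> < \<zeta>" if "\<zeta> > 0" for \<zeta>
    using tendstoD[OF a(1) that] by (simp add: dist_real_def)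
  show ?thesis unfolding transit_def
  proof (intro conjI allI impI ballI)
    show "((\<lambda>e. P2 (fst e) (P1 (fst e) (snd e))) \<longlongrightarrow> q2) (nhds (0, y0))"
      using filterlim_compose[OF b(1) lim] by simp
    show "\<forall>\<^sub>F e in nhds (0, y0). real_analytic_at (\<lambda>y. P2 (fst e) (P1 (fst e) y)) (snd e)"
      using a(2) pull[OF b(2)] by eventually_elim (rule real_analytic_at_compose)
    show "\<forall>\<^sub>F e in nhds (0, y0).
        det_path (V (fst e)) (cat (c1 (fst e) (snd e)) (T1 (fst e) (snd e)) (c2 (fst e) (P1 (fst e) (snd e))))
          (T1 (fst e) (snd e) + T2 (fst e) (P1 (fst e) (snd e))) \<and>
        cat (c1 (fst e) (snd e)) (T1 (fst e) (snd e)) (c2 (fst e) (P1 (fst e) (snd e))) 0 = (x0, snd e) \<and>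
        cat (c1 (fst e) (snd e)) (T1 (fst e) (snd e)) (c2 (fst e) (P1 (fst e) (snd e)))
          (T1 (fst e) (snd e) + T2 (fst e) (P1 (fst e) (snd e))) = (x2, P2 (fst e) (P1 (fst e) (snd e)))"
      using paths
    proof eventually_elim
      case (elim e)
      then have "0 < T1 (fst e) (snd e)" "0 < T2 (fst e) (P1 (fst e) (snd e))" by (auto simp: det_path_def)
      then show ?case using elim det_path_cat by (auto simp: cat_def)
    qed
    fix \<zeta> :: real assume \<zeta>: "\<zeta> > 0"
    show "\<forall>\<^sub>F e in nhds (0, y0). \<forall>u. 0 < u \<longrightarrow> u < T1 (fst e) (snd e) + T2 (fst e) (P1 (fst e) (snd e)) \<longrightarrow>
        cat (c1 (fst e) (snd e)) (T1 (fst e) (snd e)) (c2 (fst e) (P1 (fst e) (snd e))) u \<in> switching_lines \<longrightarrow>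
        (\<exists>b\<in>B1 \<union> {(x1, q1)} \<union> B2.
          fst (cat (c1 (fst e) (snd e)) (T1 (fst e) (snd e)) (c2 (fst e) (P1 (fst e) (snd e))) u) = fst b \<and>
          \<bar>snd (cat (c1 (fst e) (snd e)) (T1 (fst e) (snd e)) (c2 (fst e) (P1 (fst e) (snd e))) u) - snd b\<bar> < \<zeta>)"
      using paths a(4)[OF \<zeta>] pull[OF b(4)[OF \<zeta>]] near[OF \<zeta>]
    proof eventually_elim
      case (elim e)
      show ?case
      proof (intro allI impI)
        fix u
        assume u: "0 < u" "u < T1 (fst e) (snd e) + T2 (fst e) (P1 (fst e) (snd e))"
          and sw: "cat (c1 (fst e) (snd e)) (T1 (fst e) (snd e)) (c2 (fst e) (P1 (fst e) (snd e))) u \<in> switching_lines"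
        consider "u < T1 (fst e) (snd e)" | "u = T1 (fst e) (snd e)" | "T1 (fst e) (snd e) < u" by linarith
        then show "\<exists>b\<in>B1 \<union> {(x1, q1)} \<union> B2.
          fst (cat (c1 (fst e) (snd e)) (T1 (fst e) (snd e)) (c2 (fst e) (P1 (fst e) (snd e))) u) = fst b \<and>
          \<bar>snd (cat (c1 (fst e) (snd e)) (T1 (fst e) (snd e)) (c2 (fst e) (P1 (fst e) (snd e))) u) - snd b\<bar> < \<zeta>"
        proof cases
          case 1
          then show ?thesis using elim(2) u sw by (auto simp: cat_def)
        next
          case 2
          then show ?thesis using elim(1,4) by (intro bexI[of _ "(x1, q1)"]) (auto simp: cat_def)
        next
          case 3
          then show ?thesis using elim(3)[rule_format, of "u - T1 (fst e) (snd e)"] u sw by (auto simp: cat_def)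
        qed
      qed
    qed
  next
    fix \<zeta> :: real assume \<zeta>: "\<zeta> > 0"
    have img: "\<forall>\<^sub>F e in nhds (0, y0).
        cat (c1 (fst e) (snd e)) (T1 (fst e) (snd e)) (c2 (fst e) (P1 (fst e) (snd e))) `
          {0..T1 (fst e) (snd e) + T2 (fst e) (P1 (fst e) (snd e))} =
        c1 (fst e) (snd e) ` {0..T1 (fst e) (snd e)} \<union>
        c2 (fst e) (P1 (fst e) (snd e)) ` {0..T2 (fst e) (P1 (fst e) (snd e))}"
      using paths by eventually_elim (rule cat_image, auto simp: det_path_def)
    have img0: "cat (c1 0 y0) (T1 0 y0) (c2 0 (P1 0 y0)) ` {0..T1 0 y0 + T2 0 (P1 0 y0)} =
        c1 0 y0 ` {0..T1 0 y0} \<union> c2 0 q1 ` {0..T2 0 q1}"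
      using eventually_nhds_x_imp_x[OF img] P10 by simp
    show "\<forall>\<^sub>F e in nhds (0, y0).
        hausclose \<zeta> (cat (c1 (fst e) (snd e)) (T1 (fst e) (snd e)) (c2 (fst e) (P1 (fst e) (snd e))) `
          {0..T1 (fst e) (snd e) + T2 (fst e) (P1 (fst e) (snd e))})
         (cat (c1 0 y0) (T1 0 y0) (c2 0 (P1 0 y0)) ` {0..T1 0 y0 + T2 0 (P1 0 y0)})"
      using img a(5)[OF \<zeta>] pull[OF b(5)[OF \<zeta>]]
      by eventually_elim (simp add: img0 hausclose_Un)
  next
    have l3: "filterlim (\<lambda>e. (fst e, (P1 (fst e) (fst (snd e)), P1 (fst e) (snd (snd e))))) (nhds (0, (q1, q1))) (nhds (0, (y0, y0)))"
    proof (intro tendsto_Pair)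
      have "filterlim (\<lambda>e :: real \<times> real \<times> real. (fst e, fst (snd e))) (nhds (0, y0)) (nhds (0, (y0, y0)))"
        "filterlim (\<lambda>e :: real \<times> real \<times> real. (fst e, snd (snd e))) (nhds (0, y0)) (nhds (0, (y0, y0)))"
        by (auto intro!: tendsto_eq_intros filterlim_ident)
      from this[THEN filterlim_compose[OF a(1)]]
      show "((\<lambda>e. P1 (fst e) (fst (snd e))) \<longlongrightarrow> q1) (nhds (0, (y0, y0)))"
        "((\<lambda>e. P1 (fst e) (snd (snd e))) \<longlongrightarrow> q1) (nhds (0, (y0, y0)))" by simp_all
      show "(fst \<longlongrightarrow> 0) (nhds (0 :: real, (y0, y0)))" by (auto intro!: tendsto_eq_intros filterlim_ident)
    qed
    show "\<forall>\<^sub>F e in nhds (0, (y0, y0)). P2 (fst e) (P1 (fst e) (fst (snd e))) = P2 (fst e) (P1 (fst e) (snd (snd e))) \<longrightarrow>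
        fst (snd e) = snd (snd e)"
      using a(6) eventually_compose_filterlim[OF b(6) l3] by eventually_elim simp
  next
    have l2: "filterlim (\<lambda>e. (fst e, P1 (fst e) (snd e))) (at_right 0 \<times>\<^sub>F nhds q1) (at_right 0 \<times>\<^sub>F nhds y0)"
    proof (intro filterlim_Pair filterlim_fst)
      show "((\<lambda>e. P1 (fst e) (snd e)) \<longlongrightarrow> q1) (at_right 0 \<times>\<^sub>F nhds y0)"
        using a(1) unfolding nhds_prod
        by (rule tendsto_mono[rotated]) (intro prod_filter_mono, auto simp: at_within_def)
    qed
    have "((\<lambda>e. ((P2 (fst e) (P1 (fst e) (snd e)))\<^sup>2 / 2 - (P1 (fst e) (snd e))\<^sup>2 / 2 - k2) / fst e) \<longlongrightarrow> S2)
        (at_right 0 \<times>\<^sub>F nhds y0)"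
      using filterlim_compose[OF b(7) l2] by simp
    from tendsto_add[OF a(7) this]
    show "((\<lambda>e. ((P2 (fst e) (P1 (fst e) (snd e)))\<^sup>2 / 2 - (snd e)\<^sup>2 / 2 - (k1 + k2)) / fst e) \<longlongrightarrow> S1 + S2)
        (at_right 0 \<times>\<^sub>F nhds y0)"
      by (simp add: diff_divide_distrib add_divide_distrib algebra_simps)
  next
    fix p and \<zeta> :: real assume p: "p \<in> B1 \<union> {(x1, q1)} \<union> B2" and \<zeta>: "\<zeta> > 0"
    have ev2: "\<forall>\<^sub>F e in nhds (0, q1). \<exists>c' T'. det_path (V (fst e)) c' T' \<and>
       c' 0 = (x1, snd e) \<and> fst (c' T') = x2 \<and> \<bar>snd (c' T') - q2\<bar> < \<zeta>"
      using b(3) tendstoD[OF b(1) \<zeta>]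
      by eventually_elim (rule exI, rule exI, auto simp: dist_real_def)
    consider "p \<in> B1" | "p = (x1, q1)" | "p \<in> B2" using p by blast
    then show "\<forall>\<^sub>F e in nhds (0, snd p). \<exists>c' T'. det_path (V (fst e)) c' T' \<and>
       c' 0 = (fst p, snd e) \<and> fst (c' T') = x2 \<and> \<bar>snd (c' T') - q2\<bar> < \<zeta>"
    proof cases
      case 1
      obtain A d where A: "eventually A (nhds (0::real))" "d > 0"
        "\<And>\<epsilon> y. A \<epsilon> \<Longrightarrow> \<bar>y - q1\<bar> < d \<Longrightarrow> \<exists>c' T'. det_path (V \<epsilon>) c' T' \<and>
           c' 0 = (x1, y) \<and> fst (c' T') = x2 \<and> \<bar>snd (c' T') - q2\<bar> < \<zeta>"
      proof -
        obtain A A2 where A: "eventually A (nhds (0::real))" and A2: "eventually A2 (nhds q1)"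
          and imp: "\<forall>\<epsilon> y. A \<epsilon> \<longrightarrow> A2 y \<longrightarrow> (\<exists>c' T'. det_path (V \<epsilon>) c' T' \<and>
           c' 0 = (x1, y) \<and> fst (c' T') = x2 \<and> \<bar>snd (c' T') - q2\<bar> < \<zeta>)"
          using ev2 unfolding eventually_nhds_Pair fst_conv snd_conv by (elim exE conjE)
        obtain d where "d > 0" "\<forall>y. \<bar>y - q1\<bar> < d \<longrightarrow> A2 y"
          using A2 unfolding eventually_nhds_real by (elim exE conjE)
        then show thesis using A imp by (intro that[of A d]) simp_all
      qed
      have A': "\<forall>\<^sub>F e in nhds (0, snd p). A (fst e)"
        using A(1) unfolding nhds_prod by (rule eventually_compose_filterlim) (rule filterlim_fst)
      show ?thesis using a(8)[OF 1 A(2)] A'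
      proof eventually_elim
        case (elim e)
        obtain c' T' where c': "det_path (V (fst e)) c' T'" "c' 0 = (fst p, snd e)" "fst (c' T') = x1"
          "\<bar>snd (c' T') - q1\<bar> < d" using elim(1) by blast
        obtain c'' T'' where c'': "det_path (V (fst e)) c'' T''" "c'' 0 = (x1, snd (c' T'))" "fst (c'' T'') = x2"
          "\<bar>snd (c'' T'') - q2\<bar> < \<zeta>" using A(3)[OF elim(2) c'(4)] by blast
        have "0 < T'" "0 < T''" using c' c'' by (auto simp: det_path_def)
        moreover have eq: "c' T' = c'' 0" using c' c'' by (simp add: prod_eq_iff)
        ultimately show ?case using c' c'' det_path_cat[OF c'(1) c''(1) eq]
          by (intro exI[of _ "cat c' T' c''"] exI[of _ "T' + T''"]) (auto simp: cat_def)
      qed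
    next
      case 2
      then show ?thesis using ev2 by simp
    next
      case 3
      then show ?thesis using b(8)[OF 3 \<zeta>] by simp
    qed
  qed
qed


fun zint :: "zone \<Rightarrow> real set" where
  "zint LeftZone = {..<-1}" | "zint CentralZone = {-1<..<1}" | "zint RightZone = {1<..}"

lemma interior_zone_iff: "p \<in> interior (zone_set i) \<longleftrightarrow> fst p \<in> zint i"
  by (cases i) auto

lemma open_zint: "open (zint i)"
  by (cases i) auto

text \<open>An arc in zone \<open>i\<close> from the line \<open>x = x0\<close>, left in direction \<open>d0\<close>, to the line \<open>x = x1\<close>, reached
  in direction \<open>d1\<close>.\<close>

definition leg_geometry :: "zone \<Rightarrow> real \<Rightarrow> real \<Rightarrow> real \<Rightarrow> real \<Rightarrow> bool" where
  "leg_geometry i x0 d0 x1 d1 \<longleftrightarrow>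
     (i = RightZone \<and> x0 = 1 \<and> d0 = 1 \<and> x1 = 1 \<and> d1 = -1) \<or>
     (i = LeftZone \<and> x0 = -1 \<and> d0 = -1 \<and> x1 = -1 \<and> d1 = 1) \<or>
     (i = CentralZone \<and> (x0 = 1 \<and> d0 = -1 \<or> x0 = -1 \<and> d0 = 1) \<and> (x1 = 1 \<and> d1 = 1 \<or> x1 = -1 \<and> d1 = -1))"

lemma leg_geometryD:
  assumes "leg_geometry i x0 d0 x1 d1"
  shows "0 < r \<Longrightarrow> r < 1 \<Longrightarrow> x0 + d0 * r \<in> zint i" "0 < r \<Longrightarrow> r < 1 \<Longrightarrow> x1 - d1 * r \<in> zint i"
    "d0 = 1 \<or> d0 = -1" "d1 = 1 \<or> d1 = -1" "(x0, y) \<in> zone_set i" "(x1, y) \<in> zone_set i" "x1 \<notin> zint i" "x0 \<notin> zint i"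
  using assms unfolding leg_geometry_def by auto

context normal_form begin

definition regular :: "zone \<Rightarrow> real \<Rightarrow> real \<Rightarrow> real \<Rightarrow> real \<Rightarrow> real \<Rightarrow> real \<Rightarrow> real \<Rightarrow> bool" where
  "regular i x0 d0 x1 d1 \<epsilon> y \<tau> \<longleftrightarrow> \<epsilon> \<in> small \<and> 0 < \<tau> \<and> fst (flow \<epsilon> i (x0, y) \<tau>) = x1 \<and>
     (\<forall>t. 0 < t \<longrightarrow> t < \<tau> \<longrightarrow> fst (flow \<epsilon> i (x0, y) t) \<in> zint i) \<and>
     fst (field \<epsilon> i (x0, y)) * d0 > 0 \<and> fst (field \<epsilon> i (flow \<epsilon> i (x0, y) \<tau>)) * d1 > 0"

definition hit_time :: "zone \<Rightarrow> real \<Rightarrow> real \<Rightarrow> real \<Rightarrow> real \<Rightarrow> real \<Rightarrow> real \<Rightarrow> real" where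
  "hit_time i x0 d0 x1 d1 \<epsilon> y = (THE \<tau>. regular i x0 d0 x1 d1 \<epsilon> y \<tau>)"

definition leg_map :: "zone \<Rightarrow> real \<Rightarrow> real \<Rightarrow> real \<Rightarrow> real \<Rightarrow> real \<Rightarrow> real \<Rightarrow> real" where
  "leg_map i x0 d0 x1 d1 \<epsilon> y = snd (flow \<epsilon> i (x0, y) (hit_time i x0 d0 x1 d1 \<epsilon> y))"

context
  fixes i x0 d0 x1 d1
  assumes geo: "leg_geometry i x0 d0 x1 d1"
begin

lemma regular_unique:
  assumes "regular i x0 d0 x1 d1 \<epsilon> y \<tau>" "regular i x0 d0 x1 d1 \<epsilon> y \<tau>'"
  shows "\<tau> = \<tau>'"
  using assms leg_geometryD(7)[OF geo] unfolding regular_def by (metis linorder_neqE_linordered_idom)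

lemma hit_time_eq: "regular i x0 d0 x1 d1 \<epsilon> y \<tau> \<Longrightarrow> hit_time i x0 d0 x1 d1 \<epsilon> y = \<tau>"
  unfolding hit_time_def by (rule the_equality) (auto intro: regular_unique)

lemma regular_persists:
  assumes reg: "regular i x0 d0 x1 d1 \<epsilon>0 y0 \<tau>0" and \<zeta>: "\<zeta> > 0"
  shows "\<forall>\<^sub>F e in nhds (\<epsilon>0, y0). \<exists>\<tau>. \<bar>\<tau> - \<tau>0\<bar> < \<zeta> \<and> regular i x0 d0 x1 d1 (fst e) (snd e) \<tau>"
proof -
  let ?U = "small \<times> (UNIV :: real set)"
  let ?h = "\<lambda>t e. fst (flow (fst e) i (x0, snd e) t)"
  let ?h' = "\<lambda>t e. fst (field (fst e) i (flow (fst e) i (x0, snd e) t))"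
  have U: "open ?U" "(\<epsilon>0, y0) \<in> ?U"
    using open_small reg by (auto simp: open_Times regular_def)
  have cont: "continuous_on (?U \<times> UNIV) (\<lambda>z. ?h (snd z) (fst z))"
    by (intro continuous_intros continuous_on_flow)
  have cont': "continuous_on (?U \<times> UNIV) (\<lambda>z. ?h' (snd z) (fst z))"
    by (intro continuous_intros continuous_on_field_flow)
  have der: "((\<lambda>t. ?h t e) has_real_derivative ?h' t e) (at t)" if "e \<in> ?U" for t e
  proof -
    have "D (fst e) i \<noteq> 0" using that by (auto simp: small_def)
    from flow_derivative[OF this] show ?thesis
      unfolding has_real_derivative_iff_has_vector_derivative
      by (rule bounded_linear.has_vector_derivative[OF bounded_linear_fst])
  qed
  have tend: "((\<lambda>z. ?h' (snd z) (fst z)) \<longlongrightarrow> ?h' t (\<epsilon>0, y0)) (nhds ((\<epsilon>0, y0), t))" for t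
  proof -
    have "open (?U \<times> (UNIV :: real set))" by (rule open_Times[OF U(1) open_UNIV])
    then have "isCont (\<lambda>z. ?h' (snd z) (fst z)) ((\<epsilon>0, y0), t)"
      using cont' U by (simp add: continuous_on_eq_continuous_at)
    then show ?thesis
      using tendsto_at_iff_tendsto_nhds[of "\<lambda>z. ?h' (snd z) (fst z)" "((\<epsilon>0, y0), t)"] by (simp add: isCont_def)
  qed
  have "\<forall>\<^sub>F z in nhds ((\<epsilon>0, y0), \<tau>0). ?h' (snd z) (fst z) * d1 > 0"
    by (rule order_tendstoD(1)[OF tendsto_mult_right[OF tend]]) (use reg in \<open>simp add: regular_def\<close>)
  then obtain A A2 where A: "eventually A (nhds (\<epsilon>0, y0))" and A2: "eventually A2 (nhds \<tau>0)"
    and imp: "\<forall>e t. A e \<longrightarrow> A2 t \<longrightarrow> ?h' t e * d1 > 0"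
    unfolding eventually_nhds_Pair[where a = "(\<epsilon>0, y0)"] fst_conv snd_conv by (elim exE conjE)
  obtain a where a: "a > 0" "\<forall>t. \<bar>t - \<tau>0\<bar> < a \<longrightarrow> A2 t"
    using A2 unfolding eventually_nhds_real by (elim exE conjE)
  have s0: "\<forall>\<^sub>F e in nhds (\<epsilon>0, y0). fst (field (fst e) i (x0, snd e)) * d0 > 0"
  proof (rule order_tendstoD(1))
    show "((\<lambda>e. fst (field (fst e) i (x0, snd e)) * d0) \<longlongrightarrow> fst (field \<epsilon>0 i (x0, y0)) * d0) (nhds (\<epsilon>0, y0))"
      unfolding field_def by (auto intro!: tendsto_eq_intros filterlim_ident)
  qed (use reg in \<open>simp add: regular_def\<close>)
  have "\<forall>\<^sub>F e in nhds (\<epsilon>0, y0). \<exists>\<tau>. \<bar>\<tau> - \<tau>0\<bar> < min \<zeta> a \<and> 0 < \<tau> \<and> ?h \<tau> e = x1 \<and>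
      (\<forall>t. 0 < t \<longrightarrow> t < \<tau> \<longrightarrow> ?h t e \<in> zint i)"
  proof (rule arc_persists[OF U der cont cont' _ open_zint zero_less_one])
    show "?h' 0 (\<epsilon>0, y0) * d0 > 0" "?h' \<tau>0 (\<epsilon>0, y0) * d1 > 0" "0 < \<tau>0" "?h \<tau>0 (\<epsilon>0, y0) = x1"
      "\<And>t. 0 < t \<Longrightarrow> t < \<tau>0 \<Longrightarrow> ?h t (\<epsilon>0, y0) \<in> zint i"
      using reg by (auto simp: regular_def)
    show "\<And>r. 0 < r \<Longrightarrow> r < 1 \<Longrightarrow> x0 + d0 * r \<in> zint i" "\<And>r. 0 < r \<Longrightarrow> r < 1 \<Longrightarrow> x1 - d1 * r \<in> zint i"
      "d0 = 1 \<or> d0 = -1" "d1 = 1 \<or> d1 = -1"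
      using leg_geometryD[OF geo] by blast+
    show "0 < min \<zeta> a" using \<zeta> a by simp
  qed simp_all
  moreover have "\<forall>\<^sub>F e in nhds (\<epsilon>0, y0). e \<in> ?U" using U by (rule eventually_nhds_in_open)
  ultimately show ?thesis using A s0
  proof eventually_elim
    case (elim e)
    obtain \<tau> where \<tau>: "\<bar>\<tau> - \<tau>0\<bar> < min \<zeta> a" "0 < \<tau>" "?h \<tau> e = x1" "\<forall>t. 0 < t \<longrightarrow> t < \<tau> \<longrightarrow> ?h t e \<in> zint i"
      using elim(1) by blast
    have "?h' \<tau> e * d1 > 0" using imp elim(3) a(2) \<tau>(1) by simp
    moreover have "fst e \<in> small" using elim(2) by auto
    ultimately show ?case using \<tau> elim(4) by (intro exI[of _ \<tau>]) (simp add: regular_def)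
  qed
qed

lemma hit_time_persists:
  assumes reg: "regular i x0 d0 x1 d1 \<epsilon>0 y0 \<tau>0"
  shows "\<forall>\<^sub>F e in nhds (\<epsilon>0, y0). regular i x0 d0 x1 d1 (fst e) (snd e) (hit_time i x0 d0 x1 d1 (fst e) (snd e))"
    and "((\<lambda>e. hit_time i x0 d0 x1 d1 (fst e) (snd e)) \<longlongrightarrow> \<tau>0) (nhds (\<epsilon>0, y0))"
proof -
  show "\<forall>\<^sub>F e in nhds (\<epsilon>0, y0). regular i x0 d0 x1 d1 (fst e) (snd e) (hit_time i x0 d0 x1 d1 (fst e) (snd e))"
    using regular_persists[OF reg zero_less_one] by eventually_elim (use hit_time_eq in metis)
  show "((\<lambda>e. hit_time i x0 d0 x1 d1 (fst e) (snd e)) \<longlongrightarrow> \<tau>0) (nhds (\<epsilon>0, y0))"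
  proof (rule tendstoI)
    fix \<zeta> :: real assume "\<zeta> > 0"
    from regular_persists[OF reg this]
    show "\<forall>\<^sub>F e in nhds (\<epsilon>0, y0). dist (hit_time i x0 d0 x1 d1 (fst e) (snd e)) \<tau>0 < \<zeta>"
      by eventually_elim (use hit_time_eq in \<open>force simp: dist_real_def\<close>)
  qed
qed

lemma flow_analytic:
  assumes reg: "regular i x0 d0 x1 d1 \<epsilon> y \<tau>"
  shows "real_analytic_at (leg_map i x0 d0 x1 d1 \<epsilon>) y"
proof -
  let ?\<tau> = "hit_time i x0 d0 x1 d1 \<epsilon>"
  define b where "b = (\<lambda>t. exp (\<epsilon> * \<delta> i * t) * gsinh (K i) t * \<rho> i)"
  define a where "a = (\<lambda>t. fst (flow \<epsilon> i (x0, 0) t) - x1)"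
  define b' where "b' = (\<lambda>t. (\<epsilon> * \<delta> i) * b t + exp (\<epsilon> * \<delta> i * t) * gcosh (K i) t * \<rho> i)"
  define a' where "a' = (\<lambda>t. fst (field \<epsilon> i (flow \<epsilon> i (x0, 0) t)))"
  have small: "\<epsilon> \<in> small" and D: "D \<epsilon> i \<noteq> 0" using reg by (auto simp: regular_def small_def)
  have lin: "fst (flow \<epsilon> i (x0, v) t) - x1 = a t + b t * v" for v t
    by (simp add: a_def b_def flow_def algebra_simps)
  have d1: "((\<lambda>t. fst (flow \<epsilon> i p t)) has_real_derivative fst (field \<epsilon> i (flow \<epsilon> i p t))) (at t)" for p t
    using flow_derivative[OF D] unfolding has_real_derivative_iff_has_vector_derivative
    by (rule bounded_linear.has_vector_derivative[OF bounded_linear_fst])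
  have da: "(a has_real_derivative a' t) (at t)" for t
    unfolding a_def a'_def using d1 by (auto intro!: derivative_eq_intros)
  have db: "(b has_real_derivative b' t) (at t)" for t
    unfolding b_def b'_def using K_nonzero by (auto intro!: derivative_eq_intros simp: algebra_simps)
  have der: "a' t + b' t * v = fst (field \<epsilon> i (flow \<epsilon> i (x0, v) t))" for v t
  proof (rule DERIV_unique)
    show "((\<lambda>t. a t + b t * v) has_real_derivative a' t + b' t * v) (at t)"
      using da db by (auto intro!: derivative_eq_intros)
    have "((\<lambda>t. fst (flow \<epsilon> i (x0, v) t) - x1) has_real_derivative fst (field \<epsilon> i (flow \<epsilon> i (x0, v) t))) (at t)"
      using d1 by (auto intro!: derivative_eq_intros)
    then show "((\<lambda>t. a t + b t * v) has_real_derivative fst (field \<epsilon> i (flow \<epsilon> i (x0, v) t))) (at t)"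
      unfolding lin .
  qed
  have lim: "filterlim (\<lambda>v. (\<epsilon>, v)) (nhds (\<epsilon>, y)) (nhds y)"
    by (intro tendsto_Pair tendsto_const) (simp add: filterlim_ident)
  have "real_analytic_at ?\<tau> y"
  proof (rule entire_ext_implicit[OF _ _ da db])
    show "entire_ext a" "entire_ext b"
      unfolding a_def b_def flow_def fst_conv snd_conv diff_conv_add_uminus
      by (intro entire_ext_add entire_ext_mult entire_ext_const entire_ext_exp entire_ext_gcosh entire_ext_gsinh)+
    show "\<forall>\<^sub>F v in nhds y. a (?\<tau> v) + b (?\<tau> v) * v = 0"
      using eventually_compose_filterlim[OF hit_time_persists(1)[OF reg] lim]
      by eventually_elim (simp add: lin[symmetric] regular_def)
    show "isCont ?\<tau> y"
      using filterlim_compose[OF hit_time_persists(2)[OF reg] lim] hit_time_eq[OF reg]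
        tendsto_at_iff_tendsto_nhds[of ?\<tau> y] by (simp add: isCont_def)
    show "a' (?\<tau> y) + b' (?\<tau> y) * y \<noteq> 0"
      using reg unfolding der hit_time_eq[OF reg] by (auto simp: regular_def)
  qed
  then show ?thesis
    unfolding leg_map_def flow_def fst_conv snd_conv
    by (intro real_analytic_intros real_analytic_at_compose[OF _ entire_ext_real_analytic[OF entire_ext_gcosh]]
        real_analytic_at_compose[OF _ entire_ext_real_analytic[OF entire_ext_gsinh]])
qed

lemma leg_injective:
  assumes "regular i x0 d0 x1 d1 \<epsilon> y \<tau>" "regular i x0 d0 x1 d1 \<epsilon> y' \<tau>'" "\<tau> \<le> \<tau>'"
    and eq: "leg_map i x0 d0 x1 d1 \<epsilon> y = leg_map i x0 d0 x1 d1 \<epsilon> y'"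
  shows "y = y'"
proof -
  have "flow \<epsilon> i (x0, y) \<tau> = flow \<epsilon> i (x0, y') \<tau>'"
    using assms hit_time_eq[OF assms(1)] hit_time_eq[OF assms(2)]
    by (simp add: leg_map_def regular_def prod_eq_iff)
  then have "flow \<epsilon> i (flow \<epsilon> i (x0, y) \<tau>) (- \<tau>) = flow \<epsilon> i (flow \<epsilon> i (x0, y') \<tau>') (- \<tau>)" by simp
  then have *: "(x0, y) = flow \<epsilon> i (x0, y') (\<tau>' - \<tau>)" by (simp add: flow_add)
  have "\<not> \<tau> < \<tau>'"
  proof
    assume "\<tau> < \<tau>'"
    then have "fst (flow \<epsilon> i (x0, y') (\<tau>' - \<tau>)) \<in> zint i" using assms by (simp add: regular_def)
    then show False using leg_geometryD(8)[OF geo] *[symmetric] by simp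
  qed
  then have "\<tau>' = \<tau>" using assms(3) by simp
  then show ?thesis using * by simp
qed

lemma leg_enters:
  assumes "\<And>j. fst (field \<epsilon> j (x0, y)) * d0 > 0" shows "enters (field \<epsilon>) i (x0, y)"
proof -
  note a = assms[of LeftZone] assms[of CentralZone] assms[of RightZone]
  from geo consider "i = RightZone" "x0 = 1" "d0 = 1" | "i = LeftZone" "x0 = -1" "d0 = -1"
    | "i = CentralZone" "x0 = 1" "d0 = -1" | "i = CentralZone" "x0 = -1" "d0 = 1"
    unfolding leg_geometry_def by blast
  then show ?thesis
  proof cases
    case 1 show ?thesis unfolding 1(1) by (rule enters_right) (use 1 a in simp_all)
  next
    case 2 show ?thesis unfolding 2(1) by (rule enters_left) (use 2 a in simp_all)
  next
    case 3 show ?thesis unfolding 3(1) by (rule enters_central_from_right) (use 3 a in simp_all)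
  next
    case 4 show ?thesis unfolding 4(1) by (rule enters_central_from_left) (use 4 a in simp_all)
  qed
qed

lemma leg_det_path:
  assumes reg: "regular i x0 d0 x1 d1 \<epsilon> y \<tau>" and ent: "\<And>j. fst (field \<epsilon> j (x0, y)) * d0 > 0"
  shows "det_path (field \<epsilon>) (flow \<epsilon> i (x0, y)) \<tau>"
proof (rule det_path_arc)
  show "0 < \<tau>" using reg by (simp add: regular_def)
  show "enters (field \<epsilon>) i (flow \<epsilon> i (x0, y) 0)" using leg_enters[OF ent] by simp
  show int: "flow \<epsilon> i (x0, y) u \<in> interior (zone_set i)" if "0 < u" "u < \<tau>" for u
    using reg that by (simp add: regular_def interior_zone_iff)
  show "piece (field \<epsilon>) i (flow \<epsilon> i (x0, y)) 0 \<tau>"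
    unfolding piece_def
  proof (intro ballI conjI)
    fix u assume u: "u \<in> {0..\<tau>}"
    show "(flow \<epsilon> i (x0, y) has_vector_derivative field \<epsilon> i (flow \<epsilon> i (x0, y) u)) (at u within {0..\<tau>})"
      by (rule flow_derivative) (use reg in \<open>auto simp: regular_def small_def\<close>)
    consider "u = 0" | "u = \<tau>" | "0 < u" "u < \<tau>" using u by fastforce
    then show "flow \<epsilon> i (x0, y) u \<in> zone_set i"
    proof cases
      case 1
      then show ?thesis using leg_geometryD(5)[OF geo] by simp
    next
      case 2
      then have "flow \<epsilon> i (x0, y) u = (x1, snd (flow \<epsilon> i (x0, y) u))" using reg by (simp add: regular_def prod_eq_iff)
      then show ?thesis using leg_geometryD(6)[OF geo] by metis
    next
      case 3
      then show ?thesis using int interior_subset by blast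
    qed
  qed
qed

lemma leg_first_order:
  assumes reg: "regular i x0 d0 x1 d1 0 y0 \<tau>0"
  shows "((\<lambda>e. ((leg_map i x0 d0 x1 d1 (fst e) (snd e))\<^sup>2 / 2 - (snd e)\<^sup>2 / 2 -
       \<mu> i / (2 * \<rho> i) * ((x1 - s i)\<^sup>2 - (x0 - s i)\<^sup>2)) / fst e) \<longlongrightarrow>
     2 * \<delta> i * \<tau>0 * (y0\<^sup>2 / 2 - \<mu> i / (2 * \<rho> i) * (x0 - s i)\<^sup>2) + (snd (flow 0 i (x0, y0) \<tau>0) - y0) * m i)
     (at_right 0 \<times>\<^sub>F nhds y0)"
proof -
  let ?P = "leg_map i x0 d0 x1 d1" and ?\<tau> = "hit_time i x0 d0 x1 d1"
  let ?F = "at_right (0::real) \<times>\<^sub>F nhds y0"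
  define g where "g = \<mu> i / \<rho> i"
  have le: "?F \<le> nhds (0, y0)"
    unfolding nhds_prod by (intro prod_filter_mono) (auto simp: at_within_def)
  have f0: "(fst \<longlongrightarrow> 0) ?F" by (rule filterlim_mono[OF filterlim_fst _ order_refl]) (simp add: at_within_def)
  have fy: "(snd \<longlongrightarrow> y0) ?F" by (rule filterlim_snd)
  have ft: "((\<lambda>e. ?\<tau> (fst e) (snd e)) \<longlongrightarrow> \<tau>0) ?F"
    using hit_time_persists(2)[OF reg] le by (rule tendsto_mono[rotated])
  have fD: "((\<lambda>e. D (fst e) i) \<longlongrightarrow> K i) ?F"
    unfolding D_def by (rule f0 refl tendsto_eq_intros)+ simp
  have fsz: "((\<lambda>e. sz (fst e) i) \<longlongrightarrow> 0) ?F" and fsx: "((\<lambda>e. sx (fst e) i) \<longlongrightarrow> s i) ?F"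
    unfolding sz_def sx_def by (rule f0 fD refl K_nonzero tendsto_eq_intros | simp)+
  have fP: "((\<lambda>e. ?P (fst e) (snd e)) \<longlongrightarrow> snd (flow 0 i (x0, y0) \<tau>0)) ?F"
  proof -
    have "isCont (gcosh (K i)) \<tau>0" "isCont (gsinh (K i)) \<tau>0"
      using continuous_on_gcosh[OF continuous_on_id, of UNIV "K i"] continuous_on_gsinh[OF continuous_on_id, of UNIV "K i"]
      by (auto simp: continuous_on_eq_continuous_at id_def)
    from this[THEN isCont_tendsto_compose, OF ft]
    have c: "((\<lambda>e. gcosh (K i) (?\<tau> (fst e) (snd e))) \<longlongrightarrow> gcosh (K i) \<tau>0) ?F"
      "((\<lambda>e. gsinh (K i) (?\<tau> (fst e) (snd e))) \<longlongrightarrow> gsinh (K i) \<tau>0) ?F" by simp_all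
    show ?thesis unfolding leg_map_def flow_def fst_conv snd_conv
      by (rule fsz fsx fy f0 ft c refl tendsto_eq_intros)+ (simp add: sz_def sx_def)
  qed
  define \<phi> where "\<phi> = (\<lambda>w :: real. if w = 0 then 1 else (exp w - 1) / w)"
  have "\<phi> \<midarrow>0\<rightarrow> 1"
    by (rule Lim_transform_eventually[OF lim_exp_minus_1]) (auto simp: \<phi>_def eventually_at intro!: exI[of _ 1])
  then have "isCont \<phi> 0" by (simp add: isCont_def \<phi>_def)
  moreover have "((\<lambda>e. 2 * (fst e * \<delta> i * ?\<tau> (fst e) (snd e))) \<longlongrightarrow> 0) ?F"
    by (rule f0 ft refl tendsto_eq_intros)+ simp
  ultimately have fe: "((\<lambda>e. \<phi> (2 * (fst e * \<delta> i * ?\<tau> (fst e) (snd e)))) \<longlongrightarrow> 1) ?F"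
    using isCont_tendsto_compose[of 0 \<phi>] by (fastforce simp: \<phi>_def)
  have ev: "\<forall>\<^sub>F e in ?F. regular i x0 d0 x1 d1 (fst e) (snd e) (?\<tau> (fst e) (snd e)) \<and> fst e \<noteq> 0"
  proof (rule eventually_conj)
    show "\<forall>\<^sub>F e in ?F. regular i x0 d0 x1 d1 (fst e) (snd e) (?\<tau> (fst e) (snd e))"
      using le hit_time_persists(1)[OF reg] by (rule filter_leD)
    have "\<forall>\<^sub>F \<epsilon> in at_right (0::real). \<epsilon> \<noteq> 0" by (simp add: eventually_at_filter)
    moreover have "filterlim fst (at_right (0::real)) ?F" by (rule filterlim_fst)
    ultimately show "\<forall>\<^sub>F e in ?F. fst e \<noteq> 0" by (rule eventually_compose_filterlim)
  qed
  let ?Q = "\<lambda>e. (snd e - sz (fst e) i)\<^sup>2 / 2 - g / 2 * (x0 - sx (fst e) i)\<^sup>2"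
  let ?R = "\<lambda>e. (?P (fst e) (snd e) - snd e) * (K i * m i / D (fst e) i) +
     g * (fst e * \<delta> i * \<rho> i * m i / D (fst e) i) * (x1 - x0) +
     2 * \<delta> i * ?\<tau> (fst e) (snd e) * \<phi> (2 * (fst e * \<delta> i * ?\<tau> (fst e) (snd e))) * ?Q e"
  have "(?R \<longlongrightarrow> 2 * \<delta> i * \<tau>0 * (y0\<^sup>2 / 2 - \<mu> i / (2 * \<rho> i) * (x0 - s i)\<^sup>2) +
      (snd (flow 0 i (x0, y0) \<tau>0) - y0) * m i) ?F"
    by (rule fP fy f0 fD fe fsx fsz ft refl K_nonzero zero_neq_numeral[symmetric] tendsto_eq_intros)+
      (use K_nonzero[of i] in \<open>simp add: g_def\<close>)
  moreover have "\<forall>\<^sub>F e in ?F. ?R e = ((?P (fst e) (snd e))\<^sup>2 / 2 - (snd e)\<^sup>2 / 2 -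
       \<mu> i / (2 * \<rho> i) * ((x1 - s i)\<^sup>2 - (x0 - s i)\<^sup>2)) / fst e"
    using ev
  proof eventually_elim
    case (elim e)
    define \<epsilon> where "\<epsilon> = fst e"
    define y where "y = snd e"
    define \<tau> where "\<tau> = ?\<tau> \<epsilon> y"
    define q where "q = ?P \<epsilon> y"
    define Y where "Y = sz \<epsilon> i"
    define X where "X = sx \<epsilon> i"
    have r: "regular i x0 d0 x1 d1 \<epsilon> y \<tau>" "\<epsilon> \<noteq> 0" using elim by (auto simp: \<epsilon>_def y_def \<tau>_def)
    have D: "D \<epsilon> i \<noteq> 0" using r by (auto simp: regular_def small_def)
    have gh: "\<mu> i / (2 * \<rho> i) = g / 2" by (simp add: g_def)
    have fi: "(q - Y)\<^sup>2 / 2 - g / 2 * (x1 - X)\<^sup>2 = exp (2 * (\<epsilon> * \<delta> i * \<tau>)) * ((y - Y)\<^sup>2 / 2 - g / 2 * (x0 - X)\<^sup>2)"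
      using flow_first_integral[of \<epsilon> i "(x0, y)" \<tau>] r(1) unfolding gh
      by (simp add: q_def leg_map_def \<tau>_def regular_def Y_def X_def)
    have e1: "exp (2 * (\<epsilon> * \<delta> i * \<tau>)) = 1 + \<epsilon> * (2 * \<delta> i * \<tau> * \<phi> (2 * (\<epsilon> * \<delta> i * \<tau>)))"
      using r(2) by (simp add: \<phi>_def)
    have Y: "K i * m i / D \<epsilon> i = Y / \<epsilon>" using r(2) D by (simp add: Y_def sz_def field_simps)
    have X: "\<epsilon> * \<delta> i * \<rho> i * m i / D \<epsilon> i = (s i - X) / \<epsilon>"
      using r(2) D by (simp add: X_def sx_def field_simps power2_eq_square)
    define Z where "Z = 2 * \<delta> i * \<tau> * \<phi> (2 * (\<epsilon> * \<delta> i * \<tau>))"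
    define Q where "Q = (y - Y)\<^sup>2 / 2 - g / 2 * (x0 - X)\<^sup>2"
    have fi': "(q - Y)\<^sup>2 / 2 - g / 2 * (x1 - X)\<^sup>2 = Q + \<epsilon> * (Z * Q)"
      using fi unfolding e1 Z_def[symmetric] Q_def[symmetric] by (simp add: algebra_simps)
    have "q\<^sup>2 / 2 - y\<^sup>2 / 2 - g / 2 * ((x1 - s i)\<^sup>2 - (x0 - s i)\<^sup>2) =
       (q - y) * Y + g * (s i - X) * (x1 - x0) + (((q - Y)\<^sup>2 / 2 - g / 2 * (x1 - X)\<^sup>2) - Q)"
      unfolding Q_def by (simp add: power2_eq_square field_simps)
    then have "q\<^sup>2 / 2 - y\<^sup>2 / 2 - g / 2 * ((x1 - s i)\<^sup>2 - (x0 - s i)\<^sup>2) =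
       (q - y) * Y + g * (s i - X) * (x1 - x0) + \<epsilon> * (Z * Q)" unfolding fi' by simp
    then have "(q\<^sup>2 / 2 - y\<^sup>2 / 2 - g / 2 * ((x1 - s i)\<^sup>2 - (x0 - s i)\<^sup>2)) / \<epsilon> =
       (q - y) * (Y / \<epsilon>) + g * ((s i - X) / \<epsilon>) * (x1 - x0) + Z * Q"
      using r(2) by (simp add: add_divide_distrib)
    then show ?case
      unfolding gh \<epsilon>_def[symmetric] y_def[symmetric] \<tau>_def[symmetric] q_def[symmetric] X Y
        Y_def[symmetric] X_def[symmetric] Z_def[symmetric] Q_def[symmetric] by simp
  qed
  ultimately show ?thesis by (rule Lim_transform_eventually)
qed

theorem leg_transit:
  assumes reg: "regular i x0 d0 x1 d1 0 y0 \<tau>0"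
  shows "transit field x0 y0 x1 (snd (flow 0 i (x0, y0) \<tau>0)) {} (\<mu> i / (2 * \<rho> i) * ((x1 - s i)\<^sup>2 - (x0 - s i)\<^sup>2))
     (2 * \<delta> i * \<tau>0 * (y0\<^sup>2 / 2 - \<mu> i / (2 * \<rho> i) * (x0 - s i)\<^sup>2) + (snd (flow 0 i (x0, y0) \<tau>0) - y0) * m i)
     (leg_map i x0 d0 x1 d1) (\<lambda>\<epsilon> y. flow \<epsilon> i (x0, y)) (hit_time i x0 d0 x1 d1)"
proof -
  let ?P = "leg_map i x0 d0 x1 d1" and ?\<tau> = "hit_time i x0 d0 x1 d1"
  note hp = hit_time_persists[OF reg]
  have contF: "continuous_on ((small \<times> UNIV) \<times> UNIV) (\<lambda>z. flow (fst (fst z)) i (x0, snd (fst z)) (snd z))"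
    by (rule continuous_on_flow)
  have opn: "open ((small \<times> (UNIV :: real set)) \<times> (UNIV :: real set))"
    using open_small by (intro open_Times) auto
  have "isCont (\<lambda>z. flow (fst (fst z)) i (x0, snd (fst z)) (snd z)) ((0, y0), \<tau>0)"
    using contF opn zero_small by (simp add: continuous_on_eq_continuous_at)
  moreover have "((\<lambda>e. (e, ?\<tau> (fst e) (snd e))) \<longlongrightarrow> ((0, y0), \<tau>0)) (nhds (0, y0))"
    by (intro tendsto_Pair hp(2)) (simp add: filterlim_ident)
  ultimately have "((\<lambda>e. flow (fst e) i (x0, snd e) (?\<tau> (fst e) (snd e))) \<longlongrightarrow> flow 0 i (x0, y0) \<tau>0) (nhds (0, y0))"
    using isCont_tendsto_compose by fastforce
  then have limP: "((\<lambda>e. ?P (fst e) (snd e)) \<longlongrightarrow> snd (flow 0 i (x0, y0) \<tau>0)) (nhds (0, y0))"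
    unfolding leg_map_def by (rule tendsto_snd)
  have sgn: "\<forall>\<^sub>F e in nhds (0, y0). \<forall>j. fst (field (fst e) j (x0, snd e)) * d0 > 0"
  proof -
    have "\<forall>\<^sub>F e in nhds (0, y0). fst (field (fst e) j (x0, snd e)) * d0 > 0" for j
    proof (rule order_tendstoD(1))
      show "((\<lambda>e. fst (field (fst e) j (x0, snd e)) * d0) \<longlongrightarrow> \<rho> j * (y0 * d0)) (nhds (0, y0))"
        unfolding field_def by (auto intro!: tendsto_eq_intros filterlim_ident)
      have "\<rho> i * (y0 * d0) > 0" using reg by (simp add: regular_def field_def mult.assoc)
      then have "y0 * d0 > 0" using \<rho>_pos[of i] by (simp add: zero_less_mult_iff)
      then show "\<rho> j * (y0 * d0) > 0" using \<rho>_pos[of j] by simp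
    qed
    from this[of LeftZone] this[of CentralZone] this[of RightZone]
    show ?thesis by eventually_elim (metis zone.exhaust)
  qed
  show ?thesis unfolding transit_def
  proof (intro conjI allI impI ballI)
    show "((\<lambda>e. ?P (fst e) (snd e)) \<longlongrightarrow> snd (flow 0 i (x0, y0) \<tau>0)) (nhds (0, y0))" by (rule limP)
    show "\<forall>\<^sub>F e in nhds (0, y0). real_analytic_at (?P (fst e)) (snd e)"
      using hp(1) by eventually_elim (rule flow_analytic)
    show "\<forall>\<^sub>F e in nhds (0, y0). det_path (field (fst e)) (flow (fst e) i (x0, snd e)) (?\<tau> (fst e) (snd e)) \<and>
       flow (fst e) i (x0, snd e) 0 = (x0, snd e) \<and>
       flow (fst e) i (x0, snd e) (?\<tau> (fst e) (snd e)) = (x1, ?P (fst e) (snd e))"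
      using hp(1) sgn
    proof eventually_elim
      case (elim e)
      then show ?case using leg_det_path by (auto simp: leg_map_def regular_def prod_eq_iff)
    qed
    show "((\<lambda>e. ((?P (fst e) (snd e))\<^sup>2 / 2 - (snd e)\<^sup>2 / 2 -
       \<mu> i / (2 * \<rho> i) * ((x1 - s i)\<^sup>2 - (x0 - s i)\<^sup>2)) / fst e) \<longlongrightarrow>
      2 * \<delta> i * \<tau>0 * (y0\<^sup>2 / 2 - \<mu> i / (2 * \<rho> i) * (x0 - s i)\<^sup>2) + (snd (flow 0 i (x0, y0) \<tau>0) - y0) * m i)
      (at_right 0 \<times>\<^sub>F nhds y0)" by (rule leg_first_order[OF reg])
    have l: "filterlim (\<lambda>e :: real \<times> real \<times> real. (fst e, fst (snd e))) (nhds (0, y0)) (nhds (0, (y0, y0)))"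
        "filterlim (\<lambda>e :: real \<times> real \<times> real. (fst e, snd (snd e))) (nhds (0, y0)) (nhds (0, (y0, y0)))"
      by (auto intro!: tendsto_eq_intros filterlim_ident)
    show "\<forall>\<^sub>F e in nhds (0, (y0, y0)). ?P (fst e) (fst (snd e)) = ?P (fst e) (snd (snd e)) \<longrightarrow> fst (snd e) = snd (snd e)"
      using eventually_compose_filterlim[OF hp(1) l(1)] eventually_compose_filterlim[OF hp(1) l(2)]
    proof eventually_elim
      case (elim e)
      then show ?case using leg_injective by (metis fst_conv snd_conv linear)
    qed
  next
    fix \<zeta> :: real assume "\<zeta> > 0"
    show "\<forall>\<^sub>F e in nhds (0, y0). \<forall>u. 0 < u \<longrightarrow> u < ?\<tau> (fst e) (snd e) \<longrightarrow>
       flow (fst e) i (x0, snd e) u \<in> switching_lines \<longrightarrow>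
       (\<exists>b\<in>{}. fst (flow (fst e) i (x0, snd e) u) = fst b \<and> \<bar>snd (flow (fst e) i (x0, snd e) u) - snd b\<bar> < \<zeta>)"
      using hp(1)
    proof eventually_elim
      case (elim e)
      then have "flow (fst e) i (x0, snd e) u \<notin> switching_lines" if "0 < u" "u < ?\<tau> (fst e) (snd e)" for u
        using that by (intro not_switching_interior[of _ i]) (simp add: regular_def interior_zone_iff)
      then show ?case by blast
    qed
  next
    fix \<zeta> :: real assume \<zeta>: "\<zeta> > 0"
    let ?base = "flow 0 i (x0, y0)"
    have T0: "?\<tau> 0 y0 = \<tau>0" by (rule hit_time_eq[OF reg])
    have \<tau>0: "0 < \<tau>0" using reg by (simp add: regular_def)
    let ?C = "{0..\<tau>0 + 1}"
    have D0: "D 0 i \<noteq> 0" using zero_small by (simp add: small_def)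
    have "continuous_on ?C ?base"
      by (rule continuous_on_vector_derivative) (rule flow_derivative[OF D0])
    then have "uniformly_continuous_on ?C ?base" by (rule compact_uniformly_continuous) simp
    then obtain a where a: "a > 0" "\<forall>t\<in>?C. \<forall>t'\<in>?C. dist t' t < a \<longrightarrow> dist (?base t') (?base t) < \<zeta> / 2"
      using \<zeta> unfolding uniformly_continuous_on_def by (meson half_gt_zero)
    have "continuous_on ((small \<times> UNIV) \<times> UNIV)
        (\<lambda>z. dist (flow (fst (fst z)) i (x0, snd (fst z)) (snd z)) (?base (snd z)))"
    proof (intro continuous_intros contF)
      have "continuous_on UNIV ?base"
        by (rule continuous_on_vector_derivative) (rule flow_derivative[OF D0])
      then show "continuous_on ((small \<times> UNIV) \<times> UNIV) (\<lambda>z :: (real \<times> real) \<times> real. ?base (snd z))"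
        by (rule continuous_on_compose2) (auto intro!: continuous_intros)
    qed
    from eventually_tube[OF this _ _ compact_Icc, of "(0, y0)" "{..<\<zeta> / 2}" 0 "\<tau>0 + 1"]
    have close: "\<forall>\<^sub>F e in nhds (0, y0). \<forall>t\<in>?C. dist (flow (fst e) i (x0, snd e) t) (?base t) < \<zeta> / 2"
      using open_small zero_small \<zeta> by (simp add: open_Times)
    have "\<forall>\<^sub>F e in nhds (0, y0). dist (?\<tau> (fst e) (snd e)) \<tau>0 < min a 1"
      using hp(2) by (rule tendstoD) (use a in simp)
    then show "\<forall>\<^sub>F e in nhds (0, y0). hausclose \<zeta> (flow (fst e) i (x0, snd e) ` {0..?\<tau> (fst e) (snd e)})
        (flow 0 i (x0, y0) ` {0..?\<tau> 0 y0})"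
      using close hp(1)
    proof eventually_elim
      case (elim e)
      let ?c = "flow (fst e) i (x0, snd e)" and ?T = "?\<tau> (fst e) (snd e)"
      have T: "0 < ?T" "\<bar>?T - \<tau>0\<bar> < a" "\<bar>?T - \<tau>0\<bar> < 1"
        using elim(1,3) by (auto simp: regular_def dist_real_def)
      have tri: "dist (?c t) (?base t') < \<zeta>" if "t \<in> ?C" "t' \<in> ?C" "\<bar>t - t'\<bar> < a" for t t'
      proof -
        have "dist (?c t) (?base t) < \<zeta> / 2" using elim(2) that by blast
        moreover have "dist (?base t) (?base t') < \<zeta> / 2" using a(2) that by (simp add: dist_real_def)
        ultimately show ?thesis using dist_triangle[of "?c t" "?base t'" "?base t"] by linarith
      qed
      show ?case unfolding hausclose_def T0
      proof (intro conjI ballI)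
        fix p assume "p \<in> ?c ` {0..?T}"
        then obtain t where t: "p = ?c t" "0 \<le> t" "t \<le> ?T" by auto
        have "dist (?c t) (?base (min t \<tau>0)) < \<zeta>"
          by (rule tri) (use t T \<tau>0 a in auto)
        then show "\<exists>q\<in>?base ` {0..\<tau>0}. dist p q < \<zeta>" using t \<tau>0 by (intro bexI[of _ "?base (min t \<tau>0)"]) auto
      next
        fix q assume "q \<in> ?base ` {0..\<tau>0}"
        then obtain t where t: "q = ?base t" "0 \<le> t" "t \<le> \<tau>0" by auto
        have "dist (?c (min t ?T)) (?base t) < \<zeta>"
          by (rule tri) (use t T \<tau>0 a in auto)
        then show "\<exists>p\<in>?c ` {0..?T}. dist p q < \<zeta>" using t T by (intro bexI[of _ "?c (min t ?T)"]) auto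
      qed
    qed
  qed simp
qed

end

end


section \<open>Limit cycles from sign changes of the Melnikov function\<close>

lemma crossing_time_isolated:
  assumes \<gamma>: "trajectory V \<gamma>" and cr: "crossing_point V (\<gamma> t)"
  shows "\<exists>d>0. \<forall>s. t - d < s \<longrightarrow> s < t \<longrightarrow> fst (\<gamma> s) \<noteq> fst (\<gamma> t)"
proof -
  obtain i e where e: "e > 0" "piece V i \<gamma> (t - e) t" using \<gamma> unfolding trajectory_iff by blast
  have zone: "\<gamma> t \<in> zone_set i" using piece_in_zone[OF e(2)] e(1) by simp
  have nz: "fst (V i (\<gamma> t)) \<noteq> 0"
    using cr zone unfolding crossing_point_def by (cases i) (auto simp: zero_less_mult_iff)
  have der: "((\<lambda>s. fst (\<gamma> s)) has_real_derivative fst (V i (\<gamma> t))) (at t within {t - e..t})"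
    using e by (intro piece_fst_derivative) auto
  have "\<exists>d>0. \<forall>h>0. t - h \<in> {t - e..t} \<longrightarrow> h < d \<longrightarrow> fst (\<gamma> (t - h)) \<noteq> fst (\<gamma> t)"
  proof (cases "fst (V i (\<gamma> t)) > 0")
    case True
    then show ?thesis using has_real_derivative_pos_inc_left[OF der] by (metis less_irrefl)
  next
    case False
    then show ?thesis using has_real_derivative_neg_dec_left[OF der] nz by (metis less_irrefl linorder_neqE_linordered_idom)
  qed
  then obtain d where d: "d > 0" "\<forall>h>0. t - h \<in> {t - e..t} \<longrightarrow> h < d \<longrightarrow> fst (\<gamma> (t - h)) \<noteq> fst (\<gamma> t)"
    by (elim exE conjE)
  show ?thesis
  proof (intro exI conjI allI impI)
    show "min d e > 0" using d e by simp
    fix s assume "t - min d e < s" "s < t"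
    then show "fst (\<gamma> s) \<noteq> fst (\<gamma> t)" using d(2)[rule_format, of "t - s"] by simp
  qed
qed

lemma periodic_compact_range:
  assumes \<gamma>: "trajectory V \<gamma>" and T: "0 < T" "\<And>t. \<gamma> (t + T) = \<gamma> t"
  shows "compact (range \<gamma>)"
proof -
  have shift: "\<gamma> (t + T * of_nat n) = \<gamma> t" for t n
  proof (induction n)
    case (Suc n)
    have "t + T * of_nat (Suc n) = t + T * of_nat n + T" by (simp add: algebra_simps)
    then show ?case using T(2)[of "t + T * of_nat n"] Suc by metis
  qed simp
  have "\<gamma> (x + T * of_int n) = \<gamma> x" for x n
  proof (cases "n \<ge> 0")
    case True
    then show ?thesis using shift[of x "nat n"] by simp
  next
    case False
    then show ?thesis using shift[of "x + T * of_int n" "nat (- n)"] by simp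
  qed
  then have "\<gamma> t \<in> \<gamma> ` {0..T}" for t
    by (metis T(1) atLeastAtMost_iff imageI less_imp_le real_decompose)
  then have "range \<gamma> = \<gamma> ` {0..T}" by blast
  moreover have "continuous_on {0..T} \<gamma>"
    using trajectory_isCont[OF \<gamma>] by (auto intro: continuous_at_imp_continuous_on)
  ultimately show ?thesis by (simp add: compact_continuous_image)
qed

text \<open>Isolation of the periodic orbit through a fixed point of the Poincare map: a periodic orbit nearby
  meets the section, and its highest intersection point is again a fixed point, because the Poincare map
  is increasing.\<close>

lemma limit_cycle_of_fixed_point:
  fixes l r :: real
  assumes uniq: "unique_pieces V" and l: "0 \<le> l"
    and path: "\<And>y. l < y \<Longrightarrow> y < r \<Longrightarrow> det_path V (c y) (T y) \<and> c y 0 = (1, y) \<and> c y (T y) = (1, P y) \<and> P y > 0"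
    and sw: "\<And>y u. l < y \<Longrightarrow> y < r \<Longrightarrow> 0 < u \<Longrightarrow> u < T y \<Longrightarrow> c y u \<in> switching_lines \<Longrightarrow>
      \<exists>b\<in>B. fst (c y u) = fst b \<and> \<bar>snd (c y u) - snd b\<bar> < \<eta>"
    and B1: "\<And>b. b \<in> B \<Longrightarrow> fst b = 1 \<Longrightarrow> snd b \<le> - \<eta>"
    and cross: "\<And>y. l < y \<Longrightarrow> y < r \<Longrightarrow> crossing_point V (1, y)"
    and crossB: "\<And>b y. b \<in> B \<Longrightarrow> \<bar>y - snd b\<bar> < \<eta> \<Longrightarrow> crossing_point V (fst b, y)"
    and suff: "\<And>b y. b \<in> B \<Longrightarrow> \<bar>y - snd b\<bar> < \<eta> \<Longrightarrow>
      \<exists>c' T'. det_path V c' T' \<and> c' 0 = (fst b, y) \<and> fst (c' T') = 1 \<and> snd (c' T') > 0"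
    and mono: "\<And>y y'. l < y \<Longrightarrow> y < y' \<Longrightarrow> y' < r \<Longrightarrow> P y < P y'"
    and fixp: "l < y0" "y0 < r" "P y0 = y0"
    and iso: "d > 0" "\<And>y. l < y \<Longrightarrow> y < r \<Longrightarrow> y \<noteq> y0 \<Longrightarrow> \<bar>y - y0\<bar> < d \<Longrightarrow> P y \<noteq> y"
  shows "limit_cycle V (c y0 ` {0..T y0})"
    and "c y0 ` {0..T y0} \<inter> {p. fst p = 1 \<and> snd p > 0} = {(1, y0)}"
proof -
  let ?G = "c y0 ` {0..T y0}"
  have c: "det_path V (c y0) (T y0)" "c y0 0 = (1, y0)" "c y0 (T y0) = (1, y0)"
    using path[OF fixp(1,2)] fixp(3) by auto
  have T: "0 < T y0" using c(1) by (simp add: det_path_def)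
  have B1': "y < 0" if "b \<in> B" "fst b = 1" "\<bar>y - snd b\<bar> < \<eta>" for b y
    using B1[OF that(1,2)] that(3) by linarith
  have mid: "\<exists>b\<in>B. fst (c y0 u) = fst b \<and> \<bar>snd (c y0 u) - snd b\<bar> < \<eta>"
    if "0 < u" "u < T y0" "c y0 u \<in> switching_lines" for u
    using sw[OF fixp(1,2) that] .
  have simple: "c y0 u \<noteq> c y0 0" if u: "0 < u" "u < T y0" for u
  proof
    assume eq: "c y0 u = c y0 0"
    then have "c y0 u \<in> switching_lines" using c by (simp add: switching_lines_def)
    then obtain b where "b \<in> B" "fst b = 1" "\<bar>y0 - snd b\<bar> < \<eta>" using mid[OF u] eq c by auto
    then show False using B1' fixp l by fastforce
  qed
  have closed: "c y0 (T y0) = c y0 0" using c by simp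
  have per: "periodic_solution V (periodic_ext (c y0) (T y0)) (T y0)"
    by (rule periodic_solution_periodic_ext[OF uniq c(1) closed simple])
  have ran: "range (periodic_ext (c y0) (T y0)) = ?G" by (rule range_periodic_ext[OF T closed])
  have Gpt: "p = (1, y0) \<or> (\<exists>b\<in>B. fst p = fst b \<and> \<bar>snd p - snd b\<bar> < \<eta>)" if p: "p \<in> ?G" "p \<in> switching_lines" for p
  proof -
    obtain u where u: "p = c y0 u" "0 \<le> u" "u \<le> T y0" using p(1) by auto
    consider "u = 0" | "u = T y0" | "0 < u" "u < T y0" using u by fastforce
    then show ?thesis using mid[of u] p(2) u c by cases auto
  qed
  have y0G: "(1, y0) \<in> ?G" using c(2) T by (metis atLeastAtMost_iff image_eqI less_imp_le order_refl)
  have cpo: "crossing_periodic_orbit V ?G"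
    unfolding crossing_periodic_orbit_def
  proof (intro conjI ballI)
    show "periodic_orbit V ?G" unfolding periodic_orbit_def using per ran by blast
    have "(1, y0) \<in> switching_lines" by (simp add: switching_lines_def)
    then show "?G \<inter> switching_lines \<noteq> {}" using y0G by blast
    fix p assume "p \<in> ?G \<inter> switching_lines"
    then consider "p = (1, y0)" | b where "b \<in> B" "fst p = fst b" "\<bar>snd p - snd b\<bar> < \<eta>" using Gpt by blast
    then show "crossing_point V p"
    proof cases
      case 1
      then show ?thesis using cross fixp by simp
    next
      case 2
      then have "crossing_point V (fst b, snd p)" by (intro crossB)
      moreover have "(fst b, snd p) = p" using 2(2) by (simp add: prod_eq_iff)
      ultimately show ?thesis by metis
    qed
  qed
  show "?G \<inter> {p. fst p = 1 \<and> snd p > 0} = {(1, y0)}"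
  proof
    show "?G \<inter> {p. fst p = 1 \<and> snd p > 0} \<subseteq> {(1, y0)}"
    proof
      fix p assume p: "p \<in> ?G \<inter> {p. fst p = 1 \<and> snd p > 0}"
      then have "p \<in> switching_lines" by (simp add: switching_lines_def)
      then have "p = (1, y0) \<or> (\<exists>b\<in>B. fst p = fst b \<and> \<bar>snd p - snd b\<bar> < \<eta>)" using p Gpt by blast
      then show "p \<in> {(1, y0)}" using p B1' by fastforce
    qed
    show "{(1, y0)} \<subseteq> ?G \<inter> {p. fst p = 1 \<and> snd p > 0}" using y0G l fixp by auto
  qed
  define W where "W = (\<lambda>x. \<Union>b\<in>{b\<in>B. fst b = x}. {snd b - \<eta><..<snd b + \<eta>})"
  define W0 where "W0 = {l<..<r} \<inter> {y0 - d<..<y0 + d}"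
  define U :: "plane set" where "U = - ({1} \<times> (- (W0 \<union> W 1))) \<inter> - ({-1} \<times> (- W (-1)))"
  have oW: "open (W x)" for x unfolding W_def by (intro open_UN) auto
  have oW0: "open W0" unfolding W0_def by (intro open_Int) auto
  have U: "open U"
    unfolding U_def using oW oW0 by (intro open_Int open_Compl closed_Times) auto
  have W: "y \<in> W x \<longleftrightarrow> (\<exists>b\<in>B. fst b = x \<and> \<bar>y - snd b\<bar> < \<eta>)" for x y
  proof -
    have "y \<in> {snd b - \<eta><..<snd b + \<eta>} \<longleftrightarrow> \<bar>y - snd b\<bar> < \<eta>" for b :: plane by (auto simp: abs_less_iff)
    then show ?thesis unfolding W_def by blast
  qed
  have Umem: "p \<in> U \<longleftrightarrow> (fst p = 1 \<longrightarrow> snd p \<in> W0 \<or> snd p \<in> W 1) \<and> (fst p = -1 \<longrightarrow> snd p \<in> W (-1))" for p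
    unfolding U_def by (cases p) auto
  have W1neg: "y < 0" if "y \<in> W 1" for y using that B1' unfolding W by blast
  show "limit_cycle V ?G"
    unfolding limit_cycle_def
  proof (intro conjI cpo exI[of _ U] U allI impI)
    show "?G \<subseteq> U"
    proof
      fix p assume p: "p \<in> ?G"
      show "p \<in> U"
      proof (cases "p \<in> switching_lines")
        case True
        then have "p = (1, y0) \<or> (\<exists>b\<in>B. fst p = fst b \<and> \<bar>snd p - snd b\<bar> < \<eta>)" using p Gpt by blast
        moreover have "y0 \<in> W0" using fixp iso(1) by (simp add: W0_def)
        ultimately show ?thesis unfolding Umem W
          by (elim disjE) (simp, metis)
      qed (auto simp: Umem switching_lines_def)
    qed
    fix \<Gamma>' assume \<Gamma>': "crossing_periodic_orbit V \<Gamma>' \<and> \<Gamma>' \<subseteq> U"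
    then obtain \<gamma> T' where \<gamma>: "trajectory V \<gamma>" "T' > 0" "\<And>t. \<gamma> (t + T') = \<gamma> t" "\<Gamma>' = range \<gamma>"
      unfolding crossing_periodic_orbit_def periodic_orbit_def periodic_solution_def by blast
    have inU: "\<gamma> t \<in> U" for t using \<Gamma>' \<gamma>(4) by blast
    have sec: "snd (\<gamma> t) \<in> W0" if "fst (\<gamma> t) = 1" "snd (\<gamma> t) \<ge> 0" for t
      using inU[of t] that W1neg unfolding Umem by fastforce
    have meets: "\<exists>t. fst (\<gamma> t) = 1 \<and> snd (\<gamma> t) \<ge> 0"
    proof -
      obtain t where t: "\<gamma> t \<in> switching_lines" using \<Gamma>' \<gamma>(4) unfolding crossing_periodic_orbit_def by blast
      show ?thesis
      proof (cases "fst (\<gamma> t) = 1 \<and> snd (\<gamma> t) \<ge> 0")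
        case False
        have "snd (\<gamma> t) \<in> W (fst (\<gamma> t))"
          using t inU[of t] False unfolding Umem W0_def switching_lines_def using l by auto
        then obtain b where b: "b \<in> B" "fst b = fst (\<gamma> t)" "\<bar>snd (\<gamma> t) - snd b\<bar> < \<eta>" unfolding W by blast
        obtain c' T'' where c': "det_path V c' T''" "c' 0 = (fst b, snd (\<gamma> t))" "fst (c' T'') = 1" "snd (c' T'') > 0"
          using suff[OF b(1,3)] by blast
        have T'': "0 \<le> T''" using c'(1) by (simp add: det_path_def)
        have "\<gamma> t = c' 0" using c'(2) b(2) by (simp add: prod_eq_iff)
        from det_path_follow[OF uniq c'(1) \<gamma>(1) this T'' order_refl]
        have "\<gamma> (t + T'') = c' T''" .
        then show ?thesis using c' by (intro exI[of _ "t + T''"]) auto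
      qed blast
    qed
    define Z where "Z = {y. (1, y) \<in> \<Gamma>' \<and> 0 \<le> y}"
    have cp: "compact \<Gamma>'" using periodic_compact_range[OF \<gamma>(1-3)] \<gamma>(4) by simp
    have "compact (snd ` (\<Gamma>' \<inter> ({1} \<times> {0..})))"
      by (intro compact_continuous_image continuous_intros compact_Int_closed cp closed_Times closed_singleton closed_atLeast)
    moreover have "snd ` (\<Gamma>' \<inter> ({1} \<times> {0..})) = Z" unfolding Z_def by force
    ultimately have "compact Z" by simp
    moreover have "Z \<noteq> {}"
    proof -
      from meets obtain t where "fst (\<gamma> t) = 1" "snd (\<gamma> t) \<ge> 0" by (elim exE conjE)
      then have "(1, snd (\<gamma> t)) = \<gamma> t" by (simp add: prod_eq_iff)
      then have "(1, snd (\<gamma> t)) \<in> \<Gamma>'" using \<gamma>(4) by (metis rangeI)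
      then show ?thesis using \<open>snd (\<gamma> t) \<ge> 0\<close> by (auto simp: Z_def)
    qed
    ultimately have "\<exists>ym\<in>Z. \<forall>y\<in>Z. y \<le> ym" by (rule compact_attains_sup)
    then obtain ym where ym: "ym \<in> Z" and ym2: "\<forall>y\<in>Z. y \<le> ym" by (elim bexE)
    have ZW: "y \<in> W0" if "y \<in> Z" for y
    proof -
      have "(1, y) \<in> range \<gamma>" "0 \<le> y" using \<open>y \<in> Z\<close> by (simp_all add: Z_def \<gamma>(4))
      then obtain t where "\<gamma> t = (1, y)" by (metis imageE)
      then show ?thesis using sec[of t] \<open>0 \<le> y\<close> by simp
    qed
    have next_visit: "\<gamma> (t + T y) = (1, P y) \<and> 0 < T y \<and>
        (\<forall>u. 0 < u \<longrightarrow> u < T y \<longrightarrow> \<not> (fst (\<gamma> (t + u)) = 1 \<and> snd (\<gamma> (t + u)) \<ge> 0))"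
      if "\<gamma> t = (1, y)" "0 \<le> y" for t y
    proof -
      have y: "l < y" "y < r" using sec[of t] that by (auto simp: W0_def)
      note p = path[OF y]
      have f: "\<gamma> (t + u) = c y u" if "0 \<le> u" "u \<le> T y" for u
      proof -
        have "\<gamma> t = c y 0" using p \<open>\<gamma> t = (1, y)\<close> by simp
        from det_path_follow[OF uniq conjunct1[OF p] \<gamma>(1) this that] show ?thesis .
      qed
      have T0: "0 < T y" using p by (simp add: det_path_def)
      have "\<not> (fst (\<gamma> (t + u)) = 1 \<and> snd (\<gamma> (t + u)) \<ge> 0)" if u: "0 < u" "u < T y" for u
      proof
        assume *: "fst (\<gamma> (t + u)) = 1 \<and> snd (\<gamma> (t + u)) \<ge> 0"
        then have "c y u \<in> switching_lines" using f[of u] u by (simp add: switching_lines_def)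
        from sw[OF y u this] obtain b where "b \<in> B" "fst (c y u) = fst b" "\<bar>snd (c y u) - snd b\<bar> < \<eta>" by blast
        then show False using B1'[of b "snd (c y u)"] * f[of u] u by simp
      qed
      then show ?thesis using f[of "T y"] p T0 by simp
    qed
    have "(1, ym) \<in> range \<gamma>" "0 \<le> ym" using ym by (simp_all add: Z_def \<gamma>(4))
    then obtain t where t: "\<gamma> t = (1, ym)" "0 \<le> ym" by (metis imageE)
    have yml: "l < ym" "ym < r" using ZW[OF ym] by (auto simp: W0_def)
    have "\<gamma> (t + T ym) = (1, P ym)" using next_visit[OF t] by simp
    then have "(1, P ym) \<in> \<Gamma>'" unfolding \<gamma>(4) by (metis rangeI)
    then have "P ym \<in> Z" using path[OF yml] by (simp add: Z_def)
    then have le: "P ym \<le> ym" using ym2 by blast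
    define t1 where "t1 = t + T'"
    have t1: "\<gamma> t1 = (1, ym)" "t < t1" using \<gamma> t by (auto simp: t1_def)
    define A where "A = {u. t \<le> u \<and> u < t1 \<and> fst (\<gamma> u) = 1 \<and> snd (\<gamma> u) \<ge> 0}"
    have tA: "t \<in> A" using t t1 by (simp add: A_def)
    have bdd: "bdd_above A" by (rule bdd_aboveI[of _ t1]) (simp add: A_def)
    have "\<gamma> t1 \<in> \<Gamma>' \<inter> switching_lines" unfolding \<gamma>(4) using t1(1) by (intro IntI rangeI) (simp add: switching_lines_def)
    then have "crossing_point V (\<gamma> t1)" using \<Gamma>' unfolding crossing_periodic_orbit_def by blast
    from crossing_time_isolated[OF \<gamma>(1) this]
    obtain e where e: "e > 0" "\<And>u. t1 - e < u \<Longrightarrow> u < t1 \<Longrightarrow> fst (\<gamma> u) \<noteq> 1" using t1 by auto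
    have A': "A = {t..t1 - e} \<inter> \<gamma> -` ({1} \<times> {0..})"
    proof (intro set_eqI iffI)
      fix u assume "u \<in> A"
      then have u: "t \<le> u" "u < t1" "fst (\<gamma> u) = 1" "snd (\<gamma> u) \<ge> 0" by (auto simp: A_def)
      then have "u \<le> t1 - e" using e(2)[of u] by (cases "t1 - e < u") auto
      then show "u \<in> {t..t1 - e} \<inter> \<gamma> -` ({1} \<times> {0..})" using u by (simp add: mem_Times_iff)
    next
      fix u assume "u \<in> {t..t1 - e} \<inter> \<gamma> -` ({1} \<times> {0..})"
      then show "u \<in> A" using e(1) by (simp add: A_def mem_Times_iff)
    qed
    have "continuous_on {t..t1 - e} \<gamma>"
      using trajectory_isCont[OF \<gamma>(1)] by (auto intro: continuous_at_imp_continuous_on)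
    then have "closed A" unfolding A' by (rule continuous_closed_preimage) (auto intro: closed_Times)
    then have sup: "Sup A \<in> A" using tA bdd by (intro closed_contains_Sup) auto
    define u where "u = Sup A"
    define y where "y = snd (\<gamma> u)"
    have u: "t \<le> u" "u < t1" "\<gamma> u = (1, y)" "0 \<le> y" using sup unfolding u_def y_def A_def by (auto simp: prod_eq_iff)
    note nv = next_visit[OF u(3,4)]
    have "u + T y = t1"
    proof (rule antisym)
      show "u + T y \<le> t1"
      proof (rule ccontr)
        assume "\<not> u + T y \<le> t1"
        then have "\<not> (fst (\<gamma> (u + (t1 - u))) = 1 \<and> snd (\<gamma> (u + (t1 - u))) \<ge> 0)" using nv u by (intro nv[THEN conjunct2, THEN conjunct2, rule_format]) auto
        then show False using t1 t by simp
      qed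
      show "t1 \<le> u + T y"
      proof (rule ccontr)
        assume "\<not> t1 \<le> u + T y"
        moreover have "P y > 0" using path[of y] sec[of u] u by (auto simp: W0_def)
        ultimately have "u + T y \<in> A" using nv u by (simp add: A_def)
        then have "u + T y \<le> u" unfolding u_def using bdd by (intro cSup_upper)
        then show False using nv by simp
      qed
    qed
    then have Py: "P y = ym" using nv t1 by simp
    have "(1, y) \<in> \<Gamma>'" unfolding \<gamma>(4) using u(3) by (metis rangeI)
    then have yZ: "y \<in> Z" using u(4) by (simp add: Z_def)
    have yl: "l < y" using ZW[OF yZ] by (simp add: W0_def)
    have "ym \<le> P ym"
    proof (cases "y = ym")
      case False
      then have "y < ym" using bspec[OF ym2 yZ] by simp
      then show ?thesis using mono[OF yl _ yml(2)] Py by fastforce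
    qed (use Py in simp)
    then have "P ym = ym" using le by simp
    then have "ym = y0" using iso(2)[OF yml] ZW[OF ym] by (auto simp: W0_def abs_less_iff)
    then have "\<gamma> t = c y0 0" using t c by simp
    then show "\<Gamma>' = ?G" using trajectory_range_closed_path[OF uniq c(1) closed \<gamma>(1-3)] \<gamma>(4) by simp
  qed
qed

lemma eventually_nhds_box:
  assumes "\<forall>\<^sub>F e in nhds (0::real, y0::real). Q e"
  shows "\<exists>h>0. \<forall>\<epsilon> y. \<bar>\<epsilon>\<bar> < h \<longrightarrow> \<bar>y - y0\<bar> < h \<longrightarrow> Q (\<epsilon>, y)"
proof -
  obtain A1 A2 where "eventually A1 (nhds (0::real))" "eventually A2 (nhds y0)" "\<forall>x y. A1 x \<longrightarrow> A2 y \<longrightarrow> Q (x, y)"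
    using assms unfolding eventually_nhds_Pair by (elim exE conjE)
  moreover from this obtain d1 d2 where "d1 > 0" "\<forall>x. \<bar>x - 0\<bar> < d1 \<longrightarrow> A1 x" "d2 > 0" "\<forall>y. \<bar>y - y0\<bar> < d2 \<longrightarrow> A2 y"
    unfolding eventually_nhds_real by metis
  ultimately show ?thesis by (intro exI[of _ "min d1 d2"]) simp
qed

lemma eventually_nhds_box2:
  assumes "\<forall>\<^sub>F e in nhds (0::real, (y0::real, y0)). Q e"
  shows "\<exists>h>0. \<forall>\<epsilon> y y'. \<bar>\<epsilon>\<bar> < h \<longrightarrow> \<bar>y - y0\<bar> < h \<longrightarrow> \<bar>y' - y0\<bar> < h \<longrightarrow> Q (\<epsilon>, (y, y'))"
proof -
  obtain A1 A2 where A: "eventually A1 (nhds (0::real))" "eventually A2 (nhds (y0, y0))" "\<forall>x y. A1 x \<longrightarrow> A2 y \<longrightarrow> Q (x, y)"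
    using assms unfolding eventually_nhds_Pair[where a = 0] by (elim exE conjE)
  obtain A3 A4 where A': "eventually A3 (nhds y0)" "eventually A4 (nhds y0)" "\<forall>x y. A3 x \<longrightarrow> A4 y \<longrightarrow> A2 (x, y)"
    using A(2) unfolding eventually_nhds_Pair by (elim exE conjE)
  obtain d1 d2 d3 where "d1 > 0" "\<forall>x. \<bar>x - 0\<bar> < d1 \<longrightarrow> A1 x" "d2 > 0" "\<forall>y. \<bar>y - y0\<bar> < d2 \<longrightarrow> A3 y"
     "d3 > 0" "\<forall>y. \<bar>y - y0\<bar> < d3 \<longrightarrow> A4 y"
    using A(1) A'(1,2) unfolding eventually_nhds_real by metis
  then show ?thesis using A(3) A'(3) by (intro exI[of _ "min d1 (min d2 d3)"]) simp
qed


lemma finite_uniform_radius: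
  assumes "finite B" "\<And>b. b \<in> B \<Longrightarrow> \<exists>h>0. R b h" "\<And>b h h'. R b h \<Longrightarrow> 0 < h' \<Longrightarrow> h' \<le> h \<Longrightarrow> R b h'"
  shows "\<exists>h>(0::real). \<forall>b\<in>B. R b h"
  using assms(1,2)
proof (induction B rule: finite_induct)
  case (insert x B)
  obtain h1 where h1: "h1 > 0" "\<forall>b\<in>B. R b h1" using insert.IH insert.prems by (metis insertCI)
  obtain h2 where h2: "h2 > 0" "R x h2" using insert.prems by blast
  have "R b (min h1 h2)" if b: "b \<in> insert x B" for b
  proof (cases "b = x")
    case True
    then show ?thesis using assms(3)[of b h2 "min h1 h2"] h1 h2 by simp
  next
    case False
    then have "R b h1" using h1 b by blast
    then show ?thesis using assms(3)[of b h1 "min h1 h2"] h1(1) h2(1) by simp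
  qed
  then show ?case using h1 h2 by (intro exI[of _ "min h1 h2"]) simp
qed (auto intro: exI[of _ 1])

lemma increasing_of_injective:
  fixes f :: "real \<Rightarrow> real"
  assumes cont: "continuous_on {a..b} f" and inj: "inj_on f {a..b}" and ab: "f a < f b"
    and xy: "a \<le> x" "x < y" "y \<le> b"
  shows "f x < f y"
proof (cases "x = a")
  case True
  show ?thesis
  proof (cases "y = b")
    case False
    then have "f a < f y \<and> f y < f b \<or> f b < f y \<and> f y < f a"
      using continuous_inj_imp_mono[OF _ _ cont inj, of y] xy True by simp
    then show ?thesis using ab True by auto
  qed (use ab True in simp)
next
  case False
  then have x: "f a < f x" "f x < f b"
    using continuous_inj_imp_mono[OF _ _ cont inj, of x] xy ab by fastforce+
  show ?thesis
  proof (cases "y = b")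
    case False
    have "continuous_on {x..b} f" "inj_on f {x..b}"
      using xy by (auto intro: continuous_on_subset[OF cont] inj_on_subset[OF inj])
    from continuous_inj_imp_mono[OF _ _ this, of y]
    show ?thesis using x xy False by auto
  qed (use x in simp)
qed

lemma limit_cycle_bifurcation:
  fixes ya yb r0 \<sigma> \<eta>0 :: real
  assumes uniq: "\<forall>\<^sub>F \<epsilon> in nhds 0. unique_pieces (V \<epsilon>)"
    and tr: "\<And>y. ya < y \<Longrightarrow> y < yb \<Longrightarrow> transit V 1 y 1 y (B y) 0 (S y) P c T"
    and r0: "0 \<le> ya" "ya < r0" "r0 < yb"
    and fin: "finite (B r0)" and B1: "\<And>b. b \<in> B r0 \<Longrightarrow> fst b = 1 \<Longrightarrow> snd b < 0"
    and cross: "\<And>b. b \<in> insert (1, r0) (B r0) \<Longrightarrow>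
      \<forall>\<^sub>F e in nhds (0, snd b). crossing_point (V (fst e)) (fst b, snd e)"
    and sign: "\<eta>0 > 0" "\<And>y. r0 - \<eta>0 < y \<Longrightarrow> y < r0 \<Longrightarrow> \<sigma> * S y < 0"
      "\<And>y. r0 < y \<Longrightarrow> y < r0 + \<eta>0 \<Longrightarrow> \<sigma> * S y > 0"
  shows "\<exists>G z. (z \<longlongrightarrow> r0) (at_right 0) \<and> hausdorff_tendsto G (c 0 r0 ` {0..T 0 r0}) (at_right 0) \<and>
     (\<forall>\<^sub>F \<epsilon> in at_right 0. limit_cycle (V \<epsilon>) (G \<epsilon>) \<and> G \<epsilon> \<inter> {p. fst p = 1 \<and> snd p > 0} = {(1, z \<epsilon>)})"
proof -
  note t = transitD[OF tr[OF r0(2,3)]]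
  have r0pos: "r0 > 0" using r0 by simp
  define R where "R = (\<lambda>b h. (fst b = 1 \<longrightarrow> snd b \<le> - h) \<and>
    (\<forall>\<epsilon> y. \<bar>\<epsilon>\<bar> < h \<longrightarrow> \<bar>y - snd b\<bar> < h \<longrightarrow> crossing_point (V \<epsilon>) (fst b, y) \<and>
      (\<exists>c' T'. det_path (V \<epsilon>) c' T' \<and> c' 0 = (fst b, y) \<and> fst (c' T') = 1 \<and> \<bar>snd (c' T') - r0\<bar> < r0)))"
  have "\<exists>h>0. \<forall>b\<in>B r0. R b h"
  proof (rule finite_uniform_radius[OF fin])
    fix b assume b: "b \<in> B r0"
    have "\<forall>\<^sub>F e in nhds (0, snd b). crossing_point (V (fst e)) (fst b, snd e) \<and>
      (\<exists>c' T'. det_path (V (fst e)) c' T' \<and> c' 0 = (fst b, snd e) \<and> fst (c' T') = 1 \<and> \<bar>snd (c' T') - r0\<bar> < r0)"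
      by (rule eventually_conj[OF cross t(8)[OF b r0pos]]) (use b in simp)
    from eventually_nhds_box[OF this] obtain h where h: "h > 0"
      "\<forall>\<epsilon> y. \<bar>\<epsilon>\<bar> < h \<longrightarrow> \<bar>y - snd b\<bar> < h \<longrightarrow> crossing_point (V \<epsilon>) (fst b, y) \<and>
      (\<exists>c' T'. det_path (V \<epsilon>) c' T' \<and> c' 0 = (fst b, y) \<and> fst (c' T') = 1 \<and> \<bar>snd (c' T') - r0\<bar> < r0)"
      unfolding fst_conv snd_conv by (elim exE conjE)
    show "\<exists>h>0. R b h"
    proof (cases "fst b = 1")
      case True
      then have "R b (min h (- snd b))" using h(2) unfolding R_def by simp
      then show ?thesis using h(1) B1[OF b True] by (intro exI[of _ "min h (- snd b)"]) simp
    next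
      case False
      then have "R b h" using h(2) unfolding R_def by simp
      then show ?thesis using h(1) by blast
    qed
  next
    fix b h h' assume "R b h" "0 < h'" "h' \<le> h"
    then show "R b h'" unfolding R_def by auto
  qed
  then obtain \<eta> where \<eta>: "\<eta> > 0" "\<forall>b\<in>B r0. R b \<eta>" by blast
  have near: "\<forall>\<^sub>F e in nhds (0, r0). \<bar>P (fst e) (snd e) - r0\<bar> < r0"
    using tendstoD[OF t(1) r0pos] by (simp add: dist_real_def)
  have cr: "\<forall>\<^sub>F e in nhds (0, r0). crossing_point (V (fst e)) (1, snd e)"
    using cross[of "(1, r0)"] by simp
  from eventually_nhds_box[OF eventually_conj[OF near eventually_conj[OF t(2) eventually_conj[OF t(3)
        eventually_conj[OF t(4)[OF \<eta>(1)] cr]]]]]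
  obtain h1 where h1: "h1 > 0" and box: "\<forall>\<epsilon> y. \<bar>\<epsilon>\<bar> < h1 \<longrightarrow> \<bar>y - r0\<bar> < h1 \<longrightarrow>
      \<bar>P \<epsilon> y - r0\<bar> < r0 \<and> real_analytic_at (P \<epsilon>) y \<and>
      (det_path (V \<epsilon>) (c \<epsilon> y) (T \<epsilon> y) \<and> c \<epsilon> y 0 = (1, y) \<and> c \<epsilon> y (T \<epsilon> y) = (1, P \<epsilon> y)) \<and>
      (\<forall>u. 0 < u \<longrightarrow> u < T \<epsilon> y \<longrightarrow> c \<epsilon> y u \<in> switching_lines \<longrightarrow>
        (\<exists>b\<in>B r0. fst (c \<epsilon> y u) = fst b \<and> \<bar>snd (c \<epsilon> y u) - snd b\<bar> < \<eta>)) \<and>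
      crossing_point (V \<epsilon>) (1, y)"
    unfolding fst_conv snd_conv by (elim exE conjE)
  from eventually_nhds_box2[OF t(6)] obtain h2 where h2: "h2 > 0" and
    inj: "\<forall>\<epsilon> y y'. \<bar>\<epsilon>\<bar> < h2 \<longrightarrow> \<bar>y - r0\<bar> < h2 \<longrightarrow> \<bar>y' - r0\<bar> < h2 \<longrightarrow> P \<epsilon> y = P \<epsilon> y' \<longrightarrow> y = y'"
    unfolding fst_conv snd_conv by (elim exE conjE)
  define H where "H = {h1, h2, \<eta>, \<eta>0, r0 - ya, yb - r0, r0}"
  have Hpos: "x > 0" if "x \<in> H" for x
    using that h1 h2 \<eta>(1) sign(1) r0(2,3) r0pos unfolding H_def by (elim insertE) simp_all
  have Hfin: "finite H" "H \<noteq> {}" unfolding H_def by blast+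
  define h where "h = Min H"
  have h0: "h > 0" unfolding h_def by (rule Hpos[OF Min_in[OF Hfin]])
  have le: "h \<le> x" if "x \<in> {h1, h2, \<eta>, \<eta>0, r0 - ya, yb - r0, r0}" for x
    unfolding h_def by (rule Min_le[OF Hfin(1)]) (unfold H_def, rule that)
  have h: "h > 0" "h \<le> h1" "h \<le> h2" "h \<le> \<eta>" "h \<le> \<eta>0" "h \<le> r0 - ya" "h \<le> yb - r0" "h \<le> r0"
    by (rule h0 le insertI1 insertI2)+
  define a where "a = r0 - h / 2"
  define b where "b = r0 + h / 2"
  have ab: "0 < a" "a < r0" "r0 < b" "ya < a" "b < yb" using h by (auto simp: a_def b_def)
  have inbox: "\<bar>y - r0\<bar> < h" if "a \<le> y" "y \<le> b" for y using that h(1) by (auto simp: a_def b_def)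
  have line: "filterlim (\<lambda>\<epsilon>. (\<epsilon>, y)) (at_right 0 \<times>\<^sub>F nhds y) (at_right (0::real))" for y :: real
    by (intro filterlim_Pair filterlim_ident tendsto_const)
  have line': "filterlim (\<lambda>\<epsilon>. (\<epsilon>, y)) (nhds (0, y)) (at_right (0::real))" for y :: real
    by (intro tendsto_Pair tendsto_const) (simp add: tendsto_ident_at)
  have Plim: "((\<lambda>\<epsilon>. P \<epsilon> y) \<longlongrightarrow> y) (at_right 0)" if "ya < y" "y < yb" for y
    using filterlim_compose[OF transitD(1)[OF tr[OF that]] line'] by simp
  have Dsign: "\<forall>\<^sub>F \<epsilon> in at_right 0. \<sigma>' * (P \<epsilon> y - y) > 0" if y: "ya < y" "y < yb" and s: "\<sigma>' * S y > 0" for y \<sigma>'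
  proof -
    have y0: "0 < y" using y r0 by simp
    have "((\<lambda>\<epsilon>. ((P \<epsilon> y)\<^sup>2 / 2 - y\<^sup>2 / 2 - 0) / \<epsilon>) \<longlongrightarrow> S y) (at_right 0)"
      using filterlim_compose[OF transitD(7)[OF tr[OF y]] line] by simp
    from order_tendstoD(1)[OF tendsto_mult_left[OF this] s]
    have "\<forall>\<^sub>F \<epsilon> in at_right 0. 0 < \<sigma>' * (((P \<epsilon> y)\<^sup>2 / 2 - y\<^sup>2 / 2 - 0) / \<epsilon>)" .
    moreover have "\<forall>\<^sub>F \<epsilon> in at_right 0. 0 < P \<epsilon> y" by (rule order_tendstoD(1)[OF Plim[OF y] y0])
    moreover have "\<forall>\<^sub>F \<epsilon> in at_right (0::real). 0 < \<epsilon>" by (simp add: eventually_at_filter)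
    ultimately show ?thesis
    proof eventually_elim
      case (elim \<epsilon>)
      have "\<sigma>' * (((P \<epsilon> y)\<^sup>2 / 2 - y\<^sup>2 / 2 - 0) / \<epsilon>) = (\<sigma>' * (P \<epsilon> y - y)) * ((P \<epsilon> y + y) / (2 * \<epsilon>))"
        using elim(3) by (simp add: field_simps power2_eq_square)
      moreover have "(P \<epsilon> y + y) / (2 * \<epsilon>) > 0" using elim y0 by simp
      ultimately show ?case using elim(1) by (simp only: zero_less_mult_iff) linarith
    qed
  qed
  have small: "\<forall>\<^sub>F \<epsilon> in at_right (0::real). 0 < \<epsilon> \<and> \<bar>\<epsilon>\<bar> < h"
    using h(1) by (auto simp: eventually_at_right_field intro!: exI[of _ h])
  have cont: "continuous_on {a..b} (P \<epsilon>)" if "\<bar>\<epsilon>\<bar> < h" for \<epsilon>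
  proof (intro continuous_at_imp_continuous_on ballI real_analytic_at_imp_isCont)
    fix y assume y: "y \<in> {a..b}"
    have "\<bar>y - r0\<bar> < h1" using inbox[of y] y h(2) by simp
    moreover have "\<bar>\<epsilon>\<bar> < h1" using that h(2) by simp
    ultimately show "real_analytic_at (P \<epsilon>) y" using box by blast
  qed
  have zero_in: "\<forall>\<^sub>F \<epsilon> in at_right 0. \<exists>y. a' < y \<and> y < b' \<and> P \<epsilon> y = y" if a': "a \<le> a'" "a' < r0" and b': "r0 < b'" "b' \<le> b" for a' b'
  proof -
    have "\<sigma> * S a' < 0" using sign(2)[of a'] a' inbox[of a'] ab h(5) by linarith
    then have "(- \<sigma>) * S a' > 0" by simp
    from Dsign[OF _ _ this] have 1: "\<forall>\<^sub>F \<epsilon> in at_right 0. - \<sigma> * (P \<epsilon> a' - a') > 0" using a' ab by simp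
    have "\<sigma> * S b' > 0" using sign(3)[of b'] b' inbox[of b'] ab h(5) by linarith
    from Dsign[OF _ _ this] have 2: "\<forall>\<^sub>F \<epsilon> in at_right 0. \<sigma> * (P \<epsilon> b' - b') > 0" using b' ab by simp
    show ?thesis using 1 2 small
    proof eventually_elim
      case (elim \<epsilon>)
      have "continuous_on {a'..b'} (\<lambda>y. \<sigma> * (P \<epsilon> y - y))"
        using elim(3) a' b' by (intro continuous_intros continuous_on_subset[OF cont]) auto
      then have "\<exists>y\<ge>a'. y \<le> b' \<and> \<sigma> * (P \<epsilon> y - y) = 0"
        using elim a' b' by (intro IVT') auto
      then obtain y where y: "a' \<le> y" "y \<le> b'" "\<sigma> * (P \<epsilon> y - y) = 0" by blast
      have "y \<noteq> a'" "y \<noteq> b'" "\<sigma> \<noteq> 0" using elim y by auto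
      then show ?case using y by (intro exI[of _ y]) auto
    qed
  qed
  define Z where "Z = (\<lambda>\<epsilon>. {y. a \<le> y \<and> y \<le> b \<and> P \<epsilon> y = y})"
  define z where "z = (\<lambda>\<epsilon>. SOME y. y \<in> Z \<epsilon> \<and> (\<forall>y'\<in>Z \<epsilon>. dist r0 y \<le> dist r0 y'))"
  have zZ: "z \<epsilon> \<in> Z \<epsilon> \<and> (\<forall>y'\<in>Z \<epsilon>. dist r0 (z \<epsilon>) \<le> dist r0 y')" if eh: "\<bar>\<epsilon>\<bar> < h" and ne: "Z \<epsilon> \<noteq> {}" for \<epsilon>
  proof -
    have "closed {y \<in> {a..b}. P \<epsilon> y - y = 0}"
      by (rule continuous_closed_preimage_constant) (intro continuous_intros cont eh closed_atLeastAtMost)+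
    moreover have "{y \<in> {a..b}. P \<epsilon> y - y = 0} = Z \<epsilon>" by (auto simp: Z_def)
    ultimately have cl: "closed (Z \<epsilon>)" by simp
    have "\<exists>y. y \<in> Z \<epsilon> \<and> (\<forall>y'\<in>Z \<epsilon>. dist r0 y \<le> dist r0 y')"
    proof (rule distance_attains_inf[OF cl ne, of r0])
      fix y assume "y \<in> Z \<epsilon>" "\<And>y'. y' \<in> Z \<epsilon> \<Longrightarrow> dist r0 y \<le> dist r0 y'"
      then show "\<exists>y. y \<in> Z \<epsilon> \<and> (\<forall>y'\<in>Z \<epsilon>. dist r0 y \<le> dist r0 y')" by (intro exI[of _ y] conjI ballI)
    qed
    then show ?thesis unfolding z_def by (rule someI_ex)
  qed
  have zlim: "(z \<longlongrightarrow> r0) (at_right 0)"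
  proof (rule tendstoI)
    fix e :: real assume "e > 0"
    define a' where "a' = max a (r0 - e / 2)"
    define b' where "b' = min b (r0 + e / 2)"
    have "\<forall>\<^sub>F \<epsilon> in at_right 0. \<exists>y. a' < y \<and> y < b' \<and> P \<epsilon> y = y"
      by (rule zero_in) (use ab \<open>e > 0\<close> in \<open>auto simp: a'_def b'_def\<close>)
    then show "\<forall>\<^sub>F \<epsilon> in at_right 0. dist (z \<epsilon>) r0 < e" using small
    proof eventually_elim
      case (elim \<epsilon>)
      from elim(1) obtain y where y: "a' < y" "y < b'" "P \<epsilon> y = y" by (elim exE conjE)
      then have yZ: "y \<in> Z \<epsilon>" by (simp add: Z_def a'_def b'_def)
      then have "dist r0 (z \<epsilon>) \<le> dist r0 y" using conjunct2[OF zZ[of \<epsilon>]] elim(2) by blast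
      also have "\<dots> < e" using y by (auto simp: dist_real_def a'_def b'_def)
      finally show ?case by (simp add: dist_commute)
    qed
  qed
  define G where "G = (\<lambda>\<epsilon>. c \<epsilon> (z \<epsilon>) ` {0..T \<epsilon> (z \<epsilon>)})"
  have "filterlim (\<lambda>\<epsilon>. (\<epsilon>, z \<epsilon>)) (nhds (0, r0)) (at_right 0)"
    by (intro tendsto_Pair zlim) (simp add: tendsto_ident_at)
  from eventually_compose_filterlim[OF t(5) this]
  have haus: "hausdorff_tendsto G (c 0 r0 ` {0..T 0 r0}) (at_right 0)"
    unfolding hausdorff_tendsto_def hausclose_def G_def by simp
  have Pab: "\<forall>\<^sub>F \<epsilon> in at_right 0. P \<epsilon> a < P \<epsilon> b"
  proof -
    have "((\<lambda>\<epsilon>. P \<epsilon> b - P \<epsilon> a) \<longlongrightarrow> b - a) (at_right 0)"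
      by (intro tendsto_diff Plim) (use ab in auto)
    then have "\<forall>\<^sub>F \<epsilon> in at_right 0. 0 < P \<epsilon> b - P \<epsilon> a" by (rule order_tendstoD) (use ab in simp)
    then show ?thesis by eventually_elim simp
  qed
  have ends: "\<forall>\<^sub>F \<epsilon> in at_right 0. P \<epsilon> a \<noteq> a \<and> P \<epsilon> b \<noteq> b"
  proof -
    have "(- \<sigma>) * S a > 0" using sign(2)[of a] ab inbox[of a] h(5) by simp
    from Dsign[OF _ _ this] have 1: "\<forall>\<^sub>F \<epsilon> in at_right 0. - \<sigma> * (P \<epsilon> a - a) > 0" using ab by simp
    have "\<sigma> * S b > 0" using sign(3)[of b] ab inbox[of b] h(5) by simp
    from Dsign[OF _ _ this] have 2: "\<forall>\<^sub>F \<epsilon> in at_right 0. \<sigma> * (P \<epsilon> b - b) > 0" using ab by simp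
    show ?thesis using 1 2 by eventually_elim auto
  qed
  have uq: "\<forall>\<^sub>F \<epsilon> in at_right 0. unique_pieces (V \<epsilon>)"
    by (rule filter_leD[OF _ uniq]) (simp add: at_within_def)
  have zex: "\<forall>\<^sub>F \<epsilon> in at_right 0. \<exists>y. a < y \<and> y < b \<and> P \<epsilon> y = y"
    by (rule zero_in) (use ab in auto)
  have "\<forall>\<^sub>F \<epsilon> in at_right 0. limit_cycle (V \<epsilon>) (G \<epsilon>) \<and> G \<epsilon> \<inter> {p. fst p = 1 \<and> snd p > 0} = {(1, z \<epsilon>)}"
    using zex Pab ends uq small
  proof eventually_elim
    case (elim \<epsilon>)
    note eh = conjunct2[OF elim(5)]
    from elim(1) obtain y where "a < y" "y < b" "P \<epsilon> y = y" by (elim exE conjE)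
    then have "y \<in> Z \<epsilon>" by (simp add: Z_def)
    then have "Z \<epsilon> \<noteq> {}" by blast
    then have "z \<epsilon> \<in> Z \<epsilon>" using zZ[OF eh] by blast
    then have zp: "a \<le> z \<epsilon>" "z \<epsilon> \<le> b" "P \<epsilon> (z \<epsilon>) = z \<epsilon>" by (auto simp: Z_def)
    have "z \<epsilon> \<noteq> a" "z \<epsilon> \<noteq> b" using elim(3) zp(3) by metis+
    then have z: "a < z \<epsilon>" "z \<epsilon> < b" using zp by auto
    have bx: "\<bar>P \<epsilon> y - r0\<bar> < r0 \<and> real_analytic_at (P \<epsilon>) y \<and>
      (det_path (V \<epsilon>) (c \<epsilon> y) (T \<epsilon> y) \<and> c \<epsilon> y 0 = (1, y) \<and> c \<epsilon> y (T \<epsilon> y) = (1, P \<epsilon> y)) \<and>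
      (\<forall>u. 0 < u \<longrightarrow> u < T \<epsilon> y \<longrightarrow> c \<epsilon> y u \<in> switching_lines \<longrightarrow>
        (\<exists>b\<in>B r0. fst (c \<epsilon> y u) = fst b \<and> \<bar>snd (c \<epsilon> y u) - snd b\<bar> < \<eta>)) \<and>
      crossing_point (V \<epsilon>) (1, y)" if "\<bar>y - r0\<bar> < h" for y
      by (rule box[THEN spec, THEN spec, THEN mp, THEN mp]; use that eh h(2) in linarith)
    have "inj_on (P \<epsilon>) {a..b}"
    proof (rule inj_onI)
      fix y y' assume "y \<in> {a..b}" "y' \<in> {a..b}" "P \<epsilon> y = P \<epsilon> y'"
      then show "y = y'" using inj[rule_format, of \<epsilon> y y'] inbox[of y] inbox[of y'] eh h(3) by simp
    qed
    note mono = increasing_of_injective[OF cont[OF eh] this elim(2)]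
    have "\<forall>\<^sub>F y in at (z \<epsilon>). P \<epsilon> y - y \<noteq> 0"
    proof (rule real_analytic_isolated_zeros)
      show "real_analytic_at (\<lambda>y. P \<epsilon> y - y) x" if "x \<in> {r0 - h<..<r0 + h}" for x
        using bx[of x] that by (intro real_analytic_intros) (auto simp: abs_less_iff)
      show "a \<in> {r0 - h<..<r0 + h}" "z \<epsilon> \<in> {r0 - h<..<r0 + h}" "P \<epsilon> a - a \<noteq> 0"
        using inbox[of a] inbox[of "z \<epsilon>"] z ab elim(3) by auto
    qed
    then obtain d where d: "d > 0" "\<forall>y. y \<noteq> z \<epsilon> \<and> dist y (z \<epsilon>) < d \<longrightarrow> P \<epsilon> y - y \<noteq> 0"
      unfolding eventually_at by (elim exE conjE) auto
    have RB: "R b \<eta>" if "b \<in> B r0" for b using \<eta>(2) that by blast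
    have e\<eta>: "\<bar>\<epsilon>\<bar> < \<eta>" using eh h(4) by simp
    note lc = limit_cycle_of_fixed_point[where V = "V \<epsilon>" and l = a and r = b and c = "c \<epsilon>" and T = "T \<epsilon>"
        and P = "P \<epsilon>" and B = "B r0" and \<eta> = \<eta> and d = d and ?y0.0 = "z \<epsilon>"]
    have "limit_cycle (V \<epsilon>) (c \<epsilon> (z \<epsilon>) ` {0..T \<epsilon> (z \<epsilon>)}) \<and>
       c \<epsilon> (z \<epsilon>) ` {0..T \<epsilon> (z \<epsilon>)} \<inter> {p. fst p = 1 \<and> snd p > 0} = {(1, z \<epsilon>)}"
    proof (intro conjI; rule lc)
      fix y assume y: "a < y" "y < b"
      then have yb: "\<bar>y - r0\<bar> < h" by (intro inbox) auto
      show "det_path (V \<epsilon>) (c \<epsilon> y) (T \<epsilon> y) \<and> c \<epsilon> y 0 = (1, y) \<and> c \<epsilon> y (T \<epsilon> y) = (1, P \<epsilon> y) \<and> 0 < P \<epsilon> y"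
        using bx[OF yb] by auto
      then show "det_path (V \<epsilon>) (c \<epsilon> y) (T \<epsilon> y) \<and> c \<epsilon> y 0 = (1, y) \<and> c \<epsilon> y (T \<epsilon> y) = (1, P \<epsilon> y) \<and> 0 < P \<epsilon> y" .
      show "crossing_point (V \<epsilon>) (1, y)" using bx[OF yb] by simp
      then show "crossing_point (V \<epsilon>) (1, y)" .
      show "\<exists>b\<in>B r0. fst (c \<epsilon> y u) = fst b \<and> \<bar>snd (c \<epsilon> y u) - snd b\<bar> < \<eta>"
        if "0 < u" "u < T \<epsilon> y" "c \<epsilon> y u \<in> switching_lines" for u using bx[OF yb] that by simp
      then show "\<exists>b\<in>B r0. fst (c \<epsilon> y u) = fst b \<and> \<bar>snd (c \<epsilon> y u) - snd b\<bar> < \<eta>"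
        if "0 < u" "u < T \<epsilon> y" "c \<epsilon> y u \<in> switching_lines" for u using that by simp
      assume "y \<noteq> z \<epsilon>" "\<bar>y - z \<epsilon>\<bar> < d"
      then show "P \<epsilon> y \<noteq> y" using d(2) by (simp add: dist_real_def)
      then show "P \<epsilon> y \<noteq> y" .
    next
      fix y y' assume "a < y" "y < y'" "y' < b"
      then show "P \<epsilon> y < P \<epsilon> y'" by (intro mono) auto
      then show "P \<epsilon> y < P \<epsilon> y'" .
    next
      fix bb assume bb: "bb \<in> B r0"
      show "fst bb = 1 \<Longrightarrow> snd bb \<le> - \<eta>" using RB[OF bb] by (simp add: R_def)
      then show "fst bb = 1 \<Longrightarrow> snd bb \<le> - \<eta>" .
      fix y assume "\<bar>y - snd bb\<bar> < \<eta>"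
      then have *: "crossing_point (V \<epsilon>) (fst bb, y) \<and> (\<exists>c' T'. det_path (V \<epsilon>) c' T' \<and> c' 0 = (fst bb, y) \<and> fst (c' T') = 1 \<and>
          \<bar>snd (c' T') - r0\<bar> < r0)" using RB[OF bb] e\<eta> by (simp add: R_def)
      then show "crossing_point (V \<epsilon>) (fst bb, y)" by simp
      then show "crossing_point (V \<epsilon>) (fst bb, y)" .
      from * obtain c' T' where "det_path (V \<epsilon>) c' T'" "c' 0 = (fst bb, y)" "fst (c' T') = 1" "\<bar>snd (c' T') - r0\<bar> < r0"
        by blast
      then show "\<exists>c' T'. det_path (V \<epsilon>) c' T' \<and> c' 0 = (fst bb, y) \<and> fst (c' T') = 1 \<and> 0 < snd (c' T')"
        by (intro exI[of _ c'] exI[of _ T']) auto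
      then show "\<exists>c' T'. det_path (V \<epsilon>) c' T' \<and> c' 0 = (fst bb, y) \<and> fst (c' T') = 1 \<and> 0 < snd (c' T')" .
    qed (use elim(4) z zp ab d in auto)
    then show ?case by (simp add: G_def)
  qed
  then show ?thesis using zlim haus by blast
qed


section \<open>Choice of the Melnikov function\<close>

lemma taylor_second:
  fixes f f1 :: "real \<Rightarrow> real"
  assumes "\<forall>\<^sub>F t in nhds 0. (f has_real_derivative f1 t) (at t)" "(f1 has_real_derivative f2) (at 0)"
    and "f 0 = 0" "f1 0 = 0"
  shows "((\<lambda>t. f t / t\<^sup>2) \<longlongrightarrow> f2 / 2) (at 0)"
proof (rule lhopital[where f' = f1 and g' = "\<lambda>t. 2 * t"])
  have "isCont f 0" using eventually_nhds_x_imp_x[OF assms(1)] by (rule DERIV_isCont)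
  then show "(f \<longlongrightarrow> 0) (at 0)" using assms(3) by (simp add: isCont_def)
  show "((\<lambda>t. t\<^sup>2) \<longlongrightarrow> (0::real)) (at 0)" by (auto intro!: tendsto_eq_intros)
  show "\<forall>\<^sub>F t in at 0. t\<^sup>2 \<noteq> (0::real)" "\<forall>\<^sub>F t in at 0. 2 * t \<noteq> (0::real)"
    by (auto simp: eventually_at_filter)
  show "\<forall>\<^sub>F t in at 0. (f has_real_derivative f1 t) (at t)"
    using assms(1) by (simp add: eventually_nhds_conv_at)
  show "\<forall>\<^sub>F t in at 0. ((\<lambda>t. t\<^sup>2) has_real_derivative 2 * t) (at t)"
    by (intro always_eventually allI) (auto intro!: derivative_eq_intros)
  have "((\<lambda>t. f1 t / t) \<longlongrightarrow> f2) (at 0)"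
    using assms(2,4) by (simp add: DERIV_def)
  from tendsto_divide[OF this tendsto_const[of 2]]
  show "((\<lambda>t. f1 t / (2 * t)) \<longlongrightarrow> f2 / 2) (at 0)" by (simp add: field_simps)
qed

lemma taylor_third:
  fixes f f1 f2 :: "real \<Rightarrow> real"
  assumes "\<forall>\<^sub>F t in nhds 0. (f has_real_derivative f1 t) (at t)"
    and "\<forall>\<^sub>F t in nhds 0. (f1 has_real_derivative f2 t) (at t)" "(f2 has_real_derivative f3) (at 0)"
    and "f 0 = 0" "f1 0 = 0" "f2 0 = 0"
  shows "((\<lambda>t. f t / t ^ 3) \<longlongrightarrow> f3 / 6) (at 0)"
proof (rule lhopital[where f' = f1 and g' = "\<lambda>t. 3 * t\<^sup>2"])
  have "isCont f 0" using eventually_nhds_x_imp_x[OF assms(1)] by (rule DERIV_isCont)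
  then show "(f \<longlongrightarrow> 0) (at 0)" using assms by (simp add: isCont_def)
  show "((\<lambda>t. t ^ 3) \<longlongrightarrow> (0::real)) (at 0)" by (auto intro!: tendsto_eq_intros)
  show "\<forall>\<^sub>F t in at 0. t ^ 3 \<noteq> (0::real)" "\<forall>\<^sub>F t in at 0. 3 * t\<^sup>2 \<noteq> (0::real)"
    by (auto simp: eventually_at_filter)
  show "\<forall>\<^sub>F t in at 0. (f has_real_derivative f1 t) (at t)"
    using assms(1) by (simp add: eventually_nhds_conv_at)
  show "\<forall>\<^sub>F t in at 0. ((\<lambda>t. t ^ 3) has_real_derivative 3 * t\<^sup>2) (at t)"
    by (intro always_eventually allI) (auto intro!: derivative_eq_intros)
  have "((\<lambda>t. f1 t / t\<^sup>2) \<longlongrightarrow> f3 / 2) (at 0)"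
    by (rule taylor_second[OF assms(2,3,5,6)])
  from tendsto_divide[OF this tendsto_const[of 3]]
  show "((\<lambda>t. f1 t / (3 * t\<^sup>2)) \<longlongrightarrow> f3 / 6) (at 0)" by (simp add: field_simps)
qed

definition sadF :: "real \<Rightarrow> real \<Rightarrow> real" where
  "sadF w r = (w\<^sup>2 - r\<^sup>2) * ln ((w + r) / (w - r))"

definition cenG :: "real \<Rightarrow> real \<Rightarrow> real" where
  "cenG k r = (r\<^sup>2 + k\<^sup>2) * (pi + 2 * arctan (k / r))"

definition capC :: "real \<Rightarrow> real \<Rightarrow> real" where
  "capC k v = (v\<^sup>2 + k\<^sup>2) * (2 * arctan (v / k))"

lemma sadF_derivatives:
  assumes "0 < w" "\<bar>r\<bar> < w"
  shows "(sadF w has_real_derivative 2 * w - 2 * r * ln ((w + r) / (w - r))) (at r)"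
    and "((\<lambda>r. 2 * w - 2 * r * ln ((w + r) / (w - r))) has_real_derivative
          - (2 * ln ((w + r) / (w - r)) + 4 * w * r / (w\<^sup>2 - r\<^sup>2))) (at r)"
    and "((\<lambda>r. - (2 * ln ((w + r) / (w - r)) + 4 * w * r / (w\<^sup>2 - r\<^sup>2))) has_real_derivative
          - (8 * w ^ 3 / (w\<^sup>2 - r\<^sup>2)\<^sup>2)) (at r)"
proof -
  have p: "w + r > 0" "w - r > 0" using assms by auto
  have f: "w\<^sup>2 - r\<^sup>2 = (w + r) * (w - r)" by (simp add: power2_eq_square algebra_simps)
  have L: "((\<lambda>r. ln ((w + r) / (w - r))) has_real_derivative 2 * w / (w\<^sup>2 - r\<^sup>2)) (at r)"
  proof (rule has_field_derivative_transform_within_open[of "\<lambda>r. ln (w + r) - ln (w - r)" _ _ "{-w<..<w}"])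
    have "1 / (w + r) + 1 / (w - r) = 2 * w / (w\<^sup>2 - r\<^sup>2)" unfolding f using p by (simp add: field_simps)
    moreover have "((\<lambda>r. ln (w + r) - ln (w - r)) has_real_derivative 1 / (w + r) + 1 / (w - r)) (at r)"
      using p by (auto intro!: derivative_eq_intros)
    ultimately show "((\<lambda>r. ln (w + r) - ln (w - r)) has_real_derivative 2 * w / (w\<^sup>2 - r\<^sup>2)) (at r)" by simp
  qed (use assms in \<open>auto simp: ln_div\<close>)
  have nz: "w\<^sup>2 - r\<^sup>2 \<noteq> 0" unfolding f using p by simp
  define l where "l = ln ((w + r) / (w - r))"
  have d1: "((\<lambda>r. w\<^sup>2 - r\<^sup>2) has_real_derivative - (2 * r)) (at r)"
    by (auto intro!: derivative_eq_intros)
  have "((\<lambda>r. (w\<^sup>2 - r\<^sup>2) * ln ((w + r) / (w - r))) has_real_derivative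
      - (2 * r) * l + 2 * w / (w\<^sup>2 - r\<^sup>2) * (w\<^sup>2 - r\<^sup>2)) (at r)"
    unfolding l_def by (rule DERIV_mult[OF d1 L])
  moreover have "2 * w / (w\<^sup>2 - r\<^sup>2) * (w\<^sup>2 - r\<^sup>2) = 2 * w" using nz by simp
  ultimately show "(sadF w has_real_derivative 2 * w - 2 * r * ln ((w + r) / (w - r))) (at r)"
    unfolding sadF_def[abs_def] l_def by (simp add: algebra_simps)
  have "((\<lambda>r. 2 * w - 2 * r * ln ((w + r) / (w - r))) has_real_derivative
          0 - (2 * l + 2 * w / (w\<^sup>2 - r\<^sup>2) * (2 * r))) (at r)"
    unfolding l_def by (rule DERIV_diff[OF DERIV_const DERIV_mult[OF _ L]]) (auto intro!: derivative_eq_intros)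
  then show "((\<lambda>r. 2 * w - 2 * r * ln ((w + r) / (w - r))) has_real_derivative
          - (2 * ln ((w + r) / (w - r)) + 4 * w * r / (w\<^sup>2 - r\<^sup>2))) (at r)"
    unfolding l_def by (simp add: algebra_simps)
  have eq: "- (2 * (2 * w / d) + (4 * w * d - 4 * w * r * (- (2 * r))) / (d * d)) = - (8 * w ^ 3 / d\<^sup>2)"
    if "d \<noteq> 0" "w\<^sup>2 - r\<^sup>2 = d" for d
  proof -
    have "w ^ 3 = w * (d + r * r)" using that(2) by (simp add: power2_eq_square power3_eq_cube)
    then show ?thesis using that(1) by (simp add: field_simps power2_eq_square)
  qed
  have "((\<lambda>r. - (2 * ln ((w + r) / (w - r)) + 4 * w * r / (w\<^sup>2 - r\<^sup>2))) has_real_derivative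
      - (2 * (2 * w / (w\<^sup>2 - r\<^sup>2)) + (4 * w * (w\<^sup>2 - r\<^sup>2) - 4 * w * r * (- (2 * r))) / ((w\<^sup>2 - r\<^sup>2) * (w\<^sup>2 - r\<^sup>2)))) (at r)"
    by (rule DERIV_minus[OF DERIV_add[OF DERIV_cmult[OF L] DERIV_divide[OF _ d1 nz]]])
      (auto intro!: derivative_eq_intros)
  then show "((\<lambda>r. - (2 * ln ((w + r) / (w - r)) + 4 * w * r / (w\<^sup>2 - r\<^sup>2))) has_real_derivative
          - (8 * w ^ 3 / (w\<^sup>2 - r\<^sup>2)\<^sup>2)) (at r)"
    unfolding eq[OF nz refl] .
qed

lemma cenG_derivatives:
  assumes "0 < r"
  shows "(cenG k has_real_derivative 2 * r * (pi + 2 * arctan (k / r)) - 2 * k) (at r)"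
    and "((\<lambda>r. 2 * r * (pi + 2 * arctan (k / r)) - 2 * k) has_real_derivative
          2 * (pi + 2 * arctan (k / r)) - 4 * k * r / (r\<^sup>2 + k\<^sup>2)) (at r)"
    and "((\<lambda>r. 2 * (pi + 2 * arctan (k / r)) - 4 * k * r / (r\<^sup>2 + k\<^sup>2)) has_real_derivative
          - (8 * k ^ 3 / (r\<^sup>2 + k\<^sup>2)\<^sup>2)) (at r)"
proof -
  have nz: "r\<^sup>2 + k\<^sup>2 \<noteq> 0" using assms by (metis add_pos_nonneg less_irrefl zero_le_power2 zero_less_power)
  have A: "((\<lambda>r. arctan (k / r)) has_real_derivative - (k / (r\<^sup>2 + k\<^sup>2))) (at r)"
  proof -
    have "((\<lambda>r. k / r) has_real_derivative - (k / r\<^sup>2)) (at r)"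
      using assms by (auto intro!: derivative_eq_intros simp: power2_eq_square)
    from DERIV_arctan[THEN DERIV_chain2, OF this]
    have "((\<lambda>r. arctan (k / r)) has_real_derivative inverse (1 + (k / r)\<^sup>2) * - (k / r\<^sup>2)) (at r)" .
    moreover have "1 + (k / r)\<^sup>2 = (r\<^sup>2 + k\<^sup>2) / r\<^sup>2" using assms by (simp add: field_simps power2_eq_square)
    ultimately show ?thesis using assms nz by (simp add: field_simps)
  qed
  have B: "((\<lambda>r. pi + 2 * arctan (k / r)) has_real_derivative - (2 * k / (r\<^sup>2 + k\<^sup>2))) (at r)"
    using DERIV_add[OF DERIV_const DERIV_cmult[OF A]] by simp
  have d1: "((\<lambda>r. r\<^sup>2 + k\<^sup>2) has_real_derivative 2 * r) (at r)"
    by (auto intro!: derivative_eq_intros)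
  have "((\<lambda>r. (r\<^sup>2 + k\<^sup>2) * (pi + 2 * arctan (k / r))) has_real_derivative
      2 * r * (pi + 2 * arctan (k / r)) + - (2 * k / (r\<^sup>2 + k\<^sup>2)) * (r\<^sup>2 + k\<^sup>2)) (at r)"
    by (rule DERIV_mult[OF d1 B])
  moreover have "- (2 * k / (r\<^sup>2 + k\<^sup>2)) * (r\<^sup>2 + k\<^sup>2) = - (2 * k)" using nz by simp
  ultimately show "(cenG k has_real_derivative 2 * r * (pi + 2 * arctan (k / r)) - 2 * k) (at r)"
    unfolding cenG_def[abs_def] by simp
  have "((\<lambda>r. 2 * r * (pi + 2 * arctan (k / r)) - 2 * k) has_real_derivative
      2 * (pi + 2 * arctan (k / r)) + - (2 * k / (r\<^sup>2 + k\<^sup>2)) * (2 * r) - 0) (at r)"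
    by (rule DERIV_diff[OF DERIV_mult[OF _ B] DERIV_const]) (auto intro!: derivative_eq_intros)
  then show "((\<lambda>r. 2 * r * (pi + 2 * arctan (k / r)) - 2 * k) has_real_derivative
          2 * (pi + 2 * arctan (k / r)) - 4 * k * r / (r\<^sup>2 + k\<^sup>2)) (at r)"
    by (simp add: algebra_simps)
  have eq: "2 * - (2 * k / d) - (4 * k * d - 4 * k * r * (2 * r)) / (d * d) = - (8 * k ^ 3 / d\<^sup>2)"
    if "d \<noteq> 0" "r\<^sup>2 + k\<^sup>2 = d" for d
  proof -
    have k3: "k ^ 3 = k * (d - r * r)" unfolding that(2)[symmetric] by (simp add: power2_eq_square power3_eq_cube)
    show ?thesis unfolding k3 using that(1) by (simp add: field_simps power2_eq_square)
  qed
  have "((\<lambda>r. 2 * (pi + 2 * arctan (k / r)) - 4 * k * r / (r\<^sup>2 + k\<^sup>2)) has_real_derivative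
      2 * - (2 * k / (r\<^sup>2 + k\<^sup>2)) - (4 * k * (r\<^sup>2 + k\<^sup>2) - 4 * k * r * (2 * r)) / ((r\<^sup>2 + k\<^sup>2) * (r\<^sup>2 + k\<^sup>2))) (at r)"
    by (rule DERIV_diff[OF DERIV_cmult[OF B] DERIV_divide[OF _ d1 nz]]) (auto intro!: derivative_eq_intros)
  then show "((\<lambda>r. 2 * (pi + 2 * arctan (k / r)) - 4 * k * r / (r\<^sup>2 + k\<^sup>2)) has_real_derivative
          - (8 * k ^ 3 / (r\<^sup>2 + k\<^sup>2)\<^sup>2)) (at r)"
    unfolding eq[OF nz refl] .
qed

lemma sadF_expansion:
  assumes "w > 0"
  shows "((\<lambda>v. (2 * w * v - sadF w v) / v ^ 3) \<longlongrightarrow> 4 / (3 * w)) (at_right 0)"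
    and "((\<lambda>v. (2 * w * v - sadF w v - 4 / (3 * w) * v ^ 3) / v ^ 5) \<longlongrightarrow> 4 / (15 * w ^ 3)) (at_right 0)"
proof -
  have lim: "filterlim (\<lambda>v. v / w) (at_right 0) (at_right 0)" using assms by real_asymp
  have F: "sadF w v = w\<^sup>2 * ((1 - (v / w)\<^sup>2) * ln ((1 + v / w) / (1 - v / w)))" for v
  proof -
    have "(1 + v / w) / (1 - v / w) = (w + v) / (w - v)"
    proof -
      have "1 + v / w = (w + v) / w" "1 - v / w = (w - v) / w" using assms by (auto simp: field_simps)
      then show ?thesis using assms by simp
    qed
    moreover have "w\<^sup>2 - v\<^sup>2 = w\<^sup>2 * (1 - (v / w)\<^sup>2)" using assms by (simp add: field_simps power2_eq_square)
    ultimately show ?thesis unfolding sadF_def by (simp only: mult.assoc)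
  qed
  have "((\<lambda>x :: real. (2 * x - (1 - x\<^sup>2) * ln ((1 + x) / (1 - x))) / x ^ 3) \<longlongrightarrow> 4 / 3) (at_right 0)"
    by real_asymp
  from tendsto_mult[OF filterlim_compose[OF this lim] tendsto_const[of "1 / w"]]
  have 1: "((\<lambda>v. (2 * (v / w) - (1 - (v / w)\<^sup>2) * ln ((1 + v / w) / (1 - v / w))) / (v / w) ^ 3 * (1 / w)) \<longlongrightarrow> 4 / 3 * (1 / w)) (at_right 0)" .
  have "((\<lambda>x :: real. (2 * x - (1 - x\<^sup>2) * ln ((1 + x) / (1 - x)) - 4 / 3 * x ^ 3) / x ^ 5) \<longlongrightarrow> 4 / 15) (at_right 0)"
    by real_asymp
  from tendsto_mult[OF filterlim_compose[OF this lim] tendsto_const[of "1 / w ^ 3"]]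
  have 2: "((\<lambda>v. (2 * (v / w) - (1 - (v / w)\<^sup>2) * ln ((1 + v / w) / (1 - v / w)) - 4 / 3 * (v / w) ^ 3) / (v / w) ^ 5 * (1 / w ^ 3)) \<longlongrightarrow> 4 / 15 * (1 / w ^ 3)) (at_right 0)" .
  have pos: "\<forall>\<^sub>F v in at_right (0::real). v > 0" by (simp add: eventually_at_filter)
  show "((\<lambda>v. (2 * w * v - sadF w v) / v ^ 3) \<longlongrightarrow> 4 / (3 * w)) (at_right 0)"
  proof (rule Lim_transform_eventually)
    show "\<forall>\<^sub>F v in at_right 0. (2 * (v / w) - (1 - (v / w)\<^sup>2) * ln ((1 + v / w) / (1 - v / w))) / (v / w) ^ 3 * (1 / w) =
        (2 * w * v - sadF w v) / v ^ 3"
      using pos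
    proof eventually_elim
      case (elim v)
      define L where "L = (1 - (v / w)\<^sup>2) * ln ((1 + v / w) / (1 - v / w))"
      show ?case unfolding F L_def[symmetric]
        using elim assms by (simp add: field_simps power2_eq_square power3_eq_cube)
    qed
  qed (use 1 in simp)
  show "((\<lambda>v. (2 * w * v - sadF w v - 4 / (3 * w) * v ^ 3) / v ^ 5) \<longlongrightarrow> 4 / (15 * w ^ 3)) (at_right 0)"
  proof (rule Lim_transform_eventually)
    show "\<forall>\<^sub>F v in at_right 0. (2 * (v / w) - (1 - (v / w)\<^sup>2) * ln ((1 + v / w) / (1 - v / w)) - 4 / 3 * (v / w) ^ 3) / (v / w) ^ 5 * (1 / w ^ 3) =
        (2 * w * v - sadF w v - 4 / (3 * w) * v ^ 3) / v ^ 5"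
      using pos
    proof eventually_elim
      case (elim v)
      define L where "L = (1 - (v / w)\<^sup>2) * ln ((1 + v / w) / (1 - v / w))"
      show ?case unfolding F L_def[symmetric]
        using elim assms by (simp add: field_simps eval_nat_numeral)
    qed
  qed (use 2 in simp)
qed

lemma capC_expansion:
  assumes "k > 0"
  shows "((\<lambda>v. (capC k v - 2 * k * v - 4 / (3 * k) * v ^ 3) / v ^ 5) \<longlongrightarrow> - 4 / (15 * k ^ 3)) (at_right 0)"
proof -
  have lim: "filterlim (\<lambda>v. v / k) (at_right 0) (at_right 0)" using assms by real_asymp
  have F: "capC k v = k\<^sup>2 * (((v / k)\<^sup>2 + 1) * (2 * arctan (v / k)))" for v
  proof -
    have "v\<^sup>2 + k\<^sup>2 = k\<^sup>2 * ((v / k)\<^sup>2 + 1)" using assms by (simp add: field_simps power2_eq_square)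
    then show ?thesis unfolding capC_def by (simp only: mult.assoc)
  qed
  have "((\<lambda>x :: real. ((x\<^sup>2 + 1) * (2 * arctan x) - 2 * x - 4 / 3 * x ^ 3) / x ^ 5) \<longlongrightarrow> - 4 / 15) (at_right 0)"
    by real_asymp
  from tendsto_mult[OF filterlim_compose[OF this lim] tendsto_const[of "1 / k ^ 3"]]
  have 2: "((\<lambda>v. (((v / k)\<^sup>2 + 1) * (2 * arctan (v / k)) - 2 * (v / k) - 4 / 3 * (v / k) ^ 3) / (v / k) ^ 5 * (1 / k ^ 3)) \<longlongrightarrow> - 4 / 15 * (1 / k ^ 3)) (at_right 0)" .
  have pos: "\<forall>\<^sub>F v in at_right (0::real). v > 0" by (simp add: eventually_at_filter)
  show ?thesis
  proof (rule Lim_transform_eventually)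
    show "\<forall>\<^sub>F v in at_right 0. (((v / k)\<^sup>2 + 1) * (2 * arctan (v / k)) - 2 * (v / k) - 4 / 3 * (v / k) ^ 3) / (v / k) ^ 5 * (1 / k ^ 3) =
        (capC k v - 2 * k * v - 4 / (3 * k) * v ^ 3) / v ^ 5"
      using pos
    proof eventually_elim
      case (elim v)
      define L where "L = ((v / k)\<^sup>2 + 1) * (2 * arctan (v / k))"
      show ?case unfolding F L_def[symmetric]
        using elim assms by (simp add: field_simps eval_nat_numeral)
    qed
  qed (use 2 in simp)
qed


lemma eventually_sign_pos:
  assumes "((\<lambda>\<eta>. f \<eta> / \<eta> ^ n) \<longlongrightarrow> l) (at_right (0::real))" "(0::real) < l"
  shows "\<forall>\<^sub>F \<eta> in at_right 0. f \<eta> > 0"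
proof -
  have "\<forall>\<^sub>F \<eta> in at_right (0::real). \<eta> > 0" by (simp add: eventually_at_filter)
  with order_tendstoD(1)[OF assms] show ?thesis
    by eventually_elim (simp add: zero_less_divide_iff)
qed

lemma eventually_sign_neg:
  assumes "((\<lambda>\<eta>. f \<eta> / \<eta> ^ n) \<longlongrightarrow> l) (at_right (0::real))" "l < (0::real)"
  shows "\<forall>\<^sub>F \<eta> in at_right 0. f \<eta> < 0"
proof -
  have "\<forall>\<^sub>F \<eta> in at_right (0::real). \<eta> > 0" by (simp add: eventually_at_filter)
  with order_tendstoD(2)[OF assms] show ?thesis
    by eventually_elim (simp add: divide_less_0_iff)
qed

text \<open>The functions spanning the Melnikov function near the orbit of radius \<open>R\<close> that touches the
  line \<open>x = -1\<close>: \<open>M2\<close> for the orbits through two zones, \<open>M3\<close> for those through three zones.\<close>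

locale melnikov_span =
  fixes R w k w' \<kappa> :: real
  assumes R: "0 < R" "R < w" and w': "0 < w'" and \<kappa>: "0 < \<kappa>"
begin

definition M2 :: "real \<Rightarrow> real \<Rightarrow> real \<Rightarrow> real \<Rightarrow> real" where
  "M2 c1 c2 c3 r = c1 * r + c2 * sadF w r + c3 * cenG k r"

definition M3 :: "real \<Rightarrow> real \<Rightarrow> real \<Rightarrow> real \<Rightarrow> real \<Rightarrow> real \<Rightarrow> real" where
  "M3 c1 c2 c3 c4 c5 r = M2 c1 c2 c3 r +
     (c4 * sqrt (r\<^sup>2 - R\<^sup>2) + c5 * sadF w' (sqrt (r\<^sup>2 - R\<^sup>2)) - c3 * capC \<kappa> (sqrt (r\<^sup>2 - R\<^sup>2)))"

definition F1 :: "real \<Rightarrow> real" where "F1 r = 2 * w - 2 * r * ln ((w + r) / (w - r))"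
definition F2 :: "real \<Rightarrow> real" where "F2 r = - (2 * ln ((w + r) / (w - r)) + 4 * w * r / (w\<^sup>2 - r\<^sup>2))"
definition F3 :: "real \<Rightarrow> real" where "F3 r = - (8 * w ^ 3 / (w\<^sup>2 - r\<^sup>2)\<^sup>2)"
definition G1 :: "real \<Rightarrow> real" where "G1 r = 2 * r * (pi + 2 * arctan (k / r)) - 2 * k"
definition G2 :: "real \<Rightarrow> real" where "G2 r = 2 * (pi + 2 * arctan (k / r)) - 4 * k * r / (r\<^sup>2 + k\<^sup>2)"
definition G3 :: "real \<Rightarrow> real" where "G3 r = - (8 * k ^ 3 / (r\<^sup>2 + k\<^sup>2)\<^sup>2)"

lemma derivs:
  assumes "0 < r" "r < w"
  shows "(sadF w has_real_derivative F1 r) (at r)" "(F1 has_real_derivative F2 r) (at r)"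
    "(F2 has_real_derivative F3 r) (at r)" "(cenG k has_real_derivative G1 r) (at r)"
    "(G1 has_real_derivative G2 r) (at r)" "(G2 has_real_derivative G3 r) (at r)"
proof -
  have a: "0 < w" "\<bar>r\<bar> < w" using assms by auto
  note s = sadF_derivatives[OF a] and c = cenG_derivatives[OF assms(1), of k]
  show "(sadF w has_real_derivative F1 r) (at r)" using s(1) by (simp add: F1_def)
  show "(F1 has_real_derivative F2 r) (at r)" using s(2) unfolding F1_def[abs_def] F2_def .
  show "(F2 has_real_derivative F3 r) (at r)" using s(3) unfolding F2_def[abs_def] F3_def .
  show "(cenG k has_real_derivative G1 r) (at r)" using c(1) by (simp add: G1_def)
  show "(G1 has_real_derivative G2 r) (at r)" using c(2) unfolding G1_def[abs_def] G2_def .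
  show "(G2 has_real_derivative G3 r) (at r)" using c(3) unfolding G2_def[abs_def] G3_def .
qed

lemma F2_neg: "0 < r \<Longrightarrow> r < w \<Longrightarrow> F2 r < 0"
proof -
  assume r: "0 < r" "r < w"
  have "ln ((w + r) / (w - r)) > 0" using r by simp
  moreover have "4 * w * r / (w\<^sup>2 - r\<^sup>2) > 0"
    using r power_strict_mono[of r w 2] by simp
  ultimately show ?thesis unfolding F2_def by linarith
qed

definition \<phi> :: real where "\<phi> = R * F1 R - sadF w R"

lemma \<phi>_neg: "\<phi> < 0"
proof -
  have der: "((\<lambda>r. r * F1 r - sadF w r) has_real_derivative r * F2 r) (at r)" if "0 < r" "r < w" for r
    using derivs(1,2)[OF that] by (auto intro!: derivative_eq_intros)
  have "R * F1 R - sadF w R < 0 * F1 0 - sadF w 0"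
  proof (rule DERIV_neg_imp_decreasing_open[OF R(1)])
    fix x assume "0 < x" "x < R"
    then show "\<exists>y. ((\<lambda>r. r * F1 r - sadF w r) has_real_derivative y) (at x) \<and> y < 0"
      using der[of x] F2_neg[of x] R by (intro exI[of _ "x * F2 x"]) (simp add: mult_pos_neg)
  next
    show "continuous_on {0..R} (\<lambda>r. r * F1 r - sadF w r)"
      unfolding F1_def sadF_def using R by (intro continuous_intros) auto
  qed
  then show ?thesis using R by (simp add: \<phi>_def sadF_def)
qed

definition \<beta> :: real where "\<beta> = - (R * G1 R - cenG k R) / \<phi>"
definition \<alpha> :: real where "\<alpha> = - (G1 R + \<beta> * F1 R)"
definition A1 :: "real \<Rightarrow> real" where "A1 r = (R * sadF w r - sadF w R * r) / \<phi>"
definition A2 :: "real \<Rightarrow> real" where "A2 r = cenG k r + \<beta> * sadF w r + \<alpha> * r"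
definition a2 :: real where "a2 = G2 R + \<beta> * F2 R"
definition a3 :: real where "a3 = G3 R + \<beta> * F3 R"
definition B3 :: "real \<Rightarrow> real" where "B3 v = 3 * w' / 4 * (2 * w' * v - sadF w' v)"
definition odd5 :: "real \<Rightarrow> real" where "odd5 v = 4 / (3 * \<kappa>) * B3 v - (capC \<kappa> v - 2 * \<kappa> * v)"
definition q :: real where "q = 4 / (15 * \<kappa> ^ 3) + 4 / (15 * \<kappa> * w'\<^sup>2)"

lemma q_pos: "q > 0" using w' \<kappa> by (simp add: q_def add_pos_pos)

lemma near_R: "\<forall>\<^sub>F t in nhds 0. 0 < R + t \<and> R + t < w"
  unfolding eventually_nhds_real using R by (intro exI[of _ "min R (w - R)"]) auto

lemma shift_deriv:
  assumes "(f has_real_derivative D) (at (R + t))"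
  shows "((\<lambda>t. f (R + t)) has_real_derivative D) (at t)"
  using assms DERIV_shift[of f D t R] by (simp add: add.commute)

lemma A2_root: "A2 R = 0" "G1 R + \<beta> * F1 R + \<alpha> = 0"
proof -
  have p: "\<phi> \<noteq> 0" using \<phi>_neg by simp
  have "\<beta> * \<phi> = cenG k R - R * G1 R" using p by (simp add: \<beta>_def)
  then show "A2 R = 0" unfolding A2_def \<alpha>_def \<phi>_def by (simp add: algebra_simps)
qed (simp add: \<alpha>_def)

lemma A1_limit: "((\<lambda>t. A1 (R + t) / t) \<longlongrightarrow> 1) (at 0)"
proof -
  have "((\<lambda>t. A1 (R + t)) has_real_derivative 1) (at 0)"
  proof (rule shift_deriv)
    have "(A1 has_real_derivative (R * F1 R - sadF w R) / \<phi>) (at R)"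
      unfolding A1_def[abs_def] using derivs(1)[OF R] \<phi>_neg by (auto intro!: derivative_eq_intros)
    then show "(A1 has_real_derivative 1) (at (R + 0))" using \<phi>_neg by (simp add: \<phi>_def)
  qed
  then show ?thesis by (simp add: DERIV_def A1_def)
qed

lemma A2_derivs:
  assumes "0 < r" "r < w"
  shows "(A2 has_real_derivative G1 r + \<beta> * F1 r + \<alpha>) (at r)"
    and "((\<lambda>r. G1 r + \<beta> * F1 r + \<alpha>) has_real_derivative G2 r + \<beta> * F2 r) (at r)"
    and "((\<lambda>r. G2 r + \<beta> * F2 r) has_real_derivative G3 r + \<beta> * F3 r) (at r)"
  unfolding A2_def[abs_def] using derivs[OF assms] by (auto intro!: derivative_eq_intros)

lemma A2_limit2: "((\<lambda>t. A2 (R + t) / t\<^sup>2) \<longlongrightarrow> a2 / 2) (at 0)"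
proof (rule taylor_second)
  show "\<forall>\<^sub>F t in nhds 0. ((\<lambda>t. A2 (R + t)) has_real_derivative G1 (R + t) + \<beta> * F1 (R + t) + \<alpha>) (at t)"
    using near_R by eventually_elim (intro shift_deriv A2_derivs, auto)
  have "((\<lambda>t. G1 (R + t) + \<beta> * F1 (R + t) + \<alpha>) has_real_derivative G2 R + \<beta> * F2 R) (at 0)"
    using shift_deriv[of "\<lambda>r. G1 r + \<beta> * F1 r + \<alpha>" _ 0] A2_derivs(2)[OF R] by simp
  then show "((\<lambda>t. G1 (R + t) + \<beta> * F1 (R + t) + \<alpha>) has_real_derivative a2) (at 0)" by (simp add: a2_def)
qed (use A2_root in simp_all)

lemma A2_limit3:
  assumes "a2 = 0" shows "((\<lambda>t. A2 (R + t) / t ^ 3) \<longlongrightarrow> a3 / 6) (at 0)"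
proof (rule taylor_third)
  show "\<forall>\<^sub>F t in nhds 0. ((\<lambda>t. A2 (R + t)) has_real_derivative G1 (R + t) + \<beta> * F1 (R + t) + \<alpha>) (at t)"
    using near_R by eventually_elim (intro shift_deriv A2_derivs, auto)
  show "\<forall>\<^sub>F t in nhds 0. ((\<lambda>t. G1 (R + t) + \<beta> * F1 (R + t) + \<alpha>) has_real_derivative
      G2 (R + t) + \<beta> * F2 (R + t)) (at t)"
    using near_R by eventually_elim
      (rule shift_deriv[of "\<lambda>r. G1 r + \<beta> * F1 r + \<alpha>"], rule A2_derivs, auto)
  have "((\<lambda>t. G2 (R + t) + \<beta> * F2 (R + t)) has_real_derivative G3 R + \<beta> * F3 R) (at 0)"
    using shift_deriv[of "\<lambda>r. G2 r + \<beta> * F2 r" _ 0] A2_derivs(3)[OF R] by simp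
  then show "((\<lambda>t. G2 (R + t) + \<beta> * F2 (R + t)) has_real_derivative a3) (at 0)" by (simp add: a3_def)
qed (use A2_root assms in \<open>simp_all add: a2_def\<close>)

lemma a3_neg:
  assumes "a2 = 0" "0 \<le> k" shows "a3 < 0"
proof -
  have "4 * k * R / (R\<^sup>2 + k\<^sup>2) \<le> 2"
  proof -
    have "0 \<le> (R - k)\<^sup>2" by simp
    then have "4 * k * R \<le> 2 * (R\<^sup>2 + k\<^sup>2)" by (simp add: power2_eq_square algebra_simps)
    moreover have "R\<^sup>2 + k\<^sup>2 > 0" using R by (simp add: add_pos_nonneg)
    ultimately show ?thesis by (simp add: divide_le_eq)
  qed
  moreover have "arctan (k / R) \<ge> 0" using assms R by simp
  moreover have "2 * (pi + 2 * y) - x > 0" if "x \<le> 2" "y \<ge> 0" for x y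
    using that pi_gt3 by simp
  ultimately have "G2 R > 0" unfolding G2_def by blast
  then have "\<beta> * F2 R < 0" using assms(1) by (simp add: a2_def)
  then have "\<beta> > 0" using F2_neg[OF R] by (simp add: mult_less_0_iff)
  moreover have "F3 R < 0"
    unfolding F3_def using R power_strict_mono[of R w 2] by simp
  ultimately have "\<beta> * F3 R < 0" by (simp add: mult_pos_neg)
  moreover have "G3 R \<le> 0" unfolding G3_def using assms(2) by simp
  ultimately show ?thesis by (simp add: a3_def)
qed

lemma B3_limit: "((\<lambda>v. B3 v / v ^ 3) \<longlongrightarrow> 1) (at_right 0)"
proof -
  have "((\<lambda>v. 3 * w' / 4 * ((2 * w' * v - sadF w' v) / v ^ 3)) \<longlongrightarrow> 3 * w' / 4 * (4 / (3 * w'))) (at_right 0)"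
    by (intro tendsto_intros sadF_expansion w')
  then show ?thesis using w' by (simp add: B3_def)
qed

lemma odd5_limit: "((\<lambda>v. odd5 v / v ^ 5) \<longlongrightarrow> q) (at_right 0)"
proof -
  have 1: "((\<lambda>v. 4 / (3 * \<kappa>) * (3 * w' / 4 * ((2 * w' * v - sadF w' v - 4 / (3 * w') * v ^ 3) / v ^ 5)) -
       (capC \<kappa> v - 2 * \<kappa> * v - 4 / (3 * \<kappa>) * v ^ 3) / v ^ 5) \<longlongrightarrow>
     4 / (3 * \<kappa>) * (3 * w' / 4 * (4 / (15 * w' ^ 3))) - - 4 / (15 * \<kappa> ^ 3)) (at_right 0)"
    by (intro tendsto_diff tendsto_mult tendsto_const sadF_expansion capC_expansion w' \<kappa>)
  have 2: "4 / (3 * \<kappa>) * (3 * w' / 4 * (4 / (15 * w' ^ 3))) - - 4 / (15 * \<kappa> ^ 3) = q"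
    using w' \<kappa> by (simp add: q_def field_simps power2_eq_square power3_eq_cube)
  have 3: "4 / (3 * \<kappa>) * (3 * w' / 4 * ((2 * w' * v - sadF w' v - 4 / (3 * w') * v ^ 3) / v ^ 5)) -
       (capC \<kappa> v - 2 * \<kappa> * v - 4 / (3 * \<kappa>) * v ^ 3) / v ^ 5 = odd5 v / v ^ 5" for v
  proof -
    have "3 * w' / 4 * (2 * w' * v - sadF w' v - 4 / (3 * w') * v ^ 3) = B3 v - v ^ 3"
      using w' by (simp add: B3_def right_diff_distrib)
    then have "4 / (3 * \<kappa>) * (3 * w' / 4 * (2 * w' * v - sadF w' v - 4 / (3 * w') * v ^ 3)) -
        (capC \<kappa> v - 2 * \<kappa> * v - 4 / (3 * \<kappa>) * v ^ 3) = odd5 v"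
      unfolding odd5_def by (simp add: right_diff_distrib)
    moreover have "x * (y * (a / d)) - b / d = (x * (y * a) - b) / d" for x y a b d :: real
      by (simp add: diff_divide_distrib)
    ultimately show ?thesis by metis
  qed
  show ?thesis using 1 unfolding 2 3 .
qed

lemma coefficients:
  obtains c1 c2 c4 c5 where
    "\<And>r. M2 c1 c2 C r = C * A2 r + \<tau>2 * A1 r + \<tau>0 * (r / R)"
    "\<And>r. M3 c1 c2 C c4 c5 r = C * A2 r + \<tau>2 * A1 r + \<tau>0 * (r / R) +
       (C * odd5 (sqrt (r\<^sup>2 - R\<^sup>2)) + \<tau>3 * B3 (sqrt (r\<^sup>2 - R\<^sup>2)) + \<tau>1 * sqrt (r\<^sup>2 - R\<^sup>2))"
proof -
  define b where "b = C * (4 / (3 * \<kappa>)) + \<tau>3"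
  define c1 where "c1 = C * \<alpha> - \<tau>2 * (sadF w R / \<phi>) + \<tau>0 / R"
  define c2 where "c2 = C * \<beta> + \<tau>2 * (R / \<phi>)"
  define c5 where "c5 = - (3 * w' / 4 * b)"
  define c4 where "c4 = 2 * \<kappa> * C + 3 * w' / 4 * (2 * w') * b + \<tau>1"
  have 1: "M2 c1 c2 C r = C * A2 r + \<tau>2 * A1 r + \<tau>0 * (r / R)" for r
    unfolding M2_def A2_def A1_def c1_def c2_def by (simp add: algebra_simps diff_divide_distrib)
  have 2: "c4 * v + c5 * sadF w' v - C * capC \<kappa> v = C * odd5 v + \<tau>3 * B3 v + \<tau>1 * v" for v
  proof -
    have "C * odd5 v + \<tau>3 * B3 v = b * B3 v - C * (capC \<kappa> v - 2 * \<kappa> * v)"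
      unfolding odd5_def b_def by (simp add: algebra_simps)
    then show ?thesis unfolding c4_def c5_def B3_def by (simp add: algebra_simps)
  qed
  show thesis
    by (rule that[of c1 c2 c4 c5]) (use 1 2 in \<open>simp_all add: M3_def\<close>)
qed

definition pt :: "real \<Rightarrow> real \<Rightarrow> real" where "pt z \<eta> = sqrt (R\<^sup>2 + (\<eta> * z)\<^sup>2)"

lemma pt_shift:
  assumes "z > 0"
  shows "((\<lambda>\<eta>. (pt z \<eta> - R) / \<eta>\<^sup>2) \<longlongrightarrow> z\<^sup>2 / (2 * R)) (at_right 0)"
    and "filterlim (\<lambda>\<eta>. pt z \<eta> - R) (at 0) (at_right 0)"
proof -
  have pos: "\<forall>\<^sub>F \<eta> in at_right (0::real). \<eta> > 0" by (simp add: eventually_at_filter)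
  have l: "(pt z \<longlongrightarrow> R) (at_right 0)"
    unfolding pt_def[abs_def] using R by (auto intro!: tendsto_eq_intros)
  have "((\<lambda>\<eta>. z\<^sup>2 / (pt z \<eta> + R)) \<longlongrightarrow> z\<^sup>2 / (R + R)) (at_right 0)"
    using R by (intro tendsto_intros l) auto
  then have "((\<lambda>\<eta>. z\<^sup>2 / (pt z \<eta> + R)) \<longlongrightarrow> z\<^sup>2 / (2 * R)) (at_right 0)" by simp
  moreover have "\<forall>\<^sub>F \<eta> in at_right 0. z\<^sup>2 / (pt z \<eta> + R) = (pt z \<eta> - R) / \<eta>\<^sup>2"
    using pos
  proof eventually_elim
    case (elim \<eta>)
    have "(pt z \<eta>)\<^sup>2 = R\<^sup>2 + (\<eta> * z)\<^sup>2" by (simp add: pt_def)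
    then have "(pt z \<eta> - R) * (pt z \<eta> + R) = \<eta>\<^sup>2 * z\<^sup>2"
      by (simp add: power2_eq_square algebra_simps)
    moreover have "pt z \<eta> + R > 0" using R by (simp add: pt_def add_nonneg_pos)
    ultimately show ?case using elim by (simp add: field_simps)
  qed
  ultimately show "((\<lambda>\<eta>. (pt z \<eta> - R) / \<eta>\<^sup>2) \<longlongrightarrow> z\<^sup>2 / (2 * R)) (at_right 0)"
    by (rule Lim_transform_eventually)
  have "((\<lambda>\<eta>. pt z \<eta> - R) \<longlongrightarrow> R - R) (at_right 0)" by (intro tendsto_intros l)
  moreover have "\<forall>\<^sub>F \<eta> in at_right 0. pt z \<eta> - R \<noteq> 0"
    using pos
  proof eventually_elim
    case (elim \<eta>)
    have "R\<^sup>2 < R\<^sup>2 + (\<eta> * z)\<^sup>2" using elim assms by simp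
    then have "R < pt z \<eta>" unfolding pt_def by (rule real_less_rsqrt)
    then show ?case by simp
  qed
  ultimately show "filterlim (\<lambda>\<eta>. pt z \<eta> - R) (at 0) (at_right 0)" by (simp add: filterlim_at)
qed

lemma small_shift:
  assumes "s > 0"
  shows "filterlim (\<lambda>\<eta>. - (s * \<eta> ^ Suc n)) (at 0) (at_right (0::real))"
proof -
  have "((\<lambda>\<eta>. - (s * \<eta> ^ Suc n)) \<longlongrightarrow> - (s * 0 ^ Suc n)) (at_right (0::real))" by (intro tendsto_intros)
  moreover have "\<forall>\<^sub>F \<eta> in at_right (0::real). - (s * \<eta> ^ Suc n) \<noteq> 0"
    using assms by (simp add: eventually_at_filter)
  ultimately show ?thesis by (simp add: filterlim_at)
qed

lemma even_limit:
  assumes t: "filterlim t (at 0) (at_right (0::real))" "((\<lambda>\<eta>. t \<eta> / \<eta>\<^sup>2) \<longlongrightarrow> l) (at_right 0)"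
  shows "((\<lambda>\<eta>. A2 (R + t \<eta>) / \<eta> ^ 4) \<longlongrightarrow> a2 / 2 * l\<^sup>2) (at_right 0)"
    and "a2 = 0 \<Longrightarrow> ((\<lambda>\<eta>. A2 (R + t \<eta>) / \<eta> ^ 5) \<longlongrightarrow> 0) (at_right 0)"
    and "((\<lambda>\<eta>. A1 (R + t \<eta>) / \<eta>\<^sup>2) \<longlongrightarrow> l) (at_right 0)"
    and "((\<lambda>\<eta>. (R + t \<eta>) / R) \<longlongrightarrow> 1) (at_right 0)"
proof -
  have pos: "\<forall>\<^sub>F \<eta> in at_right (0::real). \<eta> > 0" by (simp add: eventually_at_filter)
  have nz: "\<forall>\<^sub>F \<eta> in at_right (0::real). t \<eta> \<noteq> 0" and t0: "(t \<longlongrightarrow> 0) (at_right 0)"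
    using t(1) by (simp_all add: filterlim_at)
  show "((\<lambda>\<eta>. A2 (R + t \<eta>) / \<eta> ^ 4) \<longlongrightarrow> a2 / 2 * l\<^sup>2) (at_right 0)"
  proof (rule Lim_transform_eventually)
    show "((\<lambda>\<eta>. A2 (R + t \<eta>) / (t \<eta>)\<^sup>2 * (t \<eta> / \<eta>\<^sup>2)\<^sup>2) \<longlongrightarrow> a2 / 2 * l\<^sup>2) (at_right 0)"
      by (intro tendsto_intros t filterlim_compose[OF A2_limit2 t(1)])
    show "\<forall>\<^sub>F \<eta> in at_right 0. A2 (R + t \<eta>) / (t \<eta>)\<^sup>2 * (t \<eta> / \<eta>\<^sup>2)\<^sup>2 = A2 (R + t \<eta>) / \<eta> ^ 4"
      using nz pos by eventually_elim (simp add: field_simps power2_eq_square eval_nat_numeral)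
  qed
  show "((\<lambda>\<eta>. A1 (R + t \<eta>) / \<eta>\<^sup>2) \<longlongrightarrow> l) (at_right 0)"
  proof (rule Lim_transform_eventually)
    have "((\<lambda>\<eta>. A1 (R + t \<eta>) / t \<eta> * (t \<eta> / \<eta>\<^sup>2)) \<longlongrightarrow> 1 * l) (at_right 0)"
      by (intro tendsto_intros t filterlim_compose[OF A1_limit t(1)])
    then show "((\<lambda>\<eta>. A1 (R + t \<eta>) / t \<eta> * (t \<eta> / \<eta>\<^sup>2)) \<longlongrightarrow> l) (at_right 0)" by simp
    show "\<forall>\<^sub>F \<eta> in at_right 0. A1 (R + t \<eta>) / t \<eta> * (t \<eta> / \<eta>\<^sup>2) = A1 (R + t \<eta>) / \<eta>\<^sup>2"
      using nz by eventually_elim simp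
  qed
  have "((\<lambda>\<eta>. (R + t \<eta>) / R) \<longlongrightarrow> (R + 0) / R) (at_right 0)"
    using R by (intro tendsto_intros t0) auto
  then show "((\<lambda>\<eta>. (R + t \<eta>) / R) \<longlongrightarrow> 1) (at_right 0)" using R by simp
  assume a: "a2 = 0"
  show "((\<lambda>\<eta>. A2 (R + t \<eta>) / \<eta> ^ 5) \<longlongrightarrow> 0) (at_right 0)"
  proof (rule Lim_transform_eventually)
    have "((\<lambda>\<eta>. A2 (R + t \<eta>) / (t \<eta>) ^ 3 * (t \<eta> / \<eta>\<^sup>2) ^ 3 * \<eta>) \<longlongrightarrow> a3 / 6 * l ^ 3 * 0) (at_right 0)"
      by (intro tendsto_mult tendsto_power t filterlim_compose[OF A2_limit3[OF a] t(1)] tendsto_ident_at)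
    then show "((\<lambda>\<eta>. A2 (R + t \<eta>) / (t \<eta>) ^ 3 * (t \<eta> / \<eta>\<^sup>2) ^ 3 * \<eta>) \<longlongrightarrow> 0) (at_right 0)" by simp
    show "\<forall>\<^sub>F \<eta> in at_right 0. A2 (R + t \<eta>) / (t \<eta>) ^ 3 * (t \<eta> / \<eta>\<^sup>2) ^ 3 * \<eta> = A2 (R + t \<eta>) / \<eta> ^ 5"
      using nz pos by eventually_elim (simp add: field_simps eval_nat_numeral)
  qed
qed

lemma odd_limit:
  assumes "z > 0"
  shows "((\<lambda>\<eta>. B3 (\<eta> * z) / \<eta> ^ 3) \<longlongrightarrow> z ^ 3) (at_right 0)"
    and "((\<lambda>\<eta>. odd5 (\<eta> * z) / \<eta> ^ 5) \<longlongrightarrow> q * z ^ 5) (at_right 0)"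
proof -
  have f: "filterlim (\<lambda>\<eta>. \<eta> * z) (at_right 0) (at_right 0)"
  proof -
    have "((\<lambda>\<eta>. \<eta> * z) \<longlongrightarrow> 0 * z) (at_right 0)" by (intro tendsto_intros)
    moreover have "\<forall>\<^sub>F \<eta> in at_right 0. \<eta> * z \<in> {0<..} \<and> \<eta> * z \<noteq> 0" using assms by (simp add: eventually_at_filter)
    ultimately show ?thesis by (simp add: filterlim_at)
  qed
  have "((\<lambda>\<eta>. B3 (\<eta> * z) / (\<eta> * z) ^ 3 * z ^ 3) \<longlongrightarrow> 1 * z ^ 3) (at_right 0)"
    by (intro tendsto_intros filterlim_compose[OF B3_limit f])
  then show "((\<lambda>\<eta>. B3 (\<eta> * z) / \<eta> ^ 3) \<longlongrightarrow> z ^ 3) (at_right 0)" using assms by (simp add: power_mult_distrib)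
  have "((\<lambda>\<eta>. odd5 (\<eta> * z) / (\<eta> * z) ^ 5 * z ^ 5) \<longlongrightarrow> q * z ^ 5) (at_right 0)"
    by (intro tendsto_intros filterlim_compose[OF odd5_limit f])
  then show "((\<lambda>\<eta>. odd5 (\<eta> * z) / \<eta> ^ 5) \<longlongrightarrow> q * z ^ 5) (at_right 0)" using assms by (simp add: power_mult_distrib)
qed

lemma points_close:
  assumes "e > 0"
  shows "z > 0 \<Longrightarrow> \<forall>\<^sub>F \<eta> in at_right 0. pt z \<eta> < R + e"
    and "s > 0 \<Longrightarrow> \<forall>\<^sub>F \<eta> in at_right 0. R - e < R + - (s * \<eta> ^ Suc n)"
proof -
  show "\<forall>\<^sub>F \<eta> in at_right 0. pt z \<eta> < R + e" if "z > 0"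
  proof -
    have "((\<lambda>\<eta>. pt z \<eta> - R) \<longlongrightarrow> 0) (at_right 0)" using pt_shift(2)[OF that] by (simp add: filterlim_at)
    from order_tendstoD(2)[OF this assms] show ?thesis by eventually_elim simp
  qed
  show "\<forall>\<^sub>F \<eta> in at_right 0. R - e < R + - (s * \<eta> ^ Suc n)" if "s > 0"
  proof -
    have "((\<lambda>\<eta>. - (s * \<eta> ^ Suc n)) \<longlongrightarrow> 0) (at_right 0)" using small_shift[OF that] by (simp add: filterlim_at)
    moreover have "- e < 0" using assms by simp
    ultimately have "\<forall>\<^sub>F \<eta> in at_right 0. - e < - (s * \<eta> ^ Suc n)" by (rule order_tendstoD(1))
    then show ?thesis by eventually_elim simp
  qed
qed

lemma pt_props:
  assumes "0 < \<eta>"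
  shows "0 < z \<Longrightarrow> z < z' \<Longrightarrow> pt z \<eta> < pt z' \<eta>" "0 < z \<Longrightarrow> R < pt z \<eta>" "0 < z \<Longrightarrow> sqrt ((pt z \<eta>)\<^sup>2 - R\<^sup>2) = \<eta> * z"
proof -
  show "pt z \<eta> < pt z' \<eta>" if "0 < z" "z < z'"
    unfolding pt_def using that assms by (intro real_sqrt_less_mono add_strict_left_mono power_strict_mono) auto
  show "R < pt z \<eta>" if "0 < z"
    unfolding pt_def using that assms R by (intro real_less_rsqrt) simp
  show "sqrt ((pt z \<eta>)\<^sup>2 - R\<^sup>2) = \<eta> * z" if "0 < z"
    using that assms by (simp add: pt_def)
qed

definition E2 :: "real \<Rightarrow> real \<Rightarrow> real \<Rightarrow> real \<Rightarrow> real" where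
  "E2 C \<tau>2 \<tau>0 r = C * A2 r + \<tau>2 * A1 r + \<tau>0 * (r / R)"

definition E3 :: "real \<Rightarrow> real \<Rightarrow> real \<Rightarrow> real \<Rightarrow> real \<Rightarrow> real \<Rightarrow> real" where
  "E3 C \<tau>3 \<tau>2 \<tau>1 \<tau>0 r = E2 C \<tau>2 \<tau>0 r +
     (C * odd5 (sqrt (r\<^sup>2 - R\<^sup>2)) + \<tau>3 * B3 (sqrt (r\<^sup>2 - R\<^sup>2)) + \<tau>1 * sqrt (r\<^sup>2 - R\<^sup>2))"

theorem sign_pattern:
  assumes e: "e > 0"
  shows "\<exists>c1 c2 c3 c4 c5 x0 x1 x2 x3 x4. R < x0 \<and> x0 < x1 \<and> x1 < x2 \<and> x2 < x3 \<and> x3 < x4 \<and> x4 < R + e \<and>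
     0 < M3 c1 c2 c3 c4 c5 x0 \<and> M3 c1 c2 c3 c4 c5 x1 < 0 \<and> 0 < M3 c1 c2 c3 c4 c5 x2 \<and>
     M3 c1 c2 c3 c4 c5 x3 < 0 \<and> 0 < M3 c1 c2 c3 c4 c5 x4 \<and>
     (0 \<le> k \<longrightarrow> (\<exists>y0 y1 y2. R - e < y0 \<and> y0 < y1 \<and> y1 < y2 \<and> y2 < R \<and>
        0 < M2 c1 c2 c3 y0 \<and> M2 c1 c2 c3 y1 < 0 \<and> 0 < M2 c1 c2 c3 y2))"
proof -
  have pos: "\<forall>\<^sub>F \<eta> in at_right (0::real). \<eta> > 0" by (simp add: eventually_at_filter)
  have "\<exists>C \<tau>3 \<tau>2 \<tau>1 \<tau>0 x0 x1 x2 x3 x4. R < x0 \<and> x0 < x1 \<and> x1 < x2 \<and> x2 < x3 \<and> x3 < x4 \<and> x4 < R + e \<and>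
     0 < E3 C \<tau>3 \<tau>2 \<tau>1 \<tau>0 x0 \<and> E3 C \<tau>3 \<tau>2 \<tau>1 \<tau>0 x1 < 0 \<and> 0 < E3 C \<tau>3 \<tau>2 \<tau>1 \<tau>0 x2 \<and>
     E3 C \<tau>3 \<tau>2 \<tau>1 \<tau>0 x3 < 0 \<and> 0 < E3 C \<tau>3 \<tau>2 \<tau>1 \<tau>0 x4 \<and>
     (0 \<le> k \<longrightarrow> (\<exists>y0 y1 y2. R - e < y0 \<and> y0 < y1 \<and> y1 < y2 \<and> y2 < R \<and>
        0 < E2 C \<tau>2 \<tau>0 y0 \<and> E2 C \<tau>2 \<tau>0 y1 < 0 \<and> 0 < E2 C \<tau>2 \<tau>0 y2))"
  proof (cases "a2 = 0")
    case False
    define C where "C = 8 * R\<^sup>2 / a2"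
    have three: "((\<lambda>\<eta>. E3 C (- 10 * \<eta>) (70 * R * \<eta>\<^sup>2) (- 50 * \<eta> ^ 3) (24 * \<eta> ^ 4) (pt z \<eta>) / \<eta> ^ 4) \<longlongrightarrow>
        (z - 1) * (z - 2) * (z - 3) * (z - 4)) (at_right 0)" if z: "z > 0" for z
    proof (rule Lim_transform_eventually)
      note l = even_limit[OF pt_shift(2)[OF z] pt_shift(1)[OF z], unfolded add_diff_cancel_left' add.commute[of R] diff_add_cancel]
      have "((\<lambda>\<eta>. C * (A2 (pt z \<eta>) / \<eta> ^ 4) + 70 * R * (A1 (pt z \<eta>) / \<eta>\<^sup>2) + 24 * (pt z \<eta> / R) +
         (C * (odd5 (\<eta> * z) / \<eta> ^ 5) * \<eta> + - 10 * (B3 (\<eta> * z) / \<eta> ^ 3) + - 50 * z)) \<longlongrightarrow>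
         C * (a2 / 2 * (z\<^sup>2 / (2 * R))\<^sup>2) + 70 * R * (z\<^sup>2 / (2 * R)) + 24 * 1 +
         (C * (q * z ^ 5) * 0 + - 10 * z ^ 3 + - 50 * z)) (at_right 0)"
        by (intro tendsto_add tendsto_mult tendsto_const l odd_limit z tendsto_ident_at)
      moreover have "C * (a2 / 2 * (z\<^sup>2 / (2 * R))\<^sup>2) = z ^ 4"
        using False R by (simp add: C_def field_simps power2_eq_square eval_nat_numeral)
      moreover have "70 * R * (z\<^sup>2 / (2 * R)) = 35 * z\<^sup>2" using R by simp
      moreover have "z ^ 4 + 35 * z\<^sup>2 + 24 * 1 + (C * (q * z ^ 5) * 0 + - 10 * z ^ 3 + - 50 * z) =
         (z - 1) * (z - 2) * (z - 3) * (z - 4)" by (simp add: eval_nat_numeral algebra_simps)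
      ultimately show "((\<lambda>\<eta>. C * (A2 (pt z \<eta>) / \<eta> ^ 4) + 70 * R * (A1 (pt z \<eta>) / \<eta>\<^sup>2) + 24 * (pt z \<eta> / R) +
         (C * (odd5 (\<eta> * z) / \<eta> ^ 5) * \<eta> + - 10 * (B3 (\<eta> * z) / \<eta> ^ 3) + - 50 * z)) \<longlongrightarrow>
         (z - 1) * (z - 2) * (z - 3) * (z - 4)) (at_right 0)" by (simp only:)
      show "\<forall>\<^sub>F \<eta> in at_right 0. C * (A2 (pt z \<eta>) / \<eta> ^ 4) + 70 * R * (A1 (pt z \<eta>) / \<eta>\<^sup>2) + 24 * (pt z \<eta> / R) +
         (C * (odd5 (\<eta> * z) / \<eta> ^ 5) * \<eta> + - 10 * (B3 (\<eta> * z) / \<eta> ^ 3) + - 50 * z) =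
         E3 C (- 10 * \<eta>) (70 * R * \<eta>\<^sup>2) (- 50 * \<eta> ^ 3) (24 * \<eta> ^ 4) (pt z \<eta>) / \<eta> ^ 4"
        using pos
      proof eventually_elim
        case (elim \<eta>)
        show ?case unfolding E3_def E2_def pt_props(3)[OF elim z] using elim
          by (simp add: add_divide_distrib diff_divide_distrib eval_nat_numeral)
      qed
    qed
    have two: "((\<lambda>\<eta>. E2 C (70 * R * \<eta>\<^sup>2) (24 * \<eta> ^ 4) (R + - (s / (2 * R) * \<eta> ^ Suc 1)) / \<eta> ^ 4) \<longlongrightarrow>
        s\<^sup>2 - 35 * s + 24) (at_right 0)" if s: "s > 0" for s
    proof (rule Lim_transform_eventually)
      have s': "s / (2 * R) > 0" using s R by simp
      have lim: "((\<lambda>\<eta>. - (s / (2 * R) * \<eta> ^ Suc 1) / \<eta>\<^sup>2) \<longlongrightarrow> - (s / (2 * R))) (at_right 0)"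
        by (rule Lim_transform_eventually[OF tendsto_const])
          (use pos in \<open>eventually_elim, simp add: power2_eq_square\<close>)
      note l = even_limit[OF small_shift[OF s'] lim]
      let ?t = "\<lambda>\<eta>. R + - (s / (2 * R) * \<eta> ^ Suc 1)"
      have "((\<lambda>\<eta>. C * (A2 (?t \<eta>) / \<eta> ^ 4) + 70 * R * (A1 (?t \<eta>) / \<eta>\<^sup>2) + 24 * (?t \<eta> / R)) \<longlongrightarrow>
         C * (a2 / 2 * (- (s / (2 * R)))\<^sup>2) + 70 * R * (- (s / (2 * R))) + 24 * 1) (at_right 0)"
        by (intro tendsto_add tendsto_mult tendsto_const l)
      moreover have "C * (a2 / 2 * (- (s / (2 * R)))\<^sup>2) + 70 * R * (- (s / (2 * R))) + 24 * 1 = s\<^sup>2 - 35 * s + 24"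
        using False R by (simp add: C_def field_simps power2_eq_square)
      ultimately show "((\<lambda>\<eta>. C * (A2 (?t \<eta>) / \<eta> ^ 4) + 70 * R * (A1 (?t \<eta>) / \<eta>\<^sup>2) + 24 * (?t \<eta> / R)) \<longlongrightarrow>
         s\<^sup>2 - 35 * s + 24) (at_right 0)" by (simp only:)
      show "\<forall>\<^sub>F \<eta> in at_right 0. C * (A2 (?t \<eta>) / \<eta> ^ 4) + 70 * R * (A1 (?t \<eta>) / \<eta>\<^sup>2) + 24 * (?t \<eta> / R) =
         E2 C (70 * R * \<eta>\<^sup>2) (24 * \<eta> ^ 4) (?t \<eta>) / \<eta> ^ 4"
        using pos
      proof eventually_elim
        case (elim \<eta>)
        define t where "t = ?t \<eta>"
        show ?case unfolding E2_def t_def[symmetric] using elim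
          by (simp add: add_divide_distrib eval_nat_numeral)
      qed
    qed
    have "\<forall>\<^sub>F \<eta> in at_right 0. 0 < \<eta> \<and> pt (9/2) \<eta> < R + e \<and> R - e < R + - (40 / (2 * R) * \<eta> ^ Suc 1) \<and>
       0 < E3 C (- 10 * \<eta>) (70 * R * \<eta>\<^sup>2) (- 50 * \<eta> ^ 3) (24 * \<eta> ^ 4) (pt (1/2) \<eta>) \<and>
       E3 C (- 10 * \<eta>) (70 * R * \<eta>\<^sup>2) (- 50 * \<eta> ^ 3) (24 * \<eta> ^ 4) (pt (3/2) \<eta>) < 0 \<and>
       0 < E3 C (- 10 * \<eta>) (70 * R * \<eta>\<^sup>2) (- 50 * \<eta> ^ 3) (24 * \<eta> ^ 4) (pt (5/2) \<eta>) \<and>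
       E3 C (- 10 * \<eta>) (70 * R * \<eta>\<^sup>2) (- 50 * \<eta> ^ 3) (24 * \<eta> ^ 4) (pt (7/2) \<eta>) < 0 \<and>
       0 < E3 C (- 10 * \<eta>) (70 * R * \<eta>\<^sup>2) (- 50 * \<eta> ^ 3) (24 * \<eta> ^ 4) (pt (9/2) \<eta>) \<and>
       0 < E2 C (70 * R * \<eta>\<^sup>2) (24 * \<eta> ^ 4) (R + - (40 / (2 * R) * \<eta> ^ Suc 1)) \<and>
       E2 C (70 * R * \<eta>\<^sup>2) (24 * \<eta> ^ 4) (R + - (2 / (2 * R) * \<eta> ^ Suc 1)) < 0 \<and>
       0 < E2 C (70 * R * \<eta>\<^sup>2) (24 * \<eta> ^ 4) (R + - ((1/2) / (2 * R) * \<eta> ^ Suc 1))"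
      by (intro eventually_conj pos points_close[OF e] eventually_sign_pos[OF three] eventually_sign_neg[OF three]
          eventually_sign_pos[OF two] eventually_sign_neg[OF two]) (use R in \<open>simp_all add: power2_eq_square\<close>)
    from eventually_happens'[OF trivial_limit_at_right_real this]
    obtain \<eta> where \<eta>: "0 < \<eta>" "pt (9/2) \<eta> < R + e" "R - e < R + - (40 / (2 * R) * \<eta> ^ Suc 1)"
       "0 < E3 C (- 10 * \<eta>) (70 * R * \<eta>\<^sup>2) (- 50 * \<eta> ^ 3) (24 * \<eta> ^ 4) (pt (1/2) \<eta>)"
       "E3 C (- 10 * \<eta>) (70 * R * \<eta>\<^sup>2) (- 50 * \<eta> ^ 3) (24 * \<eta> ^ 4) (pt (3/2) \<eta>) < 0"
       "0 < E3 C (- 10 * \<eta>) (70 * R * \<eta>\<^sup>2) (- 50 * \<eta> ^ 3) (24 * \<eta> ^ 4) (pt (5/2) \<eta>)"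
       "E3 C (- 10 * \<eta>) (70 * R * \<eta>\<^sup>2) (- 50 * \<eta> ^ 3) (24 * \<eta> ^ 4) (pt (7/2) \<eta>) < 0"
       "0 < E3 C (- 10 * \<eta>) (70 * R * \<eta>\<^sup>2) (- 50 * \<eta> ^ 3) (24 * \<eta> ^ 4) (pt (9/2) \<eta>)"
       "0 < E2 C (70 * R * \<eta>\<^sup>2) (24 * \<eta> ^ 4) (R + - (40 / (2 * R) * \<eta> ^ Suc 1))"
       "E2 C (70 * R * \<eta>\<^sup>2) (24 * \<eta> ^ 4) (R + - (2 / (2 * R) * \<eta> ^ Suc 1)) < 0"
       "0 < E2 C (70 * R * \<eta>\<^sup>2) (24 * \<eta> ^ 4) (R + - ((1/2) / (2 * R) * \<eta> ^ Suc 1))"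
      by (elim exE conjE) blast
    have o: "R < pt (1/2) \<eta>" "pt (1/2) \<eta> < pt (3/2) \<eta>" "pt (3/2) \<eta> < pt (5/2) \<eta>" "pt (5/2) \<eta> < pt (7/2) \<eta>"
      "pt (7/2) \<eta> < pt (9/2) \<eta>"
      by (intro pt_props[OF \<eta>(1)]; simp)+
    have o2: "R + - (40 / (2 * R) * \<eta> ^ Suc 1) < R + - (2 / (2 * R) * \<eta> ^ Suc 1)"
      "R + - (2 / (2 * R) * \<eta> ^ Suc 1) < R + - ((1/2) / (2 * R) * \<eta> ^ Suc 1)"
      "R + - ((1/2) / (2 * R) * \<eta> ^ Suc 1) < R"
      using R \<eta>(1) by (simp_all add: field_simps)
    show ?thesis
      by (rule exI[of _ C], rule exI[of _ "- 10 * \<eta>"], rule exI[of _ "70 * R * \<eta>\<^sup>2"], rule exI[of _ "- 50 * \<eta> ^ 3"],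
          rule exI[of _ "24 * \<eta> ^ 4"], intro exI conjI impI; rule o o2 \<eta>)
  next
    case True
    define C where "C = 1 / q"
    have Cq: "C * q = 1" "C > 0" using q_pos by (auto simp: C_def)
    have three: "((\<lambda>\<eta>. E3 C (- 65 * \<eta>\<^sup>2) (600 * R * \<eta> ^ 3) (- 476 * \<eta> ^ 4) (240 * \<eta> ^ 5) (pt z \<eta>) / \<eta> ^ 5) \<longlongrightarrow>
        (z - 1) * (z - 2) * (z - 3) * (z - 4) * (z + 10)) (at_right 0)" if z: "z > 0" for z
    proof (rule Lim_transform_eventually)
      note l = even_limit[OF pt_shift(2)[OF z] pt_shift(1)[OF z], unfolded add_diff_cancel_left' add.commute[of R] diff_add_cancel]
      have "((\<lambda>\<eta>. C * (A2 (pt z \<eta>) / \<eta> ^ 5) + 600 * R * (A1 (pt z \<eta>) / \<eta>\<^sup>2) + 240 * (pt z \<eta> / R) +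
         (C * (odd5 (\<eta> * z) / \<eta> ^ 5) + - 65 * (B3 (\<eta> * z) / \<eta> ^ 3) + - 476 * z)) \<longlongrightarrow>
         C * 0 + 600 * R * (z\<^sup>2 / (2 * R)) + 240 * 1 +
         (C * (q * z ^ 5) + - 65 * z ^ 3 + - 476 * z)) (at_right 0)"
        by (intro tendsto_add tendsto_mult tendsto_const l True odd_limit z)
      moreover have "600 * R * (z\<^sup>2 / (2 * R)) = 300 * z\<^sup>2" using R by simp
      moreover have "C * (q * z ^ 5) = z ^ 5" using Cq by (simp flip: mult.assoc)
      moreover have "C * 0 + 300 * z\<^sup>2 + 240 * 1 + (z ^ 5 + - 65 * z ^ 3 + - 476 * z) =
         (z - 1) * (z - 2) * (z - 3) * (z - 4) * (z + 10)" by (simp add: eval_nat_numeral algebra_simps)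
      ultimately show "((\<lambda>\<eta>. C * (A2 (pt z \<eta>) / \<eta> ^ 5) + 600 * R * (A1 (pt z \<eta>) / \<eta>\<^sup>2) + 240 * (pt z \<eta> / R) +
         (C * (odd5 (\<eta> * z) / \<eta> ^ 5) + - 65 * (B3 (\<eta> * z) / \<eta> ^ 3) + - 476 * z)) \<longlongrightarrow>
         (z - 1) * (z - 2) * (z - 3) * (z - 4) * (z + 10)) (at_right 0)" by (simp only:)
      show "\<forall>\<^sub>F \<eta> in at_right 0. C * (A2 (pt z \<eta>) / \<eta> ^ 5) + 600 * R * (A1 (pt z \<eta>) / \<eta>\<^sup>2) + 240 * (pt z \<eta> / R) +
         (C * (odd5 (\<eta> * z) / \<eta> ^ 5) + - 65 * (B3 (\<eta> * z) / \<eta> ^ 3) + - 476 * z) =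
         E3 C (- 65 * \<eta>\<^sup>2) (600 * R * \<eta> ^ 3) (- 476 * \<eta> ^ 4) (240 * \<eta> ^ 5) (pt z \<eta>) / \<eta> ^ 5"
        using pos
      proof eventually_elim
        case (elim \<eta>)
        show ?case unfolding E3_def E2_def pt_props(3)[OF elim z] using elim
          by (simp add: add_divide_distrib diff_divide_distrib eval_nat_numeral)
      qed
    qed
    have two: "((\<lambda>\<eta>. E2 C (600 * R * \<eta> ^ 3) (240 * \<eta> ^ 5) (R + - (s * \<eta> ^ Suc 1)) / \<eta> ^ 5) \<longlongrightarrow>
        - 600 * R * s + 240) (at_right 0)" if s: "s > 0" for s
    proof (rule Lim_transform_eventually)
      have lim: "((\<lambda>\<eta>. - (s * \<eta> ^ Suc 1) / \<eta>\<^sup>2) \<longlongrightarrow> - s) (at_right 0)"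
        by (rule Lim_transform_eventually[OF tendsto_const])
          (use pos in \<open>eventually_elim, simp add: power2_eq_square\<close>)
      note l = even_limit[OF small_shift[OF s] lim]
      let ?t = "\<lambda>\<eta>. R + - (s * \<eta> ^ Suc 1)"
      have "((\<lambda>\<eta>. C * (A2 (?t \<eta>) / \<eta> ^ 5) + 600 * R * (A1 (?t \<eta>) / \<eta>\<^sup>2) + 240 * (?t \<eta> / R)) \<longlongrightarrow>
         C * 0 + 600 * R * (- s) + 240 * 1) (at_right 0)"
        by (intro tendsto_add tendsto_mult tendsto_const l True)
      then show "((\<lambda>\<eta>. C * (A2 (?t \<eta>) / \<eta> ^ 5) + 600 * R * (A1 (?t \<eta>) / \<eta>\<^sup>2) + 240 * (?t \<eta> / R)) \<longlongrightarrow>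
         - 600 * R * s + 240) (at_right 0)" by simp
      show "\<forall>\<^sub>F \<eta> in at_right 0. C * (A2 (?t \<eta>) / \<eta> ^ 5) + 600 * R * (A1 (?t \<eta>) / \<eta>\<^sup>2) + 240 * (?t \<eta> / R) =
         E2 C (600 * R * \<eta> ^ 3) (240 * \<eta> ^ 5) (?t \<eta>) / \<eta> ^ 5"
        using pos
      proof eventually_elim
        case (elim \<eta>)
        define t where "t = ?t \<eta>"
        show ?case unfolding E2_def t_def[symmetric] using elim
          by (simp add: add_divide_distrib eval_nat_numeral)
      qed
    qed
    have far: "\<forall>\<^sub>F \<eta> in at_right 0. 0 < E2 C (600 * R * \<eta> ^ 3) (240 * \<eta> ^ 5) (R + - (1 * \<eta> ^ Suc 0))" if k: "0 \<le> k"
    proof (rule eventually_sign_pos)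
      let ?t = "\<lambda>\<eta> :: real. - (1 * \<eta> ^ Suc 0)"
      have f: "filterlim ?t (at 0) (at_right (0::real))" by (rule small_shift) simp
      have f0: "(?t \<longlongrightarrow> 0) (at_right 0)" using f unfolding filterlim_at by (rule conjunct2)
      have A1': "((\<lambda>\<eta>. A1 (R + ?t \<eta>)) \<longlongrightarrow> 0) (at_right 0)"
      proof (rule Lim_transform_eventually)
        show "((\<lambda>\<eta>. A1 (R + ?t \<eta>) / ?t \<eta> * ?t \<eta>) \<longlongrightarrow> 0) (at_right 0)"
          using tendsto_mult[OF filterlim_compose[OF A1_limit f] f0] by simp
      qed (use pos in \<open>eventually_elim, simp\<close>)
      show "((\<lambda>\<eta>. E2 C (600 * R * \<eta> ^ 3) (240 * \<eta> ^ 5) (R + ?t \<eta>) / \<eta> ^ 3) \<longlongrightarrow>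
          C * (- (a3 / 6)) + 600 * R * 0 + 240 * 0\<^sup>2 * ((R + 0) / R)) (at_right 0)"
      proof (rule Lim_transform_eventually)
        show "((\<lambda>\<eta>. C * (- (A2 (R + ?t \<eta>) / (?t \<eta>) ^ 3)) + 600 * R * A1 (R + ?t \<eta>) + 240 * \<eta>\<^sup>2 * ((R + ?t \<eta>) / R)) \<longlongrightarrow>
          C * (- (a3 / 6)) + 600 * R * 0 + 240 * 0\<^sup>2 * ((R + 0) / R)) (at_right 0)"
          using R by (intro tendsto_add tendsto_mult tendsto_const tendsto_minus tendsto_power tendsto_ident_at
              tendsto_divide A1' f0 filterlim_compose[OF A2_limit3[OF True] f]) simp
        show "\<forall>\<^sub>F \<eta> in at_right 0. C * (- (A2 (R + ?t \<eta>) / (?t \<eta>) ^ 3)) + 600 * R * A1 (R + ?t \<eta>) + 240 * \<eta>\<^sup>2 * ((R + ?t \<eta>) / R) =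
          E2 C (600 * R * \<eta> ^ 3) (240 * \<eta> ^ 5) (R + ?t \<eta>) / \<eta> ^ 3"
          using pos
        proof eventually_elim
          case (elim \<eta>)
          define t where "t = R + ?t \<eta>"
          have p: "(?t \<eta>) ^ 3 = - (\<eta> ^ 3)" by simp
          show ?case unfolding E2_def t_def[symmetric] p using elim
            by (simp add: add_divide_distrib eval_nat_numeral)
        qed
      qed
      show "0 < C * (- (a3 / 6)) + 600 * R * 0 + 240 * 0\<^sup>2 * ((R + 0) / R)"
        using a3_neg[OF True k] Cq(2) by (simp add: mult_pos_neg)
    qed
    have ord: "\<forall>\<^sub>F \<eta> in at_right 0. \<eta> < R"
      using R(1) by (auto simp: eventually_at_right_field intro!: exI[of _ R])
    have ev1: "\<forall>\<^sub>F \<eta> in at_right 0. 0 < \<eta> \<and> \<eta> < R \<and> pt (9/2) \<eta> < R + e \<and> R - e < R + - (1 * \<eta> ^ Suc 0) \<and>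
       0 < E3 C (- 65 * \<eta>\<^sup>2) (600 * R * \<eta> ^ 3) (- 476 * \<eta> ^ 4) (240 * \<eta> ^ 5) (pt (1/2) \<eta>) \<and>
       E3 C (- 65 * \<eta>\<^sup>2) (600 * R * \<eta> ^ 3) (- 476 * \<eta> ^ 4) (240 * \<eta> ^ 5) (pt (3/2) \<eta>) < 0 \<and>
       0 < E3 C (- 65 * \<eta>\<^sup>2) (600 * R * \<eta> ^ 3) (- 476 * \<eta> ^ 4) (240 * \<eta> ^ 5) (pt (5/2) \<eta>) \<and>
       E3 C (- 65 * \<eta>\<^sup>2) (600 * R * \<eta> ^ 3) (- 476 * \<eta> ^ 4) (240 * \<eta> ^ 5) (pt (7/2) \<eta>) < 0 \<and>
       0 < E3 C (- 65 * \<eta>\<^sup>2) (600 * R * \<eta> ^ 3) (- 476 * \<eta> ^ 4) (240 * \<eta> ^ 5) (pt (9/2) \<eta>) \<and>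
       E2 C (600 * R * \<eta> ^ 3) (240 * \<eta> ^ 5) (R + - (1 / R * \<eta> ^ Suc 1)) < 0 \<and>
       0 < E2 C (600 * R * \<eta> ^ 3) (240 * \<eta> ^ 5) (R + - (1 / (5 * R) * \<eta> ^ Suc 1))"
      by (intro eventually_conj pos ord points_close[OF e] eventually_sign_pos[OF three] eventually_sign_neg[OF three]
          eventually_sign_pos[OF two] eventually_sign_neg[OF two]) (use R in simp_all)
    have "\<forall>\<^sub>F \<eta> in at_right 0. 0 \<le> k \<longrightarrow> 0 < E2 C (600 * R * \<eta> ^ 3) (240 * \<eta> ^ 5) (R + - (1 * \<eta> ^ Suc 0))"
      using far by (cases "0 \<le> k") auto
    from eventually_happens'[OF trivial_limit_at_right_real eventually_conj[OF this ev1]]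
    obtain \<eta> where k: "0 \<le> k \<longrightarrow> 0 < E2 C (600 * R * \<eta> ^ 3) (240 * \<eta> ^ 5) (R + - (1 * \<eta> ^ Suc 0))"
       and \<eta>: "0 < \<eta>" "\<eta> < R" "pt (9/2) \<eta> < R + e" "R - e < R + - (1 * \<eta> ^ Suc 0)"
       "0 < E3 C (- 65 * \<eta>\<^sup>2) (600 * R * \<eta> ^ 3) (- 476 * \<eta> ^ 4) (240 * \<eta> ^ 5) (pt (1/2) \<eta>)"
       "E3 C (- 65 * \<eta>\<^sup>2) (600 * R * \<eta> ^ 3) (- 476 * \<eta> ^ 4) (240 * \<eta> ^ 5) (pt (3/2) \<eta>) < 0"
       "0 < E3 C (- 65 * \<eta>\<^sup>2) (600 * R * \<eta> ^ 3) (- 476 * \<eta> ^ 4) (240 * \<eta> ^ 5) (pt (5/2) \<eta>)"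
       "E3 C (- 65 * \<eta>\<^sup>2) (600 * R * \<eta> ^ 3) (- 476 * \<eta> ^ 4) (240 * \<eta> ^ 5) (pt (7/2) \<eta>) < 0"
       "0 < E3 C (- 65 * \<eta>\<^sup>2) (600 * R * \<eta> ^ 3) (- 476 * \<eta> ^ 4) (240 * \<eta> ^ 5) (pt (9/2) \<eta>)"
       "E2 C (600 * R * \<eta> ^ 3) (240 * \<eta> ^ 5) (R + - (1 / R * \<eta> ^ Suc 1)) < 0"
       "0 < E2 C (600 * R * \<eta> ^ 3) (240 * \<eta> ^ 5) (R + - (1 / (5 * R) * \<eta> ^ Suc 1))"
      by (elim exE conjE) blast
    have o: "R < pt (1/2) \<eta>" "pt (1/2) \<eta> < pt (3/2) \<eta>" "pt (3/2) \<eta> < pt (5/2) \<eta>" "pt (5/2) \<eta> < pt (7/2) \<eta>"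
      "pt (7/2) \<eta> < pt (9/2) \<eta>"
      by (intro pt_props[OF \<eta>(1)]; simp)+
    have o2: "R + - (1 * \<eta> ^ Suc 0) < R + - (1 / R * \<eta> ^ Suc 1)"
      "R + - (1 / R * \<eta> ^ Suc 1) < R + - (1 / (5 * R) * \<eta> ^ Suc 1)"
      "R + - (1 / (5 * R) * \<eta> ^ Suc 1) < R"
      using R \<eta>(1,2) by (simp_all add: field_simps)
    show ?thesis
      by (rule exI[of _ C], rule exI[of _ "- 65 * \<eta>\<^sup>2"], rule exI[of _ "600 * R * \<eta> ^ 3"], rule exI[of _ "- 476 * \<eta> ^ 4"],
          rule exI[of _ "240 * \<eta> ^ 5"], intro exI conjI impI; rule o o2 \<eta> k[THEN mp]; assumption?)
  qed
  then obtain C \<tau>3 \<tau>2 \<tau>1 \<tau>0 x0 x1 x2 x3 x4 where *: "R < x0 \<and> x0 < x1 \<and> x1 < x2 \<and> x2 < x3 \<and> x3 < x4 \<and> x4 < R + e \<and>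
     0 < E3 C \<tau>3 \<tau>2 \<tau>1 \<tau>0 x0 \<and> E3 C \<tau>3 \<tau>2 \<tau>1 \<tau>0 x1 < 0 \<and> 0 < E3 C \<tau>3 \<tau>2 \<tau>1 \<tau>0 x2 \<and>
     E3 C \<tau>3 \<tau>2 \<tau>1 \<tau>0 x3 < 0 \<and> 0 < E3 C \<tau>3 \<tau>2 \<tau>1 \<tau>0 x4 \<and>
     (0 \<le> k \<longrightarrow> (\<exists>y0 y1 y2. R - e < y0 \<and> y0 < y1 \<and> y1 < y2 \<and> y2 < R \<and>
        0 < E2 C \<tau>2 \<tau>0 y0 \<and> E2 C \<tau>2 \<tau>0 y1 < 0 \<and> 0 < E2 C \<tau>2 \<tau>0 y2))"
    by (elim exE)
  obtain c1 c2 c4 c5 where c: "\<And>r. M2 c1 c2 C r = C * A2 r + \<tau>2 * A1 r + \<tau>0 * (r / R)"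
    "\<And>r. M3 c1 c2 C c4 c5 r = C * A2 r + \<tau>2 * A1 r + \<tau>0 * (r / R) +
       (C * odd5 (sqrt (r\<^sup>2 - R\<^sup>2)) + \<tau>3 * B3 (sqrt (r\<^sup>2 - R\<^sup>2)) + \<tau>1 * sqrt (r\<^sup>2 - R\<^sup>2))"
    by (rule coefficients[of C \<tau>2 \<tau>0 \<tau>3 \<tau>1]) blast
  have E: "E2 C \<tau>2 \<tau>0 = M2 c1 c2 C" "E3 C \<tau>3 \<tau>2 \<tau>1 \<tau>0 = M3 c1 c2 C c4 c5"
    by (auto simp: E2_def E3_def c fun_eq_iff)
  show ?thesis using * unfolding E by (intro exI)
qed

end


section \<open>Conjugate systems\<close>

definition conjugates ::
  "(plane \<Rightarrow> plane) \<Rightarrow> (zone \<Rightarrow> zone) \<Rightarrow> (zone \<Rightarrow> plane \<Rightarrow> plane) \<Rightarrow> (zone \<Rightarrow> plane) \<Rightarrow>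
   (zone \<Rightarrow> plane \<Rightarrow> plane) \<Rightarrow> (zone \<Rightarrow> plane \<Rightarrow> plane) \<Rightarrow> bool" where
  "conjugates A \<pi> L t V W \<longleftrightarrow> inj A \<and> (\<forall>i. bounded_linear (L i)) \<and>
     (\<forall>i. \<forall>p\<in>zone_set i. A p \<in> zone_set (\<pi> i) \<and> A p = L i p + t i \<and> W (\<pi> i) (A p) = L i (V i p)) \<and>
     (\<forall>p. A p \<in> switching_lines \<longleftrightarrow> p \<in> switching_lines) \<and>
     (\<forall>p. crossing_point V p \<longrightarrow> crossing_point W (A p))"

lemma conjugates_piece:
  assumes c: "conjugates A \<pi> L t V W" and p: "piece V i \<gamma> a b"
  shows "piece W (\<pi> i) (\<lambda>s. A (\<gamma> s)) a b"
  unfolding piece_def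
proof (intro ballI conjI)
  fix s assume s: "s \<in> {a..b}"
  have z: "\<gamma> u \<in> zone_set i" if "u \<in> {a..b}" for u using p that by (simp add: piece_def)
  have cz: "A q \<in> zone_set (\<pi> i)" "A q = L i q + t i" "W (\<pi> i) (A q) = L i (V i q)" if "q \<in> zone_set i" for q
    using c that unfolding conjugates_def by blast+
  have bl: "bounded_linear (L i)" using c unfolding conjugates_def by blast
  show "A (\<gamma> s) \<in> zone_set (\<pi> i)" using cz(1) z s by blast
  have "(\<gamma> has_vector_derivative V i (\<gamma> s)) (at s within {a..b})" using p s by (simp add: piece_def)
  from bounded_linear.has_vector_derivative[OF bl this]
  have "((\<lambda>s. L i (\<gamma> s)) has_vector_derivative L i (V i (\<gamma> s))) (at s within {a..b})" .
  then have "((\<lambda>s. L i (\<gamma> s) + t i) has_vector_derivative L i (V i (\<gamma> s)) + 0) (at s within {a..b})"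
    by (rule has_vector_derivative_add) (rule has_vector_derivative_const)
  then have "((\<lambda>s. L i (\<gamma> s) + t i) has_vector_derivative W (\<pi> i) (A (\<gamma> s))) (at s within {a..b})"
    using cz(3) z s by simp
  then show "((\<lambda>s. A (\<gamma> s)) has_vector_derivative W (\<pi> i) (A (\<gamma> s))) (at s within {a..b})"
    by (rule has_vector_derivative_transform[OF s, rotated]) (use cz(2) z in simp)
qed

lemma conjugates_trajectory:
  assumes "conjugates A \<pi> L t V W" "trajectory V \<gamma>"
  shows "trajectory W (\<lambda>s. A (\<gamma> s))"
  using assms(2) conjugates_piece[OF assms(1)] unfolding trajectory_iff by meson

lemma conjugates_periodic_solution:
  assumes c: "conjugates A \<pi> L t V W" and p: "periodic_solution V \<gamma> T"
  shows "periodic_solution W (\<lambda>s. A (\<gamma> s)) T"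
proof -
  have "inj A" using c by (simp add: conjugates_def)
  have p': "trajectory V \<gamma>" "0 < T" "\<forall>t. \<gamma> (t + T) = \<gamma> t" "inj_on \<gamma> {0..<T}"
    using p by (simp_all add: periodic_solution_def)
  have "inj_on (A \<circ> \<gamma>) {0..<T}"
    using p'(4) \<open>inj A\<close> by (intro comp_inj_on) (auto intro: inj_on_subset)
  then show ?thesis unfolding periodic_solution_def
    using p' conjugates_trajectory[OF c p'(1)] by (simp add: o_def)
qed

lemma conjugates_periodic_orbit:
  assumes c: "conjugates A \<pi> L t V W" and p: "periodic_orbit V \<Gamma>"
  shows "periodic_orbit W (A ` \<Gamma>)"
proof -
  obtain \<gamma> T where "periodic_solution V \<gamma> T" "\<Gamma> = range \<gamma>" using p unfolding periodic_orbit_def by blast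
  moreover have "A ` range \<gamma> = range (\<lambda>s. A (\<gamma> s))" by blast
  ultimately show ?thesis unfolding periodic_orbit_def using conjugates_periodic_solution[OF c] by blast
qed

lemma conjugates_crossing_periodic_orbit:
  assumes c: "conjugates A \<pi> L t V W" and p: "crossing_periodic_orbit V \<Gamma>"
  shows "crossing_periodic_orbit W (A ` \<Gamma>)"
  unfolding crossing_periodic_orbit_def
proof (intro conjI ballI)
  have sw: "A p \<in> switching_lines \<longleftrightarrow> p \<in> switching_lines" for p using c unfolding conjugates_def by blast
  show "periodic_orbit W (A ` \<Gamma>)"
    using p conjugates_periodic_orbit[OF c] unfolding crossing_periodic_orbit_def by blast
  show "A ` \<Gamma> \<inter> switching_lines \<noteq> {}" using p sw unfolding crossing_periodic_orbit_def by blast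
  fix q assume "q \<in> A ` \<Gamma> \<inter> switching_lines"
  then obtain p' where "q = A p'" "p' \<in> \<Gamma>" "p' \<in> switching_lines" using sw by blast
  then show "crossing_point W q"
    using p c unfolding crossing_periodic_orbit_def conjugates_def by blast
qed

lemma conjugates_limit_cycle:
  assumes A: "conjugates A \<pi> L t V W" and B: "conjugates B \<pi>' L' t' W V"
    and AB: "\<And>p. A (B p) = p" "\<And>p. B (A p) = p" and cont: "continuous_on UNIV A" and lc: "limit_cycle W G"
  shows "limit_cycle V (B ` G)"
proof -
  obtain U where U: "open U" "G \<subseteq> U" "\<And>\<Gamma>'. crossing_periodic_orbit W \<Gamma>' \<Longrightarrow> \<Gamma>' \<subseteq> U \<Longrightarrow> \<Gamma>' = G"
    using lc unfolding limit_cycle_def by blast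
  show ?thesis unfolding limit_cycle_def
  proof (intro conjI exI[of _ "A -` U"] allI impI)
    show "crossing_periodic_orbit V (B ` G)"
      using conjugates_crossing_periodic_orbit[OF B] lc unfolding limit_cycle_def by blast
    show "open (A -` U)" using U(1) cont by (rule open_vimage)
    show "B ` G \<subseteq> A -` U" using U(2) AB by auto
    fix \<Gamma>' assume *: "crossing_periodic_orbit V \<Gamma>' \<and> \<Gamma>' \<subseteq> A -` U"
    then have "A ` \<Gamma>' = G" using U(3)[of "A ` \<Gamma>'"] conjugates_crossing_periodic_orbit[OF A] by blast
    then have "B ` G = B ` A ` \<Gamma>'" by simp
    also have "\<dots> = \<Gamma>'" using AB(2) by (simp add: image_image)
    finally show "\<Gamma>' = B ` G" by simp
  qed
qed

lemma hausdorff_tendsto_image: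
  assumes h: "hausdorff_tendsto G S F" and K: "0 < K" and lip: "\<And>p q. dist (B p) (B q) \<le> K * dist p q"
  shows "hausdorff_tendsto (\<lambda>x. B ` G x) (B ` S) F"
  unfolding hausdorff_tendsto_def
proof (intro allI impI)
  fix e :: real assume e: "e > 0"
  have lt: "dist (B p) (B q) < e" if "dist p q < e / K" for p q
  proof -
    have "dist (B p) (B q) \<le> K * dist p q" by (rule lip)
    also have "\<dots> < K * (e / K)" using that K by (rule mult_strict_left_mono)
    also have "\<dots> = e" using K by simp
    finally show ?thesis .
  qed
  have "\<forall>\<^sub>F x in F. (\<forall>p\<in>G x. \<exists>q\<in>S. dist p q < e / K) \<and> (\<forall>q\<in>S. \<exists>p\<in>G x. dist p q < e / K)"
    using h e K unfolding hausdorff_tendsto_def by simp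
  then show "\<forall>\<^sub>F x in F. (\<forall>p\<in>B ` G x. \<exists>q\<in>B ` S. dist p q < e) \<and> (\<forall>q\<in>B ` S. \<exists>p\<in>B ` G x. dist p q < e)"
    by eventually_elim (use lt in blast)
qed

section \<open>Reduction to the normal form\<close>

fun zone_swap :: "zone \<Rightarrow> zone" where
  "zone_swap LeftZone = RightZone" | "zone_swap CentralZone = CentralZone" | "zone_swap RightZone = LeftZone"

text \<open>A piecewise linear change of coordinates that maps \<open>y\<close> to a multiple of the horizontal velocity
  and, for \<open>\<sigma> = -1\<close>, exchanges the left and the right zone.\<close>

locale normalization =
  fixes a b c \<alpha> \<beta> \<delta> m :: "zone \<Rightarrow> real" and \<sigma> :: real
  assumes bC: "b CentralZone \<noteq> 0" and bpos: "b i / b CentralZone > 0"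
    and \<kappa>: "(a i)\<^sup>2 + b i * c i \<noteq> 0"
    and tR: "b CentralZone * (a RightZone + \<alpha> RightZone) = b RightZone * (a CentralZone + \<alpha> CentralZone)"
    and tL: "b CentralZone * (\<alpha> LeftZone - a LeftZone) = b LeftZone * (\<alpha> CentralZone - a CentralZone)"
    and \<sigma>: "\<sigma> = 1 \<or> \<sigma> = -1"
begin

definition rr :: "zone \<Rightarrow> real" where "rr i = b i / b CentralZone"
definition gg :: "zone \<Rightarrow> real" where "gg i = a i / rr i"
definition ee :: "zone \<Rightarrow> real" where "ee i = \<alpha> i / rr i"
definition mm :: "zone \<Rightarrow> real" where "mm i = ((a i)\<^sup>2 + b i * c i) / rr i"
definition pp :: "zone \<Rightarrow> real" where "pp i = - (b CentralZone * \<beta> i + gg i * \<alpha> i) / mm i"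
definition \<pi> :: "zone \<Rightarrow> zone" where "\<pi> i = (if \<sigma> = 1 then i else zone_swap i)"
definition hR :: real where "hR = gg RightZone - gg CentralZone"
definition hL :: real where "hL = gg LeftZone - gg CentralZone"
definition bend :: "real \<Rightarrow> real" where
  "bend x = gg CentralZone * x + ee CentralZone + hR * max 0 (x - 1) + hL * min 0 (x + 1)"
definition A :: "plane \<Rightarrow> plane" where
  "A p = (\<sigma> * fst p, \<sigma> * (b CentralZone * snd p + bend (fst p)))"
definition B :: "plane \<Rightarrow> plane" where
  "B q = (\<sigma> * fst q, (\<sigma> * snd q - bend (\<sigma> * fst q)) / b CentralZone)"
definition L :: "zone \<Rightarrow> plane \<Rightarrow> plane" where
  "L i v = (\<sigma> * fst v, \<sigma> * (b CentralZone * snd v + gg i * fst v))"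
definition L' :: "zone \<Rightarrow> plane \<Rightarrow> plane" where
  "L' j v = (\<sigma> * fst v, (\<sigma> * snd v - gg (\<pi> j) * (\<sigma> * fst v)) / b CentralZone)"
definition \<rho>n :: "zone \<Rightarrow> real" where "\<rho>n j = rr (\<pi> j)"
definition \<mu>n :: "zone \<Rightarrow> real" where "\<mu>n j = mm (\<pi> j)"
definition sn :: "zone \<Rightarrow> real" where "sn j = \<sigma> * pp (\<pi> j)"

definition X :: "zone \<Rightarrow> plane \<Rightarrow> plane" where "X = unperturbed a b c \<alpha> \<beta>"
definition F :: "zone \<Rightarrow> plane \<Rightarrow> plane" where
  "F = affine_field (\<lambda>i. \<delta> (\<pi> i)) (\<lambda>i. 0)
     (\<lambda>i. - (\<delta> (\<pi> i) * pp i + \<sigma> * rr i * m (\<pi> i))) (\<lambda>i. 0) (\<lambda>i. \<delta> (\<pi> i))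
     (\<lambda>i. (\<delta> (\<pi> i) * ee i + gg i * (\<delta> (\<pi> i) * pp i + \<sigma> * rr i * m (\<pi> i))) / b CentralZone)"

lemma rr_pos: "rr i > 0" using bpos by (simp add: rr_def)
lemma rr_b: "b i = rr i * b CentralZone" using bC by (simp add: rr_def)
lemma gg_a: "a i = rr i * gg i" using rr_pos[of i] by (simp add: gg_def)
lemma ee_\<alpha>: "\<alpha> i = rr i * ee i" using rr_pos[of i] by (simp add: ee_def)
lemma mm_nonzero: "mm i \<noteq> 0" using \<kappa>[of i] rr_pos[of i] by (simp add: mm_def)

lemma rr_C: "rr CentralZone = 1" using bC by (simp add: rr_def)

lemma \<pi>\<pi> [simp]: "\<pi> (\<pi> i) = i" unfolding \<pi>_def by (cases i) auto

lemma \<sigma>\<sigma> [simp]: "\<sigma> * \<sigma> = 1" "\<sigma> * (\<sigma> * x) = x" using \<sigma> by auto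

lemma ends: "gg RightZone + ee RightZone = gg CentralZone + ee CentralZone"
    "ee LeftZone - gg LeftZone = ee CentralZone - gg CentralZone"
proof -
  have "b CentralZone * (rr RightZone * (gg RightZone + ee RightZone)) =
      b CentralZone * (rr RightZone * (gg CentralZone + ee CentralZone))"
    using tR gg_a[of RightZone] ee_\<alpha>[of RightZone] gg_a[of CentralZone] ee_\<alpha>[of CentralZone] rr_b[of RightZone] rr_C
    by (simp add: algebra_simps)
  then show "gg RightZone + ee RightZone = gg CentralZone + ee CentralZone"
    using bC rr_pos[of RightZone] by simp
  have "b CentralZone * (rr LeftZone * (ee LeftZone - gg LeftZone)) =
      b CentralZone * (rr LeftZone * (ee CentralZone - gg CentralZone))"
    using tL gg_a[of LeftZone] ee_\<alpha>[of LeftZone] gg_a[of CentralZone] ee_\<alpha>[of CentralZone] rr_b[of LeftZone] rr_C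
    by (simp add: algebra_simps)
  then show "ee LeftZone - gg LeftZone = ee CentralZone - gg CentralZone"
    using bC rr_pos[of LeftZone] by simp
qed

lemma bend_zone: "p \<in> zone_set i \<Longrightarrow> bend (fst p) = gg i * fst p + ee i"
proof -
  assume p: "p \<in> zone_set i"
  define x where "x = fst p"
  have e: "ee RightZone = gg CentralZone + ee CentralZone - gg RightZone"
    "ee LeftZone = ee CentralZone - gg CentralZone + gg LeftZone"
    using ends by linarith+
  show "bend (fst p) = gg i * fst p + ee i"
  proof (cases i)
    case LeftZone
    then have "max 0 (x - 1) = 0" "min 0 (x + 1) = x + 1" using p by (simp_all add: x_def)
    then show ?thesis unfolding LeftZone bend_def x_def[symmetric] hL_def e(2) by (simp add: algebra_simps)
  next
    case CentralZone
    then have "max 0 (x - 1) = 0" "min 0 (x + 1) = 0" using p by (simp_all add: x_def)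
    then show ?thesis unfolding CentralZone bend_def x_def[symmetric] by simp
  next
    case RightZone
    then have "max 0 (x - 1) = x - 1" "min 0 (x + 1) = 0" using p by (simp_all add: x_def)
    then show ?thesis unfolding RightZone bend_def x_def[symmetric] hR_def e(1) by (simp add: algebra_simps)
  qed
qed

lemma AB [simp]: "A (B q) = q" and BA [simp]: "B (A p) = p"
  using bC by (simp_all add: A_def B_def)

lemma zone_\<pi>: "p \<in> zone_set i \<Longrightarrow> fst q = \<sigma> * fst p \<Longrightarrow> q \<in> zone_set (\<pi> i)"
  using \<sigma> by (cases i) (auto simp: \<pi>_def)

lemma switching_\<sigma>: "fst q = \<sigma> * fst p \<Longrightarrow> q \<in> switching_lines \<longleftrightarrow> p \<in> switching_lines"
  using \<sigma> by (auto simp: switching_lines_def)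

lemma crossing_\<sigma>:
  assumes "fst q = \<sigma> * fst p" "\<And>i. p \<in> zone_set i \<Longrightarrow> fst (W (\<pi> i) q) = \<sigma> * fst (V i p)" "crossing_point V p"
  shows "crossing_point W q"
proof -
  have s: "fst (W (\<pi> i) q) * fst (W (\<pi> j) q) = fst (V i p) * fst (V j p)"
    if "p \<in> zone_set i" "p \<in> zone_set j" for i j
    using assms(2)[OF that(1)] assms(2)[OF that(2)] \<sigma> by auto
  consider "fst p = -1" "0 < fst (V LeftZone p) * fst (V CentralZone p)"
    | "fst p = 1" "0 < fst (V CentralZone p) * fst (V RightZone p)"
    using assms(3) unfolding crossing_point_def by blast
  then show ?thesis
  proof cases
    case 1
    have "0 < fst (W (\<pi> LeftZone) q) * fst (W (\<pi> CentralZone) q)" using s[of LeftZone CentralZone] 1 by simp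
    then show ?thesis using \<sigma> assms(1) 1(1) unfolding crossing_point_def \<pi>_def by (auto simp: mult.commute)
  next
    case 2
    have "0 < fst (W (\<pi> CentralZone) q) * fst (W (\<pi> RightZone) q)" using s[of CentralZone RightZone] 2 by simp
    then show ?thesis using \<sigma> assms(1) 2(1) unfolding crossing_point_def \<pi>_def by (auto simp: mult.commute)
  qed
qed

lemma normal_form: "normal_form \<rho>n \<mu>n"
  by standard (simp_all add: \<rho>n_def \<mu>n_def rr_pos mm_nonzero)

interpretation nf: normal_form \<rho>n \<mu>n sn \<delta> m by (rule normal_form)

lemma field_A:
  assumes "p \<in> zone_set i"
  shows "nf.field \<epsilon> (\<pi> i) (A p) = L i (perturbed X F \<epsilon> i p)"
proof -
  obtain x y where p: "p = (x, y)" by (cases p)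
  define bc where "bc = b CentralZone"
  define r where "r = rr i"
  have bc: "bc \<noteq> 0" and r: "r \<noteq> 0" using bC rr_pos[of i] by (auto simp: bc_def r_def)
  have bend: "bend x = gg i * x + ee i" using bend_zone[OF assms] p by simp
  have eqs: "b i = r * bc" "a i = r * gg i" "\<alpha> i = r * ee i" unfolding r_def bc_def by (rule rr_b gg_a ee_\<alpha>)+
  have mm: "mm i = r * (gg i)\<^sup>2 + bc * c i"
    unfolding mm_def eqs r_def[symmetric] using r by (simp add: field_simps power2_eq_square)
  have mp: "mm i * pp i = - (bc * \<beta> i + gg i * (r * ee i))"
    using mm_nonzero[of i] unfolding pp_def eqs(3) bc_def by simp
  have 1: "nf.field \<epsilon> (\<pi> i) (A p) = (r * (\<sigma> * (bc * y + (gg i * x + ee i)) - \<epsilon> * m (\<pi> i)) + \<epsilon> * \<delta> (\<pi> i) * (\<sigma> * x - \<sigma> * pp i),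
      mm i * (\<sigma> * x - \<sigma> * pp i) + \<epsilon> * \<delta> (\<pi> i) * (\<sigma> * (bc * y + (gg i * x + ee i))))"
    by (simp add: nf.field_def A_def \<rho>n_def \<mu>n_def sn_def r_def bc_def p bend)
  have 2: "perturbed X F \<epsilon> i p = (r * bc * y + r * gg i * x + r * ee i + \<epsilon> * (\<delta> (\<pi> i) * x - (\<delta> (\<pi> i) * pp i + \<sigma> * r * m (\<pi> i))),
      c i * x - r * gg i * y + \<beta> i + \<epsilon> * (\<delta> (\<pi> i) * y + (\<delta> (\<pi> i) * ee i + gg i * (\<delta> (\<pi> i) * pp i + \<sigma> * r * m (\<pi> i))) / bc))"
    by (simp add: perturbed_def X_def unperturbed_eq F_def affine_field_def p eqs r_def[symmetric] bc_def[symmetric])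
  have 3: "mm i * (\<sigma> * x - \<sigma> * pp i) = \<sigma> * (mm i * x + (bc * \<beta> i + gg i * (r * ee i)))"
  proof -
    have "mm i * (\<sigma> * x - \<sigma> * pp i) = \<sigma> * (mm i * x - mm i * pp i)" by (simp add: algebra_simps)
    then show ?thesis unfolding mp by simp
  qed
  have "bc * (\<epsilon> * (\<delta> (\<pi> i) * y + (\<delta> (\<pi> i) * ee i + gg i * (\<delta> (\<pi> i) * pp i + \<sigma> * r * m (\<pi> i))) / bc)) =
     \<epsilon> * (\<delta> (\<pi> i) * (bc * y) + (\<delta> (\<pi> i) * ee i + gg i * (\<delta> (\<pi> i) * pp i + \<sigma> * r * m (\<pi> i))))"
    using bc by (simp add: field_simps)
  then have 4: "bc * (c i * x - r * gg i * y + \<beta> i + \<epsilon> * (\<delta> (\<pi> i) * y + (\<delta> (\<pi> i) * ee i + gg i * (\<delta> (\<pi> i) * pp i + \<sigma> * r * m (\<pi> i))) / bc)) =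
     bc * (c i * x - r * gg i * y + \<beta> i) +
     \<epsilon> * (\<delta> (\<pi> i) * (bc * y) + (\<delta> (\<pi> i) * ee i + gg i * (\<delta> (\<pi> i) * pp i + \<sigma> * r * m (\<pi> i))))"
    by (simp only: distrib_left)
  have s2: "\<sigma> * (\<sigma> * u) = u" for u by simp
  show ?thesis
    unfolding 1 2 L_def fst_conv snd_conv bc_def[symmetric] 4 3
    unfolding mm prod.inject
  proof
    show "r * (\<sigma> * (bc * y + (gg i * x + ee i)) - \<epsilon> * m (\<pi> i)) + \<epsilon> * \<delta> (\<pi> i) * (\<sigma> * x - \<sigma> * pp i) =
      \<sigma> * (r * bc * y + r * gg i * x + r * ee i + \<epsilon> * (\<delta> (\<pi> i) * x - (\<delta> (\<pi> i) * pp i + \<sigma> * r * m (\<pi> i))))"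
      using \<sigma> by (auto simp: algebra_simps)
  qed (simp add: algebra_simps power2_eq_square)
qed

lemma A_zone: "p \<in> zone_set i \<Longrightarrow> A p = L i p + (0, \<sigma> * ee i)"
  by (simp add: A_def L_def bend_zone algebra_simps)

lemma conjugates_A: "conjugates A \<pi> L (\<lambda>i. (0, \<sigma> * ee i)) (perturbed X F \<epsilon>) (nf.field \<epsilon>)"
  unfolding conjugates_def
proof (intro conjI allI ballI impI)
  show "inj A" by (rule inj_on_inverseI[of _ B]) simp
  show "bounded_linear (L i)" for i
    unfolding L_def[abs_def]
    by (intro bounded_linear_Pair bounded_linear_const_mult bounded_linear_add bounded_linear_fst bounded_linear_snd)
  show "A p \<in> zone_set (\<pi> i)" if "p \<in> zone_set i" for p i using zone_\<pi>[OF that] by (simp add: A_def)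
  show "A p = L i p + (0, \<sigma> * ee i)" if "p \<in> zone_set i" for p i by (rule A_zone[OF that])
  show "nf.field \<epsilon> (\<pi> i) (A p) = L i (perturbed X F \<epsilon> i p)" if "p \<in> zone_set i" for p i by (rule field_A[OF that])
  show "A p \<in> switching_lines \<longleftrightarrow> p \<in> switching_lines" for p by (rule switching_\<sigma>) (simp add: A_def)
  show "crossing_point (nf.field \<epsilon>) (A p)" if "crossing_point (perturbed X F \<epsilon>) p" for p
    by (rule crossing_\<sigma>[OF _ _ that]) (simp_all add: field_A L_def, simp add: A_def)
qed

lemma conjugates_B: "conjugates B \<pi> L' (\<lambda>j. (0, - ee (\<pi> j) / b CentralZone)) (nf.field \<epsilon>) (perturbed X F \<epsilon>)"
  unfolding conjugates_def
proof (intro conjI allI ballI impI)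
  have zB: "B q \<in> zone_set (\<pi> j)" if "q \<in> zone_set j" for q j using zone_\<pi>[OF that] by (simp add: B_def)
  have L'L: "L' j (L (\<pi> j) v) = v" for j v using bC by (simp add: L_def L'_def)
  show "inj B" by (rule inj_on_inverseI[of _ A]) simp
  show "bounded_linear (L' i)" for i
    unfolding L'_def[abs_def] divide_inverse
    by (intro bounded_linear_Pair bounded_linear_const_mult bounded_linear_mult_const bounded_linear_sub
        bounded_linear_fst bounded_linear_snd)
  show "B q \<in> zone_set (\<pi> j)" if "q \<in> zone_set j" for q j by (rule zB[OF that])
  show "B q = L' j q + (0, - ee (\<pi> j) / b CentralZone)" if "q \<in> zone_set j" for q j
    using bend_zone[OF zB[OF that]] bC by (simp add: B_def L'_def field_simps)
  show feq: "perturbed X F \<epsilon> (\<pi> j) (B q) = L' j (nf.field \<epsilon> j q)" if "q \<in> zone_set j" for q j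
    using field_A[OF zB[OF that], of \<epsilon>] L'L by simp
  show "B p \<in> switching_lines \<longleftrightarrow> p \<in> switching_lines" for p by (rule switching_\<sigma>) (simp add: B_def)
  show "crossing_point (perturbed X F \<epsilon>) (B q)" if "crossing_point (nf.field \<epsilon>) q" for q
    by (rule crossing_\<sigma>[OF _ _ that]) (simp_all add: feq L'_def, simp add: B_def)
qed

lemma continuous_A: "continuous_on UNIV A"
  unfolding A_def[abs_def] bend_def by (intro continuous_intros)

lemma lipschitz_B: "\<exists>K>0. \<forall>p q. dist (B p) (B q) \<le> K * dist p q"
proof -
  define M where "M = \<bar>gg CentralZone\<bar> + \<bar>hR\<bar> + \<bar>hL\<bar>"
  have M: "\<bar>bend x - bend y\<bar> \<le> M * \<bar>x - y\<bar>" for x y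
  proof -
    have "bend x - bend y = gg CentralZone * (x - y) + hR * (max 0 (x - 1) - max 0 (y - 1)) + hL * (min 0 (x + 1) - min 0 (y + 1))"
      by (simp add: bend_def algebra_simps)
    also have "\<bar>\<dots>\<bar> \<le> \<bar>gg CentralZone * (x - y)\<bar> + \<bar>hR * (max 0 (x - 1) - max 0 (y - 1))\<bar> + \<bar>hL * (min 0 (x + 1) - min 0 (y + 1))\<bar>"
      by (rule order_trans[OF abs_triangle_ineq add_right_mono[OF abs_triangle_ineq]])
    also have "\<dots> \<le> \<bar>gg CentralZone\<bar> * \<bar>x - y\<bar> + \<bar>hR\<bar> * \<bar>x - y\<bar> + \<bar>hL\<bar> * \<bar>x - y\<bar>"
      unfolding abs_mult by (intro add_mono mult_left_mono order_refl) (auto simp: max_def min_def)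
    finally show ?thesis by (simp add: M_def algebra_simps)
  qed
  have as: "\<bar>\<sigma> * u - \<sigma> * v\<bar> = \<bar>u - v\<bar>" for u v using \<sigma> by auto
  have "dist (B p) (B q) \<le> (1 + (1 + M) / \<bar>b CentralZone\<bar>) * dist p q" for p q
  proof -
    have d: "\<bar>fst p - fst q\<bar> \<le> dist p q" "\<bar>snd p - snd q\<bar> \<le> dist p q"
      using dist_fst_le[of p q] dist_snd_le[of p q] unfolding dist_real_def by blast+
    have sB: "snd (B p) - snd (B q) =
        ((\<sigma> * snd p - \<sigma> * snd q) - (bend (\<sigma> * fst p) - bend (\<sigma> * fst q))) / b CentralZone"
      by (simp add: B_def diff_divide_distrib)
    have "dist (B p) (B q) \<le> dist (fst (B p)) (fst (B q)) + dist (snd (B p)) (snd (B q))"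
      unfolding dist_prod_def by (rule sqrt_sum_squares_le_sum) auto
    also have "dist (fst (B p)) (fst (B q)) = \<bar>fst p - fst q\<bar>" by (simp add: B_def dist_real_def as)
    also have "dist (snd (B p)) (snd (B q)) =
        \<bar>(\<sigma> * snd p - \<sigma> * snd q) - (bend (\<sigma> * fst p) - bend (\<sigma> * fst q))\<bar> / \<bar>b CentralZone\<bar>"
      unfolding dist_real_def sB abs_divide by (rule refl)
    also have "\<dots> \<le> (\<bar>snd p - snd q\<bar> + M * \<bar>fst p - fst q\<bar>) / \<bar>b CentralZone\<bar>"
    proof (rule divide_right_mono)
      have "\<bar>(\<sigma> * snd p - \<sigma> * snd q) - (bend (\<sigma> * fst p) - bend (\<sigma> * fst q))\<bar> \<le>
          \<bar>\<sigma> * snd p - \<sigma> * snd q\<bar> + \<bar>bend (\<sigma> * fst p) - bend (\<sigma> * fst q)\<bar>"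
        by (rule abs_triangle_ineq4)
      also have "\<dots> \<le> \<bar>snd p - snd q\<bar> + M * \<bar>fst p - fst q\<bar>"
        using M[of "\<sigma> * fst p" "\<sigma> * fst q"] unfolding as by (rule add_left_mono)
      finally show "\<bar>(\<sigma> * snd p - \<sigma> * snd q) - (bend (\<sigma> * fst p) - bend (\<sigma> * fst q))\<bar> \<le>
          \<bar>snd p - snd q\<bar> + M * \<bar>fst p - fst q\<bar>" .
    qed simp
    also have "\<dots> \<le> (dist p q + M * dist p q) / \<bar>b CentralZone\<bar>"
    proof (intro divide_right_mono add_mono mult_left_mono d)
      show "0 \<le> M" by (simp add: M_def)
    qed simp
    finally have "dist (B p) (B q) \<le> \<bar>fst p - fst q\<bar> + (dist p q + M * dist p q) / \<bar>b CentralZone\<bar>" by simp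
    also have "\<dots> \<le> dist p q + (dist p q + M * dist p q) / \<bar>b CentralZone\<bar>" by (rule add_right_mono[OF d(1)])
    also have "\<dots> = (1 + (1 + M) / \<bar>b CentralZone\<bar>) * dist p q" by (simp add: algebra_simps add_divide_distrib)
    finally show ?thesis .
  qed
  moreover have "1 + (1 + M) / \<bar>b CentralZone\<bar> > 0"
    by (intro add_pos_nonneg divide_nonneg_nonneg) (auto simp: M_def)
  ultimately show ?thesis by blast
qed

lemma bifurcate_of_normal_form:
  fixes n :: nat
  assumes lim: "\<And>k. k < n \<Longrightarrow> S k \<in> \<A> \<and> hausdorff_tendsto (G k) (A ` S k) (at_right 0)"
    and lc: "\<forall>\<^sub>F \<epsilon> in at_right 0. (\<forall>k<n. limit_cycle (nf.field \<epsilon>) (G k \<epsilon>)) \<and> inj_on (\<lambda>k. G k \<epsilon>) {..<n}"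
  shows "limit_cycles_bifurcate X F \<A> n"
proof -
  obtain K where K: "K > 0" "\<And>p q. dist (B p) (B q) \<le> K * dist p q" using lipschitz_B by blast
  have BAimg: "B ` A ` S = S" for S by (simp add: image_image)
  show ?thesis unfolding limit_cycles_bifurcate_def
  proof (intro exI[of _ "\<lambda>k \<epsilon>. B ` G k \<epsilon>"] exI[of _ S] conjI allI impI)
    fix k assume k: "k < n"
    show "S k \<in> \<A>" using lim[OF k] by simp
    show "hausdorff_tendsto (\<lambda>\<epsilon>. B ` G k \<epsilon>) (S k) (at_right 0)"
      using hausdorff_tendsto_image[OF _ K, of "G k" "A ` S k"] lim[OF k] BAimg by simp
  next
    show "\<forall>\<^sub>F \<epsilon> in at_right 0. (\<forall>k<n. limit_cycle (perturbed X F \<epsilon>) (B ` G k \<epsilon>)) \<and> inj_on (\<lambda>k. B ` G k \<epsilon>) {..<n}"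
      using lc
    proof eventually_elim
      case (elim \<epsilon>)
      have "limit_cycle (perturbed X F \<epsilon>) (B ` G k \<epsilon>)" if "k < n" for k
        by (rule conjugates_limit_cycle[OF conjugates_A conjugates_B AB BA continuous_A]) (use elim that in simp)
      moreover have "inj_on (\<lambda>k. B ` G k \<epsilon>) {..<n}"
      proof (rule inj_onI)
        fix k l assume kl: "k \<in> {..<n}" "l \<in> {..<n}" "B ` G k \<epsilon> = B ` G l \<epsilon>"
        then have "A ` B ` G k \<epsilon> = A ` B ` G l \<epsilon>" by simp
        then have "G k \<epsilon> = G l \<epsilon>" by (simp add: image_image)
        then show "k = l" using elim kl by (auto dest: inj_onD)
      qed
      ultimately show ?case by blast
    qed
  qed
qed

end


section \<open>The unperturbed legs\<close>

lemma polar: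
  fixes r k :: real
  assumes "0 < r"
  shows "sqrt (r\<^sup>2 + k\<^sup>2) * cos (arctan (k / r)) = r" "sqrt (r\<^sup>2 + k\<^sup>2) * sin (arctan (k / r)) = k"
proof -
  have "sqrt (r\<^sup>2 + k\<^sup>2) = sqrt (r\<^sup>2 * (1 + (k / r)\<^sup>2))" using assms by (simp add: field_simps)
  also have "\<dots> = r * sqrt (1 + (k / r)\<^sup>2)" using assms by (simp add: real_sqrt_mult)
  finally have A: "sqrt (r\<^sup>2 + k\<^sup>2) = r * sqrt (1 + (k / r)\<^sup>2)" .
  have "sqrt (1 + (k / r)\<^sup>2) > 0" by (simp add: add_pos_nonneg)
  then show "sqrt (r\<^sup>2 + k\<^sup>2) * cos (arctan (k / r)) = r" "sqrt (r\<^sup>2 + k\<^sup>2) * sin (arctan (k / r)) = k"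
    using assms unfolding A cos_arctan sin_arctan by auto
qed

definition saddle_width :: "real \<Rightarrow> real \<Rightarrow> real \<Rightarrow> real \<Rightarrow> real" where
  "saddle_width \<rho> \<mu> s d = sqrt (\<rho> * \<mu>) * (d * s - 1) / \<rho>"

definition base_field :: "(zone \<Rightarrow> real) \<Rightarrow> (zone \<Rightarrow> real) \<Rightarrow> (zone \<Rightarrow> real) \<Rightarrow> zone \<Rightarrow> plane \<Rightarrow> plane" where
  "base_field \<rho> \<mu> s i p = (\<rho> i * snd p, \<mu> i * (fst p - s i))"

context normal_form begin

lemma field_0: "field 0 = base_field \<rho> \<mu> s"
  by (intro ext) (simp add: field_def base_field_def)

lemma flow_zero: "flow 0 i p t =
    (s i + (gcosh (K i) t * (fst p - s i) + gsinh (K i) t * \<rho> i * snd p),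
     gcosh (K i) t * snd p + gsinh (K i) t * \<mu> i * (fst p - s i))"
  by (simp add: flow_def sx_def sz_def)

context
  fixes i :: zone and d w l :: real
  assumes \<mu>: "\<mu> i > 0" and d: "d = 1 \<or> d = -1"
    and w: "w = saddle_width (\<rho> i) (\<mu> i) (s i) d" and l: "l = sqrt (\<rho> i * \<mu> i)"
begin

lemma saddle_rate: "l > 0" "K i > 0" "l\<^sup>2 = \<rho> i * \<mu> i"
  using \<rho>_pos[of i] \<mu> by (simp_all add: K_def l)

lemma saddle_position: "s i = d + d * (w * \<rho> i / l)"
proof -
  have "w * \<rho> i / l = d * s i - 1" using \<rho>_pos[of i] \<mu> by (simp add: saddle_width_def w l)
  then have "d + d * (w * \<rho> i / l) = d + d * (d * s i - 1)" by simp
  also have "\<dots> = d * d * s i" by (simp add: algebra_simps)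
  finally show ?thesis using d by auto
qed

lemma saddle_flow:
  assumes q: "q = exp (l * t)"
  shows "fst (flow 0 i (d, d * v) t) = d + d * (\<rho> i / l * (q - 1) * ((w + v) - q * (w - v)) / (2 * q))"
    and "snd (flow 0 i (d, d * v) t) = d * (((w + v) / q - q * (w - v)) / 2)"
proof -
  have q0: "q > 0" using q by simp
  have gc: "gcosh (K i) t = (q + 1 / q) / 2" and gs: "gsinh (K i) t = (q - 1 / q) / 2 / l"
    using saddle_rate(2) unfolding gcosh_def gsinh_def
    by (simp_all add: K_def l cosh_field_def sinh_field_def q exp_minus inverse_eq_divide)
  define h where "h = \<rho> i / l"
  have m: "\<mu> i / l * h = 1" and l0: "l \<noteq> 0"
    using saddle_rate \<rho>_pos[of i] \<mu> by (auto simp: h_def power2_eq_square)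
  have sd: "d - s i = - (d * (w * h))" using saddle_position by (simp add: h_def)
  have "fst (flow 0 i (d, d * v) t) = s i + ((q + 1 / q) / 2 * (d - s i) + (q - 1 / q) / 2 * h * (d * v))"
    unfolding flow_zero gc gs by (simp add: h_def)
  also have "s i = d + d * (w * h)" using sd by simp
  finally have "fst (flow 0 i (d, d * v) t) = d + d * (w * h) + ((q + 1 / q) / 2 * (- (d * (w * h))) + (q - 1 / q) / 2 * h * (d * v))"
    by simp
  also have "\<dots> = d + d * (h * (q - 1) * ((w + v) - q * (w - v)) / (2 * q))"
    using q0 by (simp add: field_simps)
  finally show "fst (flow 0 i (d, d * v) t) = d + d * (\<rho> i / l * (q - 1) * ((w + v) - q * (w - v)) / (2 * q))"
    by (simp add: h_def)
  have "snd (flow 0 i (d, d * v) t) = (q + 1 / q) / 2 * (d * v) + (q - 1 / q) / 2 * (\<mu> i / l) * (d - s i)"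
    unfolding flow_zero gc gs by simp
  also have "(q - 1 / q) / 2 * (\<mu> i / l) * (d - s i) = - ((q - 1 / q) / 2 * (\<mu> i / l * h) * (d * w))"
    unfolding sd by simp
  also have "\<dots> = - ((q - 1 / q) / 2 * (d * w))" unfolding m by simp
  also have "(q + 1 / q) / 2 * (d * v) + - ((q - 1 / q) / 2 * (d * w)) = d * (((w + v) / q - q * (w - v)) / 2)"
    using q0 by (simp add: field_simps)
  finally show "snd (flow 0 i (d, d * v) t) = d * (((w + v) / q - q * (w - v)) / 2)" .
qed

lemma saddle_leg:
  assumes geo: "leg_geometry i d d d (- d)" and v: "0 < v" "v < w"
  assumes \<tau>_def: "\<tau> = ln ((w + v) / (w - v)) / l"
  shows "snd (flow 0 i (d, d * v) \<tau>) = - d * v" "regular i d d d (- d) 0 (d * v) \<tau>"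
proof -
  have l: "l > 0" by (rule saddle_rate)
  have nz: "\<rho> i \<noteq> 0" "\<mu> i \<noteq> 0" using \<rho>_pos[of i] \<mu> by auto
  have q: "(w + v) / (w - v) = exp (l * \<tau>)" using v l by (simp add: \<tau>_def)
  have w: "w > 0" "w - v > 0" using v by linarith+
  have x: "fst (flow 0 i (d, d * v) \<tau>) = d" unfolding saddle_flow(1)[OF q] using w by simp
  have "(w + v) / ((w + v) / (w - v)) = w - v" using w v by simp
  moreover have "(w + v) / (w - v) * (w - v) = w + v" using w by simp
  ultimately show z: "snd (flow 0 i (d, d * v) \<tau>) = - d * v" unfolding saddle_flow(2)[OF q] by simp
  have \<tau>: "\<tau> > 0" using l w v unfolding \<tau>_def by (intro divide_pos_pos ln_gt_zero) (simp_all add: less_divide_eq)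
  show "regular i d d d (- d) 0 (d * v) \<tau>" unfolding regular_def
  proof (intro conjI allI impI)
    fix t assume t: "0 < t" "t < \<tau>"
    define Q where "Q = exp (l * t)"
    have Q: "1 < Q" "Q < (w + v) / (w - v)" using t l unfolding q Q_def by simp_all
    have "(w + v) - Q * (w - v) > 0" using Q(2) w by (simp add: less_divide_eq)
    then have "\<rho> i / l * (Q - 1) * ((w + v) - Q * (w - v)) / (2 * Q) > 0"
      using Q(1) l \<rho>_pos[of i] by (intro divide_pos_pos mult_pos_pos) auto
    then obtain h where h: "h > 0" "fst (flow 0 i (d, d * v) t) = d + d * h"
      using saddle_flow(1)[OF Q_def] by blast
    from geo have "i = RightZone \<and> d = 1 \<or> i = LeftZone \<and> d = -1"
      unfolding leg_geometry_def by (elim disjE conjE) simp_all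
    then show "fst (flow 0 i (d, d * v) t) \<in> zint i" unfolding h(2) using h(1) by auto
  next
    show "0 < fst (field 0 i (d, d * v)) * d" using d v \<rho>_pos[of i] by (auto simp: field_def)
    show "0 < fst (field 0 i (flow 0 i (d, d * v) \<tau>)) * (- d)"
      using d v \<rho>_pos[of i] z by (auto simp: field_def)
  qed (use zero_small \<tau> x in simp_all)
qed

lemma saddle_transit:
  assumes geo: "leg_geometry i d d d (- d)" and v: "0 < v" "v < w"
  shows "transit field d (d * v) d (- d * v) {} 0 (- (\<delta> i / l) * sadF w v - 2 * d * m i * v)
      (leg_map i d d d (- d)) (\<lambda>\<epsilon> y. flow \<epsilon> i (d, y)) (hit_time i d d d (- d))"
proof -
  define \<tau> where "\<tau> = ln ((w + v) / (w - v)) / l"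
  note leg = saddle_leg[OF geo v \<tau>_def]
  have dd: "d * d = 1" using d by auto
  have sd: "d - s i = - (d * (w * \<rho> i / l))" using saddle_position by linarith
  have "\<mu> i / (2 * \<rho> i) * (d - s i)\<^sup>2 = \<mu> i / (2 * \<rho> i) * (w * \<rho> i)\<^sup>2 / l\<^sup>2 * (d * d)"
    unfolding sd by (simp add: power2_eq_square)
  also have "\<dots> = w\<^sup>2 / 2" unfolding dd saddle_rate(3) using \<rho>_pos[of i] \<mu> by (simp add: field_simps power2_eq_square)
  finally have e: "\<mu> i / (2 * \<rho> i) * (d - s i)\<^sup>2 = w\<^sup>2 / 2" .
  have vv: "(d * v)\<^sup>2 = v\<^sup>2" using dd by (simp add: power2_eq_square algebra_simps)
  have "2 * \<delta> i * \<tau> * ((d * v)\<^sup>2 / 2 - \<mu> i / (2 * \<rho> i) * (d - s i)\<^sup>2) + (- d * v - d * v) * m i =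
    - (\<delta> i / l) * sadF w v - 2 * d * m i * v"
    unfolding e vv sadF_def \<tau>_def by (simp add: algebra_simps diff_divide_distrib)
  moreover have "\<mu> i / (2 * \<rho> i) * ((d - s i)\<^sup>2 - (d - s i)\<^sup>2) = 0" by simp
  ultimately show ?thesis using leg_transit[OF geo leg(2)] unfolding leg(1) by (simp only:)
qed

end

context
  fixes i :: zone and \<omega> p :: real
  assumes \<omega>: "\<omega> > 0" and i: "\<rho> i = 1" "\<mu> i = - \<omega>\<^sup>2" "s i = p"
begin

lemma central_flow:
  "flow 0 i (p - A * cos u / \<omega>, A * sin u) t = (p - A * cos (u + \<omega> * t) / \<omega>, A * sin (u + \<omega> * t))"
proof -
  have K: "gcosh (K i) t = cos (\<omega> * t)" "gsinh (K i) t = sin (\<omega> * t) / \<omega>"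
    using \<omega> by (simp_all add: gcosh_def gsinh_def K_def i)
  show ?thesis unfolding flow_zero K i prod.inject fst_conv snd_conv cos_add sin_add
    using \<omega> by (simp add: field_simps power2_eq_square)
qed

lemma central_leg:
  assumes geo: "leg_geometry i x0 d0 x1 d1" and iC: "i = CentralZone"
    and uv: "u < v" and A: "A \<ge> 0" and x: "x0 = p - A * cos u / \<omega>" "x1 = p - A * cos v / \<omega>"
    and int: "\<And>t. u < t \<Longrightarrow> t < v \<Longrightarrow> \<omega> * (p - 1) < A * cos t \<and> A * cos t < \<omega> * (p + 1)"
    and dir: "A * sin u * d0 > 0" "A * sin v * d1 > 0" and m: "m i = 0"
  shows "transit field x0 (A * sin u) x1 (A * sin v) {} (- \<omega>\<^sup>2 / 2 * ((x1 - p)\<^sup>2 - (x0 - p)\<^sup>2))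
      (\<delta> i / \<omega> * (v - u) * A\<^sup>2)
      (leg_map i x0 d0 x1 d1) (\<lambda>\<epsilon> y. flow \<epsilon> i (x0, y)) (hit_time i x0 d0 x1 d1)"
    and "regular i x0 d0 x1 d1 0 (A * sin u) ((v - u) / \<omega>)"
    and "flow 0 i (x0, A * sin u) ((v - u) / \<omega>) = (x1, A * sin v)"
proof -
  define \<tau> where "\<tau> = (v - u) / \<omega>"
  have \<tau>: "\<tau> > 0" "u + \<omega> * \<tau> = v" using uv \<omega> by (simp_all add: \<tau>_def)
  have fl: "flow 0 i (x0, A * sin u) t = (p - A * cos (u + \<omega> * t) / \<omega>, A * sin (u + \<omega> * t))" for t
    unfolding x by (rule central_flow)
  show e: "flow 0 i (x0, A * sin u) ((v - u) / \<omega>) = (x1, A * sin v)"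
    unfolding \<tau>_def[symmetric] fl \<tau>(2) x(2) ..
  show reg: "regular i x0 d0 x1 d1 0 (A * sin u) ((v - u) / \<omega>)" unfolding regular_def
  proof (intro conjI allI impI)
    fix t assume t: "0 < t" "t < (v - u) / \<omega>"
    then have "u < u + \<omega> * t" "u + \<omega> * t < v" using \<omega> by (simp_all add: less_divide_eq mult.commute)
    from int[OF this] have "p - 1 < A * cos (u + \<omega> * t) / \<omega>" "A * cos (u + \<omega> * t) / \<omega> < p + 1"
      using \<omega> by (simp_all add: less_divide_eq divide_less_eq mult.commute)
    then have "fst (flow 0 i (x0, A * sin u) t) \<in> {-1<..<1}" unfolding fl by simp
    then show "fst (flow 0 i (x0, A * sin u) t) \<in> zint i" using iC by simp
  qed (use zero_small uv \<omega> dir in \<open>simp_all add: e field_def i mult.assoc\<close>)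
  have "(A * sin u)\<^sup>2 / 2 - \<mu> i / (2 * \<rho> i) * (x0 - s i)\<^sup>2 = A\<^sup>2 / 2 * ((sin u)\<^sup>2 + (cos u)\<^sup>2)"
    unfolding i x using \<omega> by (simp add: power_divide power_mult_distrib algebra_simps) (simp flip: distrib_left)
  then have en: "(A * sin u)\<^sup>2 / 2 - \<mu> i / (2 * \<rho> i) * (x0 - s i)\<^sup>2 = A\<^sup>2 / 2" by simp
  have "2 * \<delta> i * ((v - u) / \<omega>) * (A\<^sup>2 / 2) = \<delta> i / \<omega> * (v - u) * A\<^sup>2" by simp
  moreover have "\<mu> i / (2 * \<rho> i) * ((x1 - s i)\<^sup>2 - (x0 - s i)\<^sup>2) = - \<omega>\<^sup>2 / 2 * ((x1 - p)\<^sup>2 - (x0 - p)\<^sup>2)"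
    unfolding i by simp
  ultimately show "transit field x0 (A * sin u) x1 (A * sin v) {} (- \<omega>\<^sup>2 / 2 * ((x1 - p)\<^sup>2 - (x0 - p)\<^sup>2))
      (\<delta> i / \<omega> * (v - u) * A\<^sup>2)
      (leg_map i x0 d0 x1 d1) (\<lambda>\<epsilon> y. flow \<epsilon> i (x0, y)) (hit_time i x0 d0 x1 d1)"
    using leg_transit[OF geo reg] unfolding e en m by (simp only: mult_zero_right add_0_right snd_conv)
qed

end

end

section \<open>The first return in the normal form\<close>

locale center_saddle = normal_form \<rho> \<mu> s \<delta> m for \<rho> \<mu> s \<delta> m +
  fixes \<omega> p :: real
  assumes \<omega>: "\<omega> > 0" and p: "p > 0" and center: "\<rho> CentralZone = 1" "\<mu> CentralZone = - \<omega>\<^sup>2" "s CentralZone = p"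
    and \<mu>R: "\<mu> RightZone > 0" and \<mu>L: "\<mu> LeftZone > 0"
begin

definition wR :: real where "wR = saddle_width (\<rho> RightZone) (\<mu> RightZone) (s RightZone) 1"
definition wL :: real where "wL = saddle_width (\<rho> LeftZone) (\<mu> LeftZone) (s LeftZone) (-1)"
definition kR :: real where "kR = \<omega> * (1 - p)"
definition kL :: real where "kL = \<omega> * (1 + p)"
definition RR :: real where "RR = 2 * \<omega> * sqrt p"

lemma RR_pos: "RR > 0" and kL_pos: "kL > 0" and RR_sq: "RR\<^sup>2 = kL\<^sup>2 - kR\<^sup>2"
proof -
  show "RR > 0" "kL > 0" using \<omega> p by (simp_all add: RR_def kL_def)
  have "RR\<^sup>2 = 4 * \<omega>\<^sup>2 * p" using p by (simp add: RR_def power_mult_distrib)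
  then show "RR\<^sup>2 = kL\<^sup>2 - kR\<^sup>2" by (simp add: kL_def kR_def power2_eq_square algebra_simps)
qed

lemma right_transit:
  assumes "0 < r" "r < wR"
  shows "transit field 1 r 1 (- r) {} 0 (- (\<delta> RightZone / sqrt (\<rho> RightZone * \<mu> RightZone)) * sadF wR r - 2 * m RightZone * r)
      (leg_map RightZone 1 1 1 (-1)) (\<lambda>\<epsilon> y. flow \<epsilon> RightZone (1, y)) (hit_time RightZone 1 1 1 (-1))"
  using saddle_transit[OF \<mu>R _ wR_def refl, of r] assms by (simp add: leg_geometry_def)

lemma left_transit:
  assumes "0 < v" "v < wL"
  shows "transit field (-1) (- v) (-1) v {} 0 (- (\<delta> LeftZone / sqrt (\<rho> LeftZone * \<mu> LeftZone)) * sadF wL v + 2 * m LeftZone * v)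
      (leg_map LeftZone (-1) (-1) (-1) 1) (\<lambda>\<epsilon> y. flow \<epsilon> LeftZone (-1, y)) (hit_time LeftZone (-1) (-1) (-1) 1)"
  using saddle_transit[OF \<mu>L _ wL_def refl, of v] assms by (simp add: leg_geometry_def)

lemma cos_between:
  assumes "- a < t" "t < b" "0 \<le> a" "a \<le> pi" "0 \<le> b" "b \<le> pi" "C \<le> cos a" "C \<le> cos b"
  shows "C < cos t"
proof (cases "0 \<le> t")
  case True
  then have "cos b < cos t" using assms by (intro cos_monotone_0_pi) auto
  then show ?thesis using assms by simp
next
  case False
  then have "cos a < cos (- t)" using assms by (intro cos_monotone_0_pi) auto
  then show ?thesis using assms by simp
qed

context
  fixes r \<theta> A :: real
  assumes r: "0 < r" and \<theta>: "\<theta> = arctan (kR / r)" and A: "A = sqrt (r\<^sup>2 + kR\<^sup>2)"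
begin

lemma amplitude: "A > 0" "A * cos \<theta> = r" "A * sin \<theta> = kR" "A\<^sup>2 = r\<^sup>2 + kR\<^sup>2"
  using polar[OF r, of kR] r by (simp_all add: A \<theta> add_pos_nonneg)

lemma angle: "0 < pi / 2 + \<theta>" "pi / 2 + \<theta> < pi" "cos (pi / 2 + \<theta>) = - sin \<theta>" "sin (pi / 2 + \<theta>) = cos \<theta>"
  using arctan_lbound[of "kR / r"] arctan_ubound[of "kR / r"] by (simp_all add: \<theta> cos_add sin_add)

lemma starts: "p - A * cos (pi / 2 + \<theta>) / \<omega> = 1"
  using \<omega> amplitude(3) unfolding angle(3) by (simp add: kR_def field_simps)

lemma central_two_zone:
  assumes rR: "r < RR" and m: "m CentralZone = 0"
  shows "transit field 1 (- r) 1 r {} 0 (\<delta> CentralZone / \<omega> * cenG kR r)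
      (leg_map CentralZone 1 (-1) 1 1) (\<lambda>\<epsilon> y. flow \<epsilon> CentralZone (1, y)) (hit_time CentralZone 1 (-1) 1 1)"
proof -
  have "A\<^sup>2 < kL\<^sup>2" unfolding amplitude(4) using RR_sq rR r power_strict_mono[of r RR 2] by simp
  then have Ak: "A < kL" using kL_pos by (simp add: power_less_imp_less_base)
  have "transit field 1 (A * sin (- (pi / 2 + \<theta>))) 1 (A * sin (pi / 2 + \<theta>)) {} (- \<omega>\<^sup>2 / 2 * ((1 - p)\<^sup>2 - (1 - p)\<^sup>2))
      (\<delta> CentralZone / \<omega> * (pi / 2 + \<theta> - (- (pi / 2 + \<theta>))) * A\<^sup>2)
      (leg_map CentralZone 1 (-1) 1 1) (\<lambda>\<epsilon> y. flow \<epsilon> CentralZone (1, y)) (hit_time CentralZone 1 (-1) 1 1)"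
  proof (rule central_leg(1)[OF \<omega> center])
    show "leg_geometry CentralZone 1 (-1) 1 1" by (simp add: leg_geometry_def)
    show "- (pi / 2 + \<theta>) < pi / 2 + \<theta>" "0 \<le> A" using angle(1) amplitude(1) by linarith+
    show "1 = p - A * cos (- (pi / 2 + \<theta>)) / \<omega>" "1 = p - A * cos (pi / 2 + \<theta>) / \<omega>"
      unfolding cos_minus starts by simp_all
    show "A * sin (- (pi / 2 + \<theta>)) * -1 > 0" "A * sin (pi / 2 + \<theta>) * 1 > 0"
      unfolding sin_minus angle(4) using amplitude(2) r by simp_all
    fix t assume t: "- (pi / 2 + \<theta>) < t" "t < pi / 2 + \<theta>"
    have "- sin \<theta> < cos t" by (rule cos_between[OF t]) (use angle in linarith)+
    then have "A * (- sin \<theta>) < A * cos t" using amplitude(1) by (rule mult_strict_left_mono)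
    moreover have "A * cos t \<le> A" using amplitude(1) by simp
    ultimately show "\<omega> * (p - 1) < A * cos t \<and> A * cos t < \<omega> * (p + 1)"
      using Ak amplitude(3) by (simp add: kL_def kR_def algebra_simps)
  qed (simp_all add: m)
  moreover have "\<delta> CentralZone / \<omega> * (pi / 2 + \<theta> - (- (pi / 2 + \<theta>))) * A\<^sup>2 = \<delta> CentralZone / \<omega> * cenG kR r"
    unfolding amplitude(4) cenG_def \<theta> by (simp add: algebra_simps add_divide_distrib)
  moreover have "- \<omega>\<^sup>2 / 2 * ((1 - p)\<^sup>2 - (1 - p)\<^sup>2) = 0" by simp
  moreover have "A * - cos \<theta> = - r" using amplitude(2) by simp
  ultimately show ?thesis unfolding sin_minus angle(4) using amplitude(2) by (simp only:)
qed

context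
  fixes v \<phi> :: real
  assumes rR: "RR < r" and v: "v = sqrt (r\<^sup>2 - RR\<^sup>2)" and \<phi>: "\<phi> = arctan (v / kL)" and mC: "m CentralZone = 0"
begin

lemma v_pos: "v > 0" using power_strict_mono[of RR r 2] rR RR_pos by (simp add: v)

lemma amplitude_left: "A * cos \<phi> = kL" "A * sin \<phi> = v"
proof -
  have "v\<^sup>2 = r\<^sup>2 - RR\<^sup>2" using power_strict_mono[of RR r 2] rR RR_pos by (simp add: v)
  then have "A = sqrt (kL\<^sup>2 + v\<^sup>2)" by (simp add: A RR_sq)
  then show "A * cos \<phi> = kL" "A * sin \<phi> = v" unfolding \<phi> using polar[OF kL_pos] by simp_all
qed

lemma angle_left: "0 < \<phi>" "\<phi> < pi / 2 + \<theta>" "- sin \<theta> < cos \<phi>"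
proof -
  show p0: "0 < \<phi>" using v_pos kL_pos by (simp add: \<phi>)
  have pl: "\<phi> < pi / 2" unfolding \<phi> by (rule arctan_ubound)
  have "A * (- sin \<theta>) < A * cos \<phi>" using amplitude(3) amplitude_left(1) \<omega> p
    by (simp add: kR_def kL_def algebra_simps)
  then show c: "- sin \<theta> < cos \<phi>" using amplitude(1) by (metis mult_less_cancel_left_pos)
  show "\<phi> < pi / 2 + \<theta>"
  proof (rule ccontr)
    assume "\<not> ?thesis"
    then have "cos \<phi> \<le> cos (pi / 2 + \<theta>)" using angle pl by (intro cos_monotone_0_pi_le) auto
    then show False using c angle(3) by linarith
  qed
qed

lemma central_between:
  assumes "\<phi> < t" "t < pi / 2 + \<theta>"
  shows "\<omega> * (p - 1) < A * cos t \<and> A * cos t < \<omega> * (p + 1)"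
proof -
  have "cos (pi / 2 + \<theta>) < cos t" "cos t < cos \<phi>" using assms angle(1,2) angle_left(1)
    by (intro cos_monotone_0_pi; linarith)+
  then have "A * (- sin \<theta>) < A * cos t" "A * cos t < A * cos \<phi>" using amplitude(1) unfolding angle(3) by (simp_all only: mult_strict_left_mono)
  then show ?thesis using amplitude(3) amplitude_left(1) by (simp add: kL_def kR_def algebra_simps)
qed

lemma ends_left: "p - A * cos \<phi> / \<omega> = -1"
  using \<omega> unfolding amplitude_left by (simp add: kL_def field_simps)

lemma central_bottom:
  "transit field 1 (- r) (-1) (- v) {} (- \<omega>\<^sup>2 / 2 * ((-1 - p)\<^sup>2 - (1 - p)\<^sup>2)) (\<delta> CentralZone / \<omega> * (pi / 2 + \<theta> - \<phi>) * A\<^sup>2)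
      (leg_map CentralZone 1 (-1) (-1) (-1)) (\<lambda>\<epsilon> y. flow \<epsilon> CentralZone (1, y)) (hit_time CentralZone 1 (-1) (-1) (-1))"
proof -
  have "transit field 1 (A * sin (- (pi / 2 + \<theta>))) (-1) (A * sin (- \<phi>)) {} (- \<omega>\<^sup>2 / 2 * ((-1 - p)\<^sup>2 - (1 - p)\<^sup>2))
      (\<delta> CentralZone / \<omega> * (- \<phi> - (- (pi / 2 + \<theta>))) * A\<^sup>2)
      (leg_map CentralZone 1 (-1) (-1) (-1)) (\<lambda>\<epsilon> y. flow \<epsilon> CentralZone (1, y)) (hit_time CentralZone 1 (-1) (-1) (-1))"
  proof (rule central_leg(1)[OF \<omega> center])
    show "leg_geometry CentralZone 1 (-1) (-1) (-1)" by (simp add: leg_geometry_def)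
    show "- (pi / 2 + \<theta>) < - \<phi>" "0 \<le> A" using angle_left amplitude(1) by linarith+
    show "1 = p - A * cos (- (pi / 2 + \<theta>)) / \<omega>" "-1 = p - A * cos (- \<phi>) / \<omega>"
      unfolding cos_minus starts ends_left by simp_all
    show "A * sin (- (pi / 2 + \<theta>)) * -1 > 0" "A * sin (- \<phi>) * -1 > 0"
      unfolding sin_minus angle(4) using amplitude(2) r amplitude_left(2) v_pos by simp_all
    show "\<omega> * (p - 1) < A * cos t \<and> A * cos t < \<omega> * (p + 1)" if "- (pi / 2 + \<theta>) < t" "t < - \<phi>" for t
      using central_between[of "- t"] that by simp
  qed (simp_all add: mC)
  then show ?thesis unfolding sin_minus angle(4) using amplitude(2) amplitude_left(2) by (simp add: algebra_simps)
qed

lemma central_top: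
  "transit field (-1) v 1 r {} (- \<omega>\<^sup>2 / 2 * ((1 - p)\<^sup>2 - (-1 - p)\<^sup>2)) (\<delta> CentralZone / \<omega> * (pi / 2 + \<theta> - \<phi>) * A\<^sup>2)
      (leg_map CentralZone (-1) 1 1 1) (\<lambda>\<epsilon> y. flow \<epsilon> CentralZone (-1, y)) (hit_time CentralZone (-1) 1 1 1)"
proof -
  have "transit field (-1) (A * sin \<phi>) 1 (A * sin (pi / 2 + \<theta>)) {} (- \<omega>\<^sup>2 / 2 * ((1 - p)\<^sup>2 - (-1 - p)\<^sup>2))
      (\<delta> CentralZone / \<omega> * (pi / 2 + \<theta> - \<phi>) * A\<^sup>2)
      (leg_map CentralZone (-1) 1 1 1) (\<lambda>\<epsilon> y. flow \<epsilon> CentralZone (-1, y)) (hit_time CentralZone (-1) 1 1 1)"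
  proof (rule central_leg(1)[OF \<omega> center])
    show "leg_geometry CentralZone (-1) 1 1 1" by (simp add: leg_geometry_def)
    show "\<phi> < pi / 2 + \<theta>" "0 \<le> A" using angle_left amplitude(1) by linarith+
    show "-1 = p - A * cos \<phi> / \<omega>" "1 = p - A * cos (pi / 2 + \<theta>) / \<omega>"
      unfolding starts ends_left by simp_all
    show "A * sin \<phi> * 1 > 0" "A * sin (pi / 2 + \<theta>) * 1 > 0"
      unfolding angle(4) using amplitude(2) r amplitude_left(2) v_pos by simp_all
    show "\<omega> * (p - 1) < A * cos t \<and> A * cos t < \<omega> * (p + 1)" if "\<phi> < t" "t < pi / 2 + \<theta>" for t
      by (rule central_between[OF that])
  qed (simp_all add: mC)
  then show ?thesis unfolding angle(4) amplitude_left(2) amplitude(2) .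
qed

end

end

definition S2 :: "real \<Rightarrow> real" where
  "S2 r = - (\<delta> RightZone / sqrt (\<rho> RightZone * \<mu> RightZone)) * sadF wR r - 2 * m RightZone * r +
     \<delta> CentralZone / \<omega> * cenG kR r"

definition S3 :: "real \<Rightarrow> real" where
  "S3 r = S2 r + (2 * m LeftZone * sqrt (r\<^sup>2 - RR\<^sup>2)
     - \<delta> LeftZone / sqrt (\<rho> LeftZone * \<mu> LeftZone) * sadF wL (sqrt (r\<^sup>2 - RR\<^sup>2))
     - \<delta> CentralZone / \<omega> * capC kL (sqrt (r\<^sup>2 - RR\<^sup>2)))"

lemma return_two_zones:
  assumes m: "m CentralZone = 0"
  shows "\<exists>P c T. \<forall>r. 0 < r \<longrightarrow> r < wR \<longrightarrow> r < RR \<longrightarrow> transit field 1 r 1 r {(1, - r)} 0 (S2 r) P c T"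
proof (intro exI allI impI)
  fix r assume r: "0 < r" "r < wR" "r < RR"
  from transit_compose[OF right_transit[OF r(1,2)] central_two_zone[OF r(1) refl refl r(3) m]]
  show "transit field 1 r 1 r {(1, - r)} 0 (S2 r)
    (\<lambda>\<epsilon> y. leg_map CentralZone 1 (-1) 1 1 \<epsilon> (leg_map RightZone 1 1 1 (-1) \<epsilon> y))
    (\<lambda>\<epsilon> y. cat (flow \<epsilon> RightZone (1, y)) (hit_time RightZone 1 1 1 (-1) \<epsilon> y)
       (flow \<epsilon> CentralZone (1, leg_map RightZone 1 1 1 (-1) \<epsilon> y)))
    (\<lambda>\<epsilon> y. hit_time RightZone 1 1 1 (-1) \<epsilon> y + hit_time CentralZone 1 (-1) 1 1 \<epsilon> (leg_map RightZone 1 1 1 (-1) \<epsilon> y))"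
    unfolding S2_def by (simp only: Un_empty_left Un_empty_right add_0_left)
qed

lemma return_three_zones:
  assumes m: "m CentralZone = 0"
  shows "\<exists>P c T. \<forall>r. RR < r \<longrightarrow> r < wR \<longrightarrow> sqrt (r\<^sup>2 - RR\<^sup>2) < wL \<longrightarrow>
    transit field 1 r 1 r {(1, - r), (-1, - sqrt (r\<^sup>2 - RR\<^sup>2)), (-1, sqrt (r\<^sup>2 - RR\<^sup>2))} 0 (S3 r) P c T"
proof -
  define sR where "sR = (\<lambda>r. - (\<delta> RightZone / sqrt (\<rho> RightZone * \<mu> RightZone)) * sadF wR r - 2 * m RightZone * r)"
  define sL where "sL = (\<lambda>v. - (\<delta> LeftZone / sqrt (\<rho> LeftZone * \<mu> LeftZone)) * sadF wL v + 2 * m LeftZone * v)"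
  define sC where "sC = (\<lambda>r. \<delta> CentralZone / \<omega> * (pi / 2 + arctan (kR / r) - arctan (sqrt (r\<^sup>2 - RR\<^sup>2) / kL)) * (sqrt (r\<^sup>2 + kR\<^sup>2))\<^sup>2)"
  have total: "sR r + sC r + sL (sqrt (r\<^sup>2 - RR\<^sup>2)) + sC r = S3 r" if "RR < r" for r
  proof -
    define v where "v = sqrt (r\<^sup>2 - RR\<^sup>2)"
    have "v\<^sup>2 = r\<^sup>2 - RR\<^sup>2" using power_strict_mono[of RR r 2] that RR_pos by (simp add: v_def)
    then have vk: "v\<^sup>2 + kL\<^sup>2 = r\<^sup>2 + kR\<^sup>2" by (simp add: RR_sq)
    define N where "N = r\<^sup>2 + kR\<^sup>2"
    have q: "(sqrt N)\<^sup>2 = N" by (simp add: N_def)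
    have "sC r + sC r = \<delta> CentralZone / \<omega> * cenG kR r - \<delta> CentralZone / \<omega> * capC kL v"
      unfolding sC_def cenG_def capC_def v_def[symmetric] vk unfolding N_def[symmetric] q
      by (simp add: algebra_simps)
    then show ?thesis unfolding S3_def S2_def sR_def sL_def v_def[symmetric] by linarith
  qed
  have "transit field 1 r 1 r {(1, - r), (-1, - sqrt (r\<^sup>2 - RR\<^sup>2)), (-1, sqrt (r\<^sup>2 - RR\<^sup>2))} 0 (S3 r)
     (\<lambda>\<epsilon> y. leg_map CentralZone (-1) 1 1 1 \<epsilon> (leg_map LeftZone (-1) (-1) (-1) 1 \<epsilon> (leg_map CentralZone 1 (-1) (-1) (-1) \<epsilon> (leg_map RightZone 1 1 1 (-1) \<epsilon> y))))
     (\<lambda>\<epsilon> y. cat (cat (cat (flow \<epsilon> RightZone (1, y)) (hit_time RightZone 1 1 1 (-1) \<epsilon> y)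
         (flow \<epsilon> CentralZone (1, leg_map RightZone 1 1 1 (-1) \<epsilon> y)))
         (hit_time RightZone 1 1 1 (-1) \<epsilon> y + hit_time CentralZone 1 (-1) (-1) (-1) \<epsilon> (leg_map RightZone 1 1 1 (-1) \<epsilon> y))
         (flow \<epsilon> LeftZone (-1, leg_map CentralZone 1 (-1) (-1) (-1) \<epsilon> (leg_map RightZone 1 1 1 (-1) \<epsilon> y))))
       (hit_time RightZone 1 1 1 (-1) \<epsilon> y + hit_time CentralZone 1 (-1) (-1) (-1) \<epsilon> (leg_map RightZone 1 1 1 (-1) \<epsilon> y) +
         hit_time LeftZone (-1) (-1) (-1) 1 \<epsilon> (leg_map CentralZone 1 (-1) (-1) (-1) \<epsilon> (leg_map RightZone 1 1 1 (-1) \<epsilon> y)))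
       (flow \<epsilon> CentralZone (-1, leg_map LeftZone (-1) (-1) (-1) 1 \<epsilon> (leg_map CentralZone 1 (-1) (-1) (-1) \<epsilon> (leg_map RightZone 1 1 1 (-1) \<epsilon> y)))))
     (\<lambda>\<epsilon> y. hit_time RightZone 1 1 1 (-1) \<epsilon> y + hit_time CentralZone 1 (-1) (-1) (-1) \<epsilon> (leg_map RightZone 1 1 1 (-1) \<epsilon> y) +
         hit_time LeftZone (-1) (-1) (-1) 1 \<epsilon> (leg_map CentralZone 1 (-1) (-1) (-1) \<epsilon> (leg_map RightZone 1 1 1 (-1) \<epsilon> y)) +
         hit_time CentralZone (-1) 1 1 1 \<epsilon> (leg_map LeftZone (-1) (-1) (-1) 1 \<epsilon> (leg_map CentralZone 1 (-1) (-1) (-1) \<epsilon> (leg_map RightZone 1 1 1 (-1) \<epsilon> y))))"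
    if r: "RR < r" "r < wR" "sqrt (r\<^sup>2 - RR\<^sup>2) < wL" for r
  proof -
    define v where "v = sqrt (r\<^sup>2 - RR\<^sup>2)"
    have r0: "0 < r" using r(1) RR_pos by linarith
    have v0: "0 < v" unfolding v_def by (rule v_pos[OF r0 refl refl r(1) refl refl m])
    have vL: "v < wL" using r(3) by (simp add: v_def)
    note t1 = right_transit[OF r0 r(2), folded sR_def]
    note t2 = central_bottom[OF r0 refl refl r(1) refl refl m, folded sC_def v_def]
    note t3 = left_transit[OF v0 vL]
    note t4 = central_top[OF r0 refl refl r(1) refl refl m, folded sC_def v_def]
    have k: "0 + - \<omega>\<^sup>2 / 2 * ((-1 - p)\<^sup>2 - (1 - p)\<^sup>2) + 0 + - \<omega>\<^sup>2 / 2 * ((1 - p)\<^sup>2 - (-1 - p)\<^sup>2) = 0"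
      by (simp add: algebra_simps)
    have B: "({} \<union> {(1, - r)} \<union> {} \<union> {(-1, - v)} \<union> {}) \<union> {(-1, v)} \<union> {} = {(1, - r), (-1, - v), (-1, v)}" by blast
    have S: "- (\<delta> RightZone / sqrt (\<rho> RightZone * \<mu> RightZone)) * sadF wR r - 2 * m RightZone * r +
       \<delta> CentralZone / \<omega> * (pi / 2 + arctan (kR / r) - arctan (v / kL)) * (sqrt (r\<^sup>2 + kR\<^sup>2))\<^sup>2 +
       (- (\<delta> LeftZone / sqrt (\<rho> LeftZone * \<mu> LeftZone)) * sadF wL v + 2 * m LeftZone * v) +
       \<delta> CentralZone / \<omega> * (pi / 2 + arctan (kR / r) - arctan (v / kL)) * (sqrt (r\<^sup>2 + kR\<^sup>2))\<^sup>2 = S3 r"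
      using total[OF r(1)] unfolding sR_def sC_def sL_def v_def .
    show ?thesis
      using transit_compose[OF transit_compose[OF transit_compose[OF t1 t2] t3] t4]
      unfolding B k S unfolding v_def .
  qed
  then show ?thesis by (intro exI allI impI)
qed

end


section \<open>Simple zeros and limit cycles in the normal form\<close>

lemma real_analytic_sign_change:
  fixes f :: "real \<Rightarrow> real"
  assumes an: "\<And>x. x \<in> {a<..<b} \<Longrightarrow> real_analytic_at f x"
    and xy: "a < x" "x < y" "y < b" and f: "f x * f y < 0"
  shows "\<exists>r \<sigma> \<eta>. x < r \<and> r < y \<and> 0 < \<eta> \<and> (\<forall>t. r - \<eta> < t \<longrightarrow> t < r \<longrightarrow> \<sigma> * f t < 0) \<and>
    (\<forall>t. r < t \<longrightarrow> t < r + \<eta> \<longrightarrow> \<sigma> * f t > (0 :: real))"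
proof -
  define \<sigma> where "\<sigma> = sgn (f y)"
  define h where "h = (\<lambda>t. \<sigma> * f t)"
  have fy: "f y \<noteq> 0" using f by auto
  have hx: "h x < 0" and hy: "h y > 0"
    using f fy by (auto simp: h_def \<sigma>_def sgn_if mult_less_0_iff)
  have han: "real_analytic_at h t" if "t \<in> {a<..<b}" for t
    unfolding h_def by (intro real_analytic_intros an that)
  have cont: "isCont h t" if "t \<in> {a<..<b}" for t by (rule real_analytic_at_imp_isCont[OF han[OF that]])
  define N where "N = {t \<in> {x..y}. h t < 0}"
  define r where "r = Sup N"
  have xN: "x \<in> N" using hx xy by (simp add: N_def)
  have bdd: "bdd_above N" by (rule bdd_aboveI[of _ y]) (simp add: N_def)
  have xr: "x \<le> r" unfolding r_def by (rule cSup_upper[OF xN bdd])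
  have ry: "r \<le> y" unfolding r_def by (rule cSup_least) (use xN in \<open>auto simp: N_def\<close>)
  have rab: "r \<in> {a<..<b}" using xr ry xy by simp
  have right: "0 \<le> h t" if "r < t" "t \<le> y" for t
  proof (rule ccontr)
    assume "\<not> ?thesis"
    then have "t \<in> N" using that xr by (simp add: N_def)
    then show False using cSup_upper[OF _ bdd] that by (force simp: r_def)
  qed
  have near: "\<exists>t\<in>N. r - \<eta> < t" if "\<eta> > 0" for \<eta>
    using less_cSup_iff[OF _ bdd, of "r - \<eta>"] xN that by (auto simp: r_def)
  have hr_le: "h r \<le> 0"
  proof (rule ccontr)
    assume "\<not> ?thesis"
    then have "\<forall>\<^sub>F t in nhds r. 0 < h t"
      using cont[OF rab] by (intro order_tendstoD(1)[of h "h r"]) (auto simp: isCont_def tendsto_nhds_iff)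
    then obtain \<eta> where \<eta>: "\<eta> > 0" "\<And>t. dist t r < \<eta> \<Longrightarrow> 0 < h t" unfolding eventually_nhds_metric by blast
    obtain t where t: "t \<in> N" "r - \<eta> < t" using near[OF \<eta>(1)] by blast
    have "t \<le> r" unfolding r_def by (rule cSup_upper[OF t(1) bdd])
    then have "dist t r < \<eta>" using t(2) by (simp add: dist_real_def)
    then show False using \<eta>(2)[of t] t(1) by (simp add: N_def)
  qed
  have ry': "r < y" using ry hr_le hy by (cases "r = y") auto
  have hr: "h r = 0"
  proof (rule ccontr)
    assume "h r \<noteq> 0"
    then have "h r < 0" using hr_le by simp
    then have "\<forall>\<^sub>F t in nhds r. h t < 0"
      using cont[OF rab] by (intro order_tendstoD(2)[of h "h r"]) (auto simp: isCont_def tendsto_nhds_iff)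
    then obtain \<eta> where \<eta>: "\<eta> > 0" "\<And>t. dist t r < \<eta> \<Longrightarrow> h t < 0" unfolding eventually_nhds_metric by blast
    define t where "t = r + min (\<eta> / 2) (y - r)"
    have t: "r < t" "t \<le> y" "dist t r < \<eta>" using \<eta>(1) ry' by (auto simp: t_def dist_real_def min_def)
    then show False using right[OF t(1,2)] \<eta>(2)[OF t(3)] by simp
  qed
  have xr': "x < r" using xr hr hx by (cases "r = x") auto
  have "\<forall>\<^sub>F t in at r. h t \<noteq> 0"
    by (rule real_analytic_isolated_zeros[of a b h y]) (use han xy hy rab in auto)
  then obtain \<eta>1 where \<eta>1: "\<eta>1 > 0" "\<And>t. t \<noteq> r \<Longrightarrow> dist t r < \<eta>1 \<Longrightarrow> h t \<noteq> 0" unfolding eventually_at by blast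
  define \<eta> where "\<eta> = min \<eta>1 (min (y - r) (r - x))"
  have \<eta>: "\<eta> > 0" "\<eta> \<le> \<eta>1" "\<eta> \<le> y - r" "\<eta> \<le> r - x" using \<eta>1(1) ry' xr' by (simp_all add: \<eta>_def)
  have nz: "h t \<noteq> 0" if "t \<noteq> r" "r - \<eta> < t" "t < r + \<eta>" for t
  proof (rule \<eta>1(2)[OF that(1)])
    have "\<bar>t - r\<bar> < \<eta>" using that(2,3) by (simp add: abs_less_iff)
    then show "dist t r < \<eta>1" using \<eta>(2) unfolding dist_real_def by linarith
  qed
  have pos: "h t > 0" if "r < t" "t < r + \<eta>" for t
    using right[of t] nz[of t] that \<eta> by force
  have neg: "h t < 0" if t: "r - \<eta> < t" "t < r" for t
  proof (rule ccontr)
    assume "\<not> h t < 0"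
    then have ht: "0 \<le> h t" by simp
    obtain u where u: "u \<in> N" "t < u" using near[of "r - t"] t by auto
    have hu: "h u < 0" using u(1) by (simp add: N_def)
    have ur: "u \<le> r" unfolding r_def by (rule cSup_upper[OF u(1) bdd])
    have "\<exists>z. t \<le> z \<and> z \<le> u \<and> h z = 0"
    proof (rule IVT2)
      show "\<forall>z. t \<le> z \<and> z \<le> u \<longrightarrow> isCont h z"
      proof (intro allI impI cont)
        fix z assume "t \<le> z \<and> z \<le> u"
        then show "z \<in> {a<..<b}" using t ur \<eta> xy ry by simp
      qed
    qed (use u hu ht in simp_all)
    then obtain z where z: "t \<le> z" "z \<le> u" "h z = 0" by blast
    have "u \<noteq> r" using hu hr by auto
    then have "z \<noteq> r" using z ur by linarith
    moreover have "r - \<eta> < z" "z < r + \<eta>" using z t ur \<eta>(1) by linarith+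
    ultimately show False using nz[of z] z(3) by blast
  qed
  show ?thesis
    by (rule exI[of _ r], rule exI[of _ \<sigma>], rule exI[of _ \<eta>]) (use xr' ry' \<eta>(1) pos neg in \<open>simp add: h_def\<close>)
qed

definition cycle_near :: "(real \<Rightarrow> zone \<Rightarrow> plane \<Rightarrow> plane) \<Rightarrow> plane set set \<Rightarrow> real \<Rightarrow> bool" where
  "cycle_near V \<A> r \<longleftrightarrow> (\<exists>G z S. S \<in> \<A> \<and> (z \<longlongrightarrow> r) (at_right 0) \<and> hausdorff_tendsto G S (at_right 0) \<and>
     (\<forall>\<^sub>F \<epsilon> in at_right 0. limit_cycle (V \<epsilon>) (G \<epsilon>) \<and> G \<epsilon> \<inter> {p. fst p = 1 \<and> snd p > 0} = {(1, z \<epsilon>)}))"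

lemma cycles_near_distinct:
  assumes d: "distinct rs" and c: "\<And>r. r \<in> set rs \<Longrightarrow> cycle_near V \<A> r" and n: "n = length rs"
  shows "\<exists>G S. (\<forall>k<n. S k \<in> \<A> \<and> hausdorff_tendsto (G k) (S k) (at_right 0)) \<and>
     (\<forall>\<^sub>F \<epsilon> in at_right 0. (\<forall>k<n. limit_cycle (V \<epsilon>) (G k \<epsilon>)) \<and> inj_on (\<lambda>k. G k \<epsilon>) {..<n})"
proof -
  define Q where "Q = (\<lambda>k G z S. S \<in> \<A> \<and> (z \<longlongrightarrow> rs ! k) (at_right 0) \<and> hausdorff_tendsto G S (at_right 0) \<and>
     (\<forall>\<^sub>F \<epsilon> in at_right 0. limit_cycle (V \<epsilon>) (G \<epsilon>) \<and> G \<epsilon> \<inter> {p. fst p = 1 \<and> snd p > 0} = {(1, z \<epsilon>)}))"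
  have "\<exists>G z S. k < n \<longrightarrow> Q k G z S" for k
  proof (cases "k < n")
    case True
    then have "cycle_near V \<A> (rs ! k)" using c n by simp
    then show ?thesis unfolding cycle_near_def Q_def by (elim exE) (intro exI impI)
  qed simp
  then have "\<forall>k. \<exists>G z S. k < n \<longrightarrow> Q k G z S" by (rule allI)
  then have "\<exists>G z S. \<forall>k. k < n \<longrightarrow> Q k (G k) (z k) (S k)" unfolding choice_iff .
  then obtain G z S where "\<forall>k. k < n \<longrightarrow> Q k (G k) (z k) (S k)" by (elim exE) (rule that)
  then have GS: "\<And>k. k < n \<Longrightarrow> S k \<in> \<A> \<and> (z k \<longlongrightarrow> rs ! k) (at_right 0) \<and> hausdorff_tendsto (G k) (S k) (at_right 0) \<and>
     (\<forall>\<^sub>F \<epsilon> in at_right 0. limit_cycle (V \<epsilon>) (G k \<epsilon>) \<and> G k \<epsilon> \<inter> {p. fst p = 1 \<and> snd p > 0} = {(1, z k \<epsilon>)})"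
    unfolding Q_def by (elim allE) (rule mp)
  have "\<forall>k\<in>{..<n}. \<forall>\<^sub>F \<epsilon> in at_right 0. limit_cycle (V \<epsilon>) (G k \<epsilon>) \<and> G k \<epsilon> \<inter> {p. fst p = 1 \<and> snd p > 0} = {(1, z k \<epsilon>)}"
    using GS by simp
  then have ev1: "\<forall>\<^sub>F \<epsilon> in at_right 0. \<forall>k\<in>{..<n}. limit_cycle (V \<epsilon>) (G k \<epsilon>) \<and> G k \<epsilon> \<inter> {p. fst p = 1 \<and> snd p > 0} = {(1, z k \<epsilon>)}"
    by (intro eventually_ball_finite) simp_all
  have "\<forall>kl\<in>{kl. kl \<in> {..<n} \<times> {..<n} \<and> fst kl \<noteq> snd kl}. \<forall>\<^sub>F \<epsilon> in at_right 0. z (fst kl) \<epsilon> - z (snd kl) \<epsilon> \<noteq> 0"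
  proof
    fix kl assume "kl \<in> {kl. kl \<in> {..<n} \<times> {..<n} \<and> fst kl \<noteq> snd kl}"
    then have kl: "fst kl < n" "snd kl < n" "fst kl \<noteq> snd kl" by auto
    have "((\<lambda>\<epsilon>. z (fst kl) \<epsilon> - z (snd kl) \<epsilon>) \<longlongrightarrow> rs ! fst kl - rs ! snd kl) (at_right 0)"
      using GS kl by (intro tendsto_diff) simp_all
    then show "\<forall>\<^sub>F \<epsilon> in at_right 0. z (fst kl) \<epsilon> - z (snd kl) \<epsilon> \<noteq> 0"
      by (rule tendsto_imp_eventually_ne) (use kl d n in \<open>simp add: nth_eq_iff_index_eq\<close>)
  qed
  then have ev2: "\<forall>\<^sub>F \<epsilon> in at_right 0. \<forall>kl\<in>{kl. kl \<in> {..<n} \<times> {..<n} \<and> fst kl \<noteq> snd kl}. z (fst kl) \<epsilon> - z (snd kl) \<epsilon> \<noteq> 0"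
    by (intro eventually_ball_finite) simp_all
  have "\<forall>\<^sub>F \<epsilon> in at_right 0. (\<forall>k<n. limit_cycle (V \<epsilon>) (G k \<epsilon>)) \<and> inj_on (\<lambda>k. G k \<epsilon>) {..<n}"
    using ev1 ev2
  proof eventually_elim
    case (elim \<epsilon>)
    have "inj_on (\<lambda>k. G k \<epsilon>) {..<n}"
    proof (rule inj_onI, rule ccontr)
      fix k l assume kl: "k \<in> {..<n}" "l \<in> {..<n}" "G k \<epsilon> = G l \<epsilon>" "k \<noteq> l"
      have "{(1, z k \<epsilon>)} = {(1 :: real, z l \<epsilon>)}" using elim(1) kl(1-3) by metis
      then have "z k \<epsilon> - z l \<epsilon> = 0" by simp
      moreover have "(k, l) \<in> {kl. kl \<in> {..<n} \<times> {..<n} \<and> fst kl \<noteq> snd kl}" using kl by simp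
      ultimately show False using elim(2) by fastforce
    qed
    then show ?case using elim(1) by simp
  qed
  moreover have "\<forall>k<n. S k \<in> \<A> \<and> hausdorff_tendsto (G k) (S k) (at_right 0)" using GS by simp
  ultimately show ?thesis by blast
qed

context center_saddle begin

lemma crossing_persists:
  assumes d: "d = 1 \<or> d = -1" and z: "z \<noteq> 0"
  shows "\<forall>\<^sub>F e in nhds (0, z). crossing_point (field (fst e)) (d, snd e)"
proof -
  have ev: "\<forall>\<^sub>F e in nhds (0, z). fst (field (fst e) i (d, snd e)) * fst (field (fst e) j (d, snd e)) > 0" for i j
  proof (rule order_tendstoD(1))
    show "((\<lambda>e. fst (field (fst e) i (d, snd e)) * fst (field (fst e) j (d, snd e))) \<longlongrightarrow> (\<rho> i * z) * (\<rho> j * z)) (nhds (0, z))"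
      unfolding field_def by (auto intro!: tendsto_eq_intros filterlim_ident)
    have zz: "0 < z * z" using z not_real_square_gt_zero by blast
    have "(\<rho> i * z) * (\<rho> j * z) = \<rho> i * \<rho> j * (z * z)" by simp
    also have "\<dots> > 0" by (rule mult_pos_pos[OF mult_pos_pos[OF \<rho>_pos \<rho>_pos] zz])
    finally show "(\<rho> i * z) * (\<rho> j * z) > 0" .
  qed
  from d show ?thesis
  proof
    assume d: "d = 1"
    show ?thesis using ev[of CentralZone RightZone] by eventually_elim (simp add: crossing_point_def d)
  next
    assume d: "d = -1"
    show ?thesis using ev[of LeftZone CentralZone] by eventually_elim (simp add: crossing_point_def d)
  qed
qed

lemma eventually_unique_pieces: "\<forall>\<^sub>F \<epsilon> in nhds 0. unique_pieces (field \<epsilon>)"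
  using eventually_nhds_in_open[OF open_small zero_small] by eventually_elim (rule unique_pieces_field)

lemma cycle_near_sign_change:
  assumes tr: "\<And>y. ya < y \<Longrightarrow> y < yb \<Longrightarrow> transit field 1 y 1 y (B y) 0 (f y) P c T"
    and an: "\<And>y. ya < y \<Longrightarrow> y < yb \<Longrightarrow> real_analytic_at f y"
    and xy: "0 \<le> ya" "ya < x" "x < y" "y < yb" and f: "f x * f y < 0"
    and fin: "\<And>r. finite (B r)" and B: "\<And>r b. ya < r \<Longrightarrow> b \<in> B r \<Longrightarrow> (fst b = 1 \<and> snd b < 0) \<or> (fst b = -1 \<and> snd b \<noteq> 0)"
    and leaves: "\<And>r c T. ya < r \<Longrightarrow> r < yb \<Longrightarrow> det_path (base_field \<rho> \<mu> s) c T \<Longrightarrow> c 0 = (1, r) \<Longrightarrow> c T = (1, r) \<Longrightarrow> c ` {0..T} \<in> \<A>"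
  shows "\<exists>r. x < r \<and> r < y \<and> cycle_near field \<A> r"
proof -
  have an': "real_analytic_at f t" if "t \<in> {ya<..<yb}" for t using an that by simp
  have "\<exists>r \<sigma> \<eta>. x < r \<and> r < y \<and> 0 < \<eta> \<and> (\<forall>t. r - \<eta> < t \<longrightarrow> t < r \<longrightarrow> \<sigma> * f t < 0) \<and>
      (\<forall>t. r < t \<longrightarrow> t < r + \<eta> \<longrightarrow> \<sigma> * f t > (0 :: real))"
    by (rule real_analytic_sign_change[where a = ya and b = yb, OF _ xy(2,3,4) f]) (rule an')
  then obtain r \<sigma> \<eta> where r: "x < r" "r < y" and \<eta>: "0 < \<eta>"
    and sg: "\<forall>t. r - \<eta> < t \<longrightarrow> t < r \<longrightarrow> \<sigma> * f t < 0" "\<forall>t. r < t \<longrightarrow> t < r + \<eta> \<longrightarrow> \<sigma> * f t > 0"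
    by (elim exE conjE) (rule that)
  have rab: "ya < r" "r < yb" using r xy by simp_all
  have "\<exists>G z. (z \<longlongrightarrow> r) (at_right 0) \<and> hausdorff_tendsto G (c 0 r ` {0..T 0 r}) (at_right 0) \<and>
     (\<forall>\<^sub>F \<epsilon> in at_right 0. limit_cycle (field \<epsilon>) (G \<epsilon>) \<and> G \<epsilon> \<inter> {p. fst p = 1 \<and> snd p > 0} = {(1, z \<epsilon>)})"
  proof (rule limit_cycle_bifurcation[OF eventually_unique_pieces tr xy(1) rab fin _ _ \<eta>])
    show "snd b < 0" if "b \<in> B r" "fst b = 1" for b using B[OF rab(1) that(1)] that(2) by auto
    show "\<forall>\<^sub>F e in nhds (0, snd b). crossing_point (field (fst e)) (fst b, snd e)" if "b \<in> insert (1, r) (B r)" for b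
    proof (rule crossing_persists)
      have "(fst b = 1 \<and> snd b \<noteq> 0) \<or> (fst b = -1 \<and> snd b \<noteq> 0)"
      proof (cases "b = (1, r)")
        case True then show ?thesis using rab xy by simp
      next
        case False
        then show ?thesis using B[OF rab(1), of b] that by auto
      qed
      then show "fst b = 1 \<or> fst b = -1" "snd b \<noteq> 0" by auto
    qed
    show "\<And>y. r - \<eta> < y \<Longrightarrow> y < r \<Longrightarrow> \<sigma> * f y < 0" using sg(1) by blast
    show "\<And>y. r < y \<Longrightarrow> y < r + \<eta> \<Longrightarrow> \<sigma> * f y > 0" using sg(2) by blast
  qed
  moreover have "c 0 r ` {0..T 0 r} \<in> \<A>"
  proof -
    note b = transit_base[OF tr[OF rab]]
    show ?thesis by (rule leaves[OF rab b(1)[unfolded field_0] b(2,3)])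
  qed
  ultimately have "cycle_near field \<A> r" unfolding cycle_near_def by blast
  then show ?thesis using r by blast
qed

lemma S2_analytic:
  assumes "0 < r" "r < wR" shows "real_analytic_at S2 r"
  unfolding S2_def[abs_def] sadF_def cenG_def
  by (intro real_analytic_intros) (use assms in \<open>simp_all add: field_simps\<close>)

lemma S3_analytic:
  assumes "RR < r" "r < wR" "sqrt (r\<^sup>2 - RR\<^sup>2) < wL" shows "real_analytic_at S3 r"
proof -
  have q: "r\<^sup>2 - RR\<^sup>2 > 0" using power_strict_mono[OF assms(1), of 2] RR_pos by simp
  have v: "sqrt (r\<^sup>2 - RR\<^sup>2) > 0" using q by simp
  have "wL - sqrt (r\<^sup>2 - RR\<^sup>2) > 0" "wL + sqrt (r\<^sup>2 - RR\<^sup>2) > 0" using v assms(3) by linarith+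
  then have "(wL + sqrt (r\<^sup>2 - RR\<^sup>2)) / (wL - sqrt (r\<^sup>2 - RR\<^sup>2)) > 0" "wL - sqrt (r\<^sup>2 - RR\<^sup>2) \<noteq> 0" by auto
  then show ?thesis
    unfolding S3_def[abs_def] sadF_def capC_def
    by (intro real_analytic_intros S2_analytic) (use assms q RR_pos kL_pos in auto)
qed

context
  fixes e :: real and \<A> :: "plane set set"
  assumes e: "e > 0" and mC: "m CentralZone = 0" and wR: "RR < wR" and wL: "0 < wL"
    and e_small: "e \<le> RR" "RR + e \<le> wR" "sqrt ((RR + e)\<^sup>2 - RR\<^sup>2) \<le> wL"
    and leaves: "\<And>r c T. RR - e < r \<Longrightarrow> r < RR + e \<Longrightarrow> r \<noteq> RR \<Longrightarrow> det_path (base_field \<rho> \<mu> s) c T \<Longrightarrow>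
      c 0 = (1, r) \<Longrightarrow> c T = (1, r) \<Longrightarrow> c ` {0..T} \<in> \<A>"
begin

lemma cycle_near_three_zones:
  assumes "RR < x" "x < y" "y < RR + e" "S3 x * S3 y < 0"
  shows "\<exists>r. x < r \<and> r < y \<and> cycle_near field \<A> r"
proof -
  obtain P c T where tr: "\<And>r. RR < r \<Longrightarrow> r < wR \<Longrightarrow> sqrt (r\<^sup>2 - RR\<^sup>2) < wL \<Longrightarrow>
    transit field 1 r 1 r {(1, - r), (-1, - sqrt (r\<^sup>2 - RR\<^sup>2)), (-1, sqrt (r\<^sup>2 - RR\<^sup>2))} 0 (S3 r) P c T"
    using return_three_zones[OF mC] by blast
  have v: "sqrt (r\<^sup>2 - RR\<^sup>2) < wL" if "RR < r" "r < RR + e" for r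
  proof -
    have "r\<^sup>2 < (RR + e)\<^sup>2" using that RR_pos by (intro power_strict_mono) auto
    then have "sqrt (r\<^sup>2 - RR\<^sup>2) < sqrt ((RR + e)\<^sup>2 - RR\<^sup>2)" by simp
    then show ?thesis using e_small(3) by linarith
  qed
  show ?thesis
  proof (rule cycle_near_sign_change[where ya = RR and yb = "RR + e" and f = S3 and P = P and c = c and T = T
        and B = "\<lambda>r. {(1, - r), (-1, - sqrt (r\<^sup>2 - RR\<^sup>2)), (-1, sqrt (r\<^sup>2 - RR\<^sup>2))}"])
    show "transit field 1 r 1 r {(1, - r), (-1, - sqrt (r\<^sup>2 - RR\<^sup>2)), (-1, sqrt (r\<^sup>2 - RR\<^sup>2))} 0 (S3 r) P c T"
      "real_analytic_at S3 r" if "RR < r" "r < RR + e" for r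
      using tr[of r] S3_analytic[of r] v[OF that] that e_small(2) by simp_all
    show "(fst b = 1 \<and> snd b < 0) \<or> (fst b = -1 \<and> snd b \<noteq> 0)"
      if "RR < r" "b \<in> {(1, - r), (-1, - sqrt (r\<^sup>2 - RR\<^sup>2)), (-1, sqrt (r\<^sup>2 - RR\<^sup>2))}" for r b
    proof -
      have "r\<^sup>2 - RR\<^sup>2 > 0" using power_strict_mono[OF that(1), of 2] RR_pos by simp
      then show ?thesis using that RR_pos by auto
    qed
    show "c ` {0..T} \<in> \<A>" if "RR < r" "r < RR + e" "det_path (base_field \<rho> \<mu> s) c T" "c 0 = (1, r)" "c T = (1, r)" for r c T
      by (rule leaves[OF _ that(2) _ that(3-5)]) (use that e in simp_all)
  qed (use assms RR_pos in simp_all)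
qed

lemma cycle_near_two_zones:
  assumes "RR - e < x" "x < y" "y < RR" "S2 x * S2 y < 0"
  shows "\<exists>r. x < r \<and> r < y \<and> cycle_near field \<A> r"
proof -
  obtain P c T where tr: "\<And>r. 0 < r \<Longrightarrow> r < wR \<Longrightarrow> r < RR \<Longrightarrow> transit field 1 r 1 r {(1, - r)} 0 (S2 r) P c T"
    using return_two_zones[OF mC] by blast
  show ?thesis
  proof (rule cycle_near_sign_change[where ya = "RR - e" and yb = RR and f = S2 and P = P and c = c and T = T
        and B = "\<lambda>r. {(1, - r)}"])
    show "transit field 1 r 1 r {(1, - r)} 0 (S2 r) P c T"
      "real_analytic_at S2 r" if "RR - e < r" "r < RR" for r
      using tr[of r] S2_analytic[of r] that e_small(1) wR by simp_all
    show "(fst b = 1 \<and> snd b < 0) \<or> (fst b = -1 \<and> snd b \<noteq> 0)" if "RR - e < r" "b \<in> {(1, - r)}" for r b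
      using that e_small(1) by simp
    show "c ` {0..T} \<in> \<A>" if "RR - e < r" "r < RR" "det_path (base_field \<rho> \<mu> s) c T" "c 0 = (1, r)" "c T = (1, r)" for r c T
      by (rule leaves[OF that(1) _ _ that(3-5)]) (use that e in simp_all)
  qed (use assms e_small(1) in simp_all)
qed

end

end

theorem normal_form_bifurcation:
  fixes \<rho> \<mu> s :: "zone \<Rightarrow> real" and \<omega> p d :: real and \<A> :: "plane set set" and n :: nat
  assumes cs: "center_saddle \<rho> \<mu> s \<omega> p"
    and wR: "2 * \<omega> * sqrt p < saddle_width (\<rho> RightZone) (\<mu> RightZone) (s RightZone) 1"
    and wL: "0 < saddle_width (\<rho> LeftZone) (\<mu> LeftZone) (s LeftZone) (-1)"
    and d: "d > 0"
    and leaves: "\<And>r c T. 2 * \<omega> * sqrt p - d < r \<Longrightarrow> r < 2 * \<omega> * sqrt p + d \<Longrightarrow> r \<noteq> 2 * \<omega> * sqrt p \<Longrightarrow>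
      det_path (base_field \<rho> \<mu> s) c T \<Longrightarrow> c 0 = (1, r) \<Longrightarrow> c T = (1, r) \<Longrightarrow> c ` {0..T} \<in> \<A>"
    and n: "n = (if p \<le> 1 then 6 else 4)"
  shows "\<exists>\<delta> m G S. (\<forall>k<n. S k \<in> \<A> \<and> hausdorff_tendsto (G k) (S k) (at_right 0)) \<and>
     (\<forall>\<^sub>F \<epsilon> in at_right 0. (\<forall>k<n. limit_cycle (normal_form.field \<rho> \<mu> s \<delta> m \<epsilon>) (G k \<epsilon>)) \<and> inj_on (\<lambda>k. G k \<epsilon>) {..<n})"
proof -
  interpret cz: center_saddle \<rho> \<mu> s "\<lambda>_. 0" "\<lambda>_. 0" \<omega> p by (rule cs)
  define R where "R = 2 * \<omega> * sqrt p"
  define w where "w = saddle_width (\<rho> RightZone) (\<mu> RightZone) (s RightZone) 1"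
  define w' where "w' = saddle_width (\<rho> LeftZone) (\<mu> LeftZone) (s LeftZone) (-1)"
  define k where "k = \<omega> * (1 - p)"
  define \<kappa> where "\<kappa> = \<omega> * (1 + p)"
  have R0: "R > 0" using cz.RR_pos by (simp add: R_def cz.RR_def)
  have \<kappa>0: "\<kappa> > 0" using cz.kL_pos by (simp add: \<kappa>_def cz.kL_def)
  have Rw: "R < w" "0 < w'" using wR wL by (simp_all add: R_def w_def w'_def)
  interpret ms: melnikov_span R w k w' \<kappa> by standard (use R0 Rw \<kappa>0 in simp_all)
  define e where "e = min d (min R (min (w - R) (sqrt (R\<^sup>2 + w'\<^sup>2) - R)))"
  have "sqrt (R\<^sup>2) < sqrt (R\<^sup>2 + w'\<^sup>2)" using Rw(2) by (intro real_sqrt_less_mono) simp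
  then have Rs: "R < sqrt (R\<^sup>2 + w'\<^sup>2)" using R0 by simp
  have e: "e > 0" "e \<le> d" "e \<le> R" "R + e \<le> w" "R + e \<le> sqrt (R\<^sup>2 + w'\<^sup>2)"
    using d R0 Rw Rs unfolding e_def by linarith+
  have "(R + e)\<^sup>2 \<le> (sqrt (R\<^sup>2 + w'\<^sup>2))\<^sup>2" using e R0 by (intro power_mono) simp_all
  then have "(R + e)\<^sup>2 - R\<^sup>2 \<le> w'\<^sup>2" by simp
  then have "sqrt ((R + e)\<^sup>2 - R\<^sup>2) \<le> sqrt (w'\<^sup>2)" by (rule real_sqrt_le_mono)
  then have e4: "sqrt ((R + e)\<^sup>2 - R\<^sup>2) \<le> w'" using Rw(2) by simp
  obtain c1 c2 c3 c4 c5 x0 x1 x2 x3 x4 where x: "R < x0" "x0 < x1" "x1 < x2" "x2 < x3" "x3 < x4" "x4 < R + e"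
    and M3: "0 < ms.M3 c1 c2 c3 c4 c5 x0" "ms.M3 c1 c2 c3 c4 c5 x1 < 0" "0 < ms.M3 c1 c2 c3 c4 c5 x2"
      "ms.M3 c1 c2 c3 c4 c5 x3 < 0" "0 < ms.M3 c1 c2 c3 c4 c5 x4"
    and M2: "0 \<le> k \<longrightarrow> (\<exists>y0 y1 y2. R - e < y0 \<and> y0 < y1 \<and> y1 < y2 \<and> y2 < R \<and>
        0 < ms.M2 c1 c2 c3 y0 \<and> ms.M2 c1 c2 c3 y1 < 0 \<and> 0 < ms.M2 c1 c2 c3 y2)"
    using ms.sign_pattern[OF e(1)] by (elim exE conjE) (rule that)
  define \<delta> where "\<delta> = (\<lambda>i. case i of LeftZone \<Rightarrow> - sqrt (\<rho> LeftZone * \<mu> LeftZone) * c5 | CentralZone \<Rightarrow> \<omega> * c3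
    | RightZone \<Rightarrow> - sqrt (\<rho> RightZone * \<mu> RightZone) * c2)"
  define m where "m = (\<lambda>i. case i of LeftZone \<Rightarrow> c4 / 2 | CentralZone \<Rightarrow> 0 | RightZone \<Rightarrow> - c1 / 2)"
  interpret cs: center_saddle \<rho> \<mu> s \<delta> m \<omega> p by (rule cs)
  have l: "sqrt (\<rho> RightZone * \<mu> RightZone) \<noteq> 0" "sqrt (\<rho> LeftZone * \<mu> LeftZone) \<noteq> 0" "\<omega> \<noteq> 0"
    using cs.\<rho>_pos[of RightZone] cs.\<rho>_pos[of LeftZone] cs.\<mu>R cs.\<mu>L cs.\<omega> by auto
  have par: "cs.RR = R" "cs.wR = w" "cs.wL = w'" "cs.kR = k" "cs.kL = \<kappa>"
    by (simp_all add: cs.RR_def R_def cs.wR_def w_def cs.wL_def w'_def cs.kR_def k_def cs.kL_def \<kappa>_def)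
  have vals: "\<delta> RightZone / sqrt (\<rho> RightZone * \<mu> RightZone) = - c2" "\<delta> CentralZone / \<omega> = c3"
    "\<delta> LeftZone / sqrt (\<rho> LeftZone * \<mu> LeftZone) = - c5" "m RightZone = - c1 / 2" "m LeftZone = c4 / 2"
    using l unfolding \<delta>_def m_def by (simp_all del: real_sqrt_eq_0_iff real_sqrt_mult)
  have S2: "cs.S2 = ms.M2 c1 c2 c3"
    unfolding cs.S2_def ms.M2_def par vals by (rule ext) simp
  have S3: "cs.S3 = ms.M3 c1 c2 c3 c4 c5"
    unfolding cs.S3_def ms.M3_def S2 par vals by (rule ext) simp
  have lv: "c ` {0..T} \<in> \<A>" if "R - e < r" "r < R + e" "r \<noteq> R" "det_path (base_field \<rho> \<mu> s) c T" "c 0 = (1, r)" "c T = (1, r)" for r c T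
    by (rule leaves[OF _ _ _ that(4-6)]) (use that(1-3) e(2) in \<open>simp_all add: R_def\<close>)
  have mC: "m CentralZone = 0" by (simp add: m_def)
  have three: "\<exists>r. x < r \<and> r < y \<and> cycle_near cs.field \<A> r"
    if "R < x" "x < y" "y < R + e" "ms.M3 c1 c2 c3 c4 c5 x * ms.M3 c1 c2 c3 c4 c5 y < 0" for x y
  proof (rule cs.cycle_near_three_zones[unfolded par S3, where e = e])
    show "c ` {0..T} \<in> \<A>" if "R - e < r" "r < R + e" "r \<noteq> R" "det_path (base_field \<rho> \<mu> s) c T" "c 0 = (1, r)" "c T = (1, r)" for r c T
      using that by (rule lv)
  qed (fact e(1) mC Rw e(3,4) e4 that)+
  have two: "\<exists>r. x < r \<and> r < y \<and> cycle_near cs.field \<A> r"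
    if "R - e < x" "x < y" "y < R" "ms.M2 c1 c2 c3 x * ms.M2 c1 c2 c3 y < 0" for x y
  proof (rule cs.cycle_near_two_zones[unfolded par S2, where e = e])
    show "c ` {0..T} \<in> \<A>" if "R - e < r" "r < R + e" "r \<noteq> R" "det_path (base_field \<rho> \<mu> s) c T" "c 0 = (1, r)" "c T = (1, r)" for r c T
      using that by (rule lv)
  qed (fact e(1) mC Rw e(3,4) e4 that)+
  have prod: "u * v < 0" if "0 < u \<and> v < 0 \<or> u < 0 \<and> 0 < v" for u v :: real
    using that by (simp add: mult_less_0_iff)
  obtain r1 where r1: "x0 < r1" "r1 < x1" "cycle_near cs.field \<A> r1"
  proof -
    have "\<exists>r. x0 < r \<and> r < x1 \<and> cycle_near cs.field \<A> r"
      by (rule three, (use x in linarith)+, rule prod, use M3 in simp)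
    then show ?thesis by (elim exE conjE) (rule that)
  qed
  obtain r2 where r2: "x1 < r2" "r2 < x2" "cycle_near cs.field \<A> r2"
  proof -
    have "\<exists>r. x1 < r \<and> r < x2 \<and> cycle_near cs.field \<A> r"
      by (rule three, (use x in linarith)+, rule prod, use M3 in simp)
    then show ?thesis by (elim exE conjE) (rule that)
  qed
  obtain r3 where r3: "x2 < r3" "r3 < x3" "cycle_near cs.field \<A> r3"
  proof -
    have "\<exists>r. x2 < r \<and> r < x3 \<and> cycle_near cs.field \<A> r"
      by (rule three, (use x in linarith)+, rule prod, use M3 in simp)
    then show ?thesis by (elim exE conjE) (rule that)
  qed
  obtain r4 where r4: "x3 < r4" "r4 < x4" "cycle_near cs.field \<A> r4"
  proof -
    have "\<exists>r. x3 < r \<and> r < x4 \<and> cycle_near cs.field \<A> r"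
      by (rule three, (use x in linarith)+, rule prod, use M3 in simp)
    then show ?thesis by (elim exE conjE) (rule that)
  qed
  have "\<exists>rs. distinct rs \<and> (\<forall>r\<in>set rs. cycle_near cs.field \<A> r) \<and> n = length rs"
  proof (cases "p \<le> 1")
    case True
    then have "0 \<le> k" using cs.\<omega> by (simp add: k_def)
    then obtain y0 y1 y2 where y: "R - e < y0" "y0 < y1" "y1 < y2" "y2 < R"
        "0 < ms.M2 c1 c2 c3 y0" "ms.M2 c1 c2 c3 y1 < 0" "0 < ms.M2 c1 c2 c3 y2"
      using M2 by (elim impE exE conjE) auto
    obtain r5 where r5: "y0 < r5" "r5 < y1" "cycle_near cs.field \<A> r5"
    proof -
      have "\<exists>r. y0 < r \<and> r < y1 \<and> cycle_near cs.field \<A> r"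
        by (rule two, (use y in linarith)+, rule prod, use y in simp)
      then show ?thesis by (elim exE conjE) (rule that)
    qed
    obtain r6 where r6: "y1 < r6" "r6 < y2" "cycle_near cs.field \<A> r6"
    proof -
      have "\<exists>r. y1 < r \<and> r < y2 \<and> cycle_near cs.field \<A> r"
        by (rule two, (use y in linarith)+, rule prod, use y in simp)
      then show ?thesis by (elim exE conjE) (rule that)
    qed
    show ?thesis
      by (rule exI[of _ "[r5, r6, r1, r2, r3, r4]"]) (use True n r1 r2 r3 r4 r5 r6 x y in auto)
  next
    case False
    show ?thesis
      by (rule exI[of _ "[r1, r2, r3, r4]"]) (use False n r1 r2 r3 r4 x in auto)
  qed
  then obtain rs where rs: "distinct rs" "\<And>r. r \<in> set rs \<Longrightarrow> cycle_near cs.field \<A> r" "n = length rs" by blast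
  from cycles_near_distinct[OF rs] show ?thesis by blast
qed


section \<open>Orbits of the unperturbed normal form\<close>

context center_saddle begin

definition energy :: "plane \<Rightarrow> real" where
  "energy q = (snd q)\<^sup>2 / 2 + \<omega>\<^sup>2 / 2 * (max (-1) (min 1 (fst q)) - p)\<^sup>2
     - \<mu> RightZone / (2 * \<rho> RightZone) * ((max 1 (fst q) - s RightZone)\<^sup>2 - (1 - s RightZone)\<^sup>2)
     - \<mu> LeftZone / (2 * \<rho> LeftZone) * ((min (-1) (fst q) - s LeftZone)\<^sup>2 - (-1 - s LeftZone)\<^sup>2)"

lemma continuous_energy: "continuous_on UNIV energy"
  unfolding energy_def[abs_def] by (intro continuous_intros) simp_all

lemma energy_zone:
  "\<exists>C. \<forall>q\<in>zone_set i. energy q = (snd q)\<^sup>2 / 2 - \<mu> i / (2 * \<rho> i) * (fst q - s i)\<^sup>2 + C"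
proof (cases i)
  case LeftZone
  have "energy q = (snd q)\<^sup>2 / 2 - \<mu> i / (2 * \<rho> i) * (fst q - s i)\<^sup>2 +
      (\<omega>\<^sup>2 / 2 * (- 1 - p)\<^sup>2 + \<mu> LeftZone / (2 * \<rho> LeftZone) * (-1 - s LeftZone)\<^sup>2)" if "fst q \<le> -1" for q
  proof -
    have "max (-1) (min 1 (fst q)) = -1" "max 1 (fst q) = 1" "min (-1) (fst q) = fst q" using that by simp_all
    then show ?thesis unfolding energy_def LeftZone by (simp add: right_diff_distrib)
  qed
  then show ?thesis unfolding LeftZone by (intro exI ballI) simp
next
  case CentralZone
  have "energy q = (snd q)\<^sup>2 / 2 - \<mu> i / (2 * \<rho> i) * (fst q - s i)\<^sup>2 + 0" if "-1 \<le> fst q" "fst q \<le> 1" for q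
  proof -
    have "max (-1) (min 1 (fst q)) = fst q" "max 1 (fst q) = 1" "min (-1) (fst q) = -1" using that by simp_all
    then show ?thesis unfolding energy_def CentralZone center by simp
  qed
  then show ?thesis unfolding CentralZone by (intro exI[of _ 0] ballI) simp
next
  case RightZone
  have "energy q = (snd q)\<^sup>2 / 2 - \<mu> i / (2 * \<rho> i) * (fst q - s i)\<^sup>2 +
      (\<omega>\<^sup>2 / 2 * (1 - p)\<^sup>2 + \<mu> RightZone / (2 * \<rho> RightZone) * (1 - s RightZone)\<^sup>2)" if "1 \<le> fst q" for q
  proof -
    have "max (-1) (min 1 (fst q)) = 1" "max 1 (fst q) = fst q" "min (-1) (fst q) = -1" using that by simp_all
    then show ?thesis unfolding energy_def RightZone by (simp add: right_diff_distrib)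
  qed
  then show ?thesis unfolding RightZone by (intro exI ballI) simp
qed

lemma energy_right: "energy (1, z) = (z\<^sup>2 + kR\<^sup>2) / 2" and energy_left: "energy (-1, z) = (z\<^sup>2 + kR\<^sup>2 + RR\<^sup>2) / 2"
proof -
  show "energy (1, z) = (z\<^sup>2 + kR\<^sup>2) / 2" by (simp add: energy_def kR_def power_mult_distrib)
  have "energy (-1, z) = (z\<^sup>2 + kL\<^sup>2) / 2" by (simp add: energy_def kL_def power_mult_distrib power2_eq_square algebra_simps)
  then show "energy (-1, z) = (z\<^sup>2 + kR\<^sup>2 + RR\<^sup>2) / 2" by (simp add: RR_sq)
qed

lemma energy_piece:
  assumes p: "piece (field 0) i \<gamma> a b" and t: "t \<in> {a..b}" "u \<in> {a..b}"
  shows "energy (\<gamma> t) = energy (\<gamma> u)"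
proof -
  obtain C where C: "\<And>q. q \<in> zone_set i \<Longrightarrow> energy q = (snd q)\<^sup>2 / 2 - \<mu> i / (2 * \<rho> i) * (fst q - s i)\<^sup>2 + C"
    using energy_zone by blast
  have fl: "\<gamma> t = flow 0 i (\<gamma> a) (t - a)" if "t \<in> {a..b}" for t
    by (rule flow_unique[OF _ _ that]) (use p zero_small in \<open>auto simp: piece_def small_def\<close>)
  have e: "energy (\<gamma> t) = (snd (\<gamma> a))\<^sup>2 / 2 - \<mu> i / (2 * \<rho> i) * (fst (\<gamma> a) - s i)\<^sup>2 + C" if "t \<in> {a..b}" for t
  proof -
    have "\<gamma> t \<in> zone_set i" using p that by (simp add: piece_def)
    then show ?thesis using flow_first_integral[of 0 i "\<gamma> a" "t - a"] C fl[OF that] by (simp add: sx_def sz_def)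
  qed
  show ?thesis unfolding e[OF t(1)] e[OF t(2)] ..
qed

lemma energy_trajectory:
  assumes \<gamma>: "trajectory (field 0) \<gamma>"
  shows "energy (\<gamma> t) = energy (\<gamma> u)"
proof (rule connected_local_const[of UNIV _ _ "\<lambda>t. energy (\<gamma> t)"])
  show "\<forall>a\<in>UNIV. \<forall>\<^sub>F b in at a. energy (\<gamma> a) = energy (\<gamma> b)"
  proof
    fix a :: real
    obtain i d where d: "d > 0" "piece (field 0) i \<gamma> a (a + d)" using \<gamma> unfolding trajectory_iff by blast
    obtain j e where e: "e > 0" "piece (field 0) j \<gamma> (a - e) a" using \<gamma> unfolding trajectory_iff by blast
    show "\<forall>\<^sub>F b in at a. energy (\<gamma> a) = energy (\<gamma> b)"
      unfolding eventually_at
    proof (intro exI[of _ "min d e"] conjI ballI impI)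
      show "0 < min d e" using d e by simp
      fix b assume "b \<noteq> a \<and> dist b a < min d e"
      then have "a \<le> b \<and> b \<le> a + d \<or> a - e \<le> b \<and> b \<le> a" by (auto simp: dist_real_def)
      then show "energy (\<gamma> a) = energy (\<gamma> b)"
      proof
        assume "a \<le> b \<and> b \<le> a + d"
        then show ?thesis using d by (intro energy_piece[OF d(2)]) simp_all
      next
        assume "a - e \<le> b \<and> b \<le> a"
        then show ?thesis using e by (intro energy_piece[OF e(2)]) simp_all
      qed
    qed
  qed
qed simp_all

context
  fixes \<gamma> :: "real \<Rightarrow> plane" and T :: real
  assumes \<gamma>: "trajectory (field 0) \<gamma>" and T: "0 < T" and per: "\<And>t. \<gamma> (t + T) = \<gamma> t"
begin

lemma later: "\<exists>t'>t0. \<gamma> t' = \<gamma> t"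
proof -
  have shift: "\<gamma> (t + of_nat n * T) = \<gamma> t" for n
  proof (induction n)
    case (Suc n)
    have "t + of_nat (Suc n) * T = t + of_nat n * T + T" by (simp add: algebra_simps)
    then show ?case using per Suc by metis
  qed simp
  obtain n where "t0 - t < of_nat n * T" using reals_Archimedean3[OF T] by blast
  then have "t0 < t + of_nat n * T" by simp
  then show ?thesis using shift by blast
qed

lemma arc_in_range:
  assumes "det_path (field 0) c S" "c 0 \<in> range \<gamma>" "0 \<le> v" "v \<le> S"
  shows "c v \<in> range \<gamma>"
proof -
  obtain t0 where t0: "\<gamma> t0 = c 0" using assms(2) by (metis rangeE)
  have "\<gamma> (t0 + v) = c v"
    by (rule det_path_follow[OF unique_pieces_field[OF zero_small] assms(1) \<gamma> t0 assms(3,4)])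
  then show ?thesis by (metis rangeI)
qed

lemma transit_in_range:
  assumes t: "transit field x0 y0 x1 q0 B k S P c S'" and start: "(x0, y0) \<in> range \<gamma>"
  shows "(x1, q0) \<in> range \<gamma>"
proof -
  note b = transit_base[OF t]
  have "0 < S' 0 y0" using b(1) by (simp add: det_path_def)
  then show ?thesis using arc_in_range[OF b(1), of "S' 0 y0"] b start by simp
qed

lemma continuous_fst: "continuous_on A (\<lambda>t. d * fst (\<gamma> t))"
  by (intro continuous_intros continuous_at_imp_continuous_on ballI trajectory_isCont[OF \<gamma>])

context
  fixes i :: zone and d w l :: real
  assumes side: "i = RightZone \<and> d = 1 \<or> i = LeftZone \<and> d = -1"
    and w: "w = saddle_width (\<rho> i) (\<mu> i) (s i) d" and l: "l = sqrt (\<rho> i * \<mu> i)"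
begin

lemma d_sign: "d = 1 \<or> d = -1" and \<mu>_side: "\<mu> i > 0" and geo: "leg_geometry i d d d (- d)"
  using side \<mu>R \<mu>L by (auto simp: leg_geometry_def)

lemma exit_point:
  assumes t0: "d * fst (\<gamma> t0) < 1" and t1: "d * fst (\<gamma> t1) > 1"
    and nz: "\<And>t. fst (\<gamma> t) = d \<Longrightarrow> snd (\<gamma> t) \<noteq> 0"
  shows "\<exists>v>0. (d, d * v) \<in> range \<gamma>"
proof -
  obtain t2 where t2: "t2 > t0" "\<gamma> t2 = \<gamma> t1" using later by blast
  define N where "N = {t0..t2} \<inter> {t. d * fst (\<gamma> t) \<le> 1}"
  have cl: "closed N" unfolding N_def by (intro closed_Int closed_Collect_le continuous_fst) simp_all
  have ne: "N \<noteq> {}" and bdd: "bdd_above N" using t0 t2 by (force simp: N_def, auto simp: N_def)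
  define u where "u = Sup N"
  have uN: "u \<in> N" unfolding u_def by (rule closed_contains_Sup[OF ne bdd cl])
  have u2: "u < t2" using uN t2 t1 by (cases "u = t2") (auto simp: N_def)
  have gt: "d * fst (\<gamma> t) > 1" if "u < t" "t \<le> t2" for t
  proof (rule ccontr)
    assume "\<not> ?thesis"
    then have "t \<in> N" using that uN by (simp add: N_def)
    then show False using cSup_upper[OF _ bdd, of t] that by (simp add: u_def)
  qed
  have eq: "d * fst (\<gamma> u) = 1"
  proof (rule ccontr)
    assume "d * fst (\<gamma> u) \<noteq> 1"
    then have lt: "d * fst (\<gamma> u) < 1" using uN by (simp add: N_def)
    obtain t where t: "u \<le> t" "t \<le> t2" "d * fst (\<gamma> t) = 1"
      using IVT'[of "\<lambda>t. d * fst (\<gamma> t)" u 1 t2] lt t1 t2 u2 continuous_fst by force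
    then show False using gt[of t] lt by (cases "u = t") auto
  qed
  have x: "fst (\<gamma> u) = d" using eq d_sign by auto
  obtain j e where e: "e > 0" "piece (field 0) j \<gamma> u (u + e)" using \<gamma> unfolding trajectory_iff by blast
  define e' where "e' = min e (t2 - u)"
  have e': "e' > 0" "u + e' \<le> t2" using e u2 by (simp_all add: e'_def)
  have pc: "piece (field 0) j \<gamma> u (u + e')" by (rule piece_subset[OF e(2)]) (simp_all add: e'_def)
  have F: "fst (field 0 j (\<gamma> u)) = \<rho> j * snd (\<gamma> u)" by (simp add: field_def)
  have ge: "d * fst (\<gamma> t) \<ge> 1" if "t \<in> {u..u + e'}" for t
    using gt[of t] eq that e' by (cases "t = u") auto
  have "\<not> d * snd (\<gamma> u) < 0"
  proof
    assume neg: "d * snd (\<gamma> u) < 0"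
    from d_sign show False
    proof
      assume d: "d = 1"
      have "fst (field 0 j (\<gamma> u)) < 0" unfolding F using neg d \<rho>_pos[of j] by (simp add: mult_pos_neg)
      from piece_fst_decreases[OF pc _ this] obtain t where "t \<in> {u..u + e'}" "fst (\<gamma> t) < fst (\<gamma> u)" using e' by auto
      then show False using ge[of t] x d by simp
    next
      assume d: "d = -1"
      have "fst (field 0 j (\<gamma> u)) > 0" unfolding F using neg d \<rho>_pos[of j] by simp
      from piece_fst_increases[OF pc _ this] obtain t where "t \<in> {u..u + e'}" "fst (\<gamma> t) > fst (\<gamma> u)" using e' by auto
      then show False using ge[of t] x d by simp
    qed
  qed
  then have "d * snd (\<gamma> u) > 0" using nz[OF x] d_sign by auto
  moreover have "(d, d * (d * snd (\<gamma> u))) = \<gamma> u" using x d_sign by (auto simp: prod_eq_iff)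
  ultimately show ?thesis by (metis rangeI)
qed

lemma exits:
  assumes v: "0 < v" and start: "(d, d * v) \<in> range \<gamma>"
  shows "\<exists>t. d * fst (\<gamma> t) > 1"
proof -
  obtain u where u: "\<gamma> u = (d, d * v)" using start by (metis rangeE)
  obtain j e where e: "e > 0" "piece (field 0) j \<gamma> u (u + e)" using \<gamma> unfolding trajectory_iff by blast
  have F: "fst (field 0 j (\<gamma> u)) = \<rho> j * (d * v)" by (simp add: field_def u)
  from d_sign show ?thesis
  proof
    assume d: "d = 1"
    have "fst (field 0 j (\<gamma> u)) > 0" unfolding F using v d \<rho>_pos[of j] by simp
    from piece_fst_increases[OF e(2) _ this] e(1) show ?thesis by (auto simp: u d)
  next
    assume d: "d = -1"
    have "fst (field 0 j (\<gamma> u)) < 0" unfolding F using v d \<rho>_pos[of j] by simp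
    from piece_fst_decreases[OF e(2) _ this] e(1) obtain t where "fst (\<gamma> t) < -1" by (auto simp: u d)
    then show ?thesis by (intro exI[of _ t]) (simp add: d)
  qed
qed

lemma below_separatrix:
  assumes v: "0 < v" and start: "(d, d * v) \<in> range \<gamma>" and t0: "d * fst (\<gamma> t0) < 1"
  shows "v < w"
proof (rule ccontr)
  assume "\<not> v < w"
  then have wv: "w \<le> v" by simp
  let ?c = "flow 0 i (d, d * v)"
  have out: "\<exists>h>0. fst (?c t) = d + d * h" if "t > 0" for t
  proof -
    define Q where "Q = exp (l * t)"
    have l0: "l > 0" by (rule saddle_rate(1)[OF \<mu>_side d_sign w l])
    have Q: "Q > 1" using that l0 by (simp add: Q_def)
    have "(v - w) * 1 \<le> (v - w) * Q" using wv Q by (intro mult_left_mono) simp_all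
    then have "(w + v) - Q * (w - v) > 0" using v by (simp add: algebra_simps)
    then have "\<rho> i / l * (Q - 1) * ((w + v) - Q * (w - v)) / (2 * Q) > 0"
      using Q l0 \<rho>_pos[of i] by (intro divide_pos_pos mult_pos_pos) auto
    then show ?thesis using saddle_flow(1)[OF \<mu>_side d_sign w l Q_def] by blast
  qed
  obtain u where u: "\<gamma> u = (d, d * v)" using start by (metis rangeE)
  obtain t where t: "t > u" "\<gamma> t = \<gamma> t0" using later by blast
  have intr: "?c v' \<in> interior (zone_set i)" if "0 < v'" for v'
    using out[OF that] side by (auto simp: interior_zone_iff)
  have dp: "det_path (field 0) ?c (t - u + 1)"
  proof (rule det_path_arc)
    show "0 < t - u + 1" using t by simp
    show "enters (field 0) i (?c 0)"
      unfolding flow_0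
    proof (rule leg_enters[OF geo])
      show "0 < fst (field 0 j (d, d * v)) * d" for j using d_sign v \<rho>_pos[of j] by (auto simp: field_def)
    qed
    show "piece (field 0) i ?c 0 (t - u + 1)"
      unfolding piece_def
    proof (intro ballI conjI)
      fix a assume a: "a \<in> {0..t - u + 1}"
      show "(?c has_vector_derivative field 0 i (?c a)) (at a within {0..t - u + 1})"
        by (rule flow_derivative) (use zero_small in \<open>simp add: small_def\<close>)
      show "?c a \<in> zone_set i"
      proof (cases "a = 0")
        case True
        then show ?thesis using side by auto
      next
        case False
        then show ?thesis using intr[of a] a interior_subset[of "zone_set i"] by auto
      qed
    qed
  qed (rule intr)
  have "\<gamma> (u + (t - u)) = ?c (t - u)"
    by (rule det_path_follow[OF unique_pieces_field[OF zero_small] dp \<gamma>]) (use u t in simp_all)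
  then have "\<gamma> t0 = ?c (t - u)" using t(2) by simp
  moreover obtain h where "h > 0" "fst (?c (t - u)) = d + d * h" using out[of "t - u"] t by auto
  ultimately have "d * fst (\<gamma> t0) = d * d + d * d * h" by (simp add: algebra_simps)
  also have "\<dots> > 1" using \<open>h > 0\<close> d_sign by auto
  finally show False using t0 by simp
qed

end

context
  assumes nz: "\<And>t. fst (\<gamma> t) = 1 \<or> fst (\<gamma> t) = -1 \<Longrightarrow> snd (\<gamma> t) \<noteq> 0" and mC: "m CentralZone = 0"
begin

lemma right_part:
  assumes "fst (\<gamma> t1) > 1" "fst (\<gamma> t0) < 1"
  shows "\<exists>r>0. r < wR \<and> (1, r) \<in> range \<gamma> \<and> (1, - r) \<in> range \<gamma>"
proof -
  obtain r where r: "r > 0" "(1, r) \<in> range \<gamma>"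
    using exit_point[of RightZone 1, OF _ refl refl, of t0 t1] assms nz by auto
  have "r < wR" using below_separatrix[of RightZone 1, OF _ wR_def refl r(1), of t0] r(2) assms(2)
    by simp
  then show ?thesis using transit_in_range[OF right_transit] r by blast
qed

lemma left_part:
  assumes "fst (\<gamma> t1) < -1" "fst (\<gamma> t0) > -1"
  shows "\<exists>v>0. v < wL \<and> (1, sqrt (v\<^sup>2 + RR\<^sup>2)) \<in> range \<gamma>"
proof -
  obtain v where v: "v > 0" "(-1, - v) \<in> range \<gamma>"
    using exit_point[of LeftZone "-1", OF _ refl refl, of t0 t1] assms nz by auto
  have vL: "v < wL" using below_separatrix[of LeftZone "-1", OF _ wL_def refl v(1), of t0] v(2) assms(2)
    by simp
  have 1: "(-1, v) \<in> range \<gamma>" by (rule transit_in_range[OF left_transit[OF v(1) vL] v(2)])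
  define r where "r = sqrt (v\<^sup>2 + RR\<^sup>2)"
  have rR: "RR < r" unfolding r_def using v(1) RR_pos by (intro real_less_rsqrt) simp
  have rv: "v = sqrt (r\<^sup>2 - RR\<^sup>2)" using v(1) by (simp add: r_def)
  have r0: "0 < r" using rR RR_pos by simp
  have "(1, r) \<in> range \<gamma>" by (rule transit_in_range[OF central_top[OF r0 refl refl rR rv refl mC] 1])
  then show ?thesis using v(1) vL by (auto simp: r_def)
qed

lemma left_imp_right:
  assumes "fst (\<gamma> t1) < -1" "fst (\<gamma> t0) > -1" shows "\<exists>t. fst (\<gamma> t) > 1"
proof -
  obtain v where v: "v > 0" "(1, sqrt (v\<^sup>2 + RR\<^sup>2)) \<in> range \<gamma>" using left_part[OF assms] by blast
  have "sqrt (v\<^sup>2 + RR\<^sup>2) > 0" using v(1) by (simp add: add_pos_nonneg)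
  from exits[of RightZone 1, OF _ refl refl this] v(2) show ?thesis by simp
qed

lemma three_zone_orbit:
  assumes "fst (\<gamma> t1) < -1" "fst (\<gamma> t2) > 1"
  shows "\<exists>r>RR. r < wR \<and> 0 < wL \<and> (1, r) \<in> range \<gamma>"
proof -
  have "fst (\<gamma> t2) > -1" using assms(2) by simp
  from left_part[OF assms(1) this] obtain v where v: "v > 0" "v < wL" "(1, sqrt (v\<^sup>2 + RR\<^sup>2)) \<in> range \<gamma>" by blast
  define r where "r = sqrt (v\<^sup>2 + RR\<^sup>2)"
  have rR: "RR < r" unfolding r_def using v(1) RR_pos by (intro real_less_rsqrt) simp
  have r0: "0 < r" using rR RR_pos by simp
  have "(1, r) \<in> range \<gamma>" using v(3) by (simp add: r_def)
  then have "r < wR" using below_separatrix[of RightZone 1, OF _ wR_def refl r0, of t1] assms(1) by simp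
  then show ?thesis using rR v by (intro exI[of _ r]) (simp add: r_def)
qed

lemma reaches_tangency:
  assumes start: "(1, - RR) \<in> range \<gamma>" shows False
proof -
  define \<theta> where "\<theta> = arctan (kR / RR)"
  define A where "A = sqrt (RR\<^sup>2 + kR\<^sup>2)"
  note am = amplitude[OF RR_pos \<theta>_def A_def] and an = angle[OF RR_pos \<theta>_def A_def]
  define u where "u = - (pi / 2 + \<theta>)"
  have AkL: "A = kL" using RR_sq kL_pos by (simp add: A_def)
  have st: "(1, - RR) = (p - A * cos u / \<omega>, A * sin u)"
    using starts[OF RR_pos \<theta>_def A_def] am(2) by (simp add: u_def sin_minus an(4) cos_minus del: minus_add_distrib)
  let ?c = "flow 0 CentralZone (1, - RR)"
  have fl: "?c t = (p - A * cos (u + \<omega> * t) / \<omega>, A * sin (u + \<omega> * t))" for t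
    unfolding st by (rule central_flow[OF \<omega> center])
  define \<tau> where "\<tau> = (pi / 2 + \<theta>) / \<omega>"
  have \<tau>: "\<tau> > 0" "u + \<omega> * \<tau> = 0" using an(1) \<omega> by (simp_all add: \<tau>_def u_def)
  have intr: "?c t \<in> interior (zone_set CentralZone)" if "0 < t" "t < \<tau>" for t
  proof -
    have r: "0 < - (u + \<omega> * t)" "- (u + \<omega> * t) < pi / 2 + \<theta>"
      using mult_strict_left_mono[OF that(2) \<omega>] mult_pos_pos[OF \<omega> that(1)] \<tau>(2) unfolding u_def by linarith+
    have "cos (pi / 2 + \<theta>) < cos (- (u + \<omega> * t))" "cos (- (u + \<omega> * t)) < cos 0"
      using r an(1,2) by (intro cos_monotone_0_pi; linarith)+
    then have c: "- sin \<theta> < cos (u + \<omega> * t)" "cos (u + \<omega> * t) < 1" unfolding an(3) cos_minus by simp_all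
    have "A * (- sin \<theta>) < A * cos (u + \<omega> * t)" "A * cos (u + \<omega> * t) < A * 1"
      using c am(1) by (intro mult_strict_left_mono; simp)+
    then have "\<omega> * (p - 1) < A * cos (u + \<omega> * t)" "A * cos (u + \<omega> * t) < \<omega> * (p + 1)"
      using am(3) AkL by (simp_all add: kR_def kL_def algebra_simps)
    then have "p - 1 < A * cos (u + \<omega> * t) / \<omega>" "A * cos (u + \<omega> * t) / \<omega> < p + 1"
      using \<omega> by (simp_all add: less_divide_eq divide_less_eq mult.commute)
    then have "fst (?c t) \<in> {-1<..<1}" unfolding fl by simp
    then show ?thesis by (simp add: interior_zone_iff)
  qed
  have fin: "?c \<tau> = (-1, 0)" unfolding fl \<tau>(2) using \<omega> by (simp add: AkL kL_def field_simps)
  have "det_path (field 0) ?c \<tau>"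
  proof (rule det_path_arc[OF \<tau>(1) _ _ intr])
    show "enters (field 0) CentralZone (?c 0)" unfolding flow_0
      by (rule enters_central_from_right) (use RR_pos \<rho>_pos[of RightZone] in \<open>simp_all add: field_def\<close>)
    show "piece (field 0) CentralZone ?c 0 \<tau>"
      unfolding piece_def
    proof (intro ballI conjI)
      fix a assume a: "a \<in> {0..\<tau>}"
      show "(?c has_vector_derivative field 0 CentralZone (?c a)) (at a within {0..\<tau>})"
        by (rule flow_derivative) (use zero_small in \<open>simp add: small_def\<close>)
      consider "a = 0" | "a = \<tau>" | "0 < a" "a < \<tau>" using a by fastforce
      then show "?c a \<in> zone_set CentralZone"
      proof cases
        case 3
        then show ?thesis using intr[of a] interior_subset[of "zone_set CentralZone"] by blast
      qed (simp_all add: fin)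
    qed
  qed
  from arc_in_range[OF this, of \<tau>] have "(-1, 0) \<in> range \<gamma>" using start \<tau>(1) fin by simp
  then obtain t where "(-1, 0) = \<gamma> t" by (rule rangeE)
  then show False using nz[of t] by (metis fst_conv snd_conv)
qed

lemma two_zone_orbit:
  assumes "fst (\<gamma> t1) > 1" "fst (\<gamma> t0) < 1" and nl: "\<And>t. \<not> fst (\<gamma> t) < -1"
  shows "\<exists>r>0. r < RR \<and> (1, r) \<in> range \<gamma>"
proof -
  obtain r where r: "r > 0" "r < wR" "(1, r) \<in> range \<gamma>" "(1, - r) \<in> range \<gamma>" using right_part[OF assms(1,2)] by blast
  have "r < RR"
  proof (rule ccontr)
    assume "\<not> r < RR"
    then consider "r = RR" | "RR < r" by linarith
    then show False
    proof cases
      case 1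
      then show False using reaches_tangency r(4) by simp
    next
      case 2
      define v where "v = sqrt (r\<^sup>2 - RR\<^sup>2)"
      have v0: "0 < v" by (rule v_pos[OF r(1) refl refl 2 v_def refl mC])
      have "(-1, - v) \<in> range \<gamma>"
        by (rule transit_in_range[OF central_bottom[OF r(1) refl refl 2 v_def refl mC] r(4)])
      then have "\<exists>t. -1 * fst (\<gamma> t) > 1"
        by (intro exits[of LeftZone "-1", OF _ refl refl v0]) simp_all
      then obtain t where "-1 * fst (\<gamma> t) > 1" by (elim exE)
      then have "fst (\<gamma> t) < -1" by simp
      then show False using nl by blast
    qed
  qed
  then show ?thesis using r by blast
qed

end

end

end


lemma continuous_path_between:
  fixes f :: "real \<Rightarrow> real"
  assumes "\<And>t. isCont f t" "f t0 \<le> y" "y \<le> f t1"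
  shows "\<exists>t. f t = y"
proof -
  have "connected (range f)"
    by (intro connected_continuous_image continuous_at_imp_continuous_on) (use assms(1) in auto)
  then have "y \<in> range f" using assms(2,3) unfolding connected_iff_interval by (metis rangeI)
  then show ?thesis by auto
qed

context center_saddle begin

context
  assumes mC: "m CentralZone = 0"
begin

lemma crossing_orbit_through:
  assumes cr: "crossing_periodic_orbit (field 0) \<Gamma>"
  shows "card (zones_visited \<Gamma>) = 3 \<Longrightarrow> \<exists>r>RR. r < wR \<and> 0 < wL \<and> (1, r) \<in> \<Gamma>"
    and "card (zones_visited \<Gamma>) = 2 \<Longrightarrow> \<exists>r>0. r < RR \<and> (1, r) \<in> \<Gamma>"
proof -
  obtain \<gamma> T where \<gamma>: "trajectory (field 0) \<gamma>" "0 < T" "\<And>t. \<gamma> (t + T) = \<gamma> t" and \<Gamma>: "\<Gamma> = range \<gamma>"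
    using cr unfolding crossing_periodic_orbit_def periodic_orbit_def periodic_solution_def by blast
  have nz: "snd (\<gamma> t) \<noteq> 0" if "fst (\<gamma> t) = 1 \<or> fst (\<gamma> t) = -1" for t
  proof -
    have "\<gamma> t \<in> \<Gamma> \<inter> switching_lines" using that by (auto simp: \<Gamma> switching_lines_def)
    then have "crossing_point (field 0) (\<gamma> t)" using cr unfolding crossing_periodic_orbit_def by blast
    then show ?thesis by (auto simp: crossing_point_def field_def)
  qed
  have zv: "i \<in> zones_visited \<Gamma> \<longleftrightarrow> (\<exists>t. fst (\<gamma> t) \<in> zint i)" for i
    unfolding zones_visited_def \<Gamma> mem_Collect_eq interior_zone_iff[symmetric] by blast
  have UN: "UNIV = {LeftZone, CentralZone, RightZone}" using zone.exhaust by blast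
  have all: "zones_visited \<Gamma> = UNIV" if LR: "LeftZone \<in> zones_visited \<Gamma>" "RightZone \<in> zones_visited \<Gamma>"
  proof -
    obtain t0 t1 where t: "fst (\<gamma> t0) < -1" "fst (\<gamma> t1) > 1" using LR unfolding zv by auto
    have "\<exists>t. fst (\<gamma> t) = 0"
      by (rule continuous_path_between[of _ t0 _ t1])
        (use t in \<open>auto intro: continuous_intros trajectory_isCont[OF \<gamma>(1)]\<close>)
    then obtain t where "fst (\<gamma> t) = 0" ..
    then have "fst (\<gamma> t) \<in> zint CentralZone" by simp
    then have "CentralZone \<in> zones_visited \<Gamma>" unfolding zv by (rule exI)
    then have "UNIV \<subseteq> zones_visited \<Gamma>" using LR unfolding UN by simp
    then show ?thesis by (rule antisym[OF subset_UNIV])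
  qed
  note orb = \<gamma> nz mC
  show "\<exists>r>RR. r < wR \<and> 0 < wL \<and> (1, r) \<in> \<Gamma>" if c3: "card (zones_visited \<Gamma>) = 3"
  proof -
    have fin: "finite (UNIV :: zone set)" "card (UNIV :: zone set) = 3" unfolding UN by simp_all
    have "zones_visited \<Gamma> = UNIV" by (rule card_subset_eq[OF fin(1)]) (use c3 fin in auto)
    then have "\<exists>t. fst (\<gamma> t) \<in> zint LeftZone" "\<exists>t. fst (\<gamma> t) \<in> zint RightZone" using zv by blast+
    then obtain t0 t1 where t: "fst (\<gamma> t0) < -1" "fst (\<gamma> t1) > 1" by auto
    show ?thesis unfolding \<Gamma> by (rule three_zone_orbit[OF orb t])
  qed
  show "\<exists>r>0. r < RR \<and> (1, r) \<in> \<Gamma>" if c2: "card (zones_visited \<Gamma>) = 2"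
  proof -
    have fin: "finite (zones_visited \<Gamma>)" using c2 card.infinite by fastforce
    have nl: "LeftZone \<notin> zones_visited \<Gamma>"
    proof
      assume L: "LeftZone \<in> zones_visited \<Gamma>"
      have "\<not> zones_visited \<Gamma> \<subseteq> {LeftZone}" using c2 card_mono[of "{LeftZone}" "zones_visited \<Gamma>"] by auto
      then obtain j where j: "j \<in> zones_visited \<Gamma>" "j \<noteq> LeftZone" by blast
      obtain t1 where t1: "fst (\<gamma> t1) < -1" using L unfolding zv by auto
      have "\<exists>t. fst (\<gamma> t) \<in> zint j" using j(1) zv by blast
      then obtain t0 where "fst (\<gamma> t0) \<in> zint j" ..
      then have t0: "fst (\<gamma> t0) > -1" using j(2) by (cases j) simp_all
      have "\<exists>t. fst (\<gamma> t) \<in> zint RightZone" using left_imp_right[OF orb t1 t0] by simp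
      then have "RightZone \<in> zones_visited \<Gamma>" unfolding zv .
      from all[OF L this] have "card (zones_visited \<Gamma>) = card {LeftZone, CentralZone, RightZone}" unfolding UN by (rule arg_cong)
      then show False using c2 by simp
    qed
    have sub: "zones_visited \<Gamma> \<subseteq> {CentralZone, RightZone}"
    proof
      fix i assume "i \<in> zones_visited \<Gamma>"
      then show "i \<in> {CentralZone, RightZone}" using nl by (cases i) simp_all
    qed
    have "card {CentralZone, RightZone} = 2" by simp
    then have "zones_visited \<Gamma> = {CentralZone, RightZone}"
      by (intro card_subset_eq[OF _ sub]) (simp_all only: c2 finite.intros)
    then have "\<exists>t. fst (\<gamma> t) \<in> zint CentralZone" "\<exists>t. fst (\<gamma> t) \<in> zint RightZone" using zv by blast+
    then obtain t0 t1 where t: "fst (\<gamma> t1) > 1" "fst (\<gamma> t0) < 1" by auto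
    have nl': "\<not> fst (\<gamma> t) < -1" for t
    proof
      assume "fst (\<gamma> t) < -1"
      then have "fst (\<gamma> t) \<in> zint LeftZone" by simp
      then show False using nl unfolding zv by (elim notE) (rule exI)
    qed
    show ?thesis unfolding \<Gamma> by (rule two_zone_orbit[OF orb t nl'])
  qed
qed

theorem annulus_leaves:
  assumes J: "connected J" "h2 \<in> J" "h3 \<in> J" and f: "continuous_on J f" "\<And>h. h \<in> J \<Longrightarrow> f h \<in> \<Gamma> h"
    and po: "\<And>h. h \<in> J \<Longrightarrow> periodic_orbit (field 0) (\<Gamma> h)"
    and alt: "\<And>h. h \<in> J \<Longrightarrow> (crossing_periodic_orbit (field 0) (\<Gamma> h) \<and> card (zones_visited (\<Gamma> h)) \<in> {2, 3}) \<or>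
      (1, 0) \<in> \<Gamma> h \<or> (-1, 0) \<in> \<Gamma> h"
    and h2: "crossing_periodic_orbit (field 0) (\<Gamma> h2)" "card (zones_visited (\<Gamma> h2)) = 2"
    and h3: "crossing_periodic_orbit (field 0) (\<Gamma> h3)" "card (zones_visited (\<Gamma> h3)) = 3"
  shows "RR < wR" "0 < wL"
    "\<exists>e>0. \<forall>r c T. RR - e < r \<longrightarrow> r < RR + e \<longrightarrow> r \<noteq> RR \<longrightarrow> det_path (base_field \<rho> \<mu> s) c T \<longrightarrow>
      c 0 = (1, r) \<longrightarrow> c T = (1, r) \<longrightarrow> (\<exists>h\<in>J. c ` {0..T} = \<Gamma> h \<and> (1, 0) \<notin> \<Gamma> h \<and> (-1, 0) \<notin> \<Gamma> h)"
proof -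
  obtain r3 where r3: "RR < r3" "r3 < wR" "0 < wL" "(1, r3) \<in> \<Gamma> h3" using crossing_orbit_through(1)[OF h3] by blast
  obtain r2 where r2: "0 < r2" "r2 < RR" "(1, r2) \<in> \<Gamma> h2" using crossing_orbit_through(2)[OF h2] by blast
  show "RR < wR" "0 < wL" using r3 by simp_all
  have level: "energy q = energy q'" if q: "h \<in> J" "q \<in> \<Gamma> h" "q' \<in> \<Gamma> h" for h q q'
  proof -
    obtain \<gamma> T where "trajectory (field 0) \<gamma>" "\<Gamma> h = range \<gamma>"
      using po[OF q(1)] unfolding periodic_orbit_def periodic_solution_def by blast
    then show ?thesis using energy_trajectory q(2,3) by (metis rangeE)
  qed
  have conn: "connected ((\<lambda>h. energy (f h)) ` J)"
    by (intro connected_continuous_image J(1) continuous_on_compose2[OF continuous_energy f(1)]) simp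
  have lev: "energy (f h2) = (r2\<^sup>2 + kR\<^sup>2) / 2" "energy (f h3) = (r3\<^sup>2 + kR\<^sup>2) / 2"
    using level[OF J(2) f(2)[OF J(2)] r2(3)] level[OF J(3) f(2)[OF J(3)] r3(4)] by (simp_all add: energy_right)
  define e where "e = min (RR - r2) (r3 - RR)"
  show "\<exists>e>0. \<forall>r c T. RR - e < r \<longrightarrow> r < RR + e \<longrightarrow> r \<noteq> RR \<longrightarrow> det_path (base_field \<rho> \<mu> s) c T \<longrightarrow>
      c 0 = (1, r) \<longrightarrow> c T = (1, r) \<longrightarrow> (\<exists>h\<in>J. c ` {0..T} = \<Gamma> h \<and> (1, 0) \<notin> \<Gamma> h \<and> (-1, 0) \<notin> \<Gamma> h)"
  proof (intro exI[of _ e] conjI allI impI)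
    show "e > 0" using r2 r3 by (simp add: e_def)
    fix r c T assume r: "RR - e < r" "r < RR + e" "r \<noteq> RR" and dp: "det_path (base_field \<rho> \<mu> s) c T"
      and c: "c 0 = (1, r)" "c T = (1, r)"
    have rr: "r2 < r" "r < r3" using r unfolding e_def by linarith+
    have r0: "0 < r" using rr r2 by simp
    have "r2\<^sup>2 \<le> r\<^sup>2" "r\<^sup>2 \<le> r3\<^sup>2" using rr r2 by (intro power_mono; linarith)+
    then have "energy (f h2) \<le> (r\<^sup>2 + kR\<^sup>2) / 2" "(r\<^sup>2 + kR\<^sup>2) / 2 \<le> energy (f h3)" unfolding lev by simp_all
    moreover have "energy (f h2) \<in> (\<lambda>h. energy (f h)) ` J" "energy (f h3) \<in> (\<lambda>h. energy (f h)) ` J" using J by simp_all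
    ultimately have "(r\<^sup>2 + kR\<^sup>2) / 2 \<in> (\<lambda>h. energy (f h)) ` J" using conn unfolding connected_iff_interval by blast
    then obtain h where h: "h \<in> J" "energy (f h) = (r\<^sup>2 + kR\<^sup>2) / 2" by auto
    have en: "energy q = (r\<^sup>2 + kR\<^sup>2) / 2" if "q \<in> \<Gamma> h" for q using level[OF h(1) that f(2)[OF h(1)]] h(2) by simp
    have n1: "(1, 0) \<notin> \<Gamma> h" using en[of "(1, 0)"] r0 by (auto simp: energy_right)
    have n2: "(-1, 0) \<notin> \<Gamma> h"
    proof
      assume "(-1, 0) \<in> \<Gamma> h"
      then have "r\<^sup>2 = RR\<^sup>2" using en[of "(-1, 0)"] by (simp add: energy_left)
      then show False using r(3) r0 RR_pos by (simp add: power2_eq_iff_nonneg)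
    qed
    have cr: "crossing_periodic_orbit (field 0) (\<Gamma> h)" "card (zones_visited (\<Gamma> h)) \<in> {2, 3}"
      using alt[OF h(1)] n1 n2 by simp_all
    have "\<exists>r'>0. (1, r') \<in> \<Gamma> h"
    proof (cases "card (zones_visited (\<Gamma> h)) = 3")
      case True
      then show ?thesis using crossing_orbit_through(1)[OF cr(1)] RR_pos by (meson less_trans)
    next
      case False
      then show ?thesis using crossing_orbit_through(2)[OF cr(1)] cr(2) by blast
    qed
    then obtain r' where r': "0 < r'" "(1, r') \<in> \<Gamma> h" by blast
    have "r'\<^sup>2 = r\<^sup>2" using en[OF r'(2)] by (simp add: energy_right)
    then have "r' = r" using r' r0 by (simp add: power2_eq_iff_nonneg)
    then have start: "(1, r) \<in> \<Gamma> h" using r'(2) by simp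
    obtain \<gamma> T' where \<gamma>: "trajectory (field 0) \<gamma>" "0 < T'" "\<And>t. \<gamma> (t + T') = \<gamma> t" and \<Gamma>: "\<Gamma> h = range \<gamma>"
      using po[OF h(1)] unfolding periodic_orbit_def periodic_solution_def by blast
    obtain t0 where "\<gamma> t0 = (1, r)" using start unfolding \<Gamma> by (metis rangeE)
    then have "range \<gamma> = c ` {0..T}"
      by (intro trajectory_range_closed_path[OF unique_pieces_field[OF zero_small] dp[folded field_0] _ \<gamma>])
        (simp_all add: c)
    then show "\<exists>h\<in>J. c ` {0..T} = \<Gamma> h \<and> (1, 0) \<notin> \<Gamma> h \<and> (-1, 0) \<notin> \<Gamma> h" using h(1) n1 n2 \<Gamma> by metis
  qed
qed

end

end

section \<open>The hypotheses on the coefficients\<close>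

lemma saddle_coefficients:
  assumes "is_saddle (unperturbed a b c \<alpha> \<beta> i) p"
  shows "(a i)\<^sup>2 + b i * c i > 0"
proof -
  let ?V = "unperturbed a b c \<alpha> \<beta> i" and ?M = "\<lambda>v :: plane. (b i * snd v + a i * fst v, c i * fst v - a i * snd v)"
  have bl: "bounded_linear ?M"
    by (intro bounded_linear_Pair bounded_linear_add bounded_linear_sub bounded_linear_const_mult
        bounded_linear_fst bounded_linear_snd)
  have V: "?V = (\<lambda>q. ?M q + (\<alpha> i, \<beta> i))" by (intro ext) (simp add: unperturbed_eq)
  have "(?V has_derivative ?M) (at p)"
    unfolding V by (rule has_derivative_eq_rhs[OF has_derivative_add[OF bounded_linear_imp_has_derivative[OF bl] has_derivative_const]]) simp
  then have "frechet_derivative ?V (at p) = ?M" by (rule frechet_derivative_at[symmetric])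
  moreover obtain l w where lw: "0 < l" "w \<noteq> 0" "frechet_derivative ?V (at p) w = l *\<^sub>R w"
    using assms unfolding is_saddle_def by blast
  ultimately have w: "b i * snd w + a i * fst w = l * fst w" "c i * fst w - a i * snd w = l * snd w"
    by (simp_all add: prod_eq_iff)
  have "((a i)\<^sup>2 + b i * c i) * fst w = a i * (b i * snd w + a i * fst w) + b i * (c i * fst w - a i * snd w)"
    by (simp add: power2_eq_square algebra_simps)
  also have "\<dots> = a i * (l * fst w) + b i * (l * snd w)" by (simp only: w)
  also have "\<dots> = l * (b i * snd w + a i * fst w)" by (simp add: algebra_simps)
  also have "\<dots> = l\<^sup>2 * fst w" unfolding w by (simp add: power2_eq_square)
  finally have 1: "((a i)\<^sup>2 + b i * c i) * fst w = l\<^sup>2 * fst w" .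
  have "((a i)\<^sup>2 + b i * c i) * snd w = c i * (b i * snd w + a i * fst w) - a i * (c i * fst w - a i * snd w)"
    by (simp add: power2_eq_square algebra_simps)
  also have "\<dots> = c i * (l * fst w) - a i * (l * snd w)" by (simp only: w)
  also have "\<dots> = l * (c i * fst w - a i * snd w)" by (simp add: algebra_simps)
  also have "\<dots> = l\<^sup>2 * snd w" unfolding w by (simp add: power2_eq_square)
  finally have 2: "((a i)\<^sup>2 + b i * c i) * snd w = l\<^sup>2 * snd w" .
  have "fst w \<noteq> 0 \<or> snd w \<noteq> 0" using lw(2) by (auto simp: prod_eq_iff)
  then have "(a i)\<^sup>2 + b i * c i = l\<^sup>2" using 1 2 by auto
  then show ?thesis using lw(1) by simp
qed

lemma periodic_convex_constant:
  fixes u v :: "real \<Rightarrow> real"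
  assumes u: "\<And>t. (u has_real_derivative v t) (at t)" and v: "\<And>t. (v has_real_derivative k * u t) (at t)"
    and k: "k \<ge> 0" and T: "T > 0" and per: "\<And>t. u (t + T) = u t" "\<And>t. v (t + T) = v t"
  shows "v t = 0"
proof -
  define g where "g = (\<lambda>t. u t * v t)"
  have dg: "(g has_real_derivative (v t)\<^sup>2 + k * (u t)\<^sup>2) (at t)" for t
    unfolding g_def by (rule derivative_eq_intros u v refl)+ (simp add: power2_eq_square algebra_simps)
  have mono: "g a \<le> g b" if "a \<le> b" for a b
  proof (rule DERIV_nonneg_imp_nondecreasing[OF that])
    show "\<exists>y. (g has_real_derivative y) (at x) \<and> 0 \<le> y" for x
      by (rule exI, rule conjI, rule dg) (use k in simp)
  qed
  have gT: "g (t + T) = g t" for t by (simp add: g_def per)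
  have const: "g x = g t" if "x \<in> {t - T..t + T}" for x
    using mono[of "t - T" x] mono[of x "t + T"] gT[of t] gT[of "t - T"] that by simp
  have "(g has_real_derivative 0) (at t)"
  proof (rule has_field_derivative_transform_within_open[of "\<lambda>_. g t"])
    show "open {t - T<..<t + T}" "t \<in> {t - T<..<t + T}" using T by simp_all
    show "g t = g x" if "x \<in> {t - T<..<t + T}" for x
      by (rule const[symmetric]) (use that in simp)
  qed simp
  then have "(v t)\<^sup>2 + k * (u t)\<^sup>2 = 0" by (rule DERIV_unique[OF dg])
  moreover have "0 \<le> k * (u t)\<^sup>2" using k by simp
  ultimately have "(v t)\<^sup>2 = 0" using zero_le_power2[of "v t"] by linarith
  then show ?thesis by simp
qed

lemma center_coefficients:
  assumes "is_center (unperturbed a b c \<alpha> \<beta> i) (px, py)"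
  shows "(a i)\<^sup>2 + b i * c i < 0" and "b i * py + a i * px + \<alpha> i = 0" "c i * px - a i * py + \<beta> i = 0"
proof -
  let ?V = "unperturbed a b c \<alpha> \<beta> i"
  show z: "b i * py + a i * px + \<alpha> i = 0" "c i * px - a i * py + \<beta> i = 0"
    using assms unfolding is_center_def by (simp_all add: unperturbed_eq prod_eq_iff)
  show "(a i)\<^sup>2 + b i * c i < 0"
  proof (rule ccontr)
    define k where "k = (a i)\<^sup>2 + b i * c i"
    assume "\<not> ?thesis"
    then have k: "k \<ge> 0" by (simp add: k_def)
    obtain U where U: "open U" "(px, py) \<in> U" "\<And>q. q \<in> U - {(px, py)} \<Longrightarrow> \<exists>\<Gamma>. closed_orbit ?V \<Gamma> \<and> q \<in> \<Gamma>"
      using assms[unfolded is_center_def, THEN conjunct2] by (elim exE conjE) (rule that, auto)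
    have "U \<noteq> {(px, py)}"
    proof
      assume "U = {(px, py)}"
      then show False using U(1) not_open_singleton[of "(px, py)"] by simp
    qed
    then obtain q where "q \<in> U - {(px, py)}" using U(2) by blast
    then have "\<exists>\<Gamma>. closed_orbit ?V \<Gamma> \<and> q \<in> \<Gamma>" by (rule U(3))
    then have "\<exists>\<gamma> T. (\<forall>t. (\<gamma> has_vector_derivative ?V (\<gamma> t)) (at t)) \<and> T > 0 \<and> (\<forall>t. \<gamma> (t + T) = \<gamma> t) \<and> inj_on \<gamma> {0..<T}"
      unfolding closed_orbit_def by (elim exE conjE) (intro exI conjI)
    then obtain \<gamma> T where \<gamma>': "\<forall>t. (\<gamma> has_vector_derivative ?V (\<gamma> t)) (at t)" "T > 0" "\<forall>t. \<gamma> (t + T) = \<gamma> t" "inj_on \<gamma> {0..<T}"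
      by (elim exE conjE) (rule that)
    note \<gamma> = \<gamma>'(1)[THEN spec] \<gamma>'(2) \<gamma>'(3)[THEN spec] \<gamma>'(4)
    define x where "x = (\<lambda>t. fst (\<gamma> t) - px)"
    define y where "y = (\<lambda>t. snd (\<gamma> t) - py)"
    have dx: "(x has_real_derivative a i * x t + b i * y t) (at t)" for t
    proof -
      have "((\<lambda>t. fst (\<gamma> t)) has_real_derivative fst (?V (\<gamma> t))) (at t)"
        unfolding has_real_derivative_iff_has_vector_derivative
        by (rule bounded_linear.has_vector_derivative[OF bounded_linear_fst \<gamma>(1)])
      then have "(x has_real_derivative fst (?V (\<gamma> t)) - 0) (at t)"
        unfolding x_def by (intro DERIV_diff DERIV_const)
      moreover have "fst (?V (\<gamma> t)) - 0 = a i * x t + b i * y t"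
        using z(1) by (simp add: unperturbed_eq x_def y_def algebra_simps)
      ultimately show ?thesis by simp
    qed
    have dy: "(y has_real_derivative c i * x t - a i * y t) (at t)" for t
    proof -
      have "((\<lambda>t. snd (\<gamma> t)) has_real_derivative snd (?V (\<gamma> t))) (at t)"
        unfolding has_real_derivative_iff_has_vector_derivative
        by (rule bounded_linear.has_vector_derivative[OF bounded_linear_snd \<gamma>(1)])
      then have "(y has_real_derivative snd (?V (\<gamma> t)) - 0) (at t)"
        unfolding y_def by (intro DERIV_diff DERIV_const)
      moreover have "snd (?V (\<gamma> t)) - 0 = c i * x t - a i * y t"
        using z(2) by (simp add: unperturbed_eq x_def y_def algebra_simps)
      ultimately show ?thesis by simp
    qed
    have per: "x (t + T) = x t" "y (t + T) = y t" for t by (simp_all add: x_def y_def \<gamma>(3))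
    have vx: "a i * x t + b i * y t = 0" for t
    proof (rule periodic_convex_constant[where u = x and v = "\<lambda>t. a i * x t + b i * y t", OF dx _ k \<gamma>(2) per(1)])
      show "((\<lambda>t. a i * x t + b i * y t) has_real_derivative k * x t) (at t)" for t
        by (rule derivative_eq_intros dx dy refl)+ (simp add: k_def power2_eq_square algebra_simps)
    qed (simp add: per)
    have vy: "c i * x t - a i * y t = 0" for t
    proof (rule periodic_convex_constant[where u = y and v = "\<lambda>t. c i * x t - a i * y t", OF dy _ k \<gamma>(2) per(2)])
      show "((\<lambda>t. c i * x t - a i * y t) has_real_derivative k * y t) (at t)" for t
        by (rule derivative_eq_intros dx dy refl)+ (simp add: k_def power2_eq_square algebra_simps)
    qed (simp add: per)
    have "x (T / 2) = x 0" by (rule DERIV_isconst_all) (use dx vx in simp)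
    moreover have "y (T / 2) = y 0" by (rule DERIV_isconst_all) (use dy vy in simp)
    ultimately have "\<gamma> (T / 2) = \<gamma> 0" by (simp add: x_def y_def prod_eq_iff)
    then have "T / 2 = 0" by (rule inj_onD[OF \<gamma>(4)]) (use \<gamma>(2) in auto)
    then show False using \<gamma>(2) by simp
  qed
qed

lemma product_nonneg_proportional:
  fixes b b' e e' :: real
  assumes nonneg: "\<And>y. (b * y + e) * (b' * y + e') \<ge> 0" and pos: "(b * y0 + e) * (b' * y0 + e') > 0" and b: "b \<noteq> 0"
  shows "b * b' > 0" "b * e' = b' * e"
proof -
  define g where "g = b * e' - b' * e"
  have shift: "b\<^sup>2 * ((b * (t - e / b) + e) * (b' * (t - e / b) + e')) = b * b * (t * g + b * b' * (t * t))" for t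
    using b by (simp add: g_def field_simps power2_eq_square)
  have bb: "b * b > 0" using b not_real_square_gt_zero by blast
  have nn: "t * g + b * b' * (t * t) \<ge> 0" for t
  proof -
    have "0 \<le> b * b * (t * g + b * b' * (t * t))"
      unfolding shift[symmetric] by (intro mult_nonneg_nonneg nonneg) simp
    then show ?thesis using bb by (simp add: zero_le_mult_iff)
  qed
  have g0: "g = 0"
  proof (rule ccontr)
    assume g: "g \<noteq> 0"
    define N where "N = \<bar>b * b'\<bar> + 1"
    have N: "N > 0" "b * b' < N" by (simp_all add: N_def)
    have "0 \<le> N * N * ((- g / N) * g + b * b' * ((- g / N) * (- g / N)))"
      using N by (intro mult_nonneg_nonneg nn) simp_all
    also have "\<dots> = (g * g) * (b * b' - N)" using N(1) by (simp add: field_simps)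
    also have "\<dots> < 0"
    proof (rule mult_pos_neg)
      show "0 < g * g" using g not_real_square_gt_zero by blast
    qed (use N(2) in simp)
    finally show False by simp
  qed
  then show "b * e' = b' * e" by (simp add: g_def)
  have "b\<^sup>2 * ((b * y0 + e) * (b' * y0 + e')) > 0" using pos b by simp
  moreover have "b\<^sup>2 * ((b * y0 + e) * (b' * y0 + e')) = b * b * (b * b' * ((y0 + e / b) * (y0 + e / b)))"
    using shift[of "y0 + e / b"] g0 by simp
  ultimately have "b * b' * ((y0 + e / b) * (y0 + e / b)) > 0" using bb by (simp add: zero_less_mult_iff)
  moreover have "(y0 + e / b) * (y0 + e / b) \<ge> 0" by simp
  ultimately show "b * b' > 0" by (metis mult_nonpos_nonneg not_less)
qed


lemma crossing_annulus_proportional: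
  fixes a b c \<alpha> \<beta> :: "zone \<Rightarrow> real"
  assumes H2: "crossing_except_tangencies (unperturbed a b c \<alpha> \<beta>)" and bC: "b CentralZone \<noteq> 0"
    and cr: "crossing_periodic_orbit (unperturbed a b c \<alpha> \<beta>) \<Gamma>" and z: "card (zones_visited \<Gamma>) = 3"
  shows "b CentralZone * b RightZone > 0" "b CentralZone * b LeftZone > 0"
    "b CentralZone * (a RightZone + \<alpha> RightZone) = b RightZone * (a CentralZone + \<alpha> CentralZone)"
    "b CentralZone * (\<alpha> LeftZone - a LeftZone) = b LeftZone * (\<alpha> CentralZone - a CentralZone)"
proof -
  let ?X = "unperturbed a b c \<alpha> \<beta>"
  obtain \<gamma> T where \<gamma>: "trajectory ?X \<gamma>" and \<Gamma>: "\<Gamma> = range \<gamma>"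
    using cr unfolding crossing_periodic_orbit_def periodic_orbit_def periodic_solution_def by blast
  have UN: "UNIV = {LeftZone, CentralZone, RightZone}" using zone.exhaust by blast
  have fin: "finite (UNIV :: zone set)" "card (UNIV :: zone set) = 3" unfolding UN by simp_all
  have "zones_visited \<Gamma> = UNIV" by (rule card_subset_eq[OF fin(1)]) (use z fin in auto)
  then have zv: "\<exists>t. fst (\<gamma> t) \<in> zint i" for i
    unfolding zones_visited_def \<Gamma> interior_zone_iff[symmetric] by blast
  obtain t0 t1 where t: "fst (\<gamma> t0) < -1" "fst (\<gamma> t1) > 1" using zv[of LeftZone] zv[of RightZone] by auto
  have cp: "\<exists>y. crossing_point ?X (x, y)" if x: "x = 1 \<or> x = -1" for x
  proof -
    have "\<exists>t. fst (\<gamma> t) = x"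
      by (rule continuous_path_between[of _ t0 _ t1])
        (use t x in \<open>auto intro: continuous_intros trajectory_isCont[OF \<gamma>]\<close>)
    then obtain t where t: "fst (\<gamma> t) = x" by blast
    then have "\<gamma> t \<in> \<Gamma> \<inter> switching_lines" using x by (auto simp: \<Gamma> switching_lines_def)
    then have "crossing_point ?X (\<gamma> t)" using cr unfolding crossing_periodic_orbit_def by blast
    moreover have "\<gamma> t = (x, snd (\<gamma> t))" using t by (simp add: prod_eq_iff)
    ultimately show ?thesis by metis
  qed
  have R: "fst (?X i (1, y)) = b i * y + (a i + \<alpha> i)" and L: "fst (?X i (-1, y)) = b i * y + (\<alpha> i - a i)" for i y
    by (simp_all add: unperturbed_eq)
  have "crossing_point ?X (1, y) \<or> tangent_point ?X (1, y)" "crossing_point ?X (-1, y) \<or> tangent_point ?X (-1, y)" for y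
    using H2 unfolding crossing_except_tangencies_def switching_lines_def by simp_all
  then have nn: "0 \<le> fst (?X CentralZone (1, y)) * fst (?X RightZone (1, y))"
      "0 \<le> fst (?X LeftZone (-1, y)) * fst (?X CentralZone (-1, y))" for y
    unfolding crossing_point_def tangent_point_def by (fastforce intro: less_imp_le)+
  obtain y where "crossing_point ?X (1, y)" using cp by blast
  then have "0 < fst (?X CentralZone (1, y)) * fst (?X RightZone (1, y))" by (simp add: crossing_point_def)
  from product_nonneg_proportional[OF nn(1)[unfolded R] this[unfolded R] bC]
  show "b CentralZone * b RightZone > 0"
    "b CentralZone * (a RightZone + \<alpha> RightZone) = b RightZone * (a CentralZone + \<alpha> CentralZone)" .
  obtain y where "crossing_point ?X (-1, y)" using cp by blast
  then have "0 < fst (?X CentralZone (-1, y)) * fst (?X LeftZone (-1, y))" by (simp add: crossing_point_def mult.commute)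
  moreover have "0 \<le> fst (?X CentralZone (-1, y)) * fst (?X LeftZone (-1, y))" for y using nn(2) by (simp add: mult.commute)
  ultimately show "b CentralZone * b LeftZone > 0"
    "b CentralZone * (\<alpha> LeftZone - a LeftZone) = b LeftZone * (\<alpha> CentralZone - a CentralZone)"
    using product_nonneg_proportional[of "b CentralZone" "\<alpha> CentralZone - a CentralZone" "b LeftZone" "\<alpha> LeftZone - a LeftZone" y] bC
    unfolding L by blast+
qed

context normalization begin

interpretation nf: normal_form \<rho>n \<mu>n sn \<delta> m by (rule normal_form)

lemma perturbed_0: "perturbed X F 0 = X"
  by (intro ext) (simp add: perturbed_def)

lemma zones_visited_A: "card (zones_visited (A ` \<Gamma>)) = card (zones_visited \<Gamma>)"
proof -
  have iff: "A p \<in> interior (zone_set (\<pi> i)) \<longleftrightarrow> p \<in> interior (zone_set i)" for p i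
    unfolding interior_zone_iff using \<sigma> by (cases i) (auto simp: A_def \<pi>_def)
  have "zones_visited (A ` \<Gamma>) = \<pi> ` zones_visited \<Gamma>"
  proof (intro equalityI subsetI)
    fix j assume "j \<in> zones_visited (A ` \<Gamma>)"
    then obtain p where p: "p \<in> \<Gamma>" "A p \<in> interior (zone_set (\<pi> (\<pi> j)))" unfolding zones_visited_def by auto
    then have "\<pi> j \<in> zones_visited \<Gamma>" unfolding iff zones_visited_def by blast
    then have "\<pi> (\<pi> j) \<in> \<pi> ` zones_visited \<Gamma>" by (rule imageI)
    then show "j \<in> \<pi> ` zones_visited \<Gamma>" by simp
  next
    fix j assume "j \<in> \<pi> ` zones_visited \<Gamma>"
    then obtain i p where "j = \<pi> i" "p \<in> \<Gamma>" "p \<in> interior (zone_set i)" unfolding zones_visited_def by blast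
    then show "j \<in> zones_visited (A ` \<Gamma>)" using iff unfolding zones_visited_def by blast
  qed
  moreover have "inj_on \<pi> (zones_visited \<Gamma>)" by (rule inj_on_inverseI[of _ \<pi>]) simp
  ultimately show ?thesis by (simp add: card_image)
qed

lemma tangent_A:
  assumes "tangent_point X p" shows "A p = (1, 0) \<or> A p = (-1, 0)"
proof -
  have "\<exists>i. p \<in> zone_set i \<and> fst (X i p) = 0 \<and> (fst p = 1 \<or> fst p = -1)"
    using assms unfolding tangent_point_def
  proof (elim disjE conjE)
    assume "fst p = -1" "fst (X LeftZone p) = 0"
    then show ?thesis by (intro exI[of _ LeftZone]) simp
  next
    assume "fst p = 1" "fst (X RightZone p) = 0"
    then show ?thesis by (intro exI[of _ RightZone]) simp
  qed (intro exI[of _ CentralZone], simp)+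
  then obtain i where i: "p \<in> zone_set i" "fst (X i p) = 0" "fst p = 1 \<or> fst p = -1"
    by (elim exE conjE) (rule that)
  have "fst (nf.field 0 (\<pi> i) (A p)) = 0"
    using field_A[OF i(1), of 0] i(2) by (simp add: perturbed_0 L_def)
  then have "snd (A p) = 0" using nf.\<rho>_pos[of "\<pi> i"] by (simp add: nf.field_def)
  moreover have "fst (A p) = 1 \<or> fst (A p) = -1" using i(3) \<sigma> by (auto simp: A_def)
  ultimately show ?thesis by (simp add: prod_eq_iff)
qed

end

theorem theorem1:
  fixes a b c \<alpha> \<beta> :: "zone \<Rightarrow> real" and X :: "zone \<Rightarrow> plane \<Rightarrow> plane"
    and px py :: real and J :: "real set" and \<Gamma> :: "real \<Rightarrow> plane set"
  assumes X: "X = unperturbed a b c \<alpha> \<beta>"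
    and H1_center: "is_center (X CentralZone) (px, py)"
    and H1_left: "\<exists>s. is_saddle (X LeftZone) s"
    and H1_right: "\<exists>s. is_saddle (X RightZone) s"
    and H2: "crossing_except_tangencies X"
    and H3: "crossing_annulus X J \<Gamma>"
    and px: "px \<noteq> 0"
  shows "(-1 \<le> px \<and> px \<le> 1 \<longrightarrow>
           (\<exists>f10 f01 f00 g10 g01 g00. limit_cycles_bifurcate X
              (affine_field f10 f01 f00 g10 g01 g00)
              {\<Gamma> h | h. h \<in> J \<and> crossing_periodic_orbit X (\<Gamma> h)} 6)) \<and>
         (px < -1 \<or> 1 < px \<longrightarrow>
           (\<exists>f10 f01 f00 g10 g01 g00. limit_cycles_bifurcate X
              (affine_field f10 f01 f00 g10 g01 g00)
              {\<Gamma> h | h. h \<in> J \<and> crossing_periodic_orbit X (\<Gamma> h)} 4))"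
proof -
  define \<kappa> where "\<kappa> = (\<lambda>i. (a i)\<^sup>2 + b i * c i)"
  have KL: "\<kappa> LeftZone > 0" and KR: "\<kappa> RightZone > 0"
    using H1_left H1_right saddle_coefficients unfolding X \<kappa>_def by blast+
  note cc = center_coefficients[OF H1_center[unfolded X]]
  have KC: "\<kappa> CentralZone < 0" using cc(1) by (simp add: \<kappa>_def)
  have bC: "b CentralZone \<noteq> 0" using cc(1) by (auto simp: not_less)
  have ann: "periodic_annulus X J \<Gamma>"
    "\<And>h. h \<in> J \<Longrightarrow> (crossing_periodic_orbit X (\<Gamma> h) \<and> card (zones_visited (\<Gamma> h)) \<in> {2, 3}) \<or> (\<exists>p\<in>\<Gamma> h. tangent_point X p)"
    "\<exists>I\<subseteq>J. open_interval I \<and> (\<forall>h\<in>I. crossing_periodic_orbit X (\<Gamma> h) \<and> card (zones_visited (\<Gamma> h)) = 3)"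
    "\<exists>I\<subseteq>J. open_interval I \<and> (\<forall>h\<in>I. crossing_periodic_orbit X (\<Gamma> h) \<and> card (zones_visited (\<Gamma> h)) = 2)"
    using H3 unfolding crossing_annulus_def by blast+
  obtain h3 where h3: "h3 \<in> J" "crossing_periodic_orbit X (\<Gamma> h3)" "card (zones_visited (\<Gamma> h3)) = 3"
    using ann(3) unfolding open_interval_def by blast
  obtain h2 where h2: "h2 \<in> J" "crossing_periodic_orbit X (\<Gamma> h2)" "card (zones_visited (\<Gamma> h2)) = 2"
    using ann(4) unfolding open_interval_def by blast
  have J: "connected J" using ann(1) unfolding periodic_annulus_def open_interval_def by (simp add: is_interval_connected_1)
  have po: "periodic_orbit X (\<Gamma> h)" if "h \<in> J" for h
    using ann(1) that unfolding periodic_annulus_def clockwise_periodic_orbit_def periodic_orbit_def by blast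
  obtain \<Phi> \<Psi> where \<Phi>: "homeomorphism (J \<times> sphere (0::complex) 1) (\<Union>h\<in>J. \<Gamma> h) \<Phi> \<Psi>"
    "\<And>h. h \<in> J \<Longrightarrow> \<Phi> ` ({h} \<times> sphere 0 1) = \<Gamma> h"
    using ann(1) unfolding periodic_annulus_def by blast
  note props = crossing_annulus_proportional[OF H2[unfolded X] bC h3(2)[unfolded X] h3(3)]
  define \<sigma> where "\<sigma> = sgn px"
  have \<sigma>: "\<sigma> = 1 \<or> \<sigma> = -1" "\<sigma> * px = \<bar>px\<bar>" using px by (auto simp: \<sigma>_def sgn_if)
  have nz: "normalization a b c \<alpha> \<sigma>"
  proof
    show "b i / b CentralZone > 0" for i
      using props(1,2) bC by (cases i) (auto simp: zero_less_divide_iff zero_less_mult_iff)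
    show "(a i)\<^sup>2 + b i * c i \<noteq> 0" for i
      using KL KR KC by (cases i) (auto simp: \<kappa>_def)
  qed (use bC props(3,4) \<sigma>(1) in simp_all)
  define z where "z = (\<lambda>_ :: zone. 0 :: real)"
  interpret N: normalization a b c \<alpha> \<beta> z z \<sigma> by (rule nz)
  have NX: "N.X = X" by (simp add: N.X_def X)
  define \<omega> where "\<omega> = sqrt (- \<kappa> CentralZone)"
  have mm: "N.mm i = \<kappa> i / N.rr i" for i by (simp add: N.mm_def \<kappa>_def)
  have piC: "N.\<pi> CentralZone = CentralZone" by (simp add: N.\<pi>_def)
  have ppC: "N.pp CentralZone = px"
  proof -
    have "\<kappa> CentralZone * px + (b CentralZone * \<beta> CentralZone + a CentralZone * \<alpha> CentralZone) =
      a CentralZone * (b CentralZone * py + a CentralZone * px + \<alpha> CentralZone) +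
      b CentralZone * (c CentralZone * px - a CentralZone * py + \<beta> CentralZone)"
      by (simp add: \<kappa>_def power2_eq_square algebra_simps)
    then have "\<kappa> CentralZone * px = - (b CentralZone * \<beta> CentralZone + a CentralZone * \<alpha> CentralZone)"
      unfolding cc(2,3) by simp
    then show ?thesis using KC by (simp add: N.pp_def N.gg_def N.rr_C mm field_simps)
  qed
  have pos: "N.\<mu>n i > 0" if "i \<noteq> CentralZone" for i
    using that KL KR N.rr_pos \<sigma>(1) unfolding N.\<mu>n_def mm by (cases i) (auto simp: N.\<pi>_def)
  have cs: "center_saddle N.\<rho>n N.\<mu>n N.sn \<omega> \<bar>px\<bar>"
  proof (intro center_saddle.intro N.normal_form center_saddle_axioms.intro)
    show "\<omega> > 0" using KC by (simp add: \<omega>_def)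
    show "\<bar>px\<bar> > 0" using px by simp
    show "N.\<rho>n CentralZone = 1" by (simp add: N.\<rho>n_def piC N.rr_C)
    show "N.\<mu>n CentralZone = - \<omega>\<^sup>2" using KC by (simp add: N.\<mu>n_def piC mm N.rr_C \<omega>_def)
    show "N.sn CentralZone = \<bar>px\<bar>" by (simp add: N.sn_def piC ppC \<sigma>(2))
  qed (use pos in simp_all)
  interpret Z: center_saddle N.\<rho>n N.\<mu>n N.sn z z \<omega> "\<bar>px\<bar>" by (rule cs)
  have zC: "z CentralZone = 0" by (simp add: z_def)
  have conj: "conjugates N.A N.\<pi> N.L (\<lambda>i. (0, \<sigma> * N.ee i)) X (Z.field 0)"
    using N.conjugates_A[of 0] unfolding N.perturbed_0 unfolding NX by simp
  have cA: "crossing_periodic_orbit (Z.field 0) (N.A ` \<Gamma> h)" if "crossing_periodic_orbit X (\<Gamma> h)" for h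
    by (rule conjugates_crossing_periodic_orbit[OF conj that])
  have tA: "(1, 0) \<in> N.A ` \<Gamma> h \<or> (-1, 0) \<in> N.A ` \<Gamma> h" if "p \<in> \<Gamma> h" "tangent_point X p" for h p
    using N.tangent_A[of p] that unfolding NX by (metis imageI)
  have f: "continuous_on J (\<lambda>h. N.A (\<Phi> (h, 1)))"
  proof (rule continuous_on_compose2[OF N.continuous_A])
    have "continuous_on (J \<times> sphere 0 1) \<Phi>" using \<Phi>(1) by (rule homeomorphism_cont1)
    then show "continuous_on J (\<lambda>h. \<Phi> (h, 1))"
      by (rule continuous_on_compose2) (auto intro!: continuous_intros)
  qed simp
  have fin: "N.A (\<Phi> (h, 1)) \<in> N.A ` \<Gamma> h" if "h \<in> J" for h
  proof -
    have "\<Phi> (h, 1) \<in> \<Phi> ` ({h} \<times> sphere 0 1)" by (intro imageI) simp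
    then show ?thesis using \<Phi>(2)[OF that] by blast
  qed
  have alt: "(crossing_periodic_orbit (Z.field 0) (N.A ` \<Gamma> h) \<and> card (zones_visited (N.A ` \<Gamma> h)) \<in> {2, 3}) \<or>
      (1, 0) \<in> N.A ` \<Gamma> h \<or> (-1, 0) \<in> N.A ` \<Gamma> h" if "h \<in> J" for h
    using ann(2)[OF that] cA tA unfolding N.zones_visited_A by blast
  have poA: "periodic_orbit (Z.field 0) (N.A ` \<Gamma> h)" if "h \<in> J" for h
    by (rule conjugates_periodic_orbit[OF conj po[OF that]])
  have card: "card (zones_visited (N.A ` \<Gamma> h2)) = 2" "card (zones_visited (N.A ` \<Gamma> h3)) = 3"
    unfolding N.zones_visited_A by (fact h2(3) h3(3))+
  have wR: "Z.RR < Z.wR"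
    by (rule Z.annulus_leaves(1)[where \<Gamma> = "\<lambda>h. N.A ` \<Gamma> h",
        OF zC J h2(1) h3(1) f fin poA alt cA[OF h2(2)] card(1) cA[OF h3(2)] card(2)])
  have wL: "0 < Z.wL"
    by (rule Z.annulus_leaves(2)[where \<Gamma> = "\<lambda>h. N.A ` \<Gamma> h",
        OF zC J h2(1) h3(1) f fin poA alt cA[OF h2(2)] card(1) cA[OF h3(2)] card(2)])
  have "\<exists>e>0. \<forall>r c T. Z.RR - e < r \<longrightarrow> r < Z.RR + e \<longrightarrow> r \<noteq> Z.RR \<longrightarrow>
      det_path (base_field N.\<rho>n N.\<mu>n N.sn) c T \<longrightarrow> c 0 = (1, r) \<longrightarrow> c T = (1, r) \<longrightarrow>
      (\<exists>h\<in>J. c ` {0..T} = N.A ` \<Gamma> h \<and> (1, 0) \<notin> N.A ` \<Gamma> h \<and> (-1, 0) \<notin> N.A ` \<Gamma> h)"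
    by (rule Z.annulus_leaves(3)[where \<Gamma> = "\<lambda>h. N.A ` \<Gamma> h",
        OF zC J h2(1) h3(1) f fin poA alt cA[OF h2(2)] card(1) cA[OF h3(2)] card(2)])
  then obtain e where e: "e > 0" "\<forall>r c T. Z.RR - e < r \<longrightarrow> r < Z.RR + e \<longrightarrow> r \<noteq> Z.RR \<longrightarrow>
      det_path (base_field N.\<rho>n N.\<mu>n N.sn) c T \<longrightarrow> c 0 = (1, r) \<longrightarrow> c T = (1, r) \<longrightarrow>
      (\<exists>h\<in>J. c ` {0..T} = N.A ` \<Gamma> h \<and> (1, 0) \<notin> N.A ` \<Gamma> h \<and> (-1, 0) \<notin> N.A ` \<Gamma> h)"
    by (elim exE conjE) (rule that)
  define \<A> where "\<A> = {\<Gamma> h | h. h \<in> J \<and> crossing_periodic_orbit X (\<Gamma> h)}"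
  define n :: nat where "n = (if \<bar>px\<bar> \<le> 1 then 6 else 4)"
  have lv: "c ` {0..T} \<in> (`) N.A ` \<A>" if r: "2 * \<omega> * sqrt \<bar>px\<bar> - e < r" "r < 2 * \<omega> * sqrt \<bar>px\<bar> + e" "r \<noteq> 2 * \<omega> * sqrt \<bar>px\<bar>"
      "det_path (base_field N.\<rho>n N.\<mu>n N.sn) c T" "c 0 = (1, r)" "c T = (1, r)" for r c T
  proof -
    have "\<exists>h\<in>J. c ` {0..T} = N.A ` \<Gamma> h \<and> (1, 0) \<notin> N.A ` \<Gamma> h \<and> (-1, 0) \<notin> N.A ` \<Gamma> h"
      by (rule e(2)[unfolded Z.RR_def, rule_format, OF r])
    then obtain h where h: "h \<in> J" "c ` {0..T} = N.A ` \<Gamma> h" "(1, 0) \<notin> N.A ` \<Gamma> h" "(-1, 0) \<notin> N.A ` \<Gamma> h"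
      by (elim bexE conjE) (rule that)
    have "crossing_periodic_orbit X (\<Gamma> h)" using ann(2)[OF h(1)] tA h(3,4) by blast
    then have "\<Gamma> h \<in> \<A>" using h(1) unfolding \<A>_def by blast
    then show ?thesis unfolding h(2) by (rule imageI)
  qed
  have "\<exists>\<delta> m G S. (\<forall>k<n. S k \<in> (`) N.A ` \<A> \<and> hausdorff_tendsto (G k) (S k) (at_right 0)) \<and>
     (\<forall>\<^sub>F \<epsilon> in at_right 0. (\<forall>k<n. limit_cycle (normal_form.field N.\<rho>n N.\<mu>n N.sn \<delta> m \<epsilon>) (G k \<epsilon>)) \<and> inj_on (\<lambda>k. G k \<epsilon>) {..<n})"
    by (rule normal_form_bifurcation[OF cs wR[unfolded Z.RR_def Z.wR_def] wL[unfolded Z.wL_def] e(1) _ n_def])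
      (rule lv; assumption)
  then obtain \<delta> m G S where GS: "\<forall>k<n. S k \<in> (`) N.A ` \<A> \<and> hausdorff_tendsto (G k) (S k) (at_right 0)"
    and lc: "\<forall>\<^sub>F \<epsilon> in at_right 0. (\<forall>k<n. limit_cycle (normal_form.field N.\<rho>n N.\<mu>n N.sn \<delta> m \<epsilon>) (G k \<epsilon>)) \<and> inj_on (\<lambda>k. G k \<epsilon>) {..<n}"
    by (elim exE conjE) (rule that)
  interpret N2: normalization a b c \<alpha> \<beta> \<delta> m \<sigma> by (rule nz)
  have "\<exists>S'. k < n \<longrightarrow> S' \<in> \<A> \<and> S k = N.A ` S'" for k
  proof (cases "k < n")
    case True
    then have "S k \<in> (`) N.A ` \<A>" using GS by blast
    then show ?thesis by (elim imageE) (intro exI impI conjI)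
  qed simp
  then have "\<forall>k. \<exists>S'. k < n \<longrightarrow> S' \<in> \<A> \<and> S k = N.A ` S'" by (rule allI)
  then have "\<exists>S'. \<forall>k. k < n \<longrightarrow> S' k \<in> \<A> \<and> S k = N.A ` S' k" unfolding choice_iff .
  then obtain S' where S': "\<forall>k. k < n \<longrightarrow> S' k \<in> \<A> \<and> S k = N.A ` S' k" by (elim exE)
  have "limit_cycles_bifurcate N2.X N2.F \<A> n"
  proof (rule N2.bifurcate_of_normal_form[where S = S' and G = G])
    show "S' k \<in> \<A> \<and> hausdorff_tendsto (G k) (N2.A ` S' k) (at_right 0)" if "k < n" for k
    proof -
      have "S' k \<in> \<A>" "S k = N.A ` S' k" using S' that by blast+
      then show ?thesis using GS that by metis
    qed
  qed (rule lc)
  then have ex: "\<exists>f10 f01 f00 g10 g01 g00. limit_cycles_bifurcate X (affine_field f10 f01 f00 g10 g01 g00) \<A> n"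
    unfolding NX N2.F_def by (intro exI)
  show ?thesis
  proof (intro conjI impI)
    assume "-1 \<le> px \<and> px \<le> 1"
    then have "n = 6" by (simp add: n_def abs_le_iff)
    then show "\<exists>f10 f01 f00 g10 g01 g00. limit_cycles_bifurcate X (affine_field f10 f01 f00 g10 g01 g00)
        {\<Gamma> h | h. h \<in> J \<and> crossing_periodic_orbit X (\<Gamma> h)} 6"
      using ex unfolding \<A>_def by (simp only:)
  next
    assume "px < -1 \<or> 1 < px"
    then have "n = 4" by (auto simp: n_def)
    then show "\<exists>f10 f01 f00 g10 g01 g00. limit_cycles_bifurcate X (affine_field f10 f01 f00 g10 g01 g00)
        {\<Gamma> h | h. h \<in> J \<and> crossing_periodic_orbit X (\<Gamma> h)} 4"
      using ex unfolding \<A>_def by (simp only:)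
  qed
qed

end
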